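(* Let $(M,L,\psi)$ be a weighted Finsler spacetime of dimension $n+1\ge3$, let $\mathsf{J}$ be a nonsingular Lagrange tensor field along a future-directed lightlike geodesic $\eta:I\to M$, and let $\epsilon\in\mathbb{R}$. Then the following hold on $I$. For $N=1$, the $\epsilon$-expansion $\theta_\epsilon$ satisfies $$\theta_\epsilon^*+\frac{2\epsilon}{n-1}\psi_\eta^*\theta_\epsilon+\frac{\theta_\epsilon^2}{n-1}+\mathrm{trace}(\sigma_\epsilon^2)+\mathrm{Ric}_1(\eta^* )=0.$$ For $N\in(-\infty,+\infty)\setminus\{1,n\}$, $$\theta_\epsilon^*+\Big(1-\epsilon^2\frac{N-n}{N-1}\Big)\frac{\theta_\epsilon^2}{n-1}+\frac{(N-1)(N-n)}{n-1}\Big(\frac{\epsilon\theta_\epsilon}{N-1}+\frac{\psi_\eta^*}{N-n}\Big)^2+\mathrm{trace}(\sigma_\epsilon^2)+\mathrm{Ric}_N(\eta^* )=0.$$ For $N=+\infty$, $$\theta_\epsilon^*+(1-\epsilon^2)\frac{\theta_\epsilon^2}{n-1}+\frac1{n-1}(\epsilon\theta_\epsilon+\psi_\eta^* )^2+\mathrm{trace}(\sigma_\epsilon^2)+\mathrm{Ric}_\infty(\eta^* )=0.$$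
   Context: **Lorentz–Finsler setting.** $M$ is a connected $C^\infty$-manifold without boundary of dimension $n+1$. A Lorentz–Finsler structure is a function $L:TM\to\mathbb{R}$ such that $L\in C^\infty(TM\setminus\{0\})$; $L(cv)=c^2L(v)$ for all $v\in TM$, $c>0$; and for every $v\in TM\setminus\{0\}$ the matrix $g_{\alpha\beta}(v)=\frac{\partial^2 L}{\partial v^\alpha\partial v^\beta}(v)$, $\alpha,\beta=0,\dots,n$, is non-degenerate of signature $(-,+,\dots,+)$. It defines a Lorentzian inner product $g_v$ on $T_xM$ (for $v\in T_xM\setminus\{0\}$), with $g_v(v,v)=2L(v)$. A vector $v$ is timelike if $L(v)<0$, lightlike if $L(v)=0$ and $v\ne 0$, causal if timelike or lightlike. A Finsler spacetime is such an $(M,L)$ time-oriented by a smooth vector field $X$ with $L(X(x))<0$ for all $x$. A causal $v\in T_xM$ is future-directed if it lies in the same connected component of $\overline{\Omega'_x}\setminus\{0\}$ as $X(x)$, where $\Omega'_x=\{v\in T_xM: L(v)<0\}$. $\Omega_x$ is the set of future-directed timelike vectors, $\overline\Omega=\bigcup_x\overline\Omega_x$. All causal curves and geodesics are future-directed. **Connection and curvature.** With $(g^{\alpha\beta}(v))$ the inverse matrix, set $\widetilde\Gamma^\alpha_{\beta\gamma}(v)=\frac12\sum_\delta g^{\alpha\delta}(v)\big(\frac{\partial g_{\delta\gamma}}{\partial x^\beta}+\frac{\partial g_{\beta\delta}}{\partial x^\gamma}-\frac{\partial g_{\beta\gamma}}{\partial x^\delta}\big)(v)$, $G^\alpha(v)=\frac12\sum_{\beta,\gamma}\widetilde\Gamma^\alpha_{\beta\gamma}(v)v^\beta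 v^\gamma$, $N^\alpha_\beta(v)=\frac{\partial G^\alpha}{\partial v^\beta}(v)$, and $\Gamma^\alpha_{\beta\gamma}(v)=\widetilde\Gamma^\alpha_{\beta\gamma}(v)-\frac12\sum_{\delta,\mu}g^{\alpha\delta}(v)\big(\frac{\partial g_{\delta\gamma}}{\partial v^\mu}N^\mu_\beta+\frac{\partial g_{\beta\delta}}{\partial v^\mu}N^\mu_\gamma-\frac{\partial g_{\beta\gamma}}{\partial v^\mu}N^\mu_\delta\big)(v)$. Along a curve $\eta$, the covariant derivative $Y'=D^{\dot\eta}_{\dot\eta}Y$ has components $\dot Y^\alpha+\sum\Gamma^\alpha_{\beta\gamma}(\dot\eta)\dot\eta^\beta Y^\gamma$; for endomorphism fields $E$, $E'(P)=E(P)'-E(P')$. A causal geodesic is a smooth causal curve with $\ddot\eta^\alpha+2G^\alpha(\dot\eta)=0$. Put $R^\alpha_\beta(v)=2\frac{\partial G^\alpha}{\partial x^\beta}-\sum_\gamma\big(\frac{\partial N^\alpha_\beta}{\partial x^\gamma}v^\gamma-2\frac{\partial N^\alpha_\beta}{\partial v^\gamma}G^\gamma\big)-\sum_\gamma N^\alpha_\gamma N^\gamma_\beta$ (all at $v$), $R_v(w)=\sum R^\alpha_\beta(v)w^\beta\frac{\partial}{\partial x^\alpha}$ and $\mathrm{Ric}(v)=\mathrm{trace}(R_v)$. **Weight.** $\psi:\overline\Omega\setminus\{0\}\to\mathbb{R}$ is $C^\infty$ with $\psi(cv)=\psi(v)$ for $c>0$. For a causal geodesic $\eta$, $\psi_\eta(t)=\psi(\dot\eta(t))$.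 For $v\in\overline\Omega\setminus\{0\}$ and the geodesic $\eta$ with $\dot\eta(0)=v$: $\mathrm{Ric}_N(v)=\mathrm{Ric}(v)+\psi_\eta''(0)-\frac{\psi_\eta'(0)^2}{N-n}$ for $N\in\mathbb{R}\setminus\{n\}$; $\mathrm{Ric}_\infty(v)=\mathrm{Ric}(v)+\psi_\eta''(0)$. **Null Lagrange tensors, $\epsilon$-quantities.** For a lightlike geodesic $\eta:I\to M$, $N_\eta(t)=\{w\in T_{\eta(t)}M: g_{\dot\eta(t)}(\dot\eta(t),w)=0\}\ni\dot\eta(t)$ and $Q_\eta(t)=N_\eta(t)/\mathbb{R}\dot\eta(t)$, of dimension $n-1$ with identity $I_{n-1}$; $g_{\dot\eta}$ induces a positive-definite metric $h$ on $Q_\eta$, the covariant derivative $'$ along $\eta$ descends to $Q_\eta$ and its endomorphisms, and $R_{\dot\eta(t)}$ induces the $h$-symmetric endomorphism $\mathsf{R}(t)$ of $Q_\eta(t)$. A Jacobi tensor field is a smooth field of endomorphisms $\mathsf{J}(t)$ of $Q_\eta(t)$ with $\mathsf{J}''+\mathsf{R}\mathsf{J}=0$ and $\ker\mathsf{J}(t)\cap\ker\mathsf{J}'(t)=\{0\}$; it is Lagrange if moreover $(\mathsf{J}')^{\mathsf{T}}\mathsf{J}-\mathsf{J}^{\mathsf{T}}\mathsf{J}'=0$ ($\mathsf{T}$ = $h$-transpose). Nonsingular means invertible for all $t\in I$. Put $\tau_\epsilon=\int e^{\frac{2(\epsilon-1)}{n-1}\psi_\eta(t)}dt$, with $*$ the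 (covariant) derivative with respect to $\tau_\epsilon$, i.e. $(\cdot)^*=e^{\frac{2(1-\epsilon)}{n-1}\psi_\eta}(\cdot)'$; $\eta^*=e^{\frac{2(1-\epsilon)}{n-1}\psi_\eta}\dot\eta$. With $\mathsf{J}_\psi=e^{-\psi_\eta/(n-1)}\mathsf{J}$: $\mathsf{B}_\epsilon=\mathsf{J}_\psi^*\mathsf{J}_\psi^{-1}$, $\theta_\epsilon=\mathrm{trace}(\mathsf{B}_\epsilon)$, $\sigma_\epsilon=\mathsf{B}_\epsilon-\frac{\theta_\epsilon}{n-1}I_{n-1}$. *)

theory Defs
  imports "HOL-Analysis.Analysis"
begin

section \<open>Smooth maps between Euclidean spaces\<close>

text \<open>\<open>Ck_on k U f\<close> is meant for open \<open>U\<close>. On an arbitrary set, smoothness means that the map extends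
  smoothly to a neighbourhood of every point (this covers intervals with endpoints and the closed
  cones on which the weight is defined); for open sets this is the usual notion.\<close>

primrec Ck_on :: "nat \<Rightarrow> 'a::real_normed_vector set \<Rightarrow> ('a \<Rightarrow> 'b::real_normed_vector) \<Rightarrow> bool" where
  "Ck_on 0 U f \<longleftrightarrow> continuous_on U f"
| "Ck_on (Suc k) U f \<longleftrightarrow> (\<forall>x\<in>U. f differentiable (at x)) \<and>
     (\<forall>v. Ck_on k U (\<lambda>x. frechet_derivative f (at x) v))"

definition smooth_on :: "'a::real_normed_vector set \<Rightarrow> ('a \<Rightarrow> 'b::real_normed_vector) \<Rightarrow> bool" where
  "smooth_on A f \<longleftrightarrow>
     (\<forall>a\<in>A. \<exists>U F. open U \<and> a \<in> U \<and> (\<forall>k. Ck_on k U F) \<and> (\<forall>x\<in>A \<inter> U. F x = f x))"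

text \<open>The derivative of a curve on an interval \<open>I\<close>, one-sided at endpoints belonging to \<open>I\<close>.\<close>

definition cderiv :: "real set \<Rightarrow> (real \<Rightarrow> 'b::real_normed_vector) \<Rightarrow> real \<Rightarrow> 'b" where
  "cderiv I f t = vector_derivative f (at t within I)"

definition nondegenerate_interval :: "real set \<Rightarrow> bool" where
  "nondegenerate_interval I \<longleftrightarrow> is_interval I \<and> interior I \<noteq> {}"


section \<open>Manifolds and tangent vectors\<close>

text \<open>A chart is a pair of its domain and its coordinate map.\<close>

type_synonym ('m, 'i) chart = "'m set \<times> ('m \<Rightarrow> real ^ 'i)"

definition chart_inv :: "('m, 'i::finite) chart \<Rightarrow> real ^ 'i \<Rightarrow> 'm" where
  "chart_inv c = inv_into (fst c) (snd c)"

definition is_chart :: "('m::topological_space, 'i::finite) chart \<Rightarrow> bool" where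
  "is_chart c \<longleftrightarrow> open (fst c) \<and> open (snd c ` fst c) \<and>
     homeomorphism (fst c) (snd c ` fst c) (snd c) (chart_inv c)"

text \<open>\<open>tchange c d p u\<close>: the components with respect to \<open>d\<close> of the tangent vector at \<open>p\<close> whose components
  with respect to \<open>c\<close> are \<open>u\<close>.\<close>

definition tchange :: "('m, 'i::finite) chart \<Rightarrow> ('m, 'i) chart \<Rightarrow> 'm \<Rightarrow> real ^ 'i \<Rightarrow> real ^ 'i" where
  "tchange c d p u = frechet_derivative (snd d \<circ> chart_inv c) (at (snd c p)) u"

text \<open>The manifold is the whole type \<open>'m\<close>, of dimension \<open>n + 1 = CARD('i)\<close>. A preferred chart
  \<open>chart_at p\<close> around every point \<open>p\<close> is fixed, and \<open>T\<^sub>p M\<close> is the model space \<open>real ^ 'i\<close>: a vector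
  \<open>v\<close> at \<open>p\<close> stands for the tangent vector with components \<open>v\<close> with respect to \<open>chart_at p\<close>. The
  function \<open>L\<close> and the weight \<open>\<psi>\<close> are functions of a base point and a tangent vector there.\<close>

record ('m, 'i::finite) finsler_data =
  atlas :: "('m, 'i) chart set"
  chart_at :: "'m \<Rightarrow> ('m, 'i) chart"
  Lag :: "'m \<Rightarrow> real ^ 'i \<Rightarrow> real"
  time_or :: "'m \<Rightarrow> real ^ 'i"
  weight :: "'m \<Rightarrow> real ^ 'i \<Rightarrow> real"

definition to_chart ::
    "('m, 'i::finite) finsler_data \<Rightarrow> ('m, 'i) chart \<Rightarrow> 'm \<Rightarrow> real ^ 'i \<Rightarrow> real ^ 'i" where
  "to_chart S c p v = tchange (chart_at S p) c p v"

definition of_chart ::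
    "('m, 'i::finite) finsler_data \<Rightarrow> ('m, 'i) chart \<Rightarrow> 'm \<Rightarrow> real ^ 'i \<Rightarrow> real ^ 'i" where
  "of_chart S c p u = tchange c (chart_at S p) p u"

definition smooth_manifold :: "('m::{t2_space, second_countable_topology}, 'i::finite) finsler_data \<Rightarrow> bool"
  where
  "smooth_manifold S \<longleftrightarrow> connected (UNIV :: 'm set) \<and>
     (\<forall>c\<in>atlas S. is_chart c) \<and>
     (\<forall>c\<in>atlas S. \<forall>d\<in>atlas S. smooth_on (snd c ` (fst c \<inter> fst d)) (snd d \<circ> chart_inv c)) \<and>
     (\<forall>p. chart_at S p \<in> atlas S \<and> p \<in> fst (chart_at S p))"

text \<open>The expression, in the coordinates \<open>(x, u)\<close> of \<open>TM\<close> induced by the chart \<open>c\<close>, of a function on \<open>TM\<close>.\<close>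

definition chart_rep ::
    "('m, 'i::finite) finsler_data \<Rightarrow> ('m, 'i) chart \<Rightarrow> ('m \<Rightarrow> real ^ 'i \<Rightarrow> real)
      \<Rightarrow> (real ^ 'i) \<times> (real ^ 'i) \<Rightarrow> real" where
  "chart_rep S c f = (\<lambda>(x, u). f (chart_inv c x) (of_chart S c (chart_inv c x) u))"


section \<open>Connection and curvature in coordinates\<close>

text \<open>In this section \<open>l\<close> is the coordinate expression of \<open>L\<close> and \<open>z = (x, v)\<close>.\<close>

definition dx :: "'i::finite \<Rightarrow> ((real ^ 'i) \<times> (real ^ 'i) \<Rightarrow> real) \<Rightarrow> (real ^ 'i) \<times> (real ^ 'i) \<Rightarrow> real"
  where "dx \<alpha> f z = frechet_derivative f (at z) (axis \<alpha> 1, 0)"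

definition dv :: "'i::finite \<Rightarrow> ((real ^ 'i) \<times> (real ^ 'i) \<Rightarrow> real) \<Rightarrow> (real ^ 'i) \<times> (real ^ 'i) \<Rightarrow> real"
  where "dv \<alpha> f z = frechet_derivative f (at z) (0, axis \<alpha> 1)"

context
  fixes l :: "(real ^ 'i::finite) \<times> (real ^ 'i) \<Rightarrow> real"
begin

definition gL :: "'i \<Rightarrow> 'i \<Rightarrow> (real ^ 'i) \<times> (real ^ 'i) \<Rightarrow> real" where
  "gL \<alpha> \<beta> = dv \<alpha> (dv \<beta> l)"

definition gmat :: "(real ^ 'i) \<times> (real ^ 'i) \<Rightarrow> real ^ 'i ^ 'i" where
  "gmat z = (\<chi> \<alpha> \<beta>. gL \<alpha> \<beta> z)"

definition ginv :: "'i \<Rightarrow> 'i \<Rightarrow> (real ^ 'i) \<times> (real ^ 'i) \<Rightarrow> real" where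
  "ginv \<alpha> \<beta> z = matrix_inv (gmat z) $ \<alpha> $ \<beta>"

definition Gam_formal :: "'i \<Rightarrow> 'i \<Rightarrow> 'i \<Rightarrow> (real ^ 'i) \<times> (real ^ 'i) \<Rightarrow> real" where
  "Gam_formal \<alpha> \<beta> \<gamma> z = 1/2 * (\<Sum>\<delta>\<in>UNIV. ginv \<alpha> \<delta> z *
     (dx \<beta> (gL \<delta> \<gamma>) z + dx \<gamma> (gL \<beta> \<delta>) z - dx \<delta> (gL \<beta> \<gamma>) z))"

definition Gspray :: "'i \<Rightarrow> (real ^ 'i) \<times> (real ^ 'i) \<Rightarrow> real" where
  "Gspray \<alpha> z = 1/2 * (\<Sum>\<beta>\<in>UNIV. \<Sum>\<gamma>\<in>UNIV. Gam_formal \<alpha> \<beta> \<gamma> z * snd z $ \<beta> * snd z $ \<gamma>)"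

definition Nconn :: "'i \<Rightarrow> 'i \<Rightarrow> (real ^ 'i) \<times> (real ^ 'i) \<Rightarrow> real" where
  "Nconn \<alpha> \<beta> = dv \<beta> (Gspray \<alpha>)"

definition Gam :: "'i \<Rightarrow> 'i \<Rightarrow> 'i \<Rightarrow> (real ^ 'i) \<times> (real ^ 'i) \<Rightarrow> real" where
  "Gam \<alpha> \<beta> \<gamma> z = Gam_formal \<alpha> \<beta> \<gamma> z - 1/2 * (\<Sum>\<delta>\<in>UNIV. \<Sum>\<mu>\<in>UNIV. ginv \<alpha> \<delta> z *
     (dv \<mu> (gL \<delta> \<gamma>) z * Nconn \<mu> \<beta> z + dv \<mu> (gL \<beta> \<delta>) z * Nconn \<mu> \<gamma> z
      - dv \<mu> (gL \<beta> \<gamma>) z * Nconn \<mu> \<delta> z))"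

definition Rmat :: "(real ^ 'i) \<times> (real ^ 'i) \<Rightarrow> real ^ 'i ^ 'i" where
  "Rmat z = (\<chi> \<alpha> \<beta>. 2 * dx \<beta> (Gspray \<alpha>) z
     - (\<Sum>\<gamma>\<in>UNIV. dx \<gamma> (Nconn \<alpha> \<beta>) z * snd z $ \<gamma> - 2 * dv \<gamma> (Nconn \<alpha> \<beta>) z * Gspray \<gamma> z)
     - (\<Sum>\<gamma>\<in>UNIV. Nconn \<alpha> \<gamma> z * Nconn \<gamma> \<beta> z))"

end

definition lorentz_signature :: "real ^ 'i ^ 'i::finite \<Rightarrow> bool" where
  "lorentz_signature g \<longleftrightarrow> (\<exists>(P :: real ^ 'i ^ 'i) (i0 :: 'i). invertible P \<and> transpose P ** g ** P =
     (\<chi> i j. if i = j then if i = i0 then - 1 else 1 else 0))"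


section \<open>Weighted Finsler spacetimes\<close>

definition causal_vec :: "('m, 'i::finite) finsler_data \<Rightarrow> 'm \<Rightarrow> real ^ 'i \<Rightarrow> bool" where
  "causal_vec S p v \<longleftrightarrow> Lag S p v < 0 \<or> (Lag S p v = 0 \<and> v \<noteq> 0)"

definition future_directed :: "('m, 'i::finite) finsler_data \<Rightarrow> 'm \<Rightarrow> real ^ 'i \<Rightarrow> bool" where
  "future_directed S p v \<longleftrightarrow> causal_vec S p v \<and>
     connected_component (closure {w. Lag S p w < 0} - {0}) (time_or S p) v"

definition Omega :: "('m, 'i::finite) finsler_data \<Rightarrow> 'm \<Rightarrow> (real ^ 'i) set" where
  "Omega S p = {v. Lag S p v < 0 \<and> future_directed S p v}"

definition lorentz_finsler :: "('m, 'i::finite) finsler_data \<Rightarrow> bool" where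
  "lorentz_finsler S \<longleftrightarrow>
     (\<forall>c\<in>atlas S. smooth_on ((snd c ` fst c) \<times> (- {0})) (chart_rep S c (Lag S))) \<and>
     (\<forall>p v. \<forall>r>0. Lag S p (r *\<^sub>R v) = r\<^sup>2 * Lag S p v) \<and>
     (\<forall>c\<in>atlas S. \<forall>x\<in>snd c ` fst c. \<forall>v. v \<noteq> 0 \<longrightarrow>
        lorentz_signature (gmat (chart_rep S c (Lag S)) (x, v)))"

definition time_orientation :: "('m, 'i::finite) finsler_data \<Rightarrow> bool" where
  "time_orientation S \<longleftrightarrow>
     (\<forall>c\<in>atlas S. smooth_on (snd c ` fst c)
        (\<lambda>x. to_chart S c (chart_inv c x) (time_or S (chart_inv c x)))) \<and>
     (\<forall>p. Lag S p (time_or S p) < 0)"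

definition weight_function :: "('m, 'i::finite) finsler_data \<Rightarrow> bool" where
  "weight_function S \<longleftrightarrow>
     (\<forall>c\<in>atlas S. smooth_on {(snd c p, to_chart S c p v) | p v. p \<in> fst c \<and> v \<in> closure (Omega S p) - {0}}
        (chart_rep S c (weight S))) \<and>
     (\<forall>p. \<forall>v\<in>closure (Omega S p) - {0}. \<forall>r>0. weight S p (r *\<^sub>R v) = weight S p v)"

definition weighted_finsler_spacetime ::
    "('m::{t2_space, second_countable_topology}, 'i::finite) finsler_data \<Rightarrow> bool" where
  "weighted_finsler_spacetime S \<longleftrightarrow>
     smooth_manifold S \<and> lorentz_finsler S \<and> time_orientation S \<and> weight_function S"


section \<open>The metric \<open>g\<^sub>v\<close>, the curvature and geodesics\<close>

text \<open>The components of \<open>v \<in> T\<^sub>p M\<close> with respect to \<open>chart_at p\<close> are \<open>v\<close> itself.\<close>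

definition coords :: "('m, 'i::finite) finsler_data \<Rightarrow> 'm \<Rightarrow> real ^ 'i \<Rightarrow> (real ^ 'i) \<times> (real ^ 'i)" where
  "coords S p v = (snd (chart_at S p) p, v)"

definition metric :: "('m, 'i::finite) finsler_data \<Rightarrow> 'm \<Rightarrow> real ^ 'i \<Rightarrow> real ^ 'i ^ 'i" where
  "metric S p v = gmat (chart_rep S (chart_at S p) (Lag S)) (coords S p v)"

definition curvature :: "('m, 'i::finite) finsler_data \<Rightarrow> 'm \<Rightarrow> real ^ 'i \<Rightarrow> real ^ 'i ^ 'i" where
  "curvature S p v = Rmat (chart_rep S (chart_at S p) (Lag S)) (coords S p v)"

definition Ric :: "('m, 'i::finite) finsler_data \<Rightarrow> 'm \<Rightarrow> real ^ 'i \<Rightarrow> real" where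
  "Ric S p v = trace (curvature S p v)"

definition smooth_curve ::
    "('m::topological_space, 'i::finite) finsler_data \<Rightarrow> real set \<Rightarrow> (real \<Rightarrow> 'm) \<Rightarrow> bool" where
  "smooth_curve S I \<eta> \<longleftrightarrow> continuous_on I \<eta> \<and>
     (\<forall>c\<in>atlas S. smooth_on {t \<in> I. \<eta> t \<in> fst c} (snd c \<circ> \<eta>))"

definition velocity ::
    "('m, 'i::finite) finsler_data \<Rightarrow> real set \<Rightarrow> (real \<Rightarrow> 'm) \<Rightarrow> real \<Rightarrow> real ^ 'i" where
  "velocity S I \<eta> t = cderiv I (snd (chart_at S (\<eta> t)) \<circ> \<eta>) t"

definition geodesic_eq ::
    "('m, 'i::finite) finsler_data \<Rightarrow> real set \<Rightarrow> (real \<Rightarrow> 'm) \<Rightarrow> bool" where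
  "geodesic_eq S I \<eta> \<longleftrightarrow> (\<forall>c\<in>atlas S. \<forall>t\<in>I. \<eta> t \<in> fst c \<longrightarrow> (\<forall>\<alpha>.
     cderiv I (cderiv I (snd c \<circ> \<eta>)) t $ \<alpha>
     + 2 * Gspray (chart_rep S c (Lag S)) \<alpha> (snd c (\<eta> t), cderiv I (snd c \<circ> \<eta>) t) = 0))"

definition causal_geodesic ::
    "('m::topological_space, 'i::finite) finsler_data \<Rightarrow> real set \<Rightarrow> (real \<Rightarrow> 'm) \<Rightarrow> bool" where
  "causal_geodesic S I \<eta> \<longleftrightarrow> nondegenerate_interval I \<and> smooth_curve S I \<eta> \<and>
     (\<forall>t\<in>I. future_directed S (\<eta> t) (velocity S I \<eta> t)) \<and> geodesic_eq S I \<eta>"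

definition lightlike_geodesic ::
    "('m::topological_space, 'i::finite) finsler_data \<Rightarrow> real set \<Rightarrow> (real \<Rightarrow> 'm) \<Rightarrow> bool" where
  "lightlike_geodesic S I \<eta> \<longleftrightarrow> causal_geodesic S I \<eta> \<and>
     (\<forall>t\<in>I. Lag S (\<eta> t) (velocity S I \<eta> t) = 0)"

definition psi_along ::
    "('m, 'i::finite) finsler_data \<Rightarrow> real set \<Rightarrow> (real \<Rightarrow> 'm) \<Rightarrow> real \<Rightarrow> real" where
  "psi_along S I \<eta> t = weight S (\<eta> t) (velocity S I \<eta> t)"

text \<open>The interval of the geodesic with initial velocity \<open>v\<close> may have \<open>0\<close> as an endpoint; by
  uniqueness of geodesics the derivatives of \<open>\<psi>\<close> at \<open>0\<close> do not depend on the choice.\<close>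

definition geodesic_from ::
    "('m::topological_space, 'i::finite) finsler_data \<Rightarrow> 'm \<Rightarrow> real ^ 'i \<Rightarrow> real set \<times> (real \<Rightarrow> 'm)" where
  "geodesic_from S p v = (SOME (I, \<xi>). causal_geodesic S I \<xi> \<and> 0 \<in> I \<and> \<xi> 0 = p \<and> velocity S I \<xi> 0 = v)"

definition psi_d1 :: "('m::topological_space, 'i::finite) finsler_data \<Rightarrow> 'm \<Rightarrow> real ^ 'i \<Rightarrow> real" where
  "psi_d1 S p v = (case geodesic_from S p v of (I, \<xi>) \<Rightarrow> cderiv I (psi_along S I \<xi>) 0)"

definition psi_d2 :: "('m::topological_space, 'i::finite) finsler_data \<Rightarrow> 'm \<Rightarrow> real ^ 'i \<Rightarrow> real" where
  "psi_d2 S p v = (case geodesic_from S p v of (I, \<xi>) \<Rightarrow> cderiv I (cderiv I (psi_along S I \<xi>)) 0)"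

text \<open>Here \<open>n = CARD('i) - 1\<close>.\<close>

definition Ric_N :: "('m::topological_space, 'i::finite) finsler_data \<Rightarrow> real \<Rightarrow> 'm \<Rightarrow> real ^ 'i \<Rightarrow> real" where
  "Ric_N S N p v = Ric S p v + psi_d2 S p v - (psi_d1 S p v)\<^sup>2 / (N - (real CARD('i) - 1))"

definition Ric_inf :: "('m::topological_space, 'i::finite) finsler_data \<Rightarrow> 'm \<Rightarrow> real ^ 'i \<Rightarrow> real" where
  "Ric_inf S p v = Ric S p v + psi_d2 S p v"

text \<open>\<open>D\<^sub>\<eta>\<^sup>\<eta> Y\<close> along \<open>\<eta>\<close> (with reference vector the velocity), for \<open>Y t \<in> T\<^bsub>\<eta> t\<^esub> M\<close>.\<close>

definition covd ::
    "('m, 'i::finite) finsler_data \<Rightarrow> real set \<Rightarrow> (real \<Rightarrow> 'm) \<Rightarrow> (real \<Rightarrow> real ^ 'i) \<Rightarrow> real \<Rightarrow> real ^ 'i" where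
  "covd S I \<eta> Y t = (let c = chart_at S (\<eta> t); v = velocity S I \<eta> t in
     cderiv I (\<lambda>s. to_chart S c (\<eta> s) (Y s)) t
     + (\<chi> \<alpha>. \<Sum>\<beta>\<in>UNIV. \<Sum>\<gamma>\<in>UNIV.
          Gam (chart_rep S c (Lag S)) \<alpha> \<beta> \<gamma> (coords S (\<eta> t) v) * v $ \<beta> * Y t $ \<gamma>))"


section \<open>The quotient of the orthogonal space of a lightlike vector\<close>

text \<open>Linear algebra of \<open>Q = v\<^sup>\<bottom> / \<real>v\<close> for a bilinear form with matrix \<open>g\<close> and a vector \<open>v\<close> with
  \<open>g(v, v) = 0\<close>. Elements of \<open>Q\<close> are cosets, endomorphisms of \<open>Q\<close> are maps on cosets of which only
  the values on \<open>Q\<close> matter.\<close>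

definition form :: "real ^ 'i ^ 'i::finite \<Rightarrow> real ^ 'i \<Rightarrow> real ^ 'i \<Rightarrow> real" where
  "form g a b = a \<bullet> (g *v b)"

definition nperp :: "real ^ 'i ^ 'i::finite \<Rightarrow> real ^ 'i \<Rightarrow> (real ^ 'i) set" where
  "nperp g v = {w. form g v w = 0}"

definition qclass :: "real ^ 'i::finite \<Rightarrow> real ^ 'i \<Rightarrow> (real ^ 'i) set" where
  "qclass v w = {w + r *\<^sub>R v | r. True}"

definition Qsp :: "real ^ 'i ^ 'i::finite \<Rightarrow> real ^ 'i \<Rightarrow> (real ^ 'i) set set" where
  "Qsp g v = qclass v ` nperp g v"

definition qadd :: "(real ^ 'i::finite) set \<Rightarrow> (real ^ 'i) set \<Rightarrow> (real ^ 'i) set" where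
  "qadd A B = {a + b | a b. a \<in> A \<and> b \<in> B}"

text \<open>The summand \<open>s *\<^sub>R v\<close> makes the result a full coset also for \<open>r = 0\<close>.\<close>

definition qscale :: "real ^ 'i::finite \<Rightarrow> real \<Rightarrow> (real ^ 'i) set \<Rightarrow> (real ^ 'i) set" where
  "qscale v r A = {r *\<^sub>R a + s *\<^sub>R v | a s. a \<in> A}"

definition qdiff :: "real ^ 'i::finite \<Rightarrow> (real ^ 'i) set \<Rightarrow> (real ^ 'i) set \<Rightarrow> (real ^ 'i) set" where
  "qdiff v A B = qadd A (qscale v (- 1) B)"

definition qendo :: "real ^ 'i ^ 'i::finite \<Rightarrow> real ^ 'i \<Rightarrow> ((real ^ 'i) set \<Rightarrow> (real ^ 'i) set) \<Rightarrow> bool" where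
  "qendo g v F \<longleftrightarrow> (\<forall>A\<in>Qsp g v. F A \<in> Qsp g v) \<and>
     (\<forall>A\<in>Qsp g v. \<forall>B\<in>Qsp g v. F (qadd A B) = qadd (F A) (F B)) \<and>
     (\<forall>A\<in>Qsp g v. \<forall>r. F (qscale v r A) = qscale v r (F A))"

text \<open>The endomorphism of \<open>Q\<close> induced by an endomorphism of the tangent space.\<close>

definition qinduced :: "real ^ 'i::finite \<Rightarrow> real ^ 'i ^ 'i \<Rightarrow> (real ^ 'i) set \<Rightarrow> (real ^ 'i) set" where
  "qinduced v M A = {M *v a + s *\<^sub>R v | a s. a \<in> A}"

definition hform :: "real ^ 'i ^ 'i::finite \<Rightarrow> (real ^ 'i) set \<Rightarrow> (real ^ 'i) set \<Rightarrow> real" where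
  "hform g A B = (THE x. \<forall>a\<in>A. \<forall>b\<in>B. form g a b = x)"

definition qtranspose ::
    "real ^ 'i ^ 'i::finite \<Rightarrow> real ^ 'i \<Rightarrow> ((real ^ 'i) set \<Rightarrow> (real ^ 'i) set) \<Rightarrow> (real ^ 'i) set \<Rightarrow> (real ^ 'i) set"
  where
  "qtranspose g v F = (SOME G. qendo g v G \<and>
     (\<forall>A\<in>Qsp g v. \<forall>B\<in>Qsp g v. hform g (F A) B = hform g A (G B)))"

text \<open>The classes of the elements of \<open>B\<close> are pairwise distinct and form a basis of \<open>Q\<close>.\<close>

definition qbasis :: "real ^ 'i ^ 'i::finite \<Rightarrow> real ^ 'i \<Rightarrow> (real ^ 'i) set \<Rightarrow> bool" where
  "qbasis g v B \<longleftrightarrow> finite B \<and> B \<subseteq> nperp g v \<and>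
     (\<forall>A\<in>Qsp g v. \<exists>!x. x \<in> extensional B \<and> A = qclass v (\<Sum>b\<in>B. x b *\<^sub>R b))"

text \<open>The sum of the diagonal entries of the matrix \<open>m\<close> of \<open>F\<close> in a basis.\<close>

definition qtrace ::
    "real ^ 'i ^ 'i::finite \<Rightarrow> real ^ 'i \<Rightarrow> ((real ^ 'i) set \<Rightarrow> (real ^ 'i) set) \<Rightarrow> real" where
  "qtrace g v F = (THE s. \<exists>B m. qbasis g v B \<and>
     (\<forall>b\<in>B. F (qclass v b) = qclass v (\<Sum>a\<in>B. m a b *\<^sub>R a)) \<and> s = (\<Sum>b\<in>B. m b b))"


section \<open>Tensor fields on \<open>Q\<^sub>\<eta>\<close>\<close>

type_synonym 'i qfield = "real \<Rightarrow> (real ^ 'i) set \<Rightarrow> (real ^ 'i) set"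

context
  fixes S :: "('m, 'i::finite) finsler_data" and I :: "real set" and \<eta> :: "real \<Rightarrow> 'm"
begin

definition vel :: "real \<Rightarrow> real ^ 'i" where
  "vel t = velocity S I \<eta> t"

definition gvel :: "real \<Rightarrow> real ^ 'i ^ 'i" where
  "gvel t = metric S (\<eta> t) (vel t)"

definition Neta :: "real \<Rightarrow> (real ^ 'i) set" where
  "Neta t = nperp (gvel t) (vel t)"

definition Qeta :: "real \<Rightarrow> (real ^ 'i) set set" where
  "Qeta t = Qsp (gvel t) (vel t)"

definition Rq :: "'i qfield" where
  "Rq t = qinduced (vel t) (curvature S (\<eta> t) (vel t))"

definition smooth_field :: "real set \<Rightarrow> (real \<Rightarrow> real ^ 'i) \<Rightarrow> bool" where
  "smooth_field J Y \<longleftrightarrow>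
     (\<forall>c\<in>atlas S. smooth_on {t \<in> J. \<eta> t \<in> fst c} (\<lambda>t. to_chart S c (\<eta> t) (Y t)))"

definition lifts :: "real set \<Rightarrow> (real \<Rightarrow> (real ^ 'i) set) \<Rightarrow> (real \<Rightarrow> real ^ 'i) \<Rightarrow> bool" where
  "lifts J P Y \<longleftrightarrow> smooth_field J Y \<and> (\<forall>t\<in>J. Y t \<in> Neta t \<and> P t = qclass (vel t) (Y t))"

definition smooth_section :: "real set \<Rightarrow> (real \<Rightarrow> (real ^ 'i) set) \<Rightarrow> bool" where
  "smooth_section J P \<longleftrightarrow> openin (top_of_set I) J \<and> (\<exists>Y. lifts J P Y)"

text \<open>The covariant derivative descends from sections of \<open>N\<^sub>\<eta>\<close> to sections of \<open>Q\<^sub>\<eta>\<close>.\<close>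

definition qcovd :: "real set \<Rightarrow> (real \<Rightarrow> (real ^ 'i) set) \<Rightarrow> real \<Rightarrow> (real ^ 'i) set" where
  "qcovd J P t = qclass (vel t) (covd S I \<eta> (SOME Y. lifts J P Y) t)"

definition smooth_qfield :: "'i qfield \<Rightarrow> bool" where
  "smooth_qfield E \<longleftrightarrow> (\<forall>t\<in>I. qendo (gvel t) (vel t) (E t)) \<and>
     (\<forall>J P. smooth_section J P \<longrightarrow> smooth_section J (\<lambda>t. E t (P t)))"

text \<open>\<open>E'(P) = E(P)' - E(P')\<close>; the value at \<open>A \<in> Q\<^sub>\<eta>(t)\<close> is computed with a local smooth section
  \<open>P\<close> through \<open>A\<close>.\<close>

definition qfield_deriv :: "'i qfield \<Rightarrow> 'i qfield" where
  "qfield_deriv E t A = (case (SOME (J, P). smooth_section J P \<and> t \<in> J \<and> P t = A) of (J, P) \<Rightarrow>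
     qdiff (vel t) (qcovd J (\<lambda>s. E s (P s)) t) (E t (qcovd J P t)))"

definition jacobi_tensor :: "'i qfield \<Rightarrow> bool" where
  "jacobi_tensor E \<longleftrightarrow> smooth_qfield E \<and>
     (\<forall>t\<in>I. \<forall>A\<in>Qeta t. qadd (qfield_deriv (qfield_deriv E) t A) (Rq t (E t A)) = qclass (vel t) 0) \<and>
     (\<forall>t\<in>I. \<forall>A\<in>Qeta t. E t A = qclass (vel t) 0 \<and> qfield_deriv E t A = qclass (vel t) 0
        \<longrightarrow> A = qclass (vel t) 0)"

definition lagrange_tensor :: "'i qfield \<Rightarrow> bool" where
  "lagrange_tensor E \<longleftrightarrow> jacobi_tensor E \<and>
     (\<forall>t\<in>I. \<forall>A\<in>Qeta t.
        qdiff (vel t) (qtranspose (gvel t) (vel t) (qfield_deriv E t) (E t A))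
                      (qtranspose (gvel t) (vel t) (E t) (qfield_deriv E t A)) = qclass (vel t) 0)"

definition nonsingular :: "'i qfield \<Rightarrow> bool" where
  "nonsingular E \<longleftrightarrow> (\<forall>t\<in>I. bij_betw (E t) (Qeta t) (Qeta t))"

definition psi_eta :: "real \<Rightarrow> real" where
  "psi_eta t = psi_along S I \<eta> t"

text \<open>Recall \<open>n - 1 = CARD('i) - 2\<close>. The derivative with respect to \<open>\<tau>\<^sub>\<epsilon>\<close> is \<open>star_factor \<epsilon>\<close> times the
  derivative with respect to the parameter of \<open>\<eta>\<close>.\<close>

definition star_factor :: "real \<Rightarrow> real \<Rightarrow> real" where
  "star_factor \<epsilon> t = exp (2 * (1 - \<epsilon>) / (real CARD('i) - 2) * psi_eta t)"

definition star :: "real \<Rightarrow> (real \<Rightarrow> real) \<Rightarrow> real \<Rightarrow> real" where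
  "star \<epsilon> f t = star_factor \<epsilon> t * cderiv I f t"

definition qfield_star :: "real \<Rightarrow> 'i qfield \<Rightarrow> 'i qfield" where
  "qfield_star \<epsilon> E t A = qscale (vel t) (star_factor \<epsilon> t) (qfield_deriv E t A)"

definition eta_star :: "real \<Rightarrow> real \<Rightarrow> real ^ 'i" where
  "eta_star \<epsilon> t = star_factor \<epsilon> t *\<^sub>R vel t"

definition J_psi :: "'i qfield \<Rightarrow> 'i qfield" where
  "J_psi E t A = qscale (vel t) (exp (- psi_eta t / (real CARD('i) - 2))) (E t A)"

definition B_eps :: "real \<Rightarrow> 'i qfield \<Rightarrow> 'i qfield" where
  "B_eps \<epsilon> E t = qfield_star \<epsilon> (J_psi E) t \<circ> inv_into (Qeta t) (J_psi E t)"

definition theta_eps :: "real \<Rightarrow> 'i qfield \<Rightarrow> real \<Rightarrow> real" where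
  "theta_eps \<epsilon> E t = qtrace (gvel t) (vel t) (B_eps \<epsilon> E t)"

definition sigma_eps :: "real \<Rightarrow> 'i qfield \<Rightarrow> 'i qfield" where
  "sigma_eps \<epsilon> E t A =
     qdiff (vel t) (B_eps \<epsilon> E t A) (qscale (vel t) (theta_eps \<epsilon> E t / (real CARD('i) - 2)) A)"

definition tr_sigma_sq :: "real \<Rightarrow> 'i qfield \<Rightarrow> real \<Rightarrow> real" where
  "tr_sigma_sq \<epsilon> E t = qtrace (gvel t) (vel t) (sigma_eps \<epsilon> E t \<circ> sigma_eps \<epsilon> E t)"

end

end

theory Submission
  imports Defs
begin

text \<open>The spray of \<open>L\<close> changes between charts by a second derivative of the transition map, so the
  derivative \<open>Y' + N Y\<close> along \<open>\<eta>\<close>, with \<open>N\<close> the nonlinear connection, is independent of the chart; it is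
  the covariant derivative, because \<open>\<Gamma>\<close> contracted with the velocity \<open>v\<close> is \<open>N\<close>. In a chart, with
  \<open>P = g\<^sub>v(v, \<cdot>)\<close>, the quotient \<open>Q\<^sub>\<eta>\<close> is identified with the Euclidean orthogonal complement of \<open>P\<close> and \<open>v\<close>.
  Endomorphism fields become matrices \<open>M\<close> compressed to this complement, and their covariant
  derivative becomes the compression of \<open>M' + N M - M N\<close>.

  For \<open>B = J' J\<^sup>-\<^sup>1\<close> the Jacobi equation gives the Riccati equation \<open>B' + B\<^sup>2 + R = 0\<close>. Its trace involves only
  \<open>Ric\<close>, since \<open>R\<^sub>v(v) = 0\<close> and \<open>g\<^sub>v(v, R\<^sub>v(w)) = 0\<close>. Up to the factor of the \<open>\<epsilon>\<close>-parametrisation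
  \<open>B\<^sub>\<epsilon>\<close> is \<open>B - \<psi>' / (n - 1)\<close>, and substitution yields one identity of which the three equations are
  rearrangements. The derivatives of \<open>\<psi>\<close> entering \<open>Ric\<^sub>N\<close> are computed along an arbitrarily chosen geodesic,
  but the spray and a local smooth extension of \<open>\<psi>\<close> determine them.\<close>


section \<open>Calculus of smooth maps\<close>

text \<open>Several notions are fixed by a choice: \<open>qtrace\<close> by a basis,
  \<open>qcovd\<close> by a lift, \<open>qfield_deriv\<close> by a section. Much of the work is to
  show these choices immaterial, and the matrix model serves that purpose. What lets differentiation
  descend to the quotient is that \<open>V\<close> is parallel (geodesic equation) and that
  \<open>P\<close> is parallel (Euler-Lagrange equation together with the vanishing horizontal
  derivative of \<open>L\<close>). The complement of \<open>P\<close> and \<open>V\<close> is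
  Euclidean in a chart, hence not parallel, so differentiating its projection \<open>Pj\<close>
  leaves error terms. Since \<open>Pj ** Pj = Pj\<close> forces \<open>Pj ** D Pj ** Pj = 0\<close>,
  they drop out of the traces. The index formulas are contracted into coordinate-free ones,
  centrally \<open>fd (p a) z (spray z) = fd l z (a, 0)\<close>; differentiating it and applying
  Euler's relations gives most properties of the connection and the curvature. The Ricci terms are
  evaluated at \<open>eta_star\<close>, a positive multiple of the velocity, whence the affine
  reparametrisation. The weight lives on a closed cone only, so a lightlike vector must first be
  recognised as a limit of future timelike ones.\<close>

abbreviation fd :: "('a::real_normed_vector \<Rightarrow> 'b::real_normed_vector) \<Rightarrow> 'a \<Rightarrow> 'a \<Rightarrow> 'b" where
  "fd f z \<equiv> frechet_derivative f (at z)"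

lemma fd_eqI: "(f has_derivative f') (at x) \<Longrightarrow> fd f x h = f' h"
  by (metis frechet_derivative_at)

lemma has_derivative_fd: "f differentiable (at x) \<Longrightarrow> (f has_derivative fd f x) (at x)"
  by (simp add: frechet_derivative_works)

lemma fd_linear: "f differentiable (at x) \<Longrightarrow> linear (fd f x)"
  by (simp add: linear_frechet_derivative)

lemma fd_cong_open:
  assumes "open U" "x \<in> U" "\<And>y. y \<in> U \<Longrightarrow> f y = g y" "f differentiable (at x)"
  shows "fd g x = fd f x" "g differentiable (at x)"
proof -
  have "(g has_derivative fd f x) (at x)"
    using has_derivative_transform_within_open[OF has_derivative_fd[OF assms(4)] assms(1,2)] assms(3) by blast
  then show "fd g x = fd f x" "g differentiable (at x)"
    by (auto simp: fd_eqI differentiable_def)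
qed

section \<open>Closure properties of maps of class C^k\<close>

lemma Ck_on_cong:
  assumes "open U" "\<And>x. x \<in> U \<Longrightarrow> f x = g x" "Ck_on k U f"
  shows "Ck_on k U g"
  using assms(2,3)
proof (induction k arbitrary: f g)
  case 0 then show ?case by (simp add: continuous_on_eq)
next
  case (Suc k)
  have "\<forall>x\<in>U. g differentiable (at x) \<and> fd g x = fd f x"
    using Suc.prems fd_cong_open[OF assms(1)] by (metis Ck_on.simps(2))
  moreover have "Ck_on k U (\<lambda>x. fd g x v)" for v
    by (rule Suc.IH[of "\<lambda>x. fd f x v"]) (use calculation Suc.prems in auto)
  ultimately show ?case by simp
qed

lemma Ck_on_subset: "Ck_on k U f \<Longrightarrow> V \<subseteq> U \<Longrightarrow> Ck_on k V f"
  by (induction k arbitrary: f) (auto intro: continuous_on_subset)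

lemma Ck_on_continuous: "Ck_on k U f \<Longrightarrow> continuous_on U f"
proof (cases k)
  case (Suc j)
  assume "Ck_on k U f"
  then show ?thesis using Suc
    by (intro continuous_at_imp_continuous_on ballI differentiable_imp_continuous_within) auto
qed simp

lemma Ck_on_SucD: "Ck_on (Suc k) U f \<Longrightarrow> Ck_on k U f"
proof (induction k arbitrary: f)
  case 0 then show ?case using Ck_on_continuous[OF 0] by simp
next
  case (Suc k) then show ?case by (metis Ck_on.simps(2))
qed

lemma Ck_on_local:
  assumes "\<And>a. a \<in> U \<Longrightarrow> \<exists>V. open V \<and> a \<in> V \<and> Ck_on k V f"
  shows "Ck_on k U f"
  using assms
proof (induction k arbitrary: f)
  case 0
  then show ?case
    by (metis Ck_on.simps(1) continuous_at_imp_continuous_on continuous_on_eq_continuous_at)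
next
  case (Suc k)
  then show ?case by (metis Ck_on.simps(2))
qed

text \<open>The closure rules below exhibit a derivative instead of handling
  \<open>frechet_derivative\<close>, which is a choice operator; openness of \<open>U\<close>
  transfers smoothness from one to the other.\<close>

lemma Ck_on_SucI:
  assumes "open U" "\<And>x. x \<in> U \<Longrightarrow> (f has_derivative f' x) (at x)" "\<And>v. Ck_on k U (\<lambda>x. f' x v)"
  shows "Ck_on (Suc k) U f"
proof -
  have "Ck_on k U (\<lambda>x. fd f x v)" for v
    using fd_eqI[OF assms(2)] by (intro Ck_on_cong[OF assms(1) _ assms(3)[of v]]) simp
  then show ?thesis using assms(2) by (auto simp: differentiable_def)
qed

lemma Ck_on_const: "Ck_on k U (\<lambda>x. c)"
  by (induction k arbitrary: c) auto

lemma Ck_on_bounded_linear: "bounded_linear f \<Longrightarrow> Ck_on k U f"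
proof (cases k)
  case 0 assume "bounded_linear f" then show ?thesis
    using 0 by (simp add: linear_continuous_on)
next
  case (Suc j)
  assume bl: "bounded_linear f"
  have "fd f x v = f v" for x v
    using bounded_linear.has_derivative[OF bl has_derivative_ident] by (rule fd_eqI)
  then show ?thesis using Suc bl
    by (auto simp: Ck_on_const bounded_linear_imp_differentiable)
qed

lemma Ck_on_add:
  assumes "open U" shows "Ck_on k U f \<Longrightarrow> Ck_on k U g \<Longrightarrow> Ck_on k U (\<lambda>x. f x + g x)"
proof (induction k arbitrary: f g)
  case 0 then show ?case by (simp add: continuous_on_add)
next
  case (Suc k)
  show ?case
  proof (rule Ck_on_SucI[OF assms, of _ "\<lambda>x v. fd f x v + fd g x v"])
    show "((\<lambda>x. f x + g x) has_derivative (\<lambda>v. fd f x v + fd g x v)) (at x)" if "x \<in> U" for x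
      using Suc.prems that by (intro has_derivative_add) (auto intro: has_derivative_fd)
    show "Ck_on k U (\<lambda>x. fd f x v + fd g x v)" for v using Suc by simp
  qed
qed

lemma Ck_on_sum:
  assumes "open U" "\<And>i. i \<in> A \<Longrightarrow> Ck_on k U (f i)"
  shows "Ck_on k U (\<lambda>x. \<Sum>i\<in>A. f i x)"
  using assms(2) by (induction A rule: infinite_finite_induct) (auto simp: Ck_on_const intro: Ck_on_add[OF assms(1)])

text \<open>One induction serves scalar, inner and matrix products alike: the Leibniz rule yields
  two terms of the same bilinear shape, each with one factor differentiated, so the induction runs
  over all pairs \<open>f\<close>, \<open>g\<close>.\<close>

lemma Ck_on_bilinear:
  assumes "bounded_bilinear B" "open U"
  shows "Ck_on k U f \<Longrightarrow> Ck_on k U g \<Longrightarrow> Ck_on k U (\<lambda>x. B (f x) (g x))"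
proof (induction k arbitrary: f g)
  case 0 then show ?case by (simp add: bounded_bilinear.continuous_on[OF assms(1)])
next
  case (Suc k)
  have der: "((\<lambda>x. B (f x) (g x)) has_derivative (\<lambda>v. B (f x) (fd g x v) + B (fd f x v) (g x))) (at x)"
    if "x \<in> U" for x
    using Suc.prems that by (intro bounded_bilinear.FDERIV[OF assms(1)]) (auto intro: has_derivative_fd)
  have "Ck_on k U (\<lambda>x. B (f x) (fd g x v) + B (fd f x v) (g x))" for v
  proof (intro Ck_on_add[OF assms(2)] Suc.IH)
    show "Ck_on k U f" "Ck_on k U g" using Suc.prems by (auto dest: Ck_on_SucD simp del: Ck_on.simps)
    show "Ck_on k U (\<lambda>x. fd f x v)" "Ck_on k U (\<lambda>x. fd g x v)" using Suc.prems by auto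
  qed
  then show ?case by (rule Ck_on_SucI[OF assms(2) der, rotated])
qed

lemma Ck_on_Pair:
  assumes "open U"
  shows "Ck_on k U f \<Longrightarrow> Ck_on k U g \<Longrightarrow> Ck_on k U (\<lambda>x. (f x, g x))"
proof (induction k arbitrary: f g)
  case 0 then show ?case by (simp add: continuous_on_Pair)
next
  case (Suc k)
  have der: "((\<lambda>x. (f x, g x)) has_derivative (\<lambda>v. (fd f x v, fd g x v))) (at x)" if "x \<in> U" for x
    using Suc.prems that by (intro has_derivative_Pair) (auto intro: has_derivative_fd)
  have "Ck_on k U (\<lambda>x. (fd f x v, fd g x v))" for v using Suc by simp
  then show ?case by (rule Ck_on_SucI[OF assms der, rotated])
qed

lemma linear_euclidean_expand:
  fixes f :: "'a::euclidean_space \<Rightarrow> 'b::real_normed_vector"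
  assumes "linear f" shows "f x = (\<Sum>i\<in>Basis. (x \<bullet> i) *\<^sub>R f i)"
proof -
  interpret linear f by fact
  have "f (\<Sum>i\<in>Basis. (x \<bullet> i) *\<^sub>R i) = (\<Sum>i\<in>Basis. (x \<bullet> i) *\<^sub>R f i)"
    by (simp add: sum scale)
  then show ?thesis by (simp add: euclidean_representation)
qed

lemma Ck_on_compose:
  fixes f :: "'a::real_normed_vector \<Rightarrow> 'b::euclidean_space" and g :: "'b \<Rightarrow> 'c::real_normed_vector"
  assumes "open U" "open V"
  shows "Ck_on k U f \<Longrightarrow> Ck_on k V g \<Longrightarrow> f ` U \<subseteq> V \<Longrightarrow> Ck_on k U (\<lambda>x. g (f x))"
proof (induction k arbitrary: f g)
  case 0 then show ?case using continuous_on_compose2 by auto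
next
  case (Suc k)
  have der: "((\<lambda>x. g (f x)) has_derivative (\<lambda>v. fd g (f x) (fd f x v))) (at x)" if "x \<in> U" for x
  proof -
    have "(f has_derivative fd f x) (at x)" "(g has_derivative fd g (f x)) (at (f x))"
      using Suc.prems that by (auto intro!: has_derivative_fd)
    from diff_chain_at[OF this] show ?thesis by (simp add: o_def)
  qed
  \<comment> \<open>\<open>Ck_on\<close> controls derivatives in fixed directions, while the
    direction here moves with \<open>x\<close>; expanding it in the basis leaves fixed directions
    with varying coefficients.\<close>
  have e: "fd g (f x) (fd f x v) = (\<Sum>i\<in>Basis. (fd f x v \<bullet> i) *\<^sub>R fd g (f x) i)" if "x \<in> U" for x v
    using Suc.prems that by (intro linear_euclidean_expand fd_linear) auto
  have "Ck_on k U (\<lambda>x. \<Sum>i\<in>Basis. (fd f x v \<bullet> i) *\<^sub>R fd g (f x) i)" for v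
  proof (intro Ck_on_sum[OF assms(1)] Ck_on_bilinear[OF bounded_bilinear_scaleR assms(1)]
      Ck_on_bilinear[OF bounded_bilinear_inner assms(1)] Ck_on_const)
    show "Ck_on k U (\<lambda>x. fd f x v)" using Suc.prems by simp
    fix i :: 'b
    show "Ck_on k U (\<lambda>x. fd g (f x) i)"
      using Suc.prems by (intro Suc.IH[of f "\<lambda>y. fd g y i"] Ck_on_SucD[of k U f]) auto
  qed
  then have "Ck_on k U (\<lambda>x. fd g (f x) (fd f x v))" for v
    by (rule Ck_on_cong[OF assms(1), rotated]) (simp add: e)
  then show ?case by (rule Ck_on_SucI[OF assms(1) der, rotated])
qed

text \<open>The derivative \<open>- (inverse x * v * inverse x)\<close> is again a product of
  inverses, so the induction needs only the product rule.\<close>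

lemma Ck_on_inverse: "Ck_on k (- {0}) (inverse :: real \<Rightarrow> real)"
proof (induction k)
  case 0 show ?case by (auto intro!: continuous_intros)
next
  case (Suc k)
  have op: "open (- {0::real})" by auto
  have der: "((inverse::real\<Rightarrow>real) has_derivative (\<lambda>v. - (inverse x * v * inverse x))) (at x)" if "x \<noteq> 0" for x
    using that by (rule has_derivative_inverse'[THEN has_derivative_at_withinI])
  have "Ck_on k (- {0}) (\<lambda>x::real. inverse x * (- v) * inverse x)" for v
    by (intro Ck_on_bilinear[OF bounded_bilinear_mult op] Suc Ck_on_const)
  then have "Ck_on k (- {0}) (\<lambda>x::real. - (inverse x * v * inverse x))" for v by simp
  then show ?case by (rule Ck_on_SucI[OF op der, rotated]) auto
qed

lemma Ck_on_exp: "Ck_on k UNIV (exp :: real \<Rightarrow> real)"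
proof (induction k)
  case 0 show ?case by (auto intro!: continuous_intros)
next
  case (Suc k)
  have der: "((exp::real\<Rightarrow>real) has_derivative (\<lambda>v. exp x * v)) (at x)" for x
    using DERIV_exp[of x] by (simp add: has_field_derivative_def)
  have "Ck_on k UNIV (\<lambda>x::real. exp x * v)" for v
    by (intro Ck_on_bilinear[OF bounded_bilinear_mult] Suc Ck_on_const) auto
  then show ?case by (rule Ck_on_SucI[OF open_UNIV der])
qed

subsection \<open>Smooth maps on open sets\<close>

text \<open>Openness is bundled in because a Frechet derivative is determined at interior points,
  and all orders because then differentiation (\<open>Cinf_fd\<close>) costs nothing.\<close>

definition Cinf :: "'a::real_normed_vector set \<Rightarrow> ('a \<Rightarrow> 'b::real_normed_vector) \<Rightarrow> bool" where
  "Cinf U f \<longleftrightarrow> open U \<and> (\<forall>k. Ck_on k U f)"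

lemma Cinf_open: "Cinf U f \<Longrightarrow> open U" by (simp add: Cinf_def)

lemma Cinf_differentiable: "Cinf U f \<Longrightarrow> x \<in> U \<Longrightarrow> f differentiable (at x)"
  by (metis Cinf_def Ck_on.simps(2))

lemma Cinf_has_derivative: "Cinf U f \<Longrightarrow> x \<in> U \<Longrightarrow> (f has_derivative fd f x) (at x)"
  by (simp add: Cinf_differentiable has_derivative_fd)

lemma Cinf_linear: "Cinf U f \<Longrightarrow> x \<in> U \<Longrightarrow> linear (fd f x)"
  by (simp add: Cinf_differentiable fd_linear)

lemma Cinf_continuous_on: "Cinf U f \<Longrightarrow> continuous_on U f"
  by (meson Cinf_def Ck_on_continuous)

lemma Cinf_fd: "Cinf U f \<Longrightarrow> Cinf U (\<lambda>x. fd f x v)"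
  by (metis Cinf_def Ck_on.simps(2))

lemma Cinf_cong: "Cinf U f \<Longrightarrow> (\<And>x. x \<in> U \<Longrightarrow> f x = g x) \<Longrightarrow> Cinf U g"
  unfolding Cinf_def by (metis Ck_on_cong)

lemma Cinf_subset: "Cinf U f \<Longrightarrow> open V \<Longrightarrow> V \<subseteq> U \<Longrightarrow> Cinf V f"
  unfolding Cinf_def by (metis Ck_on_subset)

lemma Cinf_const: "open U \<Longrightarrow> Cinf U (\<lambda>x. c)" by (simp add: Cinf_def Ck_on_const)

lemma Cinf_bounded_linear: "bounded_linear f \<Longrightarrow> open U \<Longrightarrow> Cinf U f"
  by (simp add: Cinf_def Ck_on_bounded_linear)

lemma Cinf_add: "Cinf U f \<Longrightarrow> Cinf U g \<Longrightarrow> Cinf U (\<lambda>x. f x + g x)"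
  by (simp add: Cinf_def Ck_on_add)

lemma Cinf_sum: "open U \<Longrightarrow> (\<And>i. i \<in> A \<Longrightarrow> Cinf U (f i)) \<Longrightarrow> Cinf U (\<lambda>x. \<Sum>i\<in>A. f i x)"
  by (simp add: Cinf_def Ck_on_sum)

lemma Cinf_bilinear: "bounded_bilinear B \<Longrightarrow> Cinf U f \<Longrightarrow> Cinf U g \<Longrightarrow> Cinf U (\<lambda>x. B (f x) (g x))"
  by (simp add: Cinf_def Ck_on_bilinear)

lemmas Cinf_mult = Cinf_bilinear[OF bounded_bilinear_mult]
lemmas Cinf_scaleR = Cinf_bilinear[OF bounded_bilinear_scaleR]
lemmas Cinf_inner = Cinf_bilinear[OF bounded_bilinear_inner]

lemma Cinf_Pair: "Cinf U f \<Longrightarrow> Cinf U g \<Longrightarrow> Cinf U (\<lambda>x. (f x, g x))"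
  by (simp add: Cinf_def Ck_on_Pair)

lemma Cinf_compose:
  fixes f :: "'a::real_normed_vector \<Rightarrow> 'b::euclidean_space"
  shows "Cinf U f \<Longrightarrow> Cinf V g \<Longrightarrow> f ` U \<subseteq> V \<Longrightarrow> Cinf U (\<lambda>x. g (f x))"
  unfolding Cinf_def using Ck_on_compose by blast

lemma Cinf_uminus: "Cinf U f \<Longrightarrow> Cinf U (\<lambda>x. - f x)"
  using Cinf_scaleR[OF Cinf_const, of U f "-1"] Cinf_open by auto

lemma Cinf_diff: "Cinf U f \<Longrightarrow> Cinf U g \<Longrightarrow> Cinf U (\<lambda>x. f x - g x)"
  using Cinf_add[OF _ Cinf_uminus, of U f g] by simp

lemma Cinf_prod:
  fixes f :: "'i \<Rightarrow> 'a::real_normed_vector \<Rightarrow> real"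
  shows "open U \<Longrightarrow> (\<And>i. i \<in> A \<Longrightarrow> Cinf U (f i)) \<Longrightarrow> Cinf U (\<lambda>x. \<Prod>i\<in>A. f i x)"
  by (induction A rule: infinite_finite_induct) (auto simp: Cinf_const intro!: Cinf_mult)

lemma Cinf_inverse:
  fixes f :: "'a::real_normed_vector \<Rightarrow> real"
  assumes "Cinf U f" "\<And>x. x \<in> U \<Longrightarrow> f x \<noteq> 0"
  shows "Cinf U (\<lambda>x. inverse (f x))"
  by (rule Cinf_compose[OF assms(1), of "- {0}" inverse]) (use assms in \<open>auto simp: Cinf_def Ck_on_inverse\<close>)

lemma Cinf_divide:
  fixes f g :: "'a::real_normed_vector \<Rightarrow> real"
  assumes "Cinf U f" "Cinf U g" "\<And>x. x \<in> U \<Longrightarrow> g x \<noteq> 0"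
  shows "Cinf U (\<lambda>x. f x / g x)"
  using Cinf_mult[OF assms(1) Cinf_inverse[OF assms(2,3)]] by (simp add: divide_inverse)

lemma Cinf_vec_nth: fixes f :: "'a::real_normed_vector \<Rightarrow> real ^ 'i::finite" shows "Cinf U f \<Longrightarrow> Cinf U (\<lambda>x. f x $ i)"
  using Cinf_inner[OF _ Cinf_const, of U f "axis i 1"] Cinf_open by (auto simp: inner_axis)

lemma Cinf_vec:
  fixes f :: "'i::finite \<Rightarrow> 'a::real_normed_vector \<Rightarrow> 'b::euclidean_space"
  assumes "open U" "\<And>i. Cinf U (f i)" shows "Cinf U (\<lambda>x. \<chi> i. f i x)"
proof -
  have "Cinf U (\<lambda>x. \<Sum>i\<in>UNIV. axis i (f i x))"
  proof (intro Cinf_sum assms)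
    fix i :: 'i
    have "linear (axis i :: 'b \<Rightarrow> 'b ^ 'i)"
      by (rule linearI) (auto simp: axis_def vec_eq_iff)
    then have "bounded_linear (axis i :: 'b \<Rightarrow> 'b ^ 'i)" by (simp add: linear_conv_bounded_linear)
    then show "Cinf U (\<lambda>x. axis i (f i x))"
      using Cinf_compose[OF assms(2) Cinf_bounded_linear, of "axis i" UNIV] by auto
  qed
  moreover have "(\<Sum>i\<in>UNIV. axis i (f i x)) = (\<chi> i. f i x)" for x
    by (simp add: vec_eq_iff sum_component axis_def if_distrib cong: if_cong)
  ultimately show ?thesis by simp
qed

lemma Cinf_fst: "open U \<Longrightarrow> Cinf U fst" and Cinf_snd: "open U \<Longrightarrow> Cinf U snd"
  by (auto intro: Cinf_bounded_linear bounded_linear_fst bounded_linear_snd)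

lemma Cinf_ident: "open U \<Longrightarrow> Cinf U (\<lambda>x. x)"
  by (auto intro: Cinf_bounded_linear bounded_linear_ident)

text \<open>Smoothness jointly in the base point and the direction, whereas \<open>Cinf_fd\<close>
  fixes the direction; expansion in a basis reduces the former to the latter.\<close>

lemma Cinf_fd_joint:
  fixes f :: "'a::real_normed_vector \<Rightarrow> 'b::euclidean_space" and g :: "'b \<Rightarrow> 'c::real_normed_vector"
  assumes "Cinf U f" "Cinf U h" "Cinf V g" "f ` U \<subseteq> V"
  shows "Cinf U (\<lambda>x. fd g (f x) (h x))"
proof (rule Cinf_cong)
  show "Cinf U (\<lambda>x. \<Sum>i\<in>Basis. (h x \<bullet> i) *\<^sub>R fd g (f x) i)"
    by (intro Cinf_sum Cinf_scaleR Cinf_inner Cinf_const Cinf_compose[OF assms(1), of V "\<lambda>y. fd g y i" for i] assms Cinf_fd)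
      (use assms Cinf_open in auto)
  show "x \<in> U \<Longrightarrow> (\<Sum>i\<in>Basis. (h x \<bullet> i) *\<^sub>R fd g (f x) i) = fd g (f x) (h x)" for x
    using linear_euclidean_expand[OF Cinf_linear[OF assms(3)], of "f x" "h x"] assms(4) by auto
qed

lemma Cinf_smooth_on: "Cinf U f \<Longrightarrow> A \<subseteq> U \<Longrightarrow> smooth_on A f"
  unfolding Cinf_def smooth_on_def by blast

text \<open>On an open set the local extensions demanded by \<open>smooth_on\<close> coincide with
  \<open>f\<close> itself near each point, and \<open>Ck_on\<close> is a local notion.\<close>

lemma smooth_on_open: "open U \<Longrightarrow> smooth_on U f \<longleftrightarrow> Cinf U f"
proof
  assume U: "open U" and sm: "smooth_on U f"
  show "Cinf U f" unfolding Cinf_def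
  proof (intro conjI allI U Ck_on_local)
    fix k a assume "a \<in> U"
    from bspec[OF sm[unfolded smooth_on_def] this]
    obtain V F where V: "open V" "a \<in> V" "\<forall>k. Ck_on k V F" "\<forall>x\<in>U \<inter> V. F x = f x"
      by (elim exE conjE)
    have "Ck_on k (U \<inter> V) F" using V(3) by (blast intro: Ck_on_subset)
    then have "Ck_on k (U \<inter> V) f" using U V by (rule_tac Ck_on_cong[of "U \<inter> V" F]) auto
    then show "\<exists>V. open V \<and> a \<in> V \<and> Ck_on k V f" using U V \<open>a \<in> U\<close> by blast
  qed
qed (auto intro: Cinf_smooth_on)

subsection \<open>Symmetry of second derivatives\<close>

lemma continuous_on_two_point:
  fixes f :: "'a::metric_space \<Rightarrow> real"
  assumes "continuous_on U f" "open U" "x \<in> U" "e > 0"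
  obtains d where "d > 0" "\<And>y. dist y x < d \<Longrightarrow> y \<in> U \<and> \<bar>f y - f x\<bar> < e"
proof -
  obtain d1 where d1: "d1 > 0" "ball x d1 \<subseteq> U" using assms openE by blast
  obtain d2 where d2: "d2 > 0" "\<And>y. y \<in> U \<Longrightarrow> dist y x < d2 \<Longrightarrow> dist (f y) (f x) < e"
    using assms unfolding continuous_on_iff by metis
  show ?thesis
    by (rule that[of "min d1 d2"]) (use d1 d2 in \<open>auto simp: dist_real_def subset_eq dist_commute\<close>)
qed

text \<open>The second difference of \<open>f\<close> along \<open>a\<close> and \<open>b\<close> is a value of either iterated derivative, by
  applying the mean value theorem twice.\<close>

lemma second_difference_mvt:
  fixes f :: "'a::real_normed_vector \<Rightarrow> real"
  assumes f: "\<And>y. y \<in> W \<Longrightarrow> f differentiable (at y)"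
    and fa: "\<And>y. y \<in> W \<Longrightarrow> (\<lambda>y. fd f y a) differentiable (at y)"
    and W: "\<And>s r. 0 \<le> s \<Longrightarrow> s \<le> t \<Longrightarrow> 0 \<le> r \<Longrightarrow> r \<le> t \<Longrightarrow> x + s *\<^sub>R a + r *\<^sub>R b \<in> W" and t: "0 < t"
  shows "\<exists>s r. 0 \<le> s \<and> s \<le> t \<and> 0 \<le> r \<and> r \<le> t \<and>
    f (x + t *\<^sub>R a + t *\<^sub>R b) - f (x + t *\<^sub>R a) - f (x + t *\<^sub>R b) + f x
      = t * t * fd (\<lambda>y. fd f y a) (x + s *\<^sub>R a + r *\<^sub>R b) b"
proof -
  \<comment> \<open>Increment across the strip in direction \<open>b\<close>, as a function of the
    position along \<open>a\<close>. The term \<open>0 *\<^sub>R b\<close> is kept so that the one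
    derivative rule \<open>d\<close> covers both edges.\<close>
  define h where "h s = f (x + s *\<^sub>R a + t *\<^sub>R b) - f (x + s *\<^sub>R a + 0 *\<^sub>R b)" for s
  have d: "((\<lambda>s. f (x + s *\<^sub>R a + r *\<^sub>R b)) has_real_derivative fd f (x + s *\<^sub>R a + r *\<^sub>R b) a) (at s)"
    if "0 \<le> s" "s \<le> t" "0 \<le> r" "r \<le> t" for s r
  proof -
    have "((\<lambda>s. x + s *\<^sub>R a + r *\<^sub>R b) has_derivative (\<lambda>h. h *\<^sub>R a)) (at s)"
      by (auto intro!: derivative_eq_intros)
    from diff_chain_at[OF this has_derivative_fd[OF f[OF W[OF that]]]]
    show ?thesis using linear_scale[OF fd_linear[OF f[OF W[OF that]]]]
      by (simp add: o_def has_field_derivative_def mult.commute[of _ "fd f _ _"])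
  qed
  obtain s where s: "0 < s" "s < t" "h t - h 0 = (t - 0) * (fd f (x + s *\<^sub>R a + t *\<^sub>R b) a - fd f (x + s *\<^sub>R a + 0 *\<^sub>R b) a)"
    unfolding h_def
    by (rule MVT2[OF t, of "\<lambda>s. f (x + s *\<^sub>R a + t *\<^sub>R b) - f (x + s *\<^sub>R a + 0 *\<^sub>R b)"
          "\<lambda>s. fd f (x + s *\<^sub>R a + t *\<^sub>R b) a - fd f (x + s *\<^sub>R a + 0 *\<^sub>R b) a", THEN exE])
      (use t in \<open>auto intro!: DERIV_diff d simp del: scaleR_zero_left add_0_right\<close>)
  have d2: "((\<lambda>r. fd f (x + s *\<^sub>R a + r *\<^sub>R b) a) has_real_derivative
       fd (\<lambda>y. fd f y a) (x + s *\<^sub>R a + r *\<^sub>R b) b) (at r)" if "0 \<le> r" "r \<le> t" for r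
  proof -
    have w: "x + s *\<^sub>R a + r *\<^sub>R b \<in> W" using s that by (intro W) auto
    have "((\<lambda>r. x + s *\<^sub>R a + r *\<^sub>R b) has_derivative (\<lambda>h. h *\<^sub>R b)) (at r)"
      by (auto intro!: derivative_eq_intros)
    from diff_chain_at[OF this has_derivative_fd[OF fa[OF w]]]
    show ?thesis using linear_scale[OF fd_linear[OF fa[OF w]]]
      by (simp add: o_def has_field_derivative_def mult.commute[of _ "fd _ _ _"])
  qed
  obtain r where r: "0 < r" "r < t" "fd f (x + s *\<^sub>R a + t *\<^sub>R b) a - fd f (x + s *\<^sub>R a + 0 *\<^sub>R b) a
     = (t - 0) * fd (\<lambda>y. fd f y a) (x + s *\<^sub>R a + r *\<^sub>R b) b"
    by (rule MVT2[OF t, of "\<lambda>r. fd f (x + s *\<^sub>R a + r *\<^sub>R b) a"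
          "\<lambda>r. fd (\<lambda>y. fd f y a) (x + s *\<^sub>R a + r *\<^sub>R b) b", THEN exE])
      (use t in \<open>auto intro!: d2\<close>)
  have "h t - h 0 = t * t * fd (\<lambda>y. fd f y a) (x + s *\<^sub>R a + r *\<^sub>R b) b"
    using s(3) r(3) by simp
  then show ?thesis
    by (intro exI[of _ s] exI[of _ r]) (use s r in \<open>auto simp: h_def\<close>)
qed

text \<open>Both iterated derivatives take, at points near \<open>x\<close>, the value of the same
  second difference divided by \<open>t * t\<close>. If they differed at \<open>x\<close>,
  continuity would keep these values apart.\<close>

lemma fd_fd_commute_real:
  fixes f :: "'a::real_normed_vector \<Rightarrow> real"
  assumes f: "Cinf U f" and x: "x \<in> U"
  shows "fd (\<lambda>y. fd f y a) x b = fd (\<lambda>y. fd f y b) x a"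
proof (rule ccontr)
  assume ne: "\<not> ?thesis"
  let ?F = "\<lambda>y. fd (\<lambda>y. fd f y a) y b" and ?G = "\<lambda>y. fd (\<lambda>y. fd f y b) y a"
  \<comment> \<open>Half of the supposed gap: two equal numbers within \<open>e\<close> of
    \<open>?F x\<close> and of \<open>?G x\<close> force a gap below \<open>2 * e\<close>, a
    contradiction.\<close>
  define e where "e = \<bar>?F x - ?G x\<bar> / 2"
  have e: "e > 0" using ne by (simp add: e_def)
  have op: "open U" using f by (rule Cinf_open)
  obtain d1 where d1: "d1 > 0" "\<forall>y. dist y x < d1 \<longrightarrow> y \<in> U \<and> \<bar>?F y - ?F x\<bar> < e"
    by (rule continuous_on_two_point[OF Cinf_continuous_on[OF Cinf_fd[OF Cinf_fd[OF f]]] op x e, of a b]) blast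
  obtain d2 where d2: "d2 > 0" "\<forall>y. dist y x < d2 \<longrightarrow> y \<in> U \<and> \<bar>?G y - ?G x\<bar> < e"
    by (rule continuous_on_two_point[OF Cinf_continuous_on[OF Cinf_fd[OF Cinf_fd[OF f]]] op x e, of b a]) blast
  define D where "D = norm a + norm b + 1"
  have D: "D > 0" by (simp add: D_def add_nonneg_pos)
  \<comment> \<open>Every point of the parallelogram with parameters up to \<open>t\<close> is then
    at distance at most half of \<open>min d1 d2\<close> from \<open>x\<close>.\<close>
  define t where "t = min d1 d2 / (2 * D)"
  have t: "t > 0" using d1 d2 D by (simp add: t_def)
  have near: "dist (x + s *\<^sub>R a + r *\<^sub>R b) x < min d1 d2" if "0 \<le> s" "s \<le> t" "0 \<le> r" "r \<le> t" for s r
  proof -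
    have "dist (x + s *\<^sub>R a + r *\<^sub>R b) x \<le> s * norm a + r * norm b"
      using norm_triangle_ineq[of "s *\<^sub>R a" "r *\<^sub>R b"] that by (simp add: dist_norm)
    also have "\<dots> \<le> t * norm a + t * norm b" using that by (intro add_mono mult_right_mono) auto
    also have "\<dots> \<le> t * D" using t by (simp add: D_def algebra_simps)
    also have "\<dots> = min d1 d2 / 2" using D by (simp add: t_def)
    also have "\<dots> < min d1 d2" using d1(1) d2(1) by auto
    finally show ?thesis .
  qed
  have inU: "x + s *\<^sub>R a + r *\<^sub>R b \<in> U" if "0 \<le> s" "s \<le> t" "0 \<le> r" "r \<le> t" for s r
    using d1(2) near[OF that] by simp
  have inU': "x + s *\<^sub>R b + r *\<^sub>R a \<in> U" if "0 \<le> s" "s \<le> t" "0 \<le> r" "r \<le> t" for s r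
    using inU[of r s] that by (simp add: add_ac)
  obtain s r where sr: "0 \<le> s" "s \<le> t" "0 \<le> r" "r \<le> t"
    "f (x + t *\<^sub>R a + t *\<^sub>R b) - f (x + t *\<^sub>R a) - f (x + t *\<^sub>R b) + f x = t * t * ?F (x + s *\<^sub>R a + r *\<^sub>R b)"
    using second_difference_mvt[OF Cinf_differentiable[OF f] Cinf_differentiable[OF Cinf_fd[OF f]] inU t] by blast
  obtain s' r' where sr': "0 \<le> s'" "s' \<le> t" "0 \<le> r'" "r' \<le> t"
    "f (x + t *\<^sub>R b + t *\<^sub>R a) - f (x + t *\<^sub>R b) - f (x + t *\<^sub>R a) + f x = t * t * ?G (x + s' *\<^sub>R b + r' *\<^sub>R a)"
    using second_difference_mvt[OF Cinf_differentiable[OF f] Cinf_differentiable[OF Cinf_fd[OF f]] inU' t] by blast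
  have sw: "x + p *\<^sub>R b + q *\<^sub>R a = x + q *\<^sub>R a + p *\<^sub>R b" for p q by simp
  have "t * t * ?F (x + s *\<^sub>R a + r *\<^sub>R b) = t * t * ?G (x + r' *\<^sub>R a + s' *\<^sub>R b)"
    using sr(5) sr'(5) unfolding sw by linarith
  then have eq: "?F (x + s *\<^sub>R a + r *\<^sub>R b) = ?G (x + r' *\<^sub>R a + s' *\<^sub>R b)" using t by simp
  have "\<bar>?F (x + s *\<^sub>R a + r *\<^sub>R b) - ?F x\<bar> < e" using d1(2) near[OF sr(1-4)] by simp
  moreover have "\<bar>?G (x + r' *\<^sub>R a + s' *\<^sub>R b) - ?G x\<bar> < e" using d2(2) near[OF sr'(3,4,1,2)] by simp
  moreover have "\<bar>r - s\<bar> < 2 * e" if "\<bar>p - r\<bar> < e" "\<bar>q - s\<bar> < e" "p = q" for p q r s :: real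
    using that by linarith
  ultimately have "\<bar>?F x - ?G x\<bar> < 2 * e" using eq by blast
  then show False by (simp add: e_def)
qed

lemma fd_compose_bounded_linear:
  assumes "f differentiable (at x)" "bounded_linear h"
  shows "fd (\<lambda>y. h (f y)) x v = h (fd f x v)"
  using bounded_linear.has_derivative[OF assms(2) has_derivative_fd[OF assms(1)]] by (rule fd_eqI)

lemma fd_fd_commute:
  fixes f :: "'a::real_normed_vector \<Rightarrow> 'b::euclidean_space"
  assumes f: "Cinf U f" and x: "x \<in> U"
  shows "fd (\<lambda>y. fd f y a) x b = fd (\<lambda>y. fd f y b) x a"
proof (rule euclidean_eqI)
  fix i :: 'b assume "i \<in> Basis"
  have bl: "bounded_linear (\<lambda>y. y \<bullet> i)" by (rule bounded_linear_inner_left)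
  have fi: "Cinf U (\<lambda>y. f y \<bullet> i)" using f by (intro Cinf_inner Cinf_const Cinf_open)
  have *: "fd (\<lambda>y. fd (\<lambda>y. f y \<bullet> i) y a) x b = fd (\<lambda>y. fd f y a) x b \<bullet> i" for a b
  proof -
    have e: "fd f y a \<bullet> i = fd (\<lambda>y. f y \<bullet> i) y a" if "y \<in> U" for y
      using fd_compose_bounded_linear[OF Cinf_differentiable[OF f that] bl] by simp
    have d: "(\<lambda>y. fd f y a \<bullet> i) differentiable (at x)"
      by (rule Cinf_differentiable[OF Cinf_inner[OF Cinf_fd[OF f] Cinf_const[OF Cinf_open[OF f]]] x])
    have "fd (\<lambda>y. fd (\<lambda>y. f y \<bullet> i) y a) x = fd (\<lambda>y. fd f y a \<bullet> i) x"
      by (rule fd_cong_open(1)[OF Cinf_open[OF f] x e d])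
    then show ?thesis
      using fd_compose_bounded_linear[OF Cinf_differentiable[OF Cinf_fd[OF f] x] bl] by simp
  qed
  show "fd (\<lambda>y. fd f y a) x b \<bullet> i = fd (\<lambda>y. fd f y b) x a \<bullet> i"
    using fd_fd_commute_real[OF fi x, of a b] unfolding * .
qed

section \<open>Local Finsler geometry in a chart\<close>

lemma sum_rotate: "(\<Sum>b\<in>B. \<Sum>c\<in>C. \<Sum>d\<in>D. f b c d) = (\<Sum>d\<in>D. \<Sum>b\<in>B. \<Sum>c\<in>C. f b c d)"
  for f :: "'b \<Rightarrow> 'c \<Rightarrow> 'd \<Rightarrow> 'e::comm_monoid_add"
proof -
  have "(\<Sum>c\<in>C. \<Sum>d\<in>D. f b c d) = (\<Sum>d\<in>D. \<Sum>c\<in>C. f b c d)" for b by (rule sum.swap)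
  then show ?thesis by (simp add: sum.swap[of _ D B])
qed

lemma linear_axis_expand:
  fixes f :: "real ^ 'i::finite \<Rightarrow> 'b::real_vector"
  assumes "linear f" shows "f a = (\<Sum>i\<in>UNIV. a $ i *\<^sub>R f (axis i 1))"
proof -
  interpret linear f by fact
  have "f (\<Sum>i\<in>UNIV. a $ i *\<^sub>R axis i 1) = (\<Sum>i\<in>UNIV. a $ i *\<^sub>R f (axis i 1))"
    by (simp add: sum scale)
  then show ?thesis by (simp add: basis_expansion[of a, unfolded vector_scalar_mult_def scalar_mult_eq_scaleR])
qed

lemma fd_split:
  assumes "f differentiable (at z)"
  shows "fd f z (a, b) = fd f z (a, 0) + fd f z (0, b)"
  using linear_add[OF fd_linear[OF assms], of "(a, 0)" "(0, b)"] by simp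

lemma fd_x_expand:
  fixes f :: "(real ^ 'i::finite) \<times> 'c::real_normed_vector \<Rightarrow> 'b::real_normed_vector"
  assumes "f differentiable (at z)"
  shows "fd f z (a, 0) = (\<Sum>i\<in>UNIV. a $ i *\<^sub>R fd f z (axis i 1, 0))"
proof -
  have "linear (\<lambda>a. (a, 0 :: 'c))" by (rule linearI) auto
  then have "linear (\<lambda>a. fd f z (a, 0))" using linear_compose[OF _ fd_linear[OF assms]] by (auto simp: o_def)
  from linear_axis_expand[OF this] show ?thesis .
qed

lemma fd_v_expand:
  fixes f :: "'c::real_normed_vector \<times> (real ^ 'i::finite) \<Rightarrow> 'b::real_normed_vector"
  assumes "f differentiable (at z)"
  shows "fd f z (0, b) = (\<Sum>i\<in>UNIV. b $ i *\<^sub>R fd f z (0, axis i 1))"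
proof -
  have "linear (\<lambda>a. (0 :: 'c, a))" by (rule linearI) auto
  then have "linear (\<lambda>a. fd f z (0, a))" using linear_compose[OF _ fd_linear[OF assms]] by (auto simp: o_def)
  from linear_axis_expand[OF this] show ?thesis .
qed

text \<open>Linearity in the direction of the inner derivative: symmetry moves that direction to the
  outer slot, where linearity is that of a derivative.\<close>

lemma fd_fd_sum:
  fixes f :: "'a::real_normed_vector \<Rightarrow> 'b::euclidean_space"
  assumes "Cinf U f" "z \<in> U"
  shows "fd (\<lambda>y. fd f y (\<Sum>i\<in>I. c i *\<^sub>R h i)) z k = (\<Sum>i\<in>I. c i *\<^sub>R fd (\<lambda>y. fd f y (h i)) z k)"
  unfolding fd_fd_commute[OF assms, of _ k]
  using linear_sum[OF Cinf_linear[OF Cinf_fd[OF assms(1)] assms(2)], of k "\<lambda>i. c i *\<^sub>R h i" I]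
  by (simp add: linear_scale[OF Cinf_linear[OF Cinf_fd[OF assms(1)] assms(2)]])

lemma fd_fd_v_expand:
  fixes f :: "'c::euclidean_space \<times> (real ^ 'i::finite) \<Rightarrow> 'b::euclidean_space"
  assumes "Cinf U f" "z \<in> U"
  shows "fd (\<lambda>y. fd f y (0, b)) z k = (\<Sum>i\<in>UNIV. b $ i *\<^sub>R fd (\<lambda>y. fd f y (0, axis i 1)) z k)"
  unfolding fd_fd_commute[OF assms, of _ k] by (rule fd_v_expand[OF Cinf_differentiable[OF Cinf_fd[OF assms(1)] assms(2)]])

text \<open>Leibniz rule for a derivative in a direction that itself depends on the point.
  Identities between first derivatives, such as Euler's relation and the Euler-Lagrange equation,
  are differentiated through it.\<close>

lemma fd_fd_variable:
  fixes f :: "'a::euclidean_space \<Rightarrow> 'b::euclidean_space"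
  assumes f: "Cinf U f" and z: "z \<in> U" and h: "(h has_derivative h') (at z)"
  shows "((\<lambda>y. fd f y (h y)) has_derivative (\<lambda>k. fd (\<lambda>y. fd f y (h z)) z k + fd f z (h' k))) (at z)"
proof -
  have d: "((\<lambda>y. \<Sum>i\<in>Basis. (h y \<bullet> i) *\<^sub>R fd f y i) has_derivative
      (\<lambda>k. \<Sum>i\<in>Basis. (h z \<bullet> i) *\<^sub>R fd (\<lambda>y. fd f y i) z k + (h' k \<bullet> i) *\<^sub>R fd f z i)) (at z)"
    by (intro has_derivative_sum has_derivative_scaleR has_derivative_inner_left h
        Cinf_has_derivative[OF Cinf_fd[OF f] z])
  have "(\<Sum>i\<in>Basis. (h z \<bullet> i) *\<^sub>R fd (\<lambda>y. fd f y i) z k + (h' k \<bullet> i) *\<^sub>R fd f z i)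
      = fd (\<lambda>y. fd f y (h z)) z k + fd f z (h' k)" for k
    using fd_fd_sum[OF f z, of "\<lambda>i. h z \<bullet> i" "\<lambda>i. i" Basis k]
      linear_euclidean_expand[OF Cinf_linear[OF f z], of "h' k"]
    by (simp add: euclidean_representation sum.distrib)
  with d have d': "((\<lambda>y. \<Sum>i\<in>Basis. (h y \<bullet> i) *\<^sub>R fd f y i) has_derivative
      (\<lambda>k. fd (\<lambda>y. fd f y (h z)) z k + fd f z (h' k))) (at z)" by simp
  show ?thesis
    by (rule has_derivative_transform_within_open[OF d' Cinf_open[OF f] z])
      (use linear_euclidean_expand[OF Cinf_linear[OF f]] in simp)
qed

lemma matrix_inv_mult:
  fixes A :: "'a::semiring_1 ^ 'i ^ 'i::finite"
  assumes "invertible A" shows "A ** matrix_inv A = mat 1" "matrix_inv A ** A = mat 1"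
  using someI_ex[OF assms[unfolded invertible_def]] by (auto simp: matrix_inv_def)

text \<open>By Cramer's rule an entry of the inverse is a quotient of determinants, with one column
  of \<open>A x\<close> replaced by an axis vector; determinants are polynomials in the
  entries.\<close>

lemma Cinf_matrix_inv:
  fixes A :: "'a::real_normed_vector \<Rightarrow> real ^ 'i ^ 'i::finite"
  assumes A: "\<And>i j. Cinf U (\<lambda>x. A x $ i $ j)" and U: "open U" and inv: "\<And>x. x \<in> U \<Longrightarrow> invertible (A x)"
  shows "Cinf U (\<lambda>x. matrix_inv (A x) $ k $ j)"
proof -
  let ?M = "\<lambda>x. (\<chi> i m. if m = k then axis j 1 $ i else A x $ i $ m) :: real ^ 'i ^ 'i"
  have det: "Cinf U (\<lambda>x. det (M x))" if "\<And>i m. Cinf U (\<lambda>x. M x $ i $ m)" for M :: "'a \<Rightarrow> real ^ 'i ^ 'i"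
    unfolding det_def by (intro Cinf_sum Cinf_mult Cinf_prod Cinf_const U that)
  have "Cinf U (\<lambda>x. det (?M x) / det (A x))"
  proof (intro Cinf_divide det)
    fix i m show "Cinf U (\<lambda>x. ?M x $ i $ m)" by (cases "m = k") (auto intro: A Cinf_const U)
  next
    fix x assume "x \<in> U" then show "det (A x) \<noteq> 0" using inv invertible_det_nz by blast
  qed (rule A)
  moreover have "det (?M x) / det (A x) = matrix_inv (A x) $ k $ j" if "x \<in> U" for x
  proof -
    have "A x *v (matrix_inv (A x) *v axis j 1) = axis j 1"
      using inv[OF that] by (simp add: matrix_vector_mul_assoc matrix_inv_mult)
    with cramer[of "A x" "matrix_inv (A x) *v axis j 1" "axis j 1"] inv[OF that]
    have "matrix_inv (A x) *v axis j 1 = (\<chi> k. det (\<chi> i m. if m = k then axis j 1 $ i else A x $ i $ m) / det (A x))"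
      by (simp add: invertible_det_nz)
    then have "(matrix_inv (A x) *v axis j 1) $ k = det (?M x) / det (A x)" by simp
    then show ?thesis
      by (simp add: matrix_vector_mult_def axis_def if_distrib cong: if_cong)
  qed
  ultimately show ?thesis by (rule Cinf_cong) 
qed

section \<open>Positively homogeneous functions and Euler's relations\<close>

definition pos_homogeneous :: "(real ^ 'i::finite) set \<Rightarrow> nat \<Rightarrow> ((real ^ 'i) \<times> (real ^ 'i) \<Rightarrow> 'b::real_normed_vector) \<Rightarrow> bool" where
  "pos_homogeneous X k f \<longleftrightarrow> (\<forall>x\<in>X. \<forall>u. u \<noteq> 0 \<longrightarrow> (\<forall>r>0. f (x, r *\<^sub>R u) = r ^ k *\<^sub>R f (x, u)))"

lemma pos_homogeneousD:
  "pos_homogeneous X k f \<Longrightarrow> x \<in> X \<Longrightarrow> u \<noteq> 0 \<Longrightarrow> r > 0 \<Longrightarrow> f (x, r *\<^sub>R u) = r ^ k *\<^sub>R f (x, u)"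
  by (simp add: pos_homogeneous_def)

context
  fixes X :: "(real ^ 'i::finite) set" and f :: "(real ^ 'i) \<times> (real ^ 'i) \<Rightarrow> 'b::euclidean_space" and k :: nat
  assumes X: "open X" and f: "Cinf (X \<times> - {0}) f" and hom: "pos_homogeneous X k f"
begin

text \<open>Chain rule for scaling in the fibre: a base direction scales like \<open>f\<close>
  itself, a fibre direction loses one degree.\<close>

lemma pos_homogeneous_fd:
  assumes "x \<in> X" "u \<noteq> 0" "r > 0"
  shows "fd f (x, r *\<^sub>R u) (a, r *\<^sub>R b) = r ^ k *\<^sub>R fd f (x, u) (a, b)"
proof -
  have z: "(x, u) \<in> X \<times> - {0}" and rz: "(x, r *\<^sub>R u) \<in> X \<times> - {0}" using assms by auto
  let ?S = "\<lambda>z::(real ^ 'i) \<times> (real ^ 'i). (fst z, r *\<^sub>R snd z)"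
  have S: "(?S has_derivative ?S) (at (x, u))"
    by (auto intro!: derivative_eq_intros simp: fun_eq_iff)
  have 1: "((\<lambda>z. f (?S z)) has_derivative (\<lambda>h. fd f (x, r *\<^sub>R u) (?S h))) (at (x, u))"
    using diff_chain_at[OF S, of f] Cinf_has_derivative[OF f rz] by (simp add: o_def)
  have 2: "((\<lambda>z. r ^ k *\<^sub>R f z) has_derivative (\<lambda>h. r ^ k *\<^sub>R fd f (x, u) h)) (at (x, u))"
    by (intro has_derivative_scaleR_right Cinf_has_derivative[OF f z])
  have "((\<lambda>z. r ^ k *\<^sub>R f z) has_derivative (\<lambda>h. fd f (x, r *\<^sub>R u) (?S h))) (at (x, u))"
    by (rule has_derivative_transform_within_open[OF 1 Cinf_open[OF f] z])
      (use assms in \<open>simp add: split_paired_all pos_homogeneousD[OF hom]\<close>)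
  from has_derivative_unique[OF this 2] show ?thesis by (auto simp: fun_eq_iff)
qed

lemma pos_homogeneous_fd_v:
  assumes "k = Suc j" shows "pos_homogeneous X j (\<lambda>z. fd f z (0, b))"
  unfolding pos_homogeneous_def
proof (intro ballI allI impI)
  fix x u :: "real ^ 'i" and r :: real assume z: "x \<in> X" "u \<noteq> 0" "0 < r"
  have l: "linear (fd f (x, r *\<^sub>R u))" by (rule Cinf_linear[OF f]) (use z in auto)
  have "r *\<^sub>R fd f (x, r *\<^sub>R u) (0, b) = r *\<^sub>R (r ^ j *\<^sub>R fd f (x, u) (0, b))"
    using pos_homogeneous_fd[OF z, of 0 b] linear_scale[OF l, of r "(0, b)"] assms by simp
  then show "fd f (x, r *\<^sub>R u) (0, b) = r ^ j *\<^sub>R fd f (x, u) (0, b)"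
    using z(3) by (simp del: scaleR_scaleR)
qed

lemma euler:
  assumes "x \<in> X" "u \<noteq> 0" shows "fd f (x, u) (0, u) = real k *\<^sub>R f (x, u)"
proof -
  have z: "(x, u) \<in> X \<times> - {0}" using assms by auto
  have "((\<lambda>r. (x, r *\<^sub>R u)) has_derivative (\<lambda>h. (0, h *\<^sub>R u))) (at (1::real))"
    by (auto intro!: derivative_eq_intros)
  from diff_chain_at[OF this, of f "fd f (x, u)"] Cinf_has_derivative[OF f z]
  have 1: "((\<lambda>r. f (x, r *\<^sub>R u)) has_derivative (\<lambda>h. fd f (x, u) (0, h *\<^sub>R u))) (at 1)" by (simp add: o_def)
  have 2: "((\<lambda>r. r ^ k *\<^sub>R f (x, u)) has_derivative (\<lambda>h. (of_nat k * h) *\<^sub>R f (x, u))) (at (1::real))"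
    by (auto intro!: derivative_eq_intros simp: fun_eq_iff)
  have "((\<lambda>r. r ^ k *\<^sub>R f (x, u)) has_derivative (\<lambda>h. fd f (x, u) (0, h *\<^sub>R u))) (at 1)"
    by (rule has_derivative_transform_within_open[OF 1, of "{0<..}"])
      (use assms in \<open>auto simp: pos_homogeneousD[OF hom]\<close>)
  from has_derivative_unique[OF this 2] show ?thesis by (auto dest: fun_cong[of _ _ 1])
qed

text \<open>Euler's relation \<open>fd f z (0, snd z) = k f z\<close> holds on an open set and may
  be differentiated; the extra term \<open>fd f (x, u) (0, b)\<close> comes from the moving
  direction \<open>snd z\<close>. The two corollaries read off degree \<open>k\<close> in base and
  \<open>k - 1\<close> in fibre directions.\<close>

lemma euler_fd:
  assumes "x \<in> X" "u \<noteq> 0"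
  shows "fd (\<lambda>z. fd f z (0, u)) (x, u) (a, b) + fd f (x, u) (0, b) = real k *\<^sub>R fd f (x, u) (a, b)"
proof -
  have z: "(x, u) \<in> X \<times> - {0}" using assms by auto
  have "((\<lambda>z. fd f z (0, snd z)) has_derivative
      (\<lambda>h. fd (\<lambda>y. fd f y (0, snd (x, u))) (x, u) h + fd f (x, u) (0, snd h))) (at (x, u))"
    by (rule fd_fd_variable[OF f z]) (auto intro!: derivative_eq_intros)
  moreover have "((\<lambda>z. fd f z (0, snd z)) has_derivative (\<lambda>h. real k *\<^sub>R fd f (x, u) h)) (at (x, u))"
    by (rule has_derivative_transform_within_open[OF has_derivative_scaleR_right[OF Cinf_has_derivative[OF f z]] Cinf_open[OF f] z])
      (simp add: split_paired_all euler)
  ultimately have "(\<lambda>h. fd (\<lambda>y. fd f y (0, u)) (x, u) h + fd f (x, u) (0, snd h)) = (\<lambda>h. real k *\<^sub>R fd f (x, u) h)"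
    using has_derivative_unique by (simp, blast)
  from fun_cong[OF this, of "(a, b)"] show ?thesis by simp
qed

lemma euler_x:
  assumes "x \<in> X" "u \<noteq> 0"
  shows "fd (\<lambda>z. fd f z (0, u)) (x, u) (a, 0) = real k *\<^sub>R fd f (x, u) (a, 0)"
  using euler_fd[OF assms, of a 0] linear_0[OF Cinf_linear[OF f, of "(x, u)"]] assms
  by (simp add: zero_prod_def)

lemma euler_v:
  assumes "x \<in> X" "u \<noteq> 0"
  shows "fd (\<lambda>z. fd f z (0, u)) (x, u) (0, b) = (real k - 1) *\<^sub>R fd f (x, u) (0, b)"
  using euler_fd[OF assms, of 0 b] by (simp add: algebra_simps eq_diff_eq)

end

section \<open>Spray, nonlinear connection and curvature in one chart\<close>

locale finsler_chart =
  fixes X :: "(real ^ 'i::finite) set" and l :: "(real ^ 'i) \<times> (real ^ 'i) \<Rightarrow> real"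
  assumes X: "open X"
    and smooth: "Cinf (X \<times> - {0}) l"
    and hom: "pos_homogeneous X 2 l"
    and nondeg: "\<And>x u. x \<in> X \<Longrightarrow> u \<noteq> 0 \<Longrightarrow> invertible (gmat l (x, u))"
begin

abbreviation W where "W \<equiv> X \<times> - {0 :: real ^ 'i}"

lemma open_W: "open W" using smooth by (rule Cinf_open)

text \<open>\<open>p b z\<close> is \<open>g\<^sub>v(v, b)\<close> and \<open>gg a b z\<close> is \<open>g\<^sub>v(a, b)\<close> at \<open>z = (x, v)\<close>; \<open>G\<close> and \<open>Nm\<close> collect
  the coefficients \<open>G\<^sup>\<alpha>\<close> and \<open>N\<^sup>\<alpha>\<^sub>\<beta>\<close>, and a geodesic solves \<open>(x, v)' = spray (x, v)\<close>.\<close>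

definition p :: "real ^ 'i \<Rightarrow> (real ^ 'i) \<times> (real ^ 'i) \<Rightarrow> real" where "p b z = fd l z (0, b)"
definition gg :: "real ^ 'i \<Rightarrow> real ^ 'i \<Rightarrow> (real ^ 'i) \<times> (real ^ 'i) \<Rightarrow> real" where "gg a b z = fd (p b) z (0, a)"
definition G :: "(real ^ 'i) \<times> (real ^ 'i) \<Rightarrow> real ^ 'i" where "G z = (\<chi> \<alpha>. Gspray l \<alpha> z)"
definition Nm :: "(real ^ 'i) \<times> (real ^ 'i) \<Rightarrow> real ^ 'i ^ 'i" where "Nm z = (\<chi> \<alpha> \<beta>. Nconn l \<alpha> \<beta> z)"
definition spray :: "(real ^ 'i) \<times> (real ^ 'i) \<Rightarrow> (real ^ 'i) \<times> (real ^ 'i)" where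
  "spray z = (snd z, - 2 *\<^sub>R G z)"

lemma p_eq: "p b = (\<lambda>z. fd l z (0, b))" by (simp add: p_def fun_eq_iff)
lemma gg_eq: "gg a b = (\<lambda>z. fd (p b) z (0, a))" by (simp add: gg_def fun_eq_iff)

lemma Cinf_p: "Cinf W (p b)" unfolding p_eq by (rule Cinf_fd[OF smooth])
lemma Cinf_gg: "Cinf W (gg a b)" unfolding gg_eq by (rule Cinf_fd[OF Cinf_p])

lemma hom_p: "pos_homogeneous X 1 (p b)"
  unfolding p_eq by (rule pos_homogeneous_fd_v[OF X smooth hom]) simp

lemma hom_gg: "pos_homogeneous X 0 (gg a b)"
  unfolding gg_eq by (rule pos_homogeneous_fd_v[OF X Cinf_p hom_p]) simp

lemma gL_eq: "gL l \<alpha> \<beta> = gg (axis \<alpha> 1) (axis \<beta> 1)"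
proof -
  have "dv \<beta> l = p (axis \<beta> 1)" by (rule ext) (simp add: dv_def p_def)
  then show ?thesis by (intro ext) (simp add: gL_def dv_def gg_def)
qed

lemma gg_commute: "z \<in> W \<Longrightarrow> gg a b z = gg b a z"
  unfolding gg_def p_eq by (rule fd_fd_commute[OF smooth])

lemma fd_p_v: "z \<in> W \<Longrightarrow> fd (p a) z (0, b) = gg a b z"
  using gg_commute[of z b a] by (simp only: gg_def)

lemma p_linear: "z \<in> W \<Longrightarrow> linear (\<lambda>b. p b z)"
proof -
  assume "z \<in> W"
  have "linear (\<lambda>a. (0 :: real ^ 'i, a :: real ^ 'i))" by (rule linearI) auto
  from linear_compose[OF this Cinf_linear[OF smooth \<open>z \<in> W\<close>]] show ?thesis by (simp add: o_def p_eq)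
qed

lemma gg_linear1: "z \<in> W \<Longrightarrow> linear (\<lambda>a. gg a b z)"
proof -
  assume "z \<in> W"
  have "linear (\<lambda>a. (0 :: real ^ 'i, a :: real ^ 'i))" by (rule linearI) auto
  from linear_compose[OF this Cinf_linear[OF Cinf_p \<open>z \<in> W\<close>]] show ?thesis by (simp add: o_def gg_eq)
qed

lemma gg_linear2: "z \<in> W \<Longrightarrow> linear (\<lambda>b. gg a b z)"
  using gg_linear1[of z a] gg_commute[of z a] by simp

lemma form_gmat: "z \<in> W \<Longrightarrow> form (gmat l z) a b = gg a b z"
proof -
  assume z: "z \<in> W"
  have "gg a b z = (\<Sum>\<alpha>\<in>UNIV. a $ \<alpha> * (\<Sum>\<beta>\<in>UNIV. b $ \<beta> * gL l \<alpha> \<beta> z))"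
    by (subst linear_axis_expand[OF gg_linear1[OF z]], subst linear_axis_expand[OF gg_linear2[OF z]])
      (simp add: gL_eq)
  then show ?thesis
    by (simp add: form_def inner_vec_def matrix_vector_mult_def gmat_def mult.commute)
qed

lemma gg_nondegenerate:
  assumes "z \<in> W" "\<And>a. gg a b z = gg a c z" shows "b = c"
proof -
  have "a \<bullet> (gmat l z *v b) = a \<bullet> (gmat l z *v c)" for a
    using assms form_gmat[OF assms(1)] by (metis form_def)
  then have "gmat l z *v b = gmat l z *v c" by (metis vector_eq_rdot inner_commute)
  then have "matrix_inv (gmat l z) *v (gmat l z *v b) = matrix_inv (gmat l z) *v (gmat l z *v c)" by simp
  moreover have "invertible (gmat l z)" using assms(1) nondeg by (cases z) simp
  ultimately show ?thesis by (simp add: matrix_vector_mul_assoc matrix_inv_mult)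
qed

lemma gg_radial: "x \<in> X \<Longrightarrow> u \<noteq> 0 \<Longrightarrow> gg u b (x, u) = p b (x, u)"
  using euler[OF X Cinf_p hom_p, of x u b] by (simp add: gg_def)

lemma p_radial: "x \<in> X \<Longrightarrow> u \<noteq> 0 \<Longrightarrow> p u (x, u) = 2 * l (x, u)"
  using euler[OF X smooth hom, of x u] by (simp add: p_def)

lemma Cinf_G: "Cinf W G"
proof -
  have g: "Cinf W (gL l \<alpha> \<beta>)" for \<alpha> \<beta> unfolding gL_eq by (rule Cinf_gg)
  have "Cinf W (\<lambda>z. gmat l z $ \<alpha> $ \<beta>)" for \<alpha> \<beta> using g by (simp add: gmat_def)
  from Cinf_matrix_inv[OF this open_W] have gi: "Cinf W (ginv l \<alpha> \<beta>)" for \<alpha> \<beta>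
    using nondeg unfolding ginv_def[abs_def] by auto
  have dxg: "Cinf W (dx \<gamma> (gL l \<alpha> \<beta>))" for \<alpha> \<beta> \<gamma>
    unfolding dx_def[abs_def] by (rule Cinf_fd[OF g])
  have "Cinf W (Gam_formal l \<alpha> \<beta> \<gamma>)" for \<alpha> \<beta> \<gamma>
    unfolding Gam_formal_def[abs_def]
    by (intro Cinf_mult Cinf_const Cinf_sum Cinf_add Cinf_diff gi dxg open_W)
  then have "Cinf W (Gspray l \<alpha>)" for \<alpha>
    unfolding Gspray_def[abs_def]
    by (intro Cinf_mult Cinf_const Cinf_sum Cinf_vec_nth Cinf_snd open_W)
  then show ?thesis unfolding G_def[abs_def] by (intro Cinf_vec open_W)
qed

lemma Nm_mult: "z \<in> W \<Longrightarrow> Nm z *v w = fd G z (0, w)"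
proof -
  assume z: "z \<in> W"
  have c: "fd G z h $ \<alpha> = fd (Gspray l \<alpha>) z h" for h \<alpha>
    using fd_compose_bounded_linear[OF Cinf_differentiable[OF Cinf_G z] bounded_linear_vec_nth, of \<alpha> h]
    by (simp add: G_def)
  have "Nm z $ \<alpha> $ \<beta> = fd G z (0, axis \<beta> 1) $ \<alpha>" for \<alpha> \<beta>
    by (simp add: Nm_def Nconn_def dv_def c)
  then show ?thesis
    by (subst fd_v_expand[OF Cinf_differentiable[OF Cinf_G z]])
      (simp add: vec_eq_iff matrix_vector_mult_def mult.commute sum_component)
qed

text \<open>Euler's relation turns each contracted term of the formal Christoffel symbols into a second
  derivative of \<open>l\<close>.\<close>

lemma dx_gL_contract1:
  assumes "x \<in> X" "u \<noteq> 0"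
  shows "(\<Sum>\<beta>\<in>UNIV. \<Sum>\<gamma>\<in>UNIV. dx \<beta> (gL l \<delta> \<gamma>) (x, u) * c $ \<beta> * w $ \<gamma>)
    = fd (gg (axis \<delta> 1) w) (x, u) (c, 0)"
proof -
  have z: "(x, u) \<in> W" using assms by auto
  have "(\<Sum>\<gamma>\<in>UNIV. dx \<beta> (gL l \<delta> \<gamma>) (x, u) * w $ \<gamma>) = fd (gg (axis \<delta> 1) w) (x, u) (axis \<beta> 1, 0)" for \<beta>
  proof -
    have e: "fd (gg (axis \<delta> 1) c) (x, u) = fd (\<lambda>y. fd (p (axis \<delta> 1)) y (0, c)) (x, u)" for c
      by (rule fd_cong_open(1)[OF open_W z _ Cinf_differentiable[OF Cinf_fd[OF Cinf_p] z]])
        (simp add: gg_commute[of _ _ c], simp add: gg_def)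
    show ?thesis using fd_fd_v_expand[OF Cinf_p z, of "axis \<delta> 1" w "(axis \<beta> 1, 0)"]
      by (simp add: gL_eq dx_def e mult.commute)
  qed
  then show ?thesis
    by (subst fd_x_expand[OF Cinf_differentiable[OF Cinf_gg z]])
      (simp add: mult.assoc mult.left_commute[of _ "c $ _"] sum_distrib_left[symmetric])
qed


lemma dx_gL_contract2:
  assumes "x \<in> X" "u \<noteq> 0"
  shows "(\<Sum>\<beta>\<in>UNIV. dx \<gamma> (gL l \<beta> \<delta>) (x, u) * u $ \<beta>) = fd (p (axis \<delta> 1)) (x, u) (axis \<gamma> 1, 0)"
proof -
  have z: "(x, u) \<in> W" using assms by auto
  have "(\<Sum>\<beta>\<in>UNIV. dx \<gamma> (gL l \<beta> \<delta>) (x, u) * u $ \<beta>)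
      = fd (\<lambda>y. fd (p (axis \<delta> 1)) y (0, u)) (x, u) (axis \<gamma> 1, 0)"
    using fd_fd_v_expand[OF Cinf_p z, of "axis \<delta> 1" u "(axis \<gamma> 1, 0)"]
    by (simp add: gL_eq dx_def gg_eq mult.commute)
  then show ?thesis using euler_x[OF X Cinf_p hom_p assms] by simp
qed

text \<open>The fibre derivative of the metric (the Cartan tensor) annihilates the reference vector:
  \<open>p\<close> has degree 1, so the factor in \<open>euler_v\<close> is 1 - 1.\<close>

lemma dv_gL_contract:
  assumes "x \<in> X" "u \<noteq> 0"
  shows "(\<Sum>\<beta>\<in>UNIV. dv \<mu> (gL l \<beta> \<delta>) (x, u) * u $ \<beta>) = 0"
proof -
  have z: "(x, u) \<in> W" using assms by auto
  have "(\<Sum>\<beta>\<in>UNIV. dv \<mu> (gL l \<beta> \<delta>) (x, u) * u $ \<beta>)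
      = fd (\<lambda>y. fd (p (axis \<delta> 1)) y (0, u)) (x, u) (0, axis \<mu> 1)"
    using fd_fd_v_expand[OF Cinf_p z, of "axis \<delta> 1" u "(0, axis \<mu> 1)"]
    by (simp add: gL_eq dv_def gg_eq mult.commute)
  then show ?thesis using euler_v[OF X Cinf_p hom_p assms] by simp
qed

lemma fd_p_expand: "z \<in> W \<Longrightarrow> fd (p w) z k = (\<Sum>\<gamma>\<in>UNIV. w $ \<gamma> * fd (p (axis \<gamma> 1)) z k)"
  unfolding p_eq using fd_fd_v_expand[OF smooth] by simp

lemma Gam_formal_contract:
  assumes "x \<in> X" "u \<noteq> 0"
  shows "(\<Sum>\<beta>\<in>UNIV. \<Sum>\<gamma>\<in>UNIV. (dx \<beta> (gL l \<delta> \<gamma>) (x, u) + dx \<gamma> (gL l \<beta> \<delta>) (x, u) - dx \<delta> (gL l \<beta> \<gamma>) (x, u)) * u $ \<beta> * w $ \<gamma>)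
    = fd (gg (axis \<delta> 1) w) (x, u) (u, 0) + fd (p (axis \<delta> 1)) (x, u) (w, 0) - fd (p w) (x, u) (axis \<delta> 1, 0)"
proof -
  have z: "(x, u) \<in> W" using assms by auto
  have 2: "(\<Sum>\<beta>\<in>UNIV. \<Sum>\<gamma>\<in>UNIV. dx \<gamma> (gL l \<beta> \<delta>) (x, u) * u $ \<beta> * w $ \<gamma>) = fd (p (axis \<delta> 1)) (x, u) (w, 0)"
    by (subst sum.swap, subst fd_x_expand[OF Cinf_differentiable[OF Cinf_p z]])
      (simp add: dx_gL_contract2[OF assms, symmetric] sum_distrib_left mult_ac)
  have 3: "(\<Sum>\<beta>\<in>UNIV. \<Sum>\<gamma>\<in>UNIV. dx \<delta> (gL l \<beta> \<gamma>) (x, u) * u $ \<beta> * w $ \<gamma>) = fd (p w) (x, u) (axis \<delta> 1, 0)"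
    by (subst sum.swap, subst fd_p_expand[OF z])
      (simp add: dx_gL_contract2[OF assms, symmetric] sum_distrib_left mult_ac)
  show ?thesis
    using 2 3 dx_gL_contract1[OF assms, of \<delta> u w]
    by (simp add: distrib_right left_diff_distrib sum.distrib sum_subtractf)
qed

lemma ginv_mult: "z \<in> W \<Longrightarrow> (\<Sum>\<delta>\<in>UNIV. ginv l \<alpha> \<delta> z * gg (axis \<delta> 1) b z) = b $ \<alpha>"
proof -
  assume z: "z \<in> W"
  have inv: "invertible (gmat l z)" using z nondeg by (cases z) simp
  have "gmat l z *v b = (\<chi> \<delta>. gg (axis \<delta> 1) b z)"
    using form_gmat[OF z, of "axis _ 1" b] by (simp add: form_def inner_axis' vec_eq_iff)
  then have "(\<Sum>\<delta>\<in>UNIV. ginv l \<alpha> \<delta> z * gg (axis \<delta> 1) b z) = (matrix_inv (gmat l z) *v (gmat l z *v b)) $ \<alpha>"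
    by (simp add: matrix_vector_mult_def[of "matrix_inv _"] ginv_def)
  then show ?thesis using inv by (simp add: matrix_vector_mul_assoc matrix_inv_mult)
qed

lemma ginv_solve:
  assumes "z \<in> W" "\<And>\<alpha>. y $ \<alpha> = (\<Sum>\<delta>\<in>UNIV. ginv l \<alpha> \<delta> z * c \<delta>)"
  shows "gg (axis \<delta> 1) y z = c \<delta>"
proof -
  have inv: "invertible (gmat l z)" using assms(1) nondeg by (cases z) simp
  have "y = matrix_inv (gmat l z) *v (\<chi> \<delta>. c \<delta>)"
    using assms(2) by (simp add: vec_eq_iff matrix_vector_mult_def ginv_def)
  then have "gmat l z *v y = (\<chi> \<delta>. c \<delta>)"
    using inv by (simp add: matrix_vector_mul_assoc matrix_inv_mult)
  then show ?thesis using form_gmat[OF assms(1), of "axis \<delta> 1" y] by (simp add: form_def inner_axis')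
qed

text \<open>The Euler-Lagrange equation of \<open>L\<close>, with \<open>p\<close> as momentum.
  Together with nondegeneracy it determines \<open>G\<close>, and it stands in for the defining
  formula of \<open>G\<close> in the scaling and transformation laws below.\<close>

lemma euler_lagrange:
  assumes "z \<in> W" shows "fd (p a) z (spray z) = fd l z (a, 0)"
proof -
  obtain x u where zx: "z = (x, u)" "x \<in> X" "u \<noteq> 0" using assms by auto
  \<comment> \<open>The factor 1/4 combines the 1/2 of \<open>Gspray\<close> with the 1/2 of
    \<open>Gam_formal\<close>.\<close>
  have *: "gg (axis \<delta> 1) (G z) z = (1/4) * (\<Sum>\<beta>\<in>UNIV. \<Sum>\<gamma>\<in>UNIV.
      (dx \<beta> (gL l \<delta> \<gamma>) z + dx \<gamma> (gL l \<beta> \<delta>) z - dx \<delta> (gL l \<beta> \<gamma>) z) * u $ \<beta> * u $ \<gamma>)" for \<delta>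
  proof (rule ginv_solve[OF assms])
    fix \<alpha>
    have r: "(\<Sum>\<beta>\<in>UNIV. \<Sum>\<gamma>\<in>UNIV. \<Sum>\<delta>\<in>UNIV. f \<beta> \<gamma> \<delta>) = (\<Sum>\<delta>\<in>UNIV. \<Sum>\<beta>\<in>UNIV. \<Sum>\<gamma>\<in>UNIV. f \<beta> \<gamma> \<delta>)"
      for f :: "'i \<Rightarrow> 'i \<Rightarrow> 'i \<Rightarrow> real" by (rule sum_rotate)
    show "G z $ \<alpha> = (\<Sum>\<delta>\<in>UNIV. ginv l \<alpha> \<delta> z * ((1/4) * (\<Sum>\<beta>\<in>UNIV. \<Sum>\<gamma>\<in>UNIV.
      (dx \<beta> (gL l \<delta> \<gamma>) z + dx \<gamma> (gL l \<beta> \<delta>) z - dx \<delta> (gL l \<beta> \<gamma>) z) * u $ \<beta> * u $ \<gamma>)))"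
      unfolding sum_distrib_left
      by (subst r[symmetric]) (simp add: G_def Gspray_def Gam_formal_def zx sum_distrib_left sum_distrib_right mult_ac)
  qed
  \<comment> \<open>Euler's relations evaluate the contraction at \<open>w = u\<close>: the first
    two terms coincide, and the last is twice the base derivative of \<open>l\<close>, which has
    degree 2.\<close>
  have g: "4 * gg (axis \<delta> 1) (G z) z = 2 * fd (p (axis \<delta> 1)) z (u, 0) - 2 * fd l z (axis \<delta> 1, 0)" for \<delta>
  proof -
    have "fd (gg (axis \<delta> 1) u) z (u, 0) = fd (\<lambda>y. fd (p (axis \<delta> 1)) y (0, u)) z (u, 0)"
      by (subst fd_cong_open(1)[OF open_W assms _ Cinf_differentiable[OF Cinf_fd[OF Cinf_p] assms]])
        (simp_all add: gg_commute[of _ _ u], simp add: gg_def)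
    also have "\<dots> = fd (p (axis \<delta> 1)) z (u, 0)"
      using euler_x[OF X Cinf_p hom_p zx(2,3)] by (simp add: zx)
    finally have 1: "fd (gg (axis \<delta> 1) u) z (u, 0) = fd (p (axis \<delta> 1)) z (u, 0)" .
    have 2: "fd (p u) z (axis \<delta> 1, 0) = 2 * fd l z (axis \<delta> 1, 0)"
      using euler_x[OF X smooth hom zx(2,3)] by (simp add: zx p_eq)
    show ?thesis using *[of \<delta>] Gam_formal_contract[OF zx(2,3), of \<delta> u] 1 2 unfolding zx by linarith
  qed
  have sp: "fd (p c) z (spray z) = fd (p c) z (u, 0) - 2 * gg c (G z) z" for c
  proof -
    have "fd (p c) z (spray z) = fd (p c) z (u, 0) + fd (p c) z (0, - 2 *\<^sub>R G z)"
      using fd_split[OF Cinf_differentiable[OF Cinf_p assms], of c u "- 2 *\<^sub>R G z"] by (simp add: spray_def zx)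
    also have "fd (p c) z (0, - 2 *\<^sub>R G z) = - 2 * fd (p c) z (0, G z)"
      using linear_scale[OF Cinf_linear[OF Cinf_p assms], of c "-2" "(0, G z)"] by simp
    finally show ?thesis using fd_p_v[OF assms] by simp
  qed
  have "fd (p (axis \<delta> 1)) z (spray z) = fd l z (axis \<delta> 1, 0)" for \<delta>
    using g[of \<delta>] sp[of "axis \<delta> 1"] by simp
  then show ?thesis
    using fd_p_expand[OF assms, of a "spray z"] fd_x_expand[OF Cinf_differentiable[OF smooth assms], of a] by simp
qed

text \<open>The right-hand side of \<open>sp\<close> scales quadratically while \<open>gg\<close>
  has degree 0; nondegeneracy transfers the scaling to \<open>G\<close>.\<close>

lemma hom_G: "pos_homogeneous X 2 G"
  unfolding pos_homogeneous_def
proof (intro ballI allI impI)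
  fix x u :: "real ^ 'i" and r :: real assume z: "x \<in> X" "u \<noteq> 0" "0 < r"
  have w: "(x, u) \<in> W" "(x, r *\<^sub>R u) \<in> W" using z by auto
  have sp: "2 * gg a (G y) y = fd (p a) y (snd y, 0) - fd l y (a, 0)" if "y \<in> W" for y a
  proof -
    have "fd (p a) y (spray y) = fd (p a) y (snd y, 0) + fd (p a) y (0, - 2 *\<^sub>R G y)"
      using fd_split[OF Cinf_differentiable[OF Cinf_p that], of a "snd y" "- 2 *\<^sub>R G y"] by (simp add: spray_def)
    also have "fd (p a) y (0, - 2 *\<^sub>R G y) = - 2 * gg a (G y) y"
      using linear_scale[OF Cinf_linear[OF Cinf_p that], of a "-2" "(0, G y)"] fd_p_v[OF that] by simp
    finally show ?thesis using euler_lagrange[OF that, of a] by simp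
  qed
  show "G (x, r *\<^sub>R u) = r ^ 2 *\<^sub>R G (x, u)"
  proof (rule gg_nondegenerate[OF w(2)])
    fix a
    have "2 * gg a (G (x, r *\<^sub>R u)) (x, r *\<^sub>R u) = fd (p a) (x, r *\<^sub>R u) (r *\<^sub>R u, 0) - fd l (x, r *\<^sub>R u) (a, 0)"
      using sp[OF w(2), of a] by simp
    also have "\<dots> = r * (r * fd (p a) (x, u) (u, 0)) - r ^ 2 * fd l (x, u) (a, 0)"
      using pos_homogeneous_fd[OF X Cinf_p hom_p z, of a "r *\<^sub>R u" 0] pos_homogeneous_fd[OF X smooth hom z, of a 0]
        linear_scale[OF Cinf_linear[OF Cinf_p w(1)], of a r "(u, 0)"] by simp
    also have "\<dots> = r ^ 2 * (2 * gg a (G (x, u)) (x, u))"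
      unfolding sp[OF w(1)] by (simp add: power2_eq_square right_diff_distrib)
    also have "\<dots> = 2 * gg a (r ^ 2 *\<^sub>R G (x, u)) (x, r *\<^sub>R u)"
      using pos_homogeneousD[OF hom_gg z] linear_scale[OF gg_linear2[OF w(1)]] by simp
    finally show "gg a (G (x, r *\<^sub>R u)) (x, r *\<^sub>R u) = gg a (r ^ 2 *\<^sub>R G (x, u)) (x, r *\<^sub>R u)" by simp
  qed
qed

lemma Nm_radial: "x \<in> X \<Longrightarrow> u \<noteq> 0 \<Longrightarrow> Nm (x, u) *v u = 2 *\<^sub>R G (x, u)"
  using euler[OF X Cinf_G hom_G, of x u] by (simp add: Nm_mult)

lemma spray_has_derivative:
  assumes "z \<in> W"
  shows "(spray has_derivative (\<lambda>h. (snd h, - 2 *\<^sub>R fd G z h))) (at z)"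
  unfolding spray_def[abs_def]
  by (intro has_derivative_Pair has_derivative_scaleR_right Cinf_has_derivative[OF Cinf_G assms])
    (auto intro!: derivative_eq_intros)

text \<open>Derivative of the Euler-Lagrange equation in the fibre direction \<open>w\<close>.
  Adding the version with \<open>a\<close> and \<open>w\<close> exchanged shows that the metric is
  parallel along the spray; the antisymmetric part is the curl of \<open>p\<close> in the base
  directions.\<close>

lemma Nm_characterization:
  assumes z: "z \<in> W"
  shows "2 * gg a (Nm z *v w) z = fd (gg a w) z (spray z) + fd (p a) z (w, 0) - fd (p w) z (a, 0)"
proof -
  have 1: "((\<lambda>y. fd (p a) y (spray y)) has_derivative
      (\<lambda>k. fd (\<lambda>y. fd (p a) y (spray z)) z k + fd (p a) z (snd k, - 2 *\<^sub>R fd G z k))) (at z)"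
    by (rule fd_fd_variable[OF Cinf_p z spray_has_derivative[OF z]])
  have 2: "((\<lambda>y. fd (p a) y (spray y)) has_derivative fd (\<lambda>y. fd l y (a, 0)) z) (at z)"
    by (rule has_derivative_transform_within_open[OF Cinf_has_derivative[OF Cinf_fd[OF smooth] z] open_W z])
      (simp add: euler_lagrange)
  have "fd (\<lambda>y. fd (p a) y (spray z)) z (0, w) + fd (p a) z (w, - 2 *\<^sub>R fd G z (0, w)) = fd (\<lambda>y. fd l y (a, 0)) z (0, w)"
    using fun_cong[OF has_derivative_unique[OF 1 2], of "(0, w)"] by simp
  moreover have "fd (\<lambda>y. fd l y (a, 0)) z (0, w) = fd (p w) z (a, 0)"
    unfolding p_eq by (rule fd_fd_commute[OF smooth z])
  moreover have "fd (\<lambda>y. fd (p a) y (spray z)) z (0, w) = fd (gg a w) z (spray z)"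
  proof -
    have "fd (gg a w) z (spray z) = fd (\<lambda>y. fd (p a) y (0, w)) z (spray z)"
      by (subst fd_cong_open(1)[OF open_W z _ Cinf_differentiable[OF Cinf_fd[OF Cinf_p] z]])
        (simp_all add: gg_commute[of _ _ w], simp add: gg_def)
    then show ?thesis using fd_fd_commute[OF Cinf_p z, of a "spray z" "(0, w)"] by simp
  qed
  moreover have "fd (p a) z (w, - 2 *\<^sub>R fd G z (0, w)) = fd (p a) z (w, 0) - 2 * gg a (Nm z *v w) z"
  proof -
    have "fd (p a) z (w, - 2 *\<^sub>R fd G z (0, w)) = fd (p a) z (w, 0) + fd (p a) z (0, - 2 *\<^sub>R (Nm z *v w))"
      using fd_split[OF Cinf_differentiable[OF Cinf_p z], of a w "- 2 *\<^sub>R fd G z (0, w)"] by (simp add: Nm_mult[OF z])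
    also have "fd (p a) z (0, - 2 *\<^sub>R (Nm z *v w)) = - 2 * gg a (Nm z *v w) z"
      using linear_scale[OF Cinf_linear[OF Cinf_p z], of a "-2" "(0, Nm z *v w)"] fd_p_v[OF z] by simp
    finally show ?thesis by simp
  qed
  ultimately show ?thesis by simp
qed

lemma fd_gg_radial:
  assumes "x \<in> X" "u \<noteq> 0"
  shows "fd (gg u w) (x, u) (a, b) = fd (p w) (x, u) (a, 0)"
proof -
  have z: "(x, u) \<in> W" using assms by auto
  have "fd (gg u w) (x, u) (a, b) = fd (gg u w) (x, u) (a, 0) + fd (gg u w) (x, u) (0, b)"
    by (rule fd_split[OF Cinf_differentiable[OF Cinf_gg z]])
  then show ?thesis
    using euler_x[OF X Cinf_p hom_p assms, of w a] euler_v[OF X Cinf_p hom_p assms, of w b] by (simp add: gg_eq)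
qed

text \<open>The horizontal derivative of \<open>L\<close> vanishes: put \<open>a = u\<close> in
  \<open>Nm_characterization\<close>, where Euler's relations reduce the three terms on the right to
  \<open>2 * fd l z (w, 0)\<close>.\<close>

lemma horizontal_constant:
  assumes z: "z \<in> W" shows "fd l z (w, 0) = p (Nm z *v w) z"
proof -
  obtain x u where zx: "z = (x, u)" "x \<in> X" "u \<noteq> 0" using z by auto
  have "fd (p u) z (w, 0) = 2 * fd l z (w, 0)"
    using euler_x[OF X smooth hom zx(2,3)] by (simp add: zx p_eq)
  moreover have "fd (gg u w) z (spray z) = fd (p w) z (u, 0)"
    using fd_gg_radial[OF zx(2,3)] by (simp add: zx spray_def)
  ultimately show ?thesis
    using Nm_characterization[OF z, of u w] gg_radial[OF zx(2,3)] by (simp add: zx)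
qed

text \<open>Of the three correction terms in \<open>Gam\<close>, two contract the Cartan tensor with
  \<open>u\<close> and vanish. The remaining one, by \<open>Nm_radial\<close>, turns the base
  derivative of the metric along \<open>u\<close> into the derivative along the spray, and
  \<open>Nm_characterization\<close> recognises the result.\<close>

lemma Gam_contract:
  assumes "x \<in> X" "u \<noteq> 0"
  shows "(\<Sum>\<beta>\<in>UNIV. \<Sum>\<gamma>\<in>UNIV. Gam l \<alpha> \<beta> \<gamma> (x, u) * u $ \<beta> * w $ \<gamma>) = (Nm (x, u) *v w) $ \<alpha>"
proof -
  let ?z = "(x, u)"
  have z: "?z \<in> W" using assms by auto
  let ?E = "\<lambda>\<delta> \<beta> \<gamma>. dx \<beta> (gL l \<delta> \<gamma>) ?z + dx \<gamma> (gL l \<beta> \<delta>) ?z - dx \<delta> (gL l \<beta> \<gamma>) ?z"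
  let ?F = "\<lambda>\<delta> \<beta> \<gamma>. \<Sum>\<mu>\<in>UNIV. dv \<mu> (gL l \<delta> \<gamma>) ?z * Nconn l \<mu> \<beta> ?z + dv \<mu> (gL l \<beta> \<delta>) ?z * Nconn l \<mu> \<gamma> ?z
      - dv \<mu> (gL l \<beta> \<gamma>) ?z * Nconn l \<mu> \<delta> ?z"
  have F: "(\<Sum>\<beta>\<in>UNIV. \<Sum>\<gamma>\<in>UNIV. ?F \<delta> \<beta> \<gamma> * u $ \<beta> * w $ \<gamma>) = fd (gg (axis \<delta> 1) w) ?z (0, 2 *\<^sub>R G ?z)" for \<delta>
  proof -
    have g: "gg (axis \<delta> 1) w y = (\<Sum>\<gamma>\<in>UNIV. w $ \<gamma> * gL l \<delta> \<gamma> y)" if "y \<in> W" for y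
      by (subst linear_axis_expand[OF gg_linear2[OF that]]) (simp add: gL_eq)
    have d: "gL l \<delta> \<gamma> differentiable (at ?z)" for \<gamma>
      unfolding gL_eq by (rule Cinf_differentiable[OF Cinf_gg z])
    have der: "((\<lambda>y. \<Sum>\<gamma>\<in>UNIV. w $ \<gamma> * gL l \<delta> \<gamma> y) has_derivative (\<lambda>h. \<Sum>\<gamma>\<in>UNIV. w $ \<gamma> * fd (gL l \<delta> \<gamma>) ?z h)) (at ?z)"
      by (intro has_derivative_sum has_derivative_mult_right has_derivative_fd d)
    have gh: "fd (gg (axis \<delta> 1) w) ?z h = (\<Sum>\<gamma>\<in>UNIV. w $ \<gamma> * fd (gL l \<delta> \<gamma>) ?z h)" for h
      using has_derivative_transform_within_open[OF der open_W z g[symmetric]] by (rule fd_eqI)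
    have "(\<Sum>\<beta>\<in>UNIV. Nconn l \<mu> \<beta> ?z * u $ \<beta>) = 2 * G ?z $ \<mu>" for \<mu>
      using arg_cong[OF Nm_radial[OF assms], of "\<lambda>y. y $ \<mu>"] by (simp add: Nm_def matrix_vector_mult_def)
    note N = this
    have 1: "(\<Sum>\<beta>\<in>UNIV. \<Sum>\<gamma>\<in>UNIV. \<Sum>\<mu>\<in>UNIV. dv \<mu> (gL l \<delta> \<gamma>) ?z * Nconn l \<mu> \<beta> ?z * u $ \<beta> * w $ \<gamma>)
        = (\<Sum>\<mu>\<in>UNIV. \<Sum>\<gamma>\<in>UNIV. dv \<mu> (gL l \<delta> \<gamma>) ?z * w $ \<gamma> * (2 * G ?z $ \<mu>))"
    proof -
      have "(\<Sum>\<beta>\<in>UNIV. \<Sum>\<gamma>\<in>UNIV. \<Sum>\<mu>\<in>UNIV. dv \<mu> (gL l \<delta> \<gamma>) ?z * Nconn l \<mu> \<beta> ?z * u $ \<beta> * w $ \<gamma>)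
        = (\<Sum>\<gamma>\<in>UNIV. \<Sum>\<mu>\<in>UNIV. \<Sum>\<beta>\<in>UNIV. (dv \<mu> (gL l \<delta> \<gamma>) ?z * w $ \<gamma>) * (Nconn l \<mu> \<beta> ?z * u $ \<beta>))"
        by (subst sum_rotate[symmetric]) (simp add: mult_ac)
      also have "\<dots> = (\<Sum>\<gamma>\<in>UNIV. \<Sum>\<mu>\<in>UNIV. dv \<mu> (gL l \<delta> \<gamma>) ?z * w $ \<gamma> * (2 * G ?z $ \<mu>))"
        unfolding sum_distrib_left[symmetric] N by simp
      finally show ?thesis by (subst sum.swap)
    qed
    have 2: "(\<Sum>\<beta>\<in>UNIV. \<Sum>\<gamma>\<in>UNIV. \<Sum>\<mu>\<in>UNIV. dv \<mu> (gL l \<beta> \<delta>) ?z * Nconn l \<mu> \<gamma> ?z * u $ \<beta> * w $ \<gamma>) = 0"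
    proof -
      have "(\<Sum>\<beta>\<in>UNIV. \<Sum>\<gamma>\<in>UNIV. \<Sum>\<mu>\<in>UNIV. dv \<mu> (gL l \<beta> \<delta>) ?z * Nconn l \<mu> \<gamma> ?z * u $ \<beta> * w $ \<gamma>)
        = (\<Sum>\<gamma>\<in>UNIV. \<Sum>\<mu>\<in>UNIV. \<Sum>\<beta>\<in>UNIV. (Nconn l \<mu> \<gamma> ?z * w $ \<gamma>) * (dv \<mu> (gL l \<beta> \<delta>) ?z * u $ \<beta>))"
        by (subst sum_rotate[symmetric]) (simp add: mult_ac)
      also have "\<dots> = 0" unfolding sum_distrib_left[symmetric] dv_gL_contract[OF assms] by simp
      finally show ?thesis .
    qed
    have 3: "(\<Sum>\<beta>\<in>UNIV. \<Sum>\<gamma>\<in>UNIV. \<Sum>\<mu>\<in>UNIV. dv \<mu> (gL l \<beta> \<gamma>) ?z * Nconn l \<mu> \<delta> ?z * u $ \<beta> * w $ \<gamma>) = 0"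
    proof -
      have "(\<Sum>\<beta>\<in>UNIV. \<Sum>\<gamma>\<in>UNIV. \<Sum>\<mu>\<in>UNIV. dv \<mu> (gL l \<beta> \<gamma>) ?z * Nconn l \<mu> \<delta> ?z * u $ \<beta> * w $ \<gamma>)
        = (\<Sum>\<gamma>\<in>UNIV. \<Sum>\<mu>\<in>UNIV. \<Sum>\<beta>\<in>UNIV. (Nconn l \<mu> \<delta> ?z * w $ \<gamma>) * (dv \<mu> (gL l \<beta> \<gamma>) ?z * u $ \<beta>))"
        by (subst sum_rotate[symmetric]) (simp add: mult_ac)
      also have "\<dots> = 0" unfolding sum_distrib_left[symmetric] dv_gL_contract[OF assms] by simp
      finally show ?thesis .
    qed
    have "fd (gg (axis \<delta> 1) w) ?z (0, 2 *\<^sub>R G ?z) = (\<Sum>\<mu>\<in>UNIV. \<Sum>\<gamma>\<in>UNIV. dv \<mu> (gL l \<delta> \<gamma>) ?z * w $ \<gamma> * (2 * G ?z $ \<mu>))"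
      by (subst fd_v_expand[OF Cinf_differentiable[OF Cinf_gg z]])
        (simp add: gh dv_def sum_distrib_left mult_ac)
    then show ?thesis
      using 1 2 3 by (simp add: sum_distrib_right left_diff_distrib distrib_right sum.distrib sum_subtractf)
  qed
  have "(\<Sum>\<beta>\<in>UNIV. \<Sum>\<gamma>\<in>UNIV. Gam l \<alpha> \<beta> \<gamma> ?z * u $ \<beta> * w $ \<gamma>)
      = (\<Sum>\<beta>\<in>UNIV. \<Sum>\<gamma>\<in>UNIV. \<Sum>\<delta>\<in>UNIV. ginv l \<alpha> \<delta> ?z * ((1/2) * ((?E \<delta> \<beta> \<gamma> - ?F \<delta> \<beta> \<gamma>) * u $ \<beta> * w $ \<gamma>)))"
  proof (intro sum.cong refl)
    fix \<beta> \<gamma>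
    have "Gam l \<alpha> \<beta> \<gamma> ?z = (\<Sum>\<delta>\<in>UNIV. ginv l \<alpha> \<delta> ?z * ((1/2) * (?E \<delta> \<beta> \<gamma> - ?F \<delta> \<beta> \<gamma>)))"
      unfolding Gam_def Gam_formal_def by (simp add: sum_distrib_left right_diff_distrib sum_subtractf mult.assoc mult.left_commute[of "1/2"])
    then show "Gam l \<alpha> \<beta> \<gamma> ?z * u $ \<beta> * w $ \<gamma> = (\<Sum>\<delta>\<in>UNIV. ginv l \<alpha> \<delta> ?z * ((1/2) * ((?E \<delta> \<beta> \<gamma> - ?F \<delta> \<beta> \<gamma>) * u $ \<beta> * w $ \<gamma>)))"
      by (simp only: sum_distrib_right mult.assoc)
  qed
  also have "\<dots> = (\<Sum>\<delta>\<in>UNIV. ginv l \<alpha> \<delta> ?z * ((1/2) * (\<Sum>\<beta>\<in>UNIV. \<Sum>\<gamma>\<in>UNIV. (?E \<delta> \<beta> \<gamma> - ?F \<delta> \<beta> \<gamma>) * u $ \<beta> * w $ \<gamma>)))"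
    by (subst sum_rotate) (simp only: sum_distrib_left)
  also have "\<dots> = (\<Sum>\<delta>\<in>UNIV. ginv l \<alpha> \<delta> ?z * gg (axis \<delta> 1) (Nm ?z *v w) ?z)"
  proof (intro sum.cong refl arg_cong2[of _ _ _ _ "(*)"])
    fix \<delta>
    have "(\<Sum>\<beta>\<in>UNIV. \<Sum>\<gamma>\<in>UNIV. (?E \<delta> \<beta> \<gamma> - ?F \<delta> \<beta> \<gamma>) * u $ \<beta> * w $ \<gamma>)
        = (fd (gg (axis \<delta> 1) w) ?z (u, 0) + fd (p (axis \<delta> 1)) ?z (w, 0) - fd (p w) ?z (axis \<delta> 1, 0))
          - fd (gg (axis \<delta> 1) w) ?z (0, 2 *\<^sub>R G ?z)"
      unfolding Gam_formal_contract[OF assms, symmetric] F[symmetric]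
      by (simp only: left_diff_distrib sum_subtractf)
    moreover have "fd (gg (axis \<delta> 1) w) ?z (spray ?z) = fd (gg (axis \<delta> 1) w) ?z (u, 0) - fd (gg (axis \<delta> 1) w) ?z (0, 2 *\<^sub>R G ?z)"
      using linear_diff[OF Cinf_linear[OF Cinf_gg z], of "axis \<delta> 1" w "(u, 0)" "(0, 2 *\<^sub>R G ?z)"] by (simp add: spray_def)
    ultimately show "(1/2) * (\<Sum>\<beta>\<in>UNIV. \<Sum>\<gamma>\<in>UNIV. (?E \<delta> \<beta> \<gamma> - ?F \<delta> \<beta> \<gamma>) * u $ \<beta> * w $ \<gamma>)
        = gg (axis \<delta> 1) (Nm ?z *v w) ?z"
      using Nm_characterization[OF z, of "axis \<delta> 1" w] by simp
  qed
  also have "\<dots> = (Nm ?z *v w) $ \<alpha>" by (rule ginv_mult[OF z])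
  finally show ?thesis .
qed

lemma Cinf_Nm_mult: "Cinf W (\<lambda>z. Nm z *v w)"
  by (rule Cinf_cong[OF Cinf_fd[OF Cinf_G]]) (simp add: Nm_mult)

lemma hom_Nm_mult: "pos_homogeneous X 1 (\<lambda>z. Nm z *v w)"
proof -
  have "pos_homogeneous X 1 (\<lambda>z. fd G z (0, w))" by (rule pos_homogeneous_fd_v[OF X Cinf_G hom_G]) simp
  then show ?thesis unfolding pos_homogeneous_def by (simp add: Nm_mult)
qed

lemma fd_Nm_mult: "z \<in> W \<Longrightarrow> fd (\<lambda>z. Nm z *v w) z h = fd (\<lambda>y. fd G y (0, w)) z h"
  by (subst fd_cong_open(1)[OF open_W _ Nm_mult[symmetric]])
    (auto intro: Cinf_differentiable[OF Cinf_fd[OF Cinf_G]])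

text \<open>The first sum over \<gamma> in \<open>Rmat\<close> is the derivative of the connection
  along \<open>spray z\<close>, whose components are \<open>v\<close> and \<open>- 2 G\<close>; this
  gives the curvature without indices.\<close>

lemma Rmat_mult:
  assumes z: "z \<in> W"
  shows "Rmat l z *v w = 2 *\<^sub>R fd G z (w, 0) - fd (\<lambda>z. Nm z *v w) z (spray z) - Nm z *v (Nm z *v w)"
proof (rule vec_eq_iff[THEN iffD2], rule allI)
  fix \<alpha>
  have c: "fd G z h $ \<alpha> = fd (Gspray l \<alpha>) z h" for h
    using fd_compose_bounded_linear[OF Cinf_differentiable[OF Cinf_G z] bounded_linear_vec_nth, of \<alpha> h]
    by (simp add: G_def)
  have N: "Nconn l \<alpha> \<beta> differentiable (at z)" for \<beta>
  proof -
    have "Cinf W (\<lambda>z. (Nm z *v axis \<beta> 1) $ \<alpha>)" by (intro Cinf_vec_nth Cinf_Nm_mult)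
    from Cinf_differentiable[OF this z] show ?thesis
      by (simp add: Nm_def matrix_vector_mult_def axis_def if_distrib cong: if_cong)
  qed
  have Nw: "fd (\<lambda>z. Nm z *v w) z h $ \<alpha> = (\<Sum>\<beta>\<in>UNIV. w $ \<beta> * fd (Nconn l \<alpha> \<beta>) z h)" for h
  proof -
    have "fd (\<lambda>z. Nm z *v w) z h $ \<alpha> = fd (\<lambda>z. (Nm z *v w) $ \<alpha>) z h"
      using fd_compose_bounded_linear[OF Cinf_differentiable[OF Cinf_Nm_mult z] bounded_linear_vec_nth, of w \<alpha> h] by simp
    also have "\<dots> = fd (\<lambda>z. \<Sum>\<beta>\<in>UNIV. w $ \<beta> * Nconn l \<alpha> \<beta> z) z h"
      by (simp add: Nm_def matrix_vector_mult_def mult.commute)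
    also have "\<dots> = (\<Sum>\<beta>\<in>UNIV. w $ \<beta> * fd (Nconn l \<alpha> \<beta>) z h)"
      by (rule fd_eqI) (intro has_derivative_sum has_derivative_mult_right has_derivative_fd N)
    finally show ?thesis .
  qed
  have sp: "fd (Nconn l \<alpha> \<beta>) z (spray z) = (\<Sum>\<gamma>\<in>UNIV. dx \<gamma> (Nconn l \<alpha> \<beta>) z * snd z $ \<gamma>
      - 2 * dv \<gamma> (Nconn l \<alpha> \<beta>) z * Gspray l \<gamma> z)" for \<beta>
    unfolding spray_def
    by (subst fd_split[OF N], subst fd_x_expand[OF N], subst fd_v_expand[OF N])
      (simp add: dx_def dv_def G_def sum_subtractf sum_negf mult_ac)
  have "(Rmat l z *v w) $ \<alpha> = (\<Sum>\<beta>\<in>UNIV. (2 * dx \<beta> (Gspray l \<alpha>) z - fd (Nconn l \<alpha> \<beta>) z (spray z)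
      - (\<Sum>\<gamma>\<in>UNIV. Nconn l \<alpha> \<gamma> z * Nconn l \<gamma> \<beta> z)) * w $ \<beta>)"
    by (simp add: matrix_vector_mult_def Rmat_def sp)
  also have "\<dots> = 2 * (\<Sum>\<beta>\<in>UNIV. w $ \<beta> * dx \<beta> (Gspray l \<alpha>) z) - (\<Sum>\<beta>\<in>UNIV. w $ \<beta> * fd (Nconn l \<alpha> \<beta>) z (spray z))
      - (\<Sum>\<beta>\<in>UNIV. (\<Sum>\<gamma>\<in>UNIV. Nconn l \<alpha> \<gamma> z * Nconn l \<gamma> \<beta> z) * w $ \<beta>)"
    unfolding left_diff_distrib sum_subtractf sum_distrib_left by (simp add: mult_ac)
  also have "(\<Sum>\<beta>\<in>UNIV. w $ \<beta> * dx \<beta> (Gspray l \<alpha>) z) = fd G z (w, 0) $ \<alpha>"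
    by (subst fd_x_expand[OF Cinf_differentiable[OF Cinf_G z]]) (simp add: sum_component c dx_def)
  also have "(\<Sum>\<beta>\<in>UNIV. (\<Sum>\<gamma>\<in>UNIV. Nconn l \<alpha> \<gamma> z * Nconn l \<gamma> \<beta> z) * w $ \<beta>) = (Nm z *v (Nm z *v w)) $ \<alpha>"
    by (simp add: matrix_vector_mul_assoc) (simp add: matrix_vector_mult_def matrix_matrix_mult_def Nm_def)
  finally show "(Rmat l z *v w) $ \<alpha> = (2 *\<^sub>R fd G z (w, 0) - fd (\<lambda>z. Nm z *v w) z (spray z) - Nm z *v (Nm z *v w)) $ \<alpha>"
    by (simp add: Nw)
qed

text \<open>Degree 2 of \<open>G\<close> makes the derivative of \<open>Nm\<close> along the spray,
  applied to \<open>u\<close>, equal to \<open>2 fd G (u, 0) - 2 Nm G\<close>; the other two terms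
  cancel it because \<open>Nm u = 2 G\<close>.\<close>

lemma Rmat_radial:
  assumes "x \<in> X" "u \<noteq> 0" shows "Rmat l (x, u) *v u = 0"
proof -
  have z: "(x, u) \<in> W" using assms by auto
  let ?g = "- 2 *\<^sub>R G (x, u)"
  have "fd (\<lambda>y. fd G y (0, u)) (x, u) (u, ?g) = fd (\<lambda>y. fd G y (0, u)) (x, u) (u, 0) + fd (\<lambda>y. fd G y (0, u)) (x, u) (0, ?g)"
    by (rule fd_split[OF Cinf_differentiable[OF Cinf_fd[OF Cinf_G] z]])
  also have "\<dots> = 2 *\<^sub>R fd G (x, u) (u, 0) + fd G (x, u) (0, ?g)"
    using euler_x[OF X Cinf_G hom_G assms, of u] euler_v[OF X Cinf_G hom_G assms, of ?g] by simp
  also have "fd G (x, u) (0, ?g) = - 2 *\<^sub>R (Nm (x, u) *v G (x, u))"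
    using Nm_mult[OF z, of ?g] by (simp add: matrix_vector_mult_scaleR del: scaleR_minus_left) 
  finally show ?thesis
    using Rmat_mult[OF z, of u] fd_Nm_mult[OF z, of u "spray (x, u)"] Nm_radial[OF assms]
    by (simp add: spray_def matrix_vector_mult_scaleR)
qed

text \<open>Two first-order identities for \<open>l\<close> are differentiated crosswise: the
  vanishing horizontal derivative along the spray, and the conservation of \<open>l\<close> along
  the spray (\<open>sp0\<close>) in the direction \<open>(w, 0)\<close>. Symmetry of second
  derivatives equates the results, which is the claim in view of \<open>Rmat_mult\<close>.\<close>

lemma p_Rmat:
  assumes z: "z \<in> W" shows "p (Rmat l z *v w) z = 0"
proof -
  obtain x u where zx: "z = (x, u)" "x \<in> X" "u \<noteq> 0" using z by auto
  let ?Nw = "Nm z *v w"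
  have Nd: "((\<lambda>y. Nm y *v w) has_derivative fd (\<lambda>y. Nm y *v w) z) (at z)"
    by (rule Cinf_has_derivative[OF Cinf_Nm_mult z])
  have h: "((\<lambda>y. (0 :: real ^ 'i, Nm y *v w)) has_derivative (\<lambda>h. (0, fd (\<lambda>y. Nm y *v w) z h))) (at z)"
    by (rule has_derivative_Pair[OF _ Nd]) simp
  have 1: "((\<lambda>y. fd l y (0, Nm y *v w)) has_derivative
      (\<lambda>k. fd (\<lambda>y. fd l y (0, ?Nw)) z k + fd l z (0, fd (\<lambda>y. Nm y *v w) z k))) (at z)"
    by (rule fd_fd_variable[OF smooth z h])
  have 2: "((\<lambda>y. fd l y (0, Nm y *v w)) has_derivative fd (\<lambda>y. fd l y (w, 0)) z) (at z)"
    by (rule has_derivative_transform_within_open[OF Cinf_has_derivative[OF Cinf_fd[OF smooth] z] open_W z])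
      (simp add: horizontal_constant p_def)
  have "fd (\<lambda>y. fd l y (w, 0)) z (spray z) = fd (p ?Nw) z (spray z) + p (fd (\<lambda>y. Nm y *v w) z (spray z)) z"
    using fun_cong[OF has_derivative_unique[OF 2 1], of "spray z"] by (simp add: p_eq)
  also have "fd (p ?Nw) z (spray z) = p (Nm z *v ?Nw) z"
    by (simp add: euler_lagrange[OF z] horizontal_constant[OF z])
  finally have A: "fd (\<lambda>y. fd l y (w, 0)) z (spray z) = p (Nm z *v ?Nw) z + p (fd (\<lambda>y. Nm y *v w) z (spray z)) z" .
  have 3: "((\<lambda>y. fd l y (spray y)) has_derivative
      (\<lambda>k. fd (\<lambda>y. fd l y (spray z)) z k + fd l z (snd k, - 2 *\<^sub>R fd G z k))) (at z)"
    by (rule fd_fd_variable[OF smooth z spray_has_derivative[OF z]])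
  have sp0: "fd l y (spray y) = 0" if "y \<in> W" for y
  proof -
    obtain x u where yx: "y = (x, u)" "x \<in> X" "u \<noteq> 0" using \<open>y \<in> W\<close> by auto
    have "fd l y (spray y) = fd l y (u, 0) + fd l y (0, - 2 *\<^sub>R G y)"
      using fd_split[OF Cinf_differentiable[OF smooth that], of u "- 2 *\<^sub>R G y"] by (simp add: spray_def yx)
    also have "fd l y (0, - 2 *\<^sub>R G y) = - p (2 *\<^sub>R G y) y"
      using linear_neg[OF p_linear[OF that], of "2 *\<^sub>R G y"] by (simp add: p_def)
    finally show ?thesis using horizontal_constant[OF that, of u] Nm_radial[OF yx(2,3)] by (simp add: yx)
  qed
  have 4: "((\<lambda>y. fd l y (spray y)) has_derivative (\<lambda>h. 0)) (at z)"
    by (rule has_derivative_transform_within_open[OF has_derivative_const open_W z]) (simp add: sp0)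
  have "fd (\<lambda>y. fd l y (spray z)) z (w, 0) + fd l z (0, - 2 *\<^sub>R fd G z (w, 0)) = 0"
    using fun_cong[OF has_derivative_unique[OF 3 4], of "(w, 0)"] by simp
  moreover have "fd l z (0, - 2 *\<^sub>R fd G z (w, 0)) = - p (2 *\<^sub>R fd G z (w, 0)) z"
    using linear_neg[OF p_linear[OF z], of "2 *\<^sub>R fd G z (w, 0)"] by (simp add: p_def)
  ultimately have "fd (\<lambda>y. fd l y (w, 0)) z (spray z) = p (2 *\<^sub>R fd G z (w, 0)) z"
    using fd_fd_commute[OF smooth z, of "(w, 0)" "spray z"] by simp
  with A show ?thesis
    unfolding Rmat_mult[OF z] by (simp add: linear_diff[OF p_linear[OF z]])
qed

text \<open>All three terms of \<open>Rmat_mult\<close> scale quadratically. This is needed because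
  \<open>Ric\<close> is evaluated at a multiple of the velocity.\<close>

lemma Rmat_scale:
  assumes "x \<in> X" "u \<noteq> 0" "r > 0" shows "Rmat l (x, r *\<^sub>R u) = r ^ 2 *\<^sub>R Rmat l (x, u)"
proof -
  have z: "(x, u) \<in> W" and rz: "(x, r *\<^sub>R u) \<in> W" using assms by auto
  have "Rmat l (x, r *\<^sub>R u) *v w = (r ^ 2 *\<^sub>R Rmat l (x, u)) *v w" for w
  proof -
    have 1: "fd G (x, r *\<^sub>R u) (w, 0) = r ^ 2 *\<^sub>R fd G (x, u) (w, 0)"
      using pos_homogeneous_fd[OF X Cinf_G hom_G assms, of w 0] by simp
    have "fd (\<lambda>z. Nm z *v w) (x, r *\<^sub>R u) (spray (x, r *\<^sub>R u))
        = fd (\<lambda>z. Nm z *v w) (x, r *\<^sub>R u) (r *\<^sub>R u, r *\<^sub>R (- 2 *\<^sub>R (r *\<^sub>R G (x, u))))"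
      using pos_homogeneousD[OF hom_G assms] by (simp add: spray_def power2_eq_square mult_ac)
    also have "\<dots> = r *\<^sub>R fd (\<lambda>z. Nm z *v w) (x, u) (r *\<^sub>R u, - 2 *\<^sub>R (r *\<^sub>R G (x, u)))"
      using pos_homogeneous_fd[OF X Cinf_Nm_mult hom_Nm_mult assms, of w "r *\<^sub>R u" "- 2 *\<^sub>R (r *\<^sub>R G (x, u))"] by simp
    also have "\<dots> = r *\<^sub>R (r *\<^sub>R fd (\<lambda>z. Nm z *v w) (x, u) (spray (x, u)))"
      using linear_scale[OF Cinf_linear[OF Cinf_Nm_mult z], of w r "spray (x, u)"] by (simp add: spray_def mult.commute)
    finally have 2: "fd (\<lambda>z. Nm z *v w) (x, r *\<^sub>R u) (spray (x, r *\<^sub>R u)) = r ^ 2 *\<^sub>R fd (\<lambda>z. Nm z *v w) (x, u) (spray (x, u))"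
      by (simp add: power2_eq_square)
    have 3: "Nm (x, r *\<^sub>R u) *v (Nm (x, r *\<^sub>R u) *v w) = r ^ 2 *\<^sub>R (Nm (x, u) *v (Nm (x, u) *v w))"
      using pos_homogeneousD[OF hom_Nm_mult assms] by (simp add: power2_eq_square matrix_vector_mult_scaleR)
    show ?thesis unfolding scaleR_matrix_vector_assoc[symmetric] Rmat_mult[OF rz] Rmat_mult[OF z] 1 2 3
      by (simp add: scaleR_diff_right)
  qed
  then show ?thesis by (simp add: matrix_eq)
qed

end

text \<open>The spray transforms with a second derivative of the change of coordinates \<open>\<phi>\<close>, hence so does
  the nonlinear connection.\<close>

locale finsler_chart_change = A: finsler_chart X l + B: finsler_chart X' l'
  for X X' :: "(real ^ 'i::finite) set" and l l' +
  fixes Z :: "(real ^ 'i) set" and \<phi> :: "real ^ 'i \<Rightarrow> real ^ 'i"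
  assumes Z: "Z \<subseteq> X" and \<phi>: "Cinf Z \<phi>" and \<phi>_img: "\<phi> ` Z \<subseteq> X'"
    and inj: "\<And>x u. x \<in> Z \<Longrightarrow> fd \<phi> x u = 0 \<Longrightarrow> u = 0"
    and sur: "\<And>x. x \<in> Z \<Longrightarrow> surj (fd \<phi> x)"
    and l_eq: "\<And>x u. x \<in> Z \<Longrightarrow> u \<noteq> 0 \<Longrightarrow> l (x, u) = l' (\<phi> x, fd \<phi> x u)"
begin

abbreviation T where "T x \<equiv> fd \<phi> x"
abbreviation DT where "DT x u a \<equiv> fd (\<lambda>y. fd \<phi> y u) x a"

lemma open_Z: "open Z" using \<phi> by (rule Cinf_open)

text \<open>The tangent map of \<open>\<phi>\<close>; its derivative brings in the Hessian
  \<open>DT\<close> of \<open>\<phi>\<close>, the source of all inhomogeneous transformation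
  terms.\<close>

definition \<Phi> where "\<Phi> z = (\<phi> (fst z), T (fst z) (snd z))"

lemma \<Phi>_W: "x \<in> Z \<Longrightarrow> u \<noteq> 0 \<Longrightarrow> \<Phi> (x, u) \<in> B.W"
  using inj \<phi>_img by (auto simp: \<Phi>_def)

lemma open_ZW: "open (Z \<times> - {0 :: real ^ 'i})" by (intro open_Times open_Z) auto

lemma \<Phi>_has_derivative:
  assumes "x \<in> Z"
  shows "(\<Phi> has_derivative (\<lambda>h. (T x (fst h), DT x u (fst h) + T x (snd h)))) (at (x, u))"
proof -
  have f: "(fst has_derivative fst) (at (x, u))" by (auto intro!: derivative_eq_intros)
  have 1: "((\<lambda>z. \<phi> (fst z)) has_derivative (\<lambda>h. T x (fst h))) (at (x, u))"
    using diff_chain_at[OF f, of \<phi> "T x"] Cinf_has_derivative[OF \<phi> assms] by (simp add: o_def)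
  have 2: "((\<lambda>z. \<Sum>i\<in>Basis. (snd z \<bullet> i) *\<^sub>R T (fst z) i) has_derivative
     (\<lambda>h. \<Sum>i\<in>Basis. (u \<bullet> i) *\<^sub>R DT x i (fst h) + (snd h \<bullet> i) *\<^sub>R T x i)) (at (x, u))"
  proof (intro has_derivative_sum)
    fix i :: "real ^ 'i"
    have A: "((\<lambda>z. T (fst z) i) has_derivative (\<lambda>h. DT x i (fst h))) (at (x, u))"
      using diff_chain_at[OF f, of "\<lambda>y. T y i" "DT x i"] Cinf_has_derivative[OF Cinf_fd[OF \<phi>] assms] by (simp add: o_def)
    have B: "((\<lambda>z. snd z \<bullet> i) has_derivative (\<lambda>h. snd h \<bullet> i)) (at (x, u))"
      by (auto intro!: derivative_eq_intros)
    show "((\<lambda>z. (snd z \<bullet> i) *\<^sub>R T (fst z) i) has_derivative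
      (\<lambda>h. (u \<bullet> i) *\<^sub>R DT x i (fst h) + (snd h \<bullet> i) *\<^sub>R T x i)) (at (x, u))"
      using has_derivative_scaleR[OF B A] by simp
  qed
  have e: "(\<Sum>i\<in>Basis. (u \<bullet> i) *\<^sub>R DT x i a + (b \<bullet> i) *\<^sub>R T x i) = DT x u a + T x b" for a b
    using fd_fd_sum[OF \<phi> assms, of "\<lambda>i. u \<bullet> i" "\<lambda>i. i" Basis a] linear_euclidean_expand[OF Cinf_linear[OF \<phi> assms], of b]
    by (simp add: sum.distrib euclidean_representation)
  have 3: "((\<lambda>z. T (fst z) (snd z)) has_derivative (\<lambda>h. DT x u (fst h) + T x (snd h))) (at (x, u))"
    by (rule has_derivative_transform_within_open[OF 2[unfolded e], of "Z \<times> UNIV"])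
      (use assms open_Z linear_euclidean_expand[OF Cinf_linear[OF \<phi>]] in \<open>auto simp: open_Times\<close>)
  show ?thesis unfolding \<Phi>_def[abs_def] by (rule has_derivative_Pair[OF 1 3])
qed

lemma fd_l:
  assumes "x \<in> Z" "u \<noteq> 0"
  shows "fd l (x, u) (a, b) = fd l' (\<Phi> (x, u)) (T x a, DT x u a + T x b)"
proof -
  have "((\<lambda>z. l' (\<Phi> z)) has_derivative (\<lambda>h. fd l' (\<Phi> (x, u)) (T x (fst h), DT x u (fst h) + T x (snd h)))) (at (x, u))"
    using diff_chain_at[OF \<Phi>_has_derivative[OF assms(1)] Cinf_has_derivative[OF B.smooth \<Phi>_W[OF assms]]]
    by (simp add: o_def)
  then have "(l has_derivative (\<lambda>h. fd l' (\<Phi> (x, u)) (T x (fst h), DT x u (fst h) + T x (snd h)))) (at (x, u))"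
    by (rule has_derivative_transform_within_open[OF _ open_ZW])
      (use assms in \<open>simp_all add: split_paired_all \<Phi>_def l_eq\<close>)
  from fd_eqI[OF this, of "(a, b)"] show ?thesis by simp
qed

lemma T0: "x \<in> Z \<Longrightarrow> T x 0 = 0" using linear_0[OF Cinf_linear[OF \<phi>]] .

lemma DT0: "x \<in> Z \<Longrightarrow> DT x u 0 = 0" using linear_0[OF Cinf_linear[OF Cinf_fd[OF \<phi>]]] .

lemma p_change: "x \<in> Z \<Longrightarrow> u \<noteq> 0 \<Longrightarrow> A.p b (x, u) = B.p (T x b) (\<Phi> (x, u))"
  unfolding A.p_def B.p_def by (simp add: fd_l T0 DT0)

lemma fd_p_change:
  assumes "x \<in> Z" "u \<noteq> 0"
  shows "fd (A.p c) (x, u) (a, b) = fd (B.p (T x c)) (\<Phi> (x, u)) (T x a, DT x u a + T x b) + B.p (DT x c a) (\<Phi> (x, u))"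
proof -
  have zW: "(x, u) \<in> Z \<times> - {0}" using assms by auto
  have c: "((\<lambda>z. (0 :: real ^ 'i, T (fst z) c)) has_derivative (\<lambda>h. (0, DT x c (fst h)))) (at (x, u))"
  proof (rule has_derivative_Pair)
    have f: "(fst has_derivative fst) (at (x, u))" by (auto intro!: derivative_eq_intros)
    show "((\<lambda>z. T (fst z) c) has_derivative (\<lambda>h. DT x c (fst h))) (at (x, u))"
      using diff_chain_at[OF f, of "\<lambda>y. T y c" "DT x c"] Cinf_has_derivative[OF Cinf_fd[OF \<phi>] assms(1)] by (simp add: o_def)
  qed simp
  have PhiD: "((\<lambda>z. (\<Phi> z, T (fst z) c)) has_derivative (\<lambda>h. ((T x (fst h), DT x u (fst h) + T x (snd h)), DT x c (fst h)))) (at (x, u))"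
    using has_derivative_Pair[OF \<Phi>_has_derivative[OF assms(1)]] has_derivative_snd[OF c] by simp
  \<comment> \<open>The direction \<open>T (fst z) c\<close> varies with \<open>z\<close>. It is
    carried as an additional variable next to the point, so \<open>l'\<close> is precomposed with
    \<open>fst\<close> and \<open>fd_fd_variable\<close> applies on the enlarged space.\<close>
  have q: "((\<lambda>y. fd l' (fst y) (0, snd y)) has_derivative
      (\<lambda>k. fd (B.p (T x c)) (\<Phi> (x, u)) (fst k) + B.p (snd k) (\<Phi> (x, u)))) (at (\<Phi> (x, u), T x c))"
  proof -
    let ?f = "\<lambda>y :: ((real ^ 'i) \<times> (real ^ 'i)) \<times> (real ^ 'i). l' (fst y)"
    have W2: "open (B.W \<times> (UNIV :: (real ^ 'i) set))" using B.open_W by (simp add: open_Times)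
    have 1: "Cinf (B.W \<times> UNIV) ?f" by (rule Cinf_compose[OF Cinf_fst[OF W2] B.smooth]) auto
    have m: "(\<Phi> (x, u), T x c) \<in> B.W \<times> UNIV" using \<Phi>_W[OF assms] by auto
    have fdf: "fd ?f y k = fd l' (fst y) (fst k)" if "y \<in> B.W \<times> UNIV" for y k
    proof -
      have "(fst has_derivative fst) (at y)" by (auto intro!: derivative_eq_intros)
      moreover have "(l' has_derivative fd l' (fst y)) (at (fst y))"
        using that by (intro Cinf_has_derivative[OF B.smooth]) (simp add: mem_Times_iff)
      ultimately have "((l' \<circ> fst) has_derivative (fd l' (fst y) \<circ> fst)) (at y)" by (rule diff_chain_at)
      from fd_eqI[OF this, of k] show ?thesis by (simp add: o_def)
    qed
    have h: "((\<lambda>y. ((0 :: real ^ 'i, snd y), 0 :: real ^ 'i)) has_derivative (\<lambda>k. ((0, snd k), 0))) (at (\<Phi> (x, u), T x c))"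
      by (auto intro!: derivative_eq_intros)
    have 2: "((\<lambda>y. fd ?f y ((0, snd y), 0)) has_derivative
       (\<lambda>k. fd (\<lambda>y. fd ?f y ((0, snd (\<Phi> (x, u), T x c)), 0)) (\<Phi> (x, u), T x c) k + fd ?f (\<Phi> (x, u), T x c) ((0, snd k), 0)))
       (at (\<Phi> (x, u), T x c))"
      by (rule fd_fd_variable[OF 1 m h])
    have 3: "fd (\<lambda>y. fd ?f y ((0, T x c), 0)) (\<Phi> (x, u), T x c) k = fd (B.p (T x c)) (\<Phi> (x, u)) (fst k)" for k
    proof (rule fd_eqI)
      have f: "(fst has_derivative fst) (at (\<Phi> (x, u), T x c))" by (auto intro!: derivative_eq_intros)
      have "((\<lambda>y. B.p (T x c) (fst y)) has_derivative (\<lambda>k. fd (B.p (T x c)) (\<Phi> (x, u)) (fst k))) (at (\<Phi> (x, u), T x c))"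
        using diff_chain_at[OF f, of "B.p (T x c)" "fd (B.p (T x c)) (\<Phi> (x, u))"]
          Cinf_has_derivative[OF B.Cinf_p \<Phi>_W[OF assms]] by (simp add: o_def)
      then show "((\<lambda>y. fd ?f y ((0, T x c), 0)) has_derivative (\<lambda>k. fd (B.p (T x c)) (\<Phi> (x, u)) (fst k))) (at (\<Phi> (x, u), T x c))"
        by (rule has_derivative_transform_within_open[OF _ W2 m]) (simp add: fdf B.p_def)
    qed
    have 4: "((\<lambda>y. fd ?f y ((0, snd y), 0)) has_derivative
      (\<lambda>k. fd (B.p (T x c)) (\<Phi> (x, u)) (fst k) + B.p (snd k) (\<Phi> (x, u)))) (at (\<Phi> (x, u), T x c))"
      using 2 3 fdf[OF m] by (simp add: B.p_def)
    show ?thesis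
      by (rule has_derivative_transform_within_open[OF 4 W2 m]) (simp add: fdf)
  qed
  have q': "((\<lambda>y. fd l' (fst y) (0, snd y)) has_derivative
      (\<lambda>k. fd (B.p (T x c)) (\<Phi> (x, u)) (fst k) + B.p (snd k) (\<Phi> (x, u))))
      (at ((\<lambda>z. (\<Phi> z, T (fst z) c)) (x, u)))" using q by simp
  have "((\<lambda>z. fd l' (\<Phi> z) (0, T (fst z) c)) has_derivative
     (\<lambda>h. fd (B.p (T x c)) (\<Phi> (x, u)) (T x (fst h), DT x u (fst h) + T x (snd h)) + B.p (DT x c (fst h)) (\<Phi> (x, u)))) (at (x, u))"
    using diff_chain_at[OF PhiD q'] by (simp add: o_def)
  then have "(A.p c has_derivative
     (\<lambda>h. fd (B.p (T x c)) (\<Phi> (x, u)) (T x (fst h), DT x u (fst h) + T x (snd h)) + B.p (DT x c (fst h)) (\<Phi> (x, u)))) (at (x, u))"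
    by (rule has_derivative_transform_within_open[OF _ open_ZW zW]) (simp add: split_paired_all p_change B.p_def)
  from fd_eqI[OF this, of "(a, b)"] show ?thesis by simp
qed

text \<open>The Euler-Lagrange equation is compared in both charts. The Hessian terms
  \<open>DT x u a\<close> and \<open>DT x a u\<close> cancel by symmetry, \<open>sur\<close> writes
  every test vector as \<open>T x a\<close>, and nondegeneracy strips off the metric.\<close>

lemma spray_change:
  assumes "x \<in> Z" "u \<noteq> 0"
  shows "2 *\<^sub>R T x (A.G (x, u)) = 2 *\<^sub>R B.G (\<Phi> (x, u)) + DT x u u"
proof -
  have zA: "(x, u) \<in> A.W" using assms Z by auto
  have zB: "\<Phi> (x, u) \<in> B.W" using \<Phi>_W[OF assms] .
  let ?y = "\<Phi> (x, u)"
  let ?s = "DT x u u + T x (- 2 *\<^sub>R A.G (x, u))"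
  have key: "B.gg c ?s ?y = B.gg c (- 2 *\<^sub>R B.G ?y) ?y" for c
  proof -
    obtain a where a: "c = T x a" using sur[OF assms(1)] by (metis surjD)
    have "fd (B.p (T x a)) ?y (T x u, ?s) + B.p (DT x a u) ?y = fd l' ?y (T x a, DT x u a + T x 0)"
      using A.euler_lagrange[OF zA, of a] fd_p_change[OF assms, of a u "- 2 *\<^sub>R A.G (x, u)"] fd_l[OF assms, of a 0]
      by (simp add: A.spray_def)
    also have "\<dots> = fd l' ?y (T x a, 0) + B.p (DT x u a) ?y"
      using fd_split[OF Cinf_differentiable[OF B.smooth zB], of "T x a" "DT x u a"] T0[OF assms(1)] by (simp add: B.p_def)
    also have "DT x u a = DT x a u" by (rule fd_fd_commute[OF \<phi> assms(1)])
    also have "fd l' ?y (T x a, 0) = fd (B.p (T x a)) ?y (T x u, - 2 *\<^sub>R B.G ?y)"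
      using B.euler_lagrange[OF zB, of "T x a"] by (simp add: B.spray_def \<Phi>_def)
    finally have "fd (B.p (T x a)) ?y (T x u, ?s) = fd (B.p (T x a)) ?y (T x u, - 2 *\<^sub>R B.G ?y)" by simp
    moreover have "fd (B.p (T x a)) ?y (T x u, s) = fd (B.p (T x a)) ?y (T x u, 0) + B.gg (T x a) s ?y" for s
      using fd_split[OF Cinf_differentiable[OF B.Cinf_p zB], of "T x a" "T x u" s] B.fd_p_v[OF zB] by simp
    ultimately show ?thesis unfolding a by (metis add_left_cancel)
  qed
  have "?s = - 2 *\<^sub>R B.G ?y" by (rule B.gg_nondegenerate[OF zB key])
  moreover have "T x (- 2 *\<^sub>R A.G (x, u)) = - (2 *\<^sub>R T x (A.G (x, u)))"
    using linear_scale[OF Cinf_linear[OF \<phi> assms(1)], of "- 2" "A.G (x, u)"] by simp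
  ultimately have "DT x u u - 2 *\<^sub>R T x (A.G (x, u)) = - (2 *\<^sub>R B.G ?y)" by simp
  then show ?thesis by (simp add: diff_eq_eq)
qed

text \<open>Fibre derivative of \<open>spray_change\<close>: the quadratic term
  \<open>DT x u u\<close> comes from a symmetric form, so it contributes twice, matching the factor
  2 in front of \<open>G\<close>.\<close>

lemma Nm_change:
  assumes "x \<in> Z" "u \<noteq> 0"
  shows "T x (A.Nm (x, u) *v w) = B.Nm (\<Phi> (x, u)) *v T x w + DT x u w"
proof -
  have zA: "(x, u) \<in> A.W" using assms Z by auto
  have zB: "\<Phi> (x, u) \<in> B.W" using \<Phi>_W[OF assms] .
  have c: "((\<lambda>v. (x, v)) has_derivative (\<lambda>h. (0, h))) (at u)" by (auto intro!: derivative_eq_intros)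
  have lT: "bounded_linear (T x)" using Cinf_linear[OF \<phi> assms(1)] by (simp add: linear_conv_bounded_linear)
  have 1: "((\<lambda>v. 2 *\<^sub>R T x (A.G (x, v))) has_derivative (\<lambda>h. 2 *\<^sub>R T x (fd A.G (x, u) (0, h)))) (at u)"
    using has_derivative_scaleR_right[OF bounded_linear.has_derivative[OF lT diff_chain_at[OF c Cinf_has_derivative[OF A.Cinf_G zA]]], of 2]
    by (simp add: o_def)
  have 2: "((\<lambda>v. \<Phi> (x, v)) has_derivative (\<lambda>h. (0, T x h))) (at u)"
    using diff_chain_at[OF c \<Phi>_has_derivative[OF assms(1)]] T0[OF assms(1)] DT0[OF assms(1)] by (simp add: o_def)
  have 3: "((\<lambda>v. 2 *\<^sub>R B.G (\<Phi> (x, v))) has_derivative (\<lambda>h. 2 *\<^sub>R fd B.G (\<Phi> (x, u)) (0, T x h))) (at u)"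
    using has_derivative_scaleR_right[OF diff_chain_at[OF 2 Cinf_has_derivative[OF B.Cinf_G zB]], of 2]
    by (simp add: o_def)
  have 4: "((\<lambda>v. DT x v v) has_derivative (\<lambda>h. DT x u h + DT x h u)) (at u)"
  proof -
    have e: "DT x v a = (\<Sum>i\<in>Basis. (v \<bullet> i) *\<^sub>R DT x i a)" for v a
      using fd_fd_sum[OF \<phi> assms(1), of "\<lambda>i. v \<bullet> i" "\<lambda>i. i" Basis a] by (simp add: euclidean_representation)
    have bl: "bounded_linear (DT x i)" for i
      using Cinf_linear[OF Cinf_fd[OF \<phi>] assms(1)] by (simp add: linear_conv_bounded_linear)
    have "((\<lambda>v. \<Sum>i\<in>Basis. (v \<bullet> i) *\<^sub>R DT x i v) has_derivative
      (\<lambda>h. \<Sum>i\<in>Basis. (u \<bullet> i) *\<^sub>R DT x i h + (h \<bullet> i) *\<^sub>R DT x i u)) (at u)"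
      by (intro has_derivative_sum has_derivative_scaleR has_derivative_inner_left
          bounded_linear.has_derivative[OF bl] has_derivative_ident)
    then show ?thesis by (simp add: e[symmetric] sum.distrib)
  qed
  have "((\<lambda>v. 2 *\<^sub>R T x (A.G (x, v))) has_derivative
      (\<lambda>h. 2 *\<^sub>R fd B.G (\<Phi> (x, u)) (0, T x h) + (DT x u h + DT x h u))) (at u)"
    by (rule has_derivative_transform_within_open[OF has_derivative_add[OF 3 4], of "- {0}"])
      (use assms spray_change in auto)
  from fun_cong[OF has_derivative_unique[OF 1 this], of w]
  have "2 *\<^sub>R T x (A.Nm (x, u) *v w) = 2 *\<^sub>R (B.Nm (\<Phi> (x, u)) *v T x w) + 2 *\<^sub>R DT x u w"
    using fd_fd_commute[OF \<phi> assms(1), of w u] by (simp add: A.Nm_mult[OF zA] B.Nm_mult[OF zB] scaleR_2)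
  then have "2 *\<^sub>R T x (A.Nm (x, u) *v w) = 2 *\<^sub>R (B.Nm (\<Phi> (x, u)) *v T x w + DT x u w)"
    by (simp only: scaleR_add_right)
  then show ?thesis by (simp del: scaleR_add_right)
qed

end

section \<open>Smooth curves and charts\<close>

lemma smooth_on_Cinf:
  assumes "smooth_on A f" "a \<in> A"
  obtains U F where "a \<in> U" "Cinf U F" "\<And>x. x \<in> A \<Longrightarrow> x \<in> U \<Longrightarrow> F x = f x"
proof -
  from bspec[OF assms(1)[unfolded smooth_on_def] assms(2)] obtain U F where
    "open U" "a \<in> U" "\<forall>k. Ck_on k U F" "\<forall>x\<in>A \<inter> U. F x = f x" by (elim exE conjE)
  then show ?thesis by (intro that[of U F]) (auto simp: Cinf_def)
qed

lemma smooth_onI_Cinf: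
  assumes "\<And>a. a \<in> A \<Longrightarrow> \<exists>U F. a \<in> U \<and> Cinf U F \<and> (\<forall>x\<in>A \<inter> U. F x = f x)"
  shows "smooth_on A f"
  unfolding smooth_on_def
proof
  fix a assume "a \<in> A"
  from assms[OF this] obtain U F where "a \<in> U" "Cinf U F" "\<forall>x\<in>A \<inter> U. F x = f x" by (elim exE conjE)
  then show "\<exists>U F. open U \<and> a \<in> U \<and> (\<forall>k. Ck_on k U F) \<and> (\<forall>x\<in>A \<inter> U. F x = f x)"
    by (intro exI[of _ U] exI[of _ F]) (simp add: Cinf_def)
qed

lemma smooth_on_subset:
  assumes "smooth_on A f" "B \<subseteq> A" shows "smooth_on B f"
proof (rule smooth_onI_Cinf)
  fix a assume "a \<in> B"
  then have "a \<in> A" using assms(2) by blast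
  obtain U F where "a \<in> U" "Cinf U F" "\<And>x. x \<in> A \<Longrightarrow> x \<in> U \<Longrightarrow> F x = f x"
    by (rule smooth_on_Cinf[OF assms(1) \<open>a \<in> A\<close>]) blast
  then show "\<exists>U F. a \<in> U \<and> Cinf U F \<and> (\<forall>x\<in>B \<inter> U. F x = f x)"
    using assms(2) by (intro exI[of _ U] exI[of _ F]) auto
qed

lemma smooth_on_cong:
  assumes "smooth_on A f" "\<And>x. x \<in> A \<Longrightarrow> f x = g x" shows "smooth_on A g"
proof (rule smooth_onI_Cinf)
  fix a assume "a \<in> A"
  obtain U F where "a \<in> U" "Cinf U F" "\<And>x. x \<in> A \<Longrightarrow> x \<in> U \<Longrightarrow> F x = f x"
    by (rule smooth_on_Cinf[OF assms(1) \<open>a \<in> A\<close>]) blast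
  then show "\<exists>U F. a \<in> U \<and> Cinf U F \<and> (\<forall>x\<in>A \<inter> U. F x = g x)"
    using assms(2) by (intro exI[of _ U] exI[of _ F]) auto
qed

lemma smooth_on_local:
  assumes "\<And>a. a \<in> A \<Longrightarrow> \<exists>U. open U \<and> a \<in> U \<and> smooth_on (A \<inter> U) f"
  shows "smooth_on A f"
proof (rule smooth_onI_Cinf)
  fix a assume a: "a \<in> A"
  then obtain U where U: "open U" "a \<in> U" "smooth_on (A \<inter> U) f" using assms by blast
  obtain V F where V: "a \<in> V" "Cinf V F" "\<And>x. x \<in> A \<inter> U \<Longrightarrow> x \<in> V \<Longrightarrow> F x = f x"
    by (rule smooth_on_Cinf[OF U(3), of a]) (use a U in auto)
  have "Cinf (V \<inter> U) F" by (rule Cinf_subset[OF V(2)]) (use U V Cinf_open in auto)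
  then show "\<exists>U F. a \<in> U \<and> Cinf U F \<and> (\<forall>x\<in>A \<inter> U. F x = f x)"
    using U V by (intro exI[of _ "V \<inter> U"] exI[of _ F]) auto
qed

lemma smooth_on_compose:
  fixes f :: "'a::real_normed_vector \<Rightarrow> 'b::euclidean_space" and g :: "'b \<Rightarrow> 'c::real_normed_vector"
  assumes "smooth_on A f" "smooth_on B g" "f ` A \<subseteq> B"
  shows "smooth_on A (\<lambda>x. g (f x))"
proof (rule smooth_onI_Cinf)
  fix a assume a: "a \<in> A"
  obtain U F where U: "a \<in> U" "Cinf U F" "\<And>x. x \<in> A \<Longrightarrow> x \<in> U \<Longrightarrow> F x = f x"
    by (rule smooth_on_Cinf[OF assms(1) a]) blast
  have "f a \<in> B" using assms a by auto
  then obtain V H where V: "f a \<in> V" "Cinf V H" "\<And>x. x \<in> B \<Longrightarrow> x \<in> V \<Longrightarrow> H x = g x"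
    by (rule smooth_on_Cinf[OF assms(2)]) blast
  \<comment> \<open>Shrunk so that the extension \<open>F\<close>, which is tied to \<open>f\<close>
    on \<open>A\<close> only, still maps into the domain of \<open>H\<close>.\<close>
  let ?U = "U \<inter> F -` V"
  have op: "open ?U"
    using continuous_open_preimage[OF Cinf_continuous_on[OF U(2)] Cinf_open[OF U(2)] Cinf_open[OF V(2)]] .
  have "Cinf ?U F" by (rule Cinf_subset[OF U(2) op]) auto
  then have "Cinf ?U (\<lambda>x. H (F x))" by (rule Cinf_compose[OF _ V(2)]) auto
  moreover have "a \<in> ?U" using U V a by auto
  moreover have "H (F x) = g (f x)" if "x \<in> A \<inter> ?U" for x
    using that U(3)[of x] V(3)[of "f x"] assms(3) by auto
  ultimately show "\<exists>U F. a \<in> U \<and> Cinf U F \<and> (\<forall>x\<in>A \<inter> U. F x = g (f x))"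
    by (intro exI[of _ ?U] exI[of _ "\<lambda>x. H (F x)"]) auto
qed

lemma smooth_on_Cinf_compose:
  fixes f :: "'a::real_normed_vector \<Rightarrow> 'b::euclidean_space" and g :: "'b \<Rightarrow> 'c::real_normed_vector"
  assumes "smooth_on A f" "Cinf B g" "\<And>x. x \<in> A \<Longrightarrow> f x \<in> B"
  shows "smooth_on A (\<lambda>x. g (f x))"
  by (rule smooth_on_compose[OF assms(1) Cinf_smooth_on[OF assms(2) subset_refl]]) (use assms in auto)

lemma smooth_on_Pair:
  assumes "smooth_on A f" "smooth_on A g" shows "smooth_on A (\<lambda>x. (f x, g x))"
proof (rule smooth_onI_Cinf)
  fix a assume a: "a \<in> A"
  obtain U F where U: "a \<in> U" "Cinf U F" "\<And>x. x \<in> A \<Longrightarrow> x \<in> U \<Longrightarrow> F x = f x"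
    by (rule smooth_on_Cinf[OF assms(1) a]) blast
  obtain V H where V: "a \<in> V" "Cinf V H" "\<And>x. x \<in> A \<Longrightarrow> x \<in> V \<Longrightarrow> H x = g x"
    by (rule smooth_on_Cinf[OF assms(2) a]) blast
  have op: "open (U \<inter> V)" using Cinf_open[OF U(2)] Cinf_open[OF V(2)] by (rule open_Int)
  have "Cinf (U \<inter> V) (\<lambda>x. (F x, H x))"
    by (intro Cinf_Pair Cinf_subset[OF U(2) op] Cinf_subset[OF V(2) op]) auto
  then show "\<exists>U F. a \<in> U \<and> Cinf U F \<and> (\<forall>x\<in>A \<inter> U. F x = (f x, g x))"
    using U V by (intro exI[of _ "U \<inter> V"] exI[of _ "\<lambda>x. (F x, H x)"]) auto
qed

lemma smooth_on_bilinear: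
  fixes f :: "'a::real_normed_vector \<Rightarrow> 'b::euclidean_space" and g :: "'a \<Rightarrow> 'c::euclidean_space"
  assumes "bounded_bilinear B" "smooth_on A f" "smooth_on A g" shows "smooth_on A (\<lambda>x. B (f x) (g x))"
  using smooth_on_Cinf_compose[OF smooth_on_Pair[OF assms(2,3)] Cinf_bilinear[OF assms(1) Cinf_fst[OF open_UNIV] Cinf_snd[OF open_UNIV]]]
  by simp

lemmas smooth_on_mult = smooth_on_bilinear[OF bounded_bilinear_mult]
lemmas smooth_on_scaleR = smooth_on_bilinear[OF bounded_bilinear_scaleR]
lemmas smooth_on_inner = smooth_on_bilinear[OF bounded_bilinear_inner]

lemma smooth_on_linear:
  fixes f :: "'a::real_normed_vector \<Rightarrow> 'b::euclidean_space"
  assumes "smooth_on A f" "bounded_linear h" shows "smooth_on A (\<lambda>x. h (f x))"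
  using smooth_on_Cinf_compose[OF assms(1) Cinf_bounded_linear[OF assms(2) open_UNIV]] by simp

lemma smooth_on_const: "smooth_on A (\<lambda>x. c)"
  by (rule Cinf_smooth_on[OF Cinf_const[OF open_UNIV]]) simp

lemma smooth_on_add:
  fixes f g :: "'a::real_normed_vector \<Rightarrow> 'b::euclidean_space"
  assumes "smooth_on A f" "smooth_on A g" shows "smooth_on A (\<lambda>x. f x + g x)"
  using smooth_on_linear[OF smooth_on_Pair[OF assms] bounded_linear_add[OF bounded_linear_fst bounded_linear_snd]] by simp

lemma smooth_on_diff:
  fixes f g :: "'a::real_normed_vector \<Rightarrow> 'b::euclidean_space"
  assumes "smooth_on A f" "smooth_on A g" shows "smooth_on A (\<lambda>x. f x - g x)"
  using smooth_on_linear[OF smooth_on_Pair[OF assms] bounded_linear_sub[OF bounded_linear_fst bounded_linear_snd]] by simp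

lemma smooth_on_inverse:
  fixes f :: "'a::real_normed_vector \<Rightarrow> real"
  assumes "smooth_on A f" "\<And>x. x \<in> A \<Longrightarrow> f x \<noteq> 0" shows "smooth_on A (\<lambda>x. inverse (f x))"
  by (rule smooth_on_Cinf_compose[OF assms(1), of "- {0}" inverse]) (use assms(2) in \<open>auto simp: Cinf_def Ck_on_inverse\<close>)

lemma smooth_on_divide:
  fixes f g :: "'a::real_normed_vector \<Rightarrow> real"
  assumes "smooth_on A f" "smooth_on A g" "\<And>x. x \<in> A \<Longrightarrow> g x \<noteq> 0" shows "smooth_on A (\<lambda>x. f x / g x)"
  using smooth_on_mult[OF assms(1) smooth_on_inverse[OF assms(2,3)]] by (simp add: divide_inverse)

lemma smooth_on_exp: "smooth_on A f \<Longrightarrow> smooth_on A (\<lambda>x. exp (f x :: real))"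
  by (rule smooth_on_Cinf_compose[of A f UNIV exp]) (auto simp: Cinf_def Ck_on_exp)

subsection \<open>Derivatives on an interval\<close>

locale interval_domain =
  fixes I :: "real set" assumes I: "nondegenerate_interval I"
begin

text \<open>A connected set with more than one point has no isolated points; this makes derivatives
  within \<open>I\<close>, one-sided at endpoints, unique.\<close>

lemma at_within_I: "t \<in> I \<Longrightarrow> at t within I \<noteq> bot"
proof -
  assume t: "t \<in> I"
  have "connected I" "\<not> (\<exists>x. I = {x})" using I by (auto simp: nondegenerate_interval_def is_interval_connected)
  then have "t islimpt I" using t connected_imp_perfect by blast
  then show ?thesis by (simp add: trivial_limit_within)
qed

lemma cderiv_eqI: "t \<in> I \<Longrightarrow> (f has_vector_derivative d) (at t within I) \<Longrightarrow> cderiv I f t = d"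
  unfolding cderiv_def by (rule vector_derivative_within[OF at_within_I])

lemma openin_ball:
  assumes "openin (top_of_set I) K" "t \<in> K"
  obtains e where "e > 0" "\<And>s. s \<in> I \<Longrightarrow> dist s t < e \<Longrightarrow> s \<in> K"
proof -
  obtain e where "e > 0" "ball t e \<inter> I \<subseteq> K"
    using assms by (meson openin_contains_ball)
  then show ?thesis by (intro that[of e]) (auto simp: dist_commute)
qed

lemma has_vector_derivative_local:
  assumes "(f has_vector_derivative d) (at t within I)" "openin (top_of_set I) K" "t \<in> K"
    "\<And>s. s \<in> K \<Longrightarrow> f s = g s"
  shows "(g has_vector_derivative d) (at t within I)"
proof -
  obtain e where e: "e > 0" "\<And>s. s \<in> I \<Longrightarrow> dist s t < e \<Longrightarrow> s \<in> K" by (rule openin_ball[OF assms(2,3)]) blast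
  have "t \<in> I" using assms(2,3) openin_imp_subset by blast
  with e assms(1,4) show ?thesis
    unfolding has_vector_derivative_def by (intro has_derivative_transform_within[of f _ t I e g]) auto
qed

lemma cderiv_cong:
  assumes "openin (top_of_set I) K" "t \<in> K" "\<And>s. s \<in> K \<Longrightarrow> f s = g s"
  shows "cderiv I f t = cderiv I g t"
proof -
  have "(f has_vector_derivative d) (at t within I) \<longleftrightarrow> (g has_vector_derivative d) (at t within I)" for d
    using has_vector_derivative_local[OF _ assms(1,2)] assms(3) by metis
  then show ?thesis by (simp add: cderiv_def vector_derivative_def)
qed

context
  fixes K :: "real set" and f :: "real \<Rightarrow> 'b::real_normed_vector"
  assumes K: "openin (top_of_set I) K" and f: "smooth_on K f"
begin

text \<open>Derivatives within \<open>I\<close>, including one-sided ones, are those of a smooth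
  extension; hence \<open>cderiv\<close> of a smooth curve is smooth again.\<close>

lemma local_Cinf_extension:
  assumes t: "t \<in> K"
  obtains U F where "t \<in> U" "Cinf U F" "\<And>x. x \<in> K \<inter> U \<Longrightarrow> F x = f x"
    "\<And>x. x \<in> K \<inter> U \<Longrightarrow> (f has_vector_derivative fd F x 1) (at x within I)"
proof -
  obtain U F where U: "t \<in> U" "Cinf U F" "\<And>x. x \<in> K \<Longrightarrow> x \<in> U \<Longrightarrow> F x = f x"
    by (rule smooth_on_Cinf[OF f t]) blast
  have KU: "openin (top_of_set I) (K \<inter> U)"
    using K Cinf_open[OF U(2)] by (simp add: openin_Int_open)
  have "(f has_vector_derivative fd F x 1) (at x within I)" if x: "x \<in> K \<inter> U" for x
  proof -
    have hd: "(F has_derivative fd F x) (at x)" using Cinf_has_derivative[OF U(2)] x by auto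
    have "fd F x h = h *\<^sub>R fd F x 1" for h
      using linear_scale[OF Cinf_linear[OF U(2)], of x h 1] x by (metis IntD2 mult.right_neutral real_scaleR_def)
    then have "fd F x = (\<lambda>h. h *\<^sub>R fd F x 1)" by (rule ext)
    then have "(F has_vector_derivative fd F x 1) (at x)"
      unfolding has_vector_derivative_def by (rule has_derivative_eq_rhs[OF hd])
    then have "(F has_vector_derivative fd F x 1) (at x within I)" by (rule has_vector_derivative_at_within)
    then show ?thesis by (rule has_vector_derivative_local[OF _ KU x]) (use U in auto)
  qed
  with U show ?thesis by (intro that[of U F]) auto
qed

lemma smooth_on_has_cderiv:
  assumes t: "t \<in> K" shows "(f has_vector_derivative cderiv I f t) (at t within I)"
proof -
  obtain U F where U: "t \<in> U" "(f has_vector_derivative fd F t 1) (at t within I)"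
    by (rule local_Cinf_extension[OF t]) (use t in blast)
  moreover have "t \<in> I" using t K openin_imp_subset by blast
  ultimately show ?thesis using cderiv_eqI by metis
qed

lemma smooth_on_cderiv: "smooth_on K (cderiv I f)"
proof (rule smooth_onI_Cinf)
  fix a assume a: "a \<in> K"
  obtain U F where U: "a \<in> U" "Cinf U F"
    "\<And>x. x \<in> K \<inter> U \<Longrightarrow> (f has_vector_derivative fd F x 1) (at x within I)"
    by (rule local_Cinf_extension[OF a]) blast
  have "fd F x 1 = cderiv I f x" if "x \<in> K \<inter> U" for x
  proof -
    have "x \<in> I" using that openin_imp_subset[OF K] by auto
    from cderiv_eqI[OF this U(3)[OF that]] show ?thesis by simp
  qed
  then show "\<exists>U F. a \<in> U \<and> Cinf U F \<and> (\<forall>x\<in>K \<inter> U. F x = cderiv I f x)"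
    using U Cinf_fd[OF U(2), of 1] by (intro exI[of _ U] exI[of _ "\<lambda>x. fd F x 1"]) auto
qed

end

lemma has_vector_derivative_compose_fd:
  assumes "(f has_vector_derivative d) (at t within I)" "g differentiable (at (f t))"
  shows "((\<lambda>s. g (f s)) has_vector_derivative fd g (f t) d) (at t within I)"
  using vector_derivative_diff_chain_within[OF assms(1) has_derivative_at_withinI[OF has_derivative_fd[OF assms(2)]]]
  by (simp add: o_def)

end

section \<open>Tangent vectors in charts\<close>

locale manifold =
  fixes S :: "('m::{t2_space, second_countable_topology}, 'i::finite) finsler_data"
  assumes mfd: "smooth_manifold S"
begin

lemma chart_in: "chart_at S q \<in> atlas S" "q \<in> fst (chart_at S q)"
  using mfd by (auto simp: smooth_manifold_def)

lemma chart_hom: "c \<in> atlas S \<Longrightarrow> homeomorphism (fst c) (snd c ` fst c) (snd c) (chart_inv c)"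
  and open_dom: "c \<in> atlas S \<Longrightarrow> open (fst c)"
  and open_img: "c \<in> atlas S \<Longrightarrow> open (snd c ` fst c)"
  using mfd by (auto simp: smooth_manifold_def is_chart_def)

lemma chart_inv_left: "c \<in> atlas S \<Longrightarrow> q \<in> fst c \<Longrightarrow> chart_inv c (snd c q) = q"
  using homeomorphism_apply1[OF chart_hom] .

lemma open_chart_image:
  assumes "c \<in> atlas S" "open A" shows "open (snd c ` (fst c \<inter> A))"
proof -
  have "openin (top_of_set (snd c ` fst c)) (snd c ` (fst c \<inter> A))"
    using homeomorphism_imp_open_map[OF chart_hom[OF assms(1)]] assms(2) by (simp add: openin_open_Int)
  then show ?thesis using open_img[OF assms(1)] openin_open_trans by blast
qed

lemma Cinf_transition:
  assumes "c \<in> atlas S" "d \<in> atlas S"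
  shows "Cinf (snd c ` (fst c \<inter> fst d)) (snd d \<circ> chart_inv c)"
  using mfd assms smooth_on_open[OF open_chart_image[OF assms(1) open_dom[OF assms(2)]]]
  by (auto simp: smooth_manifold_def)

lemma tchange_linear: "c \<in> atlas S \<Longrightarrow> d \<in> atlas S \<Longrightarrow> q \<in> fst c \<Longrightarrow> q \<in> fst d \<Longrightarrow> linear (tchange c d q)"
  unfolding tchange_def by (rule Cinf_linear[OF Cinf_transition]) auto

lemma tchange_chain:
  assumes "c \<in> atlas S" "d \<in> atlas S" "e \<in> atlas S" "q \<in> fst c" "q \<in> fst d" "q \<in> fst e"
  shows "tchange d e q (tchange c d q u) = tchange c e q u"
proof -
  let ?f = "snd d \<circ> chart_inv c" and ?g = "snd e \<circ> chart_inv d"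
  have q: "snd c q \<in> snd c ` (fst c \<inter> (fst d \<inter> fst e))" using assms by auto
  have fq: "?f (snd c q) = snd d q" using assms chart_inv_left by simp
  have f: "(?f has_derivative fd ?f (snd c q)) (at (snd c q))"
    by (rule Cinf_has_derivative[OF Cinf_transition]) (use assms in auto)
  have g: "(?g has_derivative fd ?g (snd d q)) (at (?f (snd c q)))"
    unfolding fq by (rule Cinf_has_derivative[OF Cinf_transition]) (use assms in auto)
  have "((snd e \<circ> chart_inv c) has_derivative (fd ?g (snd d q) \<circ> fd ?f (snd c q))) (at (snd c q))"
    by (rule has_derivative_transform_within_open[OF diff_chain_at[OF f g] open_chart_image[OF assms(1)] q])
      (use assms in \<open>auto simp: chart_inv_left[OF assms(1)] chart_inv_left[OF assms(2)] intro!: open_Int open_dom\<close>)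
  from fd_eqI[OF this] show ?thesis by (simp add: tchange_def o_def)
qed

lemma tchange_id:
  assumes "c \<in> atlas S" "q \<in> fst c" shows "tchange c c q u = u"
proof -
  have "((snd c \<circ> chart_inv c) has_derivative (\<lambda>u. u)) (at (snd c q))"
    by (rule has_derivative_transform_within_open[OF has_derivative_ident open_img[OF assms(1)]])
      (use assms in \<open>auto simp: chart_inv_left[OF assms(1)]\<close>)
  from fd_eqI[OF this] show ?thesis by (simp add: tchange_def)
qed

lemma to_chart_linear: "c \<in> atlas S \<Longrightarrow> q \<in> fst c \<Longrightarrow> linear (to_chart S c q)"
  and of_chart_linear: "c \<in> atlas S \<Longrightarrow> q \<in> fst c \<Longrightarrow> linear (of_chart S c q)"
  unfolding to_chart_def[abs_def] of_chart_def[abs_def] using tchange_linear chart_in by blast+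

lemma to_of_chart: "c \<in> atlas S \<Longrightarrow> q \<in> fst c \<Longrightarrow> to_chart S c q (of_chart S c q u) = u"
  and of_to_chart: "c \<in> atlas S \<Longrightarrow> q \<in> fst c \<Longrightarrow> of_chart S c q (to_chart S c q u) = u"
  unfolding to_chart_def of_chart_def by (simp_all add: tchange_chain tchange_id chart_in)

lemma tchange_to_chart: "c \<in> atlas S \<Longrightarrow> d \<in> atlas S \<Longrightarrow> q \<in> fst c \<Longrightarrow> q \<in> fst d \<Longrightarrow>
    tchange c d q (to_chart S c q u) = to_chart S d q u"
  unfolding to_chart_def by (simp add: tchange_chain chart_in)

lemma of_chart_tchange: "c \<in> atlas S \<Longrightarrow> d \<in> atlas S \<Longrightarrow> q \<in> fst c \<Longrightarrow> q \<in> fst d \<Longrightarrow>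
    of_chart S d q (tchange c d q u) = of_chart S c q u"
  unfolding of_chart_def by (simp add: tchange_chain chart_in)

lemma to_chart_self: "to_chart S (chart_at S q) q u = u"
  unfolding to_chart_def by (simp add: tchange_id chart_in)

end

lemma lorentz_signature_invertible:
  fixes g :: "real ^ 'i ^ 'i::finite"
  assumes "lorentz_signature g" shows "invertible g"
proof -
  obtain P :: "real ^ 'i ^ 'i" and i0 :: 'i where
    P: "transpose P ** g ** P = (\<chi> i j. if i = j then if i = i0 then - 1 else 1 else 0)"
    using assms by (auto simp: lorentz_signature_def)
  have "det (transpose P ** g ** P) = (\<Prod>i\<in>UNIV. if i = i0 then - 1 else 1)"
    unfolding P by (subst det_diagonal) auto
  then have "det (transpose P ** g ** P) \<noteq> 0" by simp
  then show ?thesis by (auto simp: det_mul invertible_det_nz)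
qed

section \<open>Charts of a spacetime as Finsler charts\<close>

locale spacetime =
  fixes S :: "('m::{t2_space, second_countable_topology}, 'i::finite) finsler_data"
  assumes wfs: "weighted_finsler_spacetime S"
begin

sublocale manifold S using wfs by unfold_locales (simp add: weighted_finsler_spacetime_def)

abbreviation lc where "lc c \<equiv> chart_rep S c (Lag S)"

lemma Lag_scale: "r > 0 \<Longrightarrow> Lag S q (r *\<^sub>R v) = r ^ 2 * Lag S q v"
  using wfs by (auto simp: weighted_finsler_spacetime_def lorentz_finsler_def)

lemma Lag_0: "Lag S q 0 = 0"
  using Lag_scale[of 2 q 0] by simp

lemma finsler_chart:
  assumes c: "c \<in> atlas S" shows "finsler_chart (snd c ` fst c) (lc c)"
proof
  show "open (snd c ` fst c)" using open_img[OF c] .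
  have "open ((snd c ` fst c) \<times> (- {0 :: real ^ 'i}))" by (intro open_Times open_img c) auto
  from smooth_on_open[OF this] show "Cinf ((snd c ` fst c) \<times> - {0}) (lc c)"
    using wfs c by (auto simp: weighted_finsler_spacetime_def lorentz_finsler_def)
  show "pos_homogeneous (snd c ` fst c) 2 (lc c)"
    unfolding pos_homogeneous_def
  proof (intro ballI allI impI)
    fix x u and r :: real assume x: "x \<in> snd c ` fst c" and r: "0 < r"
    then obtain q where q: "q \<in> fst c" "x = snd c q" by auto
    show "lc c (x, r *\<^sub>R u) = r\<^sup>2 *\<^sub>R lc c (x, u)"
      using Lag_scale[OF r] linear_scale[OF of_chart_linear[OF c q(1)]] chart_inv_left[OF c q(1)]
      by (simp add: chart_rep_def q(2))
  qed
  show "invertible (gmat (lc c) (x, u))" if "x \<in> snd c ` fst c" "u \<noteq> 0" for x u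
    using wfs c that by (intro lorentz_signature_invertible) (auto simp: weighted_finsler_spacetime_def lorentz_finsler_def)
qed

text \<open>Invertibility of the derivative of the transition map comes from the cocycle rule
  \<open>tchange_chain\<close>, going from \<open>c\<close> to \<open>d\<close> and back, and from
  \<open>d\<close> to \<open>c\<close> and back.\<close>

lemma finsler_chart_change:
  assumes c: "c \<in> atlas S" and d: "d \<in> atlas S"
  shows "finsler_chart_change (snd c ` fst c) (snd d ` fst d) (lc c) (lc d) (snd c ` (fst c \<inter> fst d)) (snd d \<circ> chart_inv c)"
proof -
  interpret A: finsler_chart "snd c ` fst c" "lc c" by (rule finsler_chart[OF c])
  interpret B: finsler_chart "snd d ` fst d" "lc d" by (rule finsler_chart[OF d])
  show ?thesis
  proof
    show "snd c ` (fst c \<inter> fst d) \<subseteq> snd c ` fst c" by auto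
    show "Cinf (snd c ` (fst c \<inter> fst d)) (snd d \<circ> chart_inv c)" by (rule Cinf_transition[OF c d])
    show "(snd d \<circ> chart_inv c) ` snd c ` (fst c \<inter> fst d) \<subseteq> snd d ` fst d" using chart_inv_left[OF c] by auto
    fix x assume "x \<in> snd c ` (fst c \<inter> fst d)"
    then obtain q where q: "q \<in> fst c" "q \<in> fst d" "x = snd c q" by auto
    have T: "fd (snd d \<circ> chart_inv c) x = tchange c d q" by (simp add: tchange_def[abs_def] q)
    show "u = 0" if "fd (snd d \<circ> chart_inv c) x u = 0" for u
      using that tchange_chain[OF c d c q(1,2,1), of u] linear_0[OF tchange_linear[OF d c q(2,1)]] tchange_id[OF c q(1)]
      by (simp add: T)
    show "surj (fd (snd d \<circ> chart_inv c) x)" unfolding T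
      by (rule surjI[of _ "tchange d c q"]) (simp add: tchange_chain[OF d c d q(2,1,2)] tchange_id[OF d q(2)])
    show "lc c (x, u) = lc d ((snd d \<circ> chart_inv c) x, fd (snd d \<circ> chart_inv c) x u)" for u
      unfolding T using of_chart_tchange[OF c d q(1,2)] chart_inv_left[OF c q(1)] chart_inv_left[OF d q(2)]
      by (simp add: chart_rep_def q(3))
  qed
qed

end

lemma bounded_bilinear_matrix_vector_mult: "bounded_bilinear ((*v) :: real ^ 'i ^ 'j \<Rightarrow> real ^ 'i::finite \<Rightarrow> real ^ 'j::finite)"
  unfolding bilinear_conv_bounded_bilinear[symmetric] bilinear_def
  by (auto intro!: linearI simp: vec_eq_iff matrix_vector_mult_def sum.distrib algebra_simps sum_distrib_left)

lemma bounded_bilinear_matrix_mult: "bounded_bilinear ((**) :: real ^ 'i ^ 'j \<Rightarrow> real ^ 'k ^ 'i::finite \<Rightarrow> real ^ 'k::finite ^ 'j::finite)"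
  unfolding bilinear_conv_bounded_bilinear[symmetric] bilinear_def
  by (auto intro!: linearI simp: vec_eq_iff matrix_matrix_mult_def sum.distrib algebra_simps sum_distrib_left)

section \<open>Geodesics in charts\<close>

locale geodesic = spacetime S
  for S :: "('m::{t2_space, second_countable_topology}, 'i::finite) finsler_data" +
  fixes I :: "real set" and \<eta> :: "real \<Rightarrow> 'm"
  assumes geo: "causal_geodesic S I \<eta>"
begin

sublocale interval_domain I using geo by unfold_locales (simp add: causal_geodesic_def)

abbreviation Gc where "Gc c \<equiv> finsler_chart.G (lc c)"
abbreviation Nc where "Nc c \<equiv> finsler_chart.Nm (lc c)"
abbreviation pc where "pc c \<equiv> finsler_chart.p (lc c)"

text \<open>\<open>Xc\<close>, \<open>Vc\<close> and \<open>Pc\<close> (below) are the position, the velocity \<open>v\<close> and the covector \<open>g\<^sub>v(v, \<cdot>)\<close> in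
  the chart \<open>c\<close>, on the set \<open>Kc c\<close> of times at which the chart covers the curve.\<close>

definition Kc where "Kc c = {t \<in> I. \<eta> t \<in> fst c}"
definition Xc where "Xc c t = snd c (\<eta> t)"
definition Vc where "Vc c t = cderiv I (snd c \<circ> \<eta>) t"
definition zc where "zc c t = (Xc c t, Vc c t)"
abbreviation c0 where "c0 t \<equiv> chart_at S (\<eta> t)"

lemma KcD: "t \<in> Kc c \<Longrightarrow> t \<in> I \<and> \<eta> t \<in> fst c"
  by (simp add: Kc_def)

lemma Kc_self: "t \<in> I \<Longrightarrow> t \<in> Kc (c0 t)" using chart_in by (auto simp: Kc_def)

lemma Kc_openin: "c \<in> atlas S \<Longrightarrow> openin (top_of_set I) (Kc c)"
proof -
  assume "c \<in> atlas S"
  moreover have "continuous_on I \<eta>" using geo by (simp add: causal_geodesic_def smooth_curve_def)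
  moreover have "Kc c = I \<inter> \<eta> -` fst c" by (auto simp: Kc_def)
  ultimately show ?thesis by (simp add: continuous_openin_preimage_gen open_dom)
qed

lemma smooth_Xc: "c \<in> atlas S \<Longrightarrow> smooth_on (Kc c) (Xc c)"
proof -
  assume "c \<in> atlas S"
  then have "smooth_on (Kc c) (snd c \<circ> \<eta>)" using geo by (auto simp: causal_geodesic_def smooth_curve_def Kc_def)
  then show ?thesis by (simp add: Xc_def[abs_def] o_def)
qed

lemma Xc_eq: "snd c \<circ> \<eta> = Xc c" by (simp add: Xc_def fun_eq_iff)
lemma Vc_eq: "cderiv I (Xc c) = Vc c" by (simp add: Vc_def fun_eq_iff Xc_eq)

lemma smooth_Vc: "c \<in> atlas S \<Longrightarrow> smooth_on (Kc c) (Vc c)"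
  using smooth_on_cderiv[OF Kc_openin smooth_Xc] unfolding Vc_eq by blast

lemma Xc_derivative: "c \<in> atlas S \<Longrightarrow> t \<in> Kc c \<Longrightarrow> (Xc c has_vector_derivative Vc c t) (at t within I)"
  using smooth_on_has_cderiv[OF Kc_openin smooth_Xc] by (simp add: Vc_eq)

lemma Xc_transition:
  assumes "c \<in> atlas S" "t \<in> Kc c" shows "(snd d \<circ> chart_inv c) (Xc c t) = Xc d t"
  using chart_inv_left[OF assms(1)] assms(2) by (simp add: Xc_def Kc_def)

lemma Vc_change:
  assumes c: "c \<in> atlas S" and d: "d \<in> atlas S" and t: "t \<in> Kc c" "t \<in> Kc d"
  shows "Vc d t = tchange c d (\<eta> t) (Vc c t)"
proof -
  let ?f = "snd d \<circ> chart_inv c"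
  have x: "Xc c t \<in> snd c ` (fst c \<inter> fst d)" using t by (auto simp: Kc_def Xc_def)
  have "((\<lambda>s. ?f (Xc c s)) has_vector_derivative fd ?f (Xc c t) (Vc c t)) (at t within I)"
    by (rule has_vector_derivative_compose_fd[OF Xc_derivative[OF c t(1)] Cinf_differentiable[OF Cinf_transition[OF c d] x]])
  then have "(Xc d has_vector_derivative fd ?f (Xc c t) (Vc c t)) (at t within I)"
    by (rule has_vector_derivative_local[OF _ Kc_openin[OF c] t(1)]) (rule Xc_transition[OF c])
  then have "cderiv I (Xc d) t = fd ?f (Xc c t) (Vc c t)" using t by (intro cderiv_eqI) (auto simp: Kc_def)
  then show ?thesis by (simp add: Vc_eq tchange_def Xc_def)
qed

lemma velocity_eq: "velocity S I \<eta> t = Vc (c0 t) t"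
  by (simp add: velocity_def Vc_def)

lemma Vc_velocity: "c \<in> atlas S \<Longrightarrow> t \<in> Kc c \<Longrightarrow> Vc c t = to_chart S c (\<eta> t) (velocity S I \<eta> t)"
  unfolding velocity_eq to_chart_def using Vc_change[OF chart_in(1)] Kc_self KcD by blast

lemma velocity_nonzero: "t \<in> I \<Longrightarrow> velocity S I \<eta> t \<noteq> 0"
  using geo Lag_0 by (fastforce simp: causal_geodesic_def future_directed_def causal_vec_def)

lemma Vc_nonzero: "c \<in> atlas S \<Longrightarrow> t \<in> Kc c \<Longrightarrow> Vc c t \<noteq> 0"
  using Vc_velocity[of c t] velocity_nonzero[of t] of_to_chart[of c "\<eta> t" "velocity S I \<eta> t"]
    linear_0[OF of_chart_linear[of c "\<eta> t"]] by (auto simp: Kc_def)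

lemma zc_W: "c \<in> atlas S \<Longrightarrow> t \<in> Kc c \<Longrightarrow> zc c t \<in> (snd c ` fst c) \<times> - {0}"
  using Vc_nonzero[of c t] by (auto simp: zc_def Xc_def Kc_def)

lemma smooth_zc: "c \<in> atlas S \<Longrightarrow> smooth_on (Kc c) (zc c)"
  unfolding zc_def[abs_def] by (intro smooth_on_Pair smooth_Xc smooth_Vc)

lemma Vc_derivative:
  assumes c: "c \<in> atlas S" and t: "t \<in> Kc c"
  shows "(Vc c has_vector_derivative - 2 *\<^sub>R Gc c (zc c t)) (at t within I)"
proof -
  interpret C: finsler_chart "snd c ` fst c" "lc c" by (rule finsler_chart[OF c])
  have "cderiv I (Vc c) t $ \<alpha> + 2 * Gspray (lc c) \<alpha> (zc c t) = 0" for \<alpha>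
    using geo c t unfolding causal_geodesic_def geodesic_eq_def
    by (auto simp: Xc_eq Vc_eq zc_def Kc_def Xc_def[symmetric])
  then have "cderiv I (Vc c) t = - 2 *\<^sub>R Gc c (zc c t)"
    by (simp add: vec_eq_iff C.G_def eq_neg_iff_add_eq_0)
  then show ?thesis using smooth_on_has_cderiv[OF Kc_openin[OF c] smooth_Vc[OF c] t] by simp
qed

lemma zc_derivative:
  assumes c: "c \<in> atlas S" and t: "t \<in> Kc c"
  shows "(zc c has_vector_derivative finsler_chart.spray (lc c) (zc c t)) (at t within I)"
proof -
  interpret C: finsler_chart "snd c ` fst c" "lc c" by (rule finsler_chart[OF c])
  show ?thesis
    using has_vector_derivative_Pair[OF Xc_derivative[OF c t] Vc_derivative[OF c t]]
    by (simp add: zc_def[abs_def] C.spray_def)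
qed

text \<open>The velocity is parallel: \<open>Nm_radial\<close> rewrites the geodesic equation with
  the nonlinear connection.\<close>

lemma Vc_derivative_N:
  assumes c: "c \<in> atlas S" and t: "t \<in> Kc c"
  shows "(Vc c has_vector_derivative - (Nc c (zc c t) *v Vc c t)) (at t within I)"
proof -
  interpret C: finsler_chart "snd c ` fst c" "lc c" by (rule finsler_chart[OF c])
  show ?thesis using Vc_derivative[OF c t] zc_W[OF c t] C.Nm_radial[of "Xc c t" "Vc c t"] by (auto simp: zc_def)
qed

definition Pc where "Pc c t = (\<chi> \<alpha>. pc c (axis \<alpha> 1) (zc c t))"

lemma Pc_inner:
  assumes c: "c \<in> atlas S" and t: "t \<in> Kc c" shows "pc c a (zc c t) = Pc c t \<bullet> a"
proof -
  interpret C: finsler_chart "snd c ` fst c" "lc c" by (rule finsler_chart[OF c])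
  show ?thesis
    by (subst linear_axis_expand[OF C.p_linear[OF zc_W[OF c t]]]) (simp add: Pc_def inner_vec_def mult.commute)
qed

lemma smooth_Pc:
  assumes c: "c \<in> atlas S" shows "smooth_on (Kc c) (Pc c)"
proof -
  interpret C: finsler_chart "snd c ` fst c" "lc c" by (rule finsler_chart[OF c])
  have "Cinf C.W (\<lambda>z. \<chi> \<alpha>. C.p (axis \<alpha> 1) z)" by (intro Cinf_vec C.open_W C.Cinf_p)
  from smooth_on_Cinf_compose[OF smooth_zc[OF c] this] zc_W[OF c] show ?thesis by (simp add: Pc_def[abs_def])
qed

lemma smooth_Nc:
  assumes c: "c \<in> atlas S" shows "smooth_on (Kc c) (\<lambda>t. Nc c (zc c t))"
proof -
  interpret C: finsler_chart "snd c ` fst c" "lc c" by (rule finsler_chart[OF c])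
  have "Cinf C.W (\<lambda>z. (C.Nm z *v axis \<beta> 1) $ \<alpha>)" for \<alpha> \<beta> by (intro Cinf_vec_nth C.Cinf_Nm_mult)
  moreover have "(C.Nm z *v axis \<beta> 1) $ \<alpha> = C.Nm z $ \<alpha> $ \<beta>" for z \<alpha> \<beta>
    by (simp add: matrix_vector_mult_def axis_def if_distrib cong: if_cong)
  ultimately have "Cinf C.W (\<lambda>z. \<chi> \<alpha> \<beta>. C.Nm z $ \<alpha> $ \<beta>)" by (intro Cinf_vec C.open_W) simp
  then have "Cinf C.W C.Nm" by simp
  from smooth_on_Cinf_compose[OF smooth_zc[OF c] this] zc_W[OF c] show ?thesis by simp
qed

text \<open>The covector is parallel: the Euler-Lagrange equation gives the base derivative of
  \<open>L\<close>, which \<open>horizontal_constant\<close> expresses through the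
  connection.\<close>

lemma Pc_derivative:
  assumes c: "c \<in> atlas S" and t: "t \<in> Kc c"
  shows "((\<lambda>s. Pc c s \<bullet> a) has_vector_derivative Pc c t \<bullet> (Nc c (zc c t) *v a)) (at t within I)"
proof -
  interpret C: finsler_chart "snd c ` fst c" "lc c" by (rule finsler_chart[OF c])
  have "((\<lambda>s. C.p a (zc c s)) has_vector_derivative fd (C.p a) (zc c t) (C.spray (zc c t))) (at t within I)"
    by (rule has_vector_derivative_compose_fd[OF zc_derivative[OF c t] Cinf_differentiable[OF C.Cinf_p zc_W[OF c t]]])
  then have "((\<lambda>s. C.p a (zc c s)) has_vector_derivative Pc c t \<bullet> (Nc c (zc c t) *v a)) (at t within I)"
    using C.euler_lagrange[OF zc_W[OF c t]] C.horizontal_constant[OF zc_W[OF c t]] Pc_inner[OF c t] by simp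
  then show ?thesis
    by (rule has_vector_derivative_local[OF _ Kc_openin[OF c] t]) (simp add: Pc_inner[OF c])
qed

lemma Pc_nonzero:
  assumes c: "c \<in> atlas S" and t: "t \<in> Kc c" shows "Pc c t \<noteq> 0"
proof
  interpret C: finsler_chart "snd c ` fst c" "lc c" by (rule finsler_chart[OF c])
  assume "Pc c t = 0"
  then have p0: "C.p a (zc c t) = 0" for a using Pc_inner[OF c t] by simp
  have "Vc c t = 0"
  proof (rule C.gg_nondegenerate[OF zc_W[OF c t]])
    fix a
    have "C.gg (Vc c t) a (zc c t) = 0"
      using C.gg_radial[of "Xc c t" "Vc c t" a] zc_W[OF c t] p0 by (simp add: zc_def)
    then show "C.gg a (Vc c t) (zc c t) = C.gg a 0 (zc c t)"
      using C.gg_commute[OF zc_W[OF c t], of a "Vc c t"] linear_0[OF C.gg_linear2[OF zc_W[OF c t]], of a] by (simp only:)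
  qed
  then show False using Vc_nonzero[OF c t] by simp
qed

lemma lc_zc: "c \<in> atlas S \<Longrightarrow> t \<in> Kc c \<Longrightarrow> lc c (zc c t) = Lag S (\<eta> t) (velocity S I \<eta> t)"
  using chart_inv_left[of c "\<eta> t"] of_to_chart[of c "\<eta> t"]
  by (simp add: zc_def chart_rep_def Xc_def Vc_velocity Kc_def)

lemma Pc_Vc:
  assumes c: "c \<in> atlas S" and t: "t \<in> Kc c"
  shows "Pc c t \<bullet> Vc c t = 2 * Lag S (\<eta> t) (velocity S I \<eta> t)"
proof -
  interpret C: finsler_chart "snd c ` fst c" "lc c" by (rule finsler_chart[OF c])
  show ?thesis
    using C.p_radial[of "Xc c t" "Vc c t"] zc_W[OF c t] Pc_inner[OF c t] lc_zc[OF c t] by (simp add: zc_def)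
qed

lemma Pc_change:
  assumes c: "c \<in> atlas S" and d: "d \<in> atlas S" and t: "t \<in> Kc c" "t \<in> Kc d"
  shows "Pc c t \<bullet> a = Pc d t \<bullet> tchange c d (\<eta> t) a"
proof -
  let ?f = "snd d \<circ> chart_inv c"
  interpret F: finsler_chart_change "snd c ` fst c" "snd d ` fst d" "lc c" "lc d" "snd c ` (fst c \<inter> fst d)" ?f
    by (rule finsler_chart_change[OF c d])
  have x: "Xc c t \<in> snd c ` (fst c \<inter> fst d)" using t by (auto simp: Kc_def Xc_def)
  have T: "fd ?f (Xc c t) a = tchange c d (\<eta> t) a" for a by (simp add: tchange_def Xc_def)
  have "F.\<Phi> (Xc c t, Vc c t) = zc d t"
    using Xc_transition[OF c t(1)] Vc_change[OF c d t] by (simp add: F.\<Phi>_def zc_def T)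
  then show ?thesis
    using F.p_change[OF x Vc_nonzero[OF c t(1)], of a] Pc_inner[OF c t(1)] Pc_inner[OF d t(2)]
    by (simp add: T zc_def)
qed

subsection \<open>The covariant derivative in a chart\<close>

abbreviation tc where "tc c Y \<equiv> \<lambda>s. to_chart S c (\<eta> s) (Y s)"

lemma smooth_fieldD: "smooth_field S \<eta> J Y \<Longrightarrow> c \<in> atlas S \<Longrightarrow> J \<subseteq> I \<Longrightarrow> smooth_on (J \<inter> Kc c) (tc c Y)"
  unfolding smooth_field_def by (erule ballE[of _ _ c], erule smooth_on_subset) (auto simp: Kc_def)

lemma smooth_fieldI: "(\<And>c. c \<in> atlas S \<Longrightarrow> smooth_on (J \<inter> Kc c) (tc c Y)) \<Longrightarrow> J \<subseteq> I \<Longrightarrow> smooth_field S \<eta> J Y"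
  unfolding smooth_field_def
proof
  fix c assume a: "\<And>c. c \<in> atlas S \<Longrightarrow> smooth_on (J \<inter> Kc c) (tc c Y)" "J \<subseteq> I" "c \<in> atlas S"
  then have "{t \<in> J. \<eta> t \<in> fst c} = J \<inter> Kc c" by (auto simp: Kc_def)
  then show "smooth_on {t \<in> J. \<eta> t \<in> fst c} (tc c Y)" using a by simp
qed

lemma openin_Int_Kc: "openin (top_of_set I) J \<Longrightarrow> c \<in> atlas S \<Longrightarrow> openin (top_of_set I) (J \<inter> Kc c)"
  by (intro openin_Int Kc_openin)

lemma covd_self:
  assumes t: "t \<in> I"
  shows "covd S I \<eta> Y t = cderiv I (tc (c0 t) Y) t + Nc (c0 t) (zc (c0 t) t) *v Y t"
proof -
  interpret C: finsler_chart "snd (c0 t) ` fst (c0 t)" "lc (c0 t)" by (rule finsler_chart[OF chart_in(1)])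
  have z: "zc (c0 t) t \<in> C.W" by (rule zc_W[OF chart_in(1) Kc_self[OF t]])
  have "coords S (\<eta> t) (velocity S I \<eta> t) = zc (c0 t) t"
    by (simp add: coords_def zc_def velocity_eq Xc_def)
  then show ?thesis
    using C.Gam_contract[of "Xc (c0 t) t" "Vc (c0 t) t" _ "Y t"] z
    by (simp add: covd_def Let_def velocity_eq zc_def vec_eq_iff)
qed

text \<open>\<open>covd\<close> is defined in the chart at \<open>\<eta> t\<close>, which changes
  with \<open>t\<close>; this permits one chart for a whole stretch of the curve. Differentiating
  the transition of components produces a Hessian term, and \<open>Nm_change\<close> produces the
  same one.\<close>

lemma covd_chart:
  assumes c: "c \<in> atlas S" and J: "openin (top_of_set I) J" and Y: "smooth_field S \<eta> J Y"
    and t: "t \<in> J" "t \<in> Kc c"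
  shows "to_chart S c (\<eta> t) (covd S I \<eta> Y t) = cderiv I (tc c Y) t + Nc c (zc c t) *v to_chart S c (\<eta> t) (Y t)"
proof -
  have tI: "t \<in> I" and JI: "J \<subseteq> I" using t J openin_imp_subset by (auto simp: Kc_def)
  define d where "d = c0 t"
  have d: "d \<in> atlas S" "t \<in> Kc d" using chart_in Kc_self[OF tI] by (auto simp: d_def)
  let ?f = "snd c \<circ> chart_inv d"
  interpret F: finsler_chart_change "snd d ` fst d" "snd c ` fst c" "lc d" "lc c" "snd d ` (fst d \<inter> fst c)" ?f
    by (rule finsler_chart_change[OF d(1) c])
  have x: "Xc d t \<in> snd d ` (fst d \<inter> fst c)" using t d by (auto simp: Kc_def Xc_def)
  have T: "fd ?f (Xc d s) a = tchange d c (\<eta> s) a" for a s by (simp add: tchange_def Xc_def)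
  have TT: "to_chart S c (\<eta> t) a = fd ?f (Xc d t) a" for a
    by (simp add: to_chart_def d_def tchange_def Xc_def)
  have Phi: "F.\<Phi> (zc d t) = zc c t"
    using Xc_transition[OF d] Vc_change[OF d(1) c d(2) t(2)] by (simp add: F.\<Phi>_def zc_def T)
  let ?w = "tc d Y t" and ?w' = "cderiv I (tc d Y) t"
  have "smooth_on (J \<inter> Kc d) (tc d Y)" by (rule smooth_fieldD[OF Y d(1) JI])
  then have w': "(tc d Y has_vector_derivative ?w') (at t within I)"
    using smooth_on_has_cderiv[OF openin_Int_Kc[OF J d(1)]] t d by blast
  have "((\<lambda>s. (Xc d s, tc d Y s)) has_vector_derivative (Vc d t, ?w')) (at t within I)"
    by (rule has_vector_derivative_Pair[OF Xc_derivative[OF d] w'])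
  from vector_derivative_diff_chain_within[OF this has_derivative_at_withinI[OF F.\<Phi>_has_derivative[OF x]]]
  have "((\<lambda>s. F.\<Phi> (Xc d s, tc d Y s)) has_vector_derivative
     (fd ?f (Xc d t) (Vc d t), F.DT (Xc d t) ?w (Vc d t) + fd ?f (Xc d t) ?w')) (at t within I)"
    by (simp add: o_def)
  then have "((\<lambda>s. snd (F.\<Phi> (Xc d s, tc d Y s))) has_vector_derivative
     snd (fd ?f (Xc d t) (Vc d t), F.DT (Xc d t) ?w (Vc d t) + fd ?f (Xc d t) ?w')) (at t within I)"
    by (rule bounded_linear.has_vector_derivative[OF bounded_linear_snd])
  then have "(tc c Y has_vector_derivative F.DT (Xc d t) ?w (Vc d t) + fd ?f (Xc d t) ?w') (at t within I)"
    unfolding snd_conv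
  proof (rule has_vector_derivative_local[OF _ openin_Int[OF Kc_openin[OF c] Kc_openin[OF d(1)]]])
    show "t \<in> Kc c \<inter> Kc d" using t d by auto
    fix s assume "s \<in> Kc c \<inter> Kc d"
    then show "snd (F.\<Phi> (Xc d s, tc d Y s)) = tc c Y s"
      using tchange_to_chart[OF d(1) c, of "\<eta> s" "Y s"] by (simp add: F.\<Phi>_def T Kc_def)
  qed
  then have 1: "cderiv I (tc c Y) t = F.DT (Xc d t) ?w (Vc d t) + fd ?f (Xc d t) ?w'"
    by (rule cderiv_eqI[OF tI])
  have Yt: "Y t = ?w" using to_chart_self by (simp add: d_def)
  have "covd S I \<eta> Y t = ?w' + Nc d (zc d t) *v ?w" unfolding covd_self[OF tI] d_def[symmetric] using Yt by simp
  then have "to_chart S c (\<eta> t) (covd S I \<eta> Y t) = fd ?f (Xc d t) (?w' + Nc d (zc d t) *v ?w)"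
    by (simp only: TT)
  also have "\<dots> = fd ?f (Xc d t) ?w' + fd ?f (Xc d t) (Nc d (zc d t) *v ?w)"
    by (rule linear_add[OF Cinf_linear[OF F.\<phi> x]])
  also have "fd ?f (Xc d t) (Nc d (zc d t) *v ?w) = Nc c (zc c t) *v fd ?f (Xc d t) ?w + F.DT (Xc d t) (Vc d t) ?w"
    using F.Nm_change[OF x Vc_nonzero[OF d]] Phi by (simp add: zc_def)
  also have "fd ?f (Xc d t) ?w = to_chart S c (\<eta> t) (Y t)"
    using tchange_to_chart[OF d(1) c, of "\<eta> t" "Y t"] t d by (simp add: T Kc_def)
  also have "F.DT (Xc d t) (Vc d t) ?w = F.DT (Xc d t) ?w (Vc d t)" by (rule fd_fd_commute[OF F.\<phi> x])
  finally show ?thesis using 1 by (simp add: algebra_simps o_def)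
qed

lemma smooth_field_covd:
  assumes J: "openin (top_of_set I) J" and Y: "smooth_field S \<eta> J Y"
  shows "smooth_field S \<eta> J (covd S I \<eta> Y)"
proof (rule smooth_fieldI)
  show JI: "J \<subseteq> I" using J openin_imp_subset by blast
  fix c assume c: "c \<in> atlas S"
  have w: "smooth_on (J \<inter> Kc c) (tc c Y)" by (rule smooth_fieldD[OF Y c JI])
  have "smooth_on (J \<inter> Kc c) (\<lambda>t. cderiv I (tc c Y) t + Nc c (zc c t) *v tc c Y t)"
    by (intro smooth_on_add smooth_on_bilinear[OF bounded_bilinear_matrix_vector_mult] w
        smooth_on_subset[OF smooth_Nc[OF c]] smooth_on_cderiv[OF openin_Int_Kc[OF J c] w]) auto
  then show "smooth_on (J \<inter> Kc c) (tc c (covd S I \<eta> Y))"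
    by (rule smooth_on_cong) (simp add: covd_chart[OF c J Y])
qed

end

section \<open>The quotient of the orthogonal space\<close>

subsection \<open>Cosets\<close>

lemma qclass_eq_iff: "qclass v a = qclass v b \<longleftrightarrow> (\<exists>r. a = b + r *\<^sub>R v)"
proof
  assume "qclass v a = qclass v b"
  moreover have "a \<in> qclass v a" unfolding qclass_def by (auto intro: exI[of _ 0])
  ultimately show "\<exists>r. a = b + r *\<^sub>R v" by (auto simp: qclass_def)
next
  assume "\<exists>r. a = b + r *\<^sub>R v"
  then obtain r where r: "a = b + r *\<^sub>R v" by blast
  show "qclass v a = qclass v b"
  proof (intro set_eqI iffI)
    fix x assume "x \<in> qclass v a"
    then obtain s where "x = b + (r + s) *\<^sub>R v" by (auto simp: qclass_def r scaleR_add_left add.assoc)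
    then show "x \<in> qclass v b" by (auto simp: qclass_def)
  next
    fix x assume "x \<in> qclass v b"
    then obtain s where "x = a + (s - r) *\<^sub>R v" by (auto simp: qclass_def r scaleR_diff_left)
    then show "x \<in> qclass v a" by (auto simp: qclass_def)
  qed
qed

lemma qadd_qclass: "qadd (qclass v a) (qclass v b) = qclass v (a + b)"
proof (intro set_eqI iffI)
  fix x assume "x \<in> qadd (qclass v a) (qclass v b)"
  then obtain r s where "x = a + b + (r + s) *\<^sub>R v"
    by (auto simp: qadd_def qclass_def scaleR_add_left add_ac)
  then show "x \<in> qclass v (a + b)" by (auto simp: qclass_def)
next
  fix x assume "x \<in> qclass v (a + b)"
  then obtain r where "x = (a + r *\<^sub>R v) + (b + 0 *\<^sub>R v)" by (auto simp: qclass_def add_ac)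
  then show "x \<in> qadd (qclass v a) (qclass v b)" unfolding qadd_def qclass_def by blast
qed

lemma qscale_qclass: "qscale v r (qclass v a) = qclass v (r *\<^sub>R a)"
proof (intro set_eqI iffI)
  fix x assume "x \<in> qscale v r (qclass v a)"
  then obtain s k where "x = r *\<^sub>R a + (r * s + k) *\<^sub>R v"
    by (auto simp: qscale_def qclass_def scaleR_add_left scaleR_add_right add_ac)
  then show "x \<in> qclass v (r *\<^sub>R a)" by (auto simp: qclass_def)
next
  fix x assume "x \<in> qclass v (r *\<^sub>R a)"
  then obtain s where "x = r *\<^sub>R (a + 0 *\<^sub>R v) + s *\<^sub>R v" by (auto simp: qclass_def)
  then show "x \<in> qscale v r (qclass v a)" unfolding qscale_def qclass_def by blast
qed

lemma qdiff_qclass: "qdiff v (qclass v a) (qclass v b) = qclass v (a - b)"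
  by (simp add: qdiff_def qscale_qclass qadd_qclass)

lemma qinduced_qclass:
  assumes "M *v v = 0" shows "qinduced v M (qclass v a) = qclass v (M *v a)"
proof (intro set_eqI iffI)
  fix x assume "x \<in> qinduced v M (qclass v a)"
  then show "x \<in> qclass v (M *v a)" using assms
    by (auto simp: qinduced_def qclass_def matrix_vector_right_distrib matrix_vector_mult_scaleR)
next
  fix x assume "x \<in> qclass v (M *v a)"
  then obtain s where "x = M *v (a + 0 *\<^sub>R v) + s *\<^sub>R v" by (auto simp: qclass_def)
  then show "x \<in> qinduced v M (qclass v a)" unfolding qinduced_def qclass_def by blast
qed

subsection \<open>The projection along two orthogonal vectors\<close>

definition outer :: "real ^ 'i::finite \<Rightarrow> real ^ 'i \<Rightarrow> real ^ 'i ^ 'i" where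
  "outer a b = (\<chi> i j. a $ i * b $ j)"

lemma outer_mult: "outer a b *v w = (b \<bullet> w) *\<^sub>R a"
  by (simp add: vec_eq_iff outer_def matrix_vector_mult_def inner_vec_def sum_distrib_left mult_ac)

lemma trace_mult_outer: "trace (M ** outer a b) = b \<bullet> (M *v a)"
  by (simp add: trace_def matrix_matrix_mult_def outer_def inner_vec_def matrix_vector_mult_def sum_distrib_left mult_ac)

text \<open>For orthogonal \<open>a\<close> and \<open>b\<close> this is the Euclidean orthogonal
  projection onto the complement of both. It is applied to \<open>Pc\<close> and \<open>Vc\<close>,
  which are orthogonal because g_v(v, v) = 2 L(v) = 0 for a lightlike velocity.\<close>

definition proj :: "real ^ 'i::finite \<Rightarrow> real ^ 'i \<Rightarrow> real ^ 'i ^ 'i" where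
  "proj a b = mat 1 - inverse (a \<bullet> a) *\<^sub>R outer a a - inverse (b \<bullet> b) *\<^sub>R outer b b"

lemma proj_mult: "proj a b *v w = w - ((a \<bullet> w) / (a \<bullet> a)) *\<^sub>R a - ((b \<bullet> w) / (b \<bullet> b)) *\<^sub>R b"
  by (simp add: proj_def matrix_vector_mult_diff_rdistrib scaleR_matrix_vector_assoc[symmetric] outer_mult divide_inverse mult.commute)

locale orthogonal_pair =
  fixes P V :: "real ^ 'i::finite"
  assumes P: "P \<noteq> 0" and V: "V \<noteq> 0" and PV: "P \<bullet> V = 0"
begin

lemma VP: "V \<bullet> P = 0" using PV by (simp add: inner_commute)

lemma proj_P: "proj P V *v P = 0" and proj_V: "proj P V *v V = 0"
  using P V PV VP by (simp_all add: proj_mult)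

lemma P_proj: "P \<bullet> (proj P V *v w) = 0" and V_proj: "V \<bullet> (proj P V *v w) = 0"
  using P V PV VP by (simp_all add: proj_mult inner_diff_right)

lemma proj_perp: "P \<bullet> w = 0 \<Longrightarrow> proj P V *v w = w - ((V \<bullet> w) / (V \<bullet> V)) *\<^sub>R V"
  by (simp add: proj_mult)

lemma proj_fix: "P \<bullet> w = 0 \<Longrightarrow> V \<bullet> w = 0 \<Longrightarrow> proj P V *v w = w"
  by (simp add: proj_mult)

lemma proj_idem: "proj P V ** proj P V = proj P V"
  by (simp add: matrix_eq matrix_vector_mul_assoc[symmetric] proj_fix P_proj V_proj)

text \<open>The two corrections are the diagonal entries of \<open>M\<close> in the normalised
  directions \<open>P\<close> and \<open>V\<close>; for the curvature both will vanish, so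
  compression keeps its trace.\<close>

lemma trace_mult_proj: "trace (M ** proj P V) = trace M - (P \<bullet> (M *v P)) / (P \<bullet> P) - (V \<bullet> (M *v V)) / (V \<bullet> V)"
proof -
  have "M ** proj P V = M - inverse (P \<bullet> P) *\<^sub>R (M ** outer P P) - inverse (V \<bullet> V) *\<^sub>R (M ** outer V V)"
    by (simp add: matrix_eq matrix_vector_mul_assoc[symmetric] proj_def matrix_vector_mult_diff_rdistrib
        scaleR_matrix_vector_assoc[symmetric] matrix_vector_mult_diff_distrib matrix_vector_mult_scaleR)
  moreover have "trace (r *\<^sub>R A) = r * trace A" for r and A :: "real ^ 'i ^ 'i"
    by (simp add: trace_def sum_distrib_left)
  ultimately show ?thesis by (simp add: trace_sub trace_mult_outer divide_inverse mult.commute)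
qed

lemma trace_proj: "trace (proj P V) = real CARD('i) - 2"
  using trace_mult_proj[of "mat 1"] P V by (simp add: trace_I)

text \<open>Selects one matrix for each endomorphism of the quotient: it annihilates
  \<open>P\<close> and \<open>V\<close> and maps into their complement, so that product and trace of
  matrices match those of endomorphisms.\<close>

definition compressed :: "real ^ 'i ^ 'i \<Rightarrow> bool" where
  "compressed M \<longleftrightarrow> M ** proj P V = M \<and> proj P V ** M = M"

lemma compressedD:
  assumes "compressed M"
  shows "M *v (proj P V *v w) = M *v w" "proj P V *v (M *v w) = M *v w" "M *v V = 0" "M *v P = 0"
    "P \<bullet> (M *v w) = 0" "V \<bullet> (M *v w) = 0"
proof -
  show a: "M *v (proj P V *v w) = M *v w" for w using assms by (simp add: compressed_def matrix_vector_mul_assoc)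
  show b: "proj P V *v (M *v w) = M *v w" using assms by (simp add: compressed_def matrix_vector_mul_assoc)
  show "M *v V = 0" "M *v P = 0" using a[of V] a[of P] by (simp_all add: proj_V proj_P)
  show "P \<bullet> (M *v w) = 0" "V \<bullet> (M *v w) = 0" using b P_proj V_proj by metis+
qed

lemma compressed_proj: "compressed (proj P V ** M ** proj P V)"
  by (simp add: compressed_def matrix_mul_assoc proj_idem) (simp add: matrix_mul_assoc[symmetric] proj_idem)

end

text \<open>\<open>A\<close> and \<open>B\<close> identify \<open>v\<^sup>\<bottom> / \<real>v\<close> with the range of \<open>proj P V\<close>.\<close>

locale quotient_model = orthogonal_pair P V for P V :: "real ^ 'i::finite" +
  fixes g :: "real ^ 'i ^ 'i" and v :: "real ^ 'i" and A B :: "real ^ 'i \<Rightarrow> real ^ 'i"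
  assumes linA: "linear A" and linB: "linear B" and AB: "A (B w) = w" and BA: "B (A w) = w"
    and nperp: "nperp g v = {w. P \<bullet> A w = 0}" and Av: "A v = V"
begin

definition cls where "cls y = qclass v (B y)"

definition represents :: "((real ^ 'i) set \<Rightarrow> (real ^ 'i) set) \<Rightarrow> real ^ 'i ^ 'i \<Rightarrow> bool" where
  "represents F M \<longleftrightarrow> compressed M \<and> (\<forall>y. P \<bullet> y = 0 \<longrightarrow> F (cls y) = cls (M *v y))"

lemma BV: "B V = v" using Av BA by metis

lemma cls_eq_iff: "cls y = cls y' \<longleftrightarrow> (\<exists>r. y = y' + r *\<^sub>R V)"
proof -
  have "B y = B y' + r *\<^sub>R v \<longleftrightarrow> y = y' + r *\<^sub>R V" for r
    using linear_add[OF linB, of y' "r *\<^sub>R V"] linear_scale[OF linB, of r V] BV AB by metis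
  then show ?thesis by (simp add: cls_def qclass_eq_iff)
qed

lemma Qsp_eq: "Qsp g v = cls ` {y. P \<bullet> y = 0}"
proof (intro set_eqI iffI)
  fix x assume "x \<in> Qsp g v"
  then obtain w where "P \<bullet> A w = 0" "x = qclass v w" by (auto simp: Qsp_def nperp)
  then show "x \<in> cls ` {y. P \<bullet> y = 0}" by (intro image_eqI[of _ _ "A w"]) (auto simp: cls_def BA)
next
  fix x assume "x \<in> cls ` {y. P \<bullet> y = 0}"
  then obtain y where "P \<bullet> y = 0" "x = cls y" by auto
  then show "x \<in> Qsp g v" unfolding Qsp_def nperp by (intro image_eqI[of _ _ "B y"]) (auto simp: cls_def AB)
qed

lemma cls_proj: "P \<bullet> y = 0 \<Longrightarrow> cls (proj P V *v y) = cls y"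
  unfolding cls_eq_iff proj_perp by (intro exI[of _ "- (V \<bullet> y / (V \<bullet> V))"]) simp

lemma cls_add: "qadd (cls a) (cls b) = cls (a + b)" by (simp add: cls_def qadd_qclass linear_add[OF linB])
lemma cls_scale: "qscale v r (cls a) = cls (r *\<^sub>R a)" by (simp add: cls_def qscale_qclass linear_scale[OF linB])
lemma cls_diff: "qdiff v (cls a) (cls b) = cls (a - b)" by (simp add: cls_def qdiff_qclass linear_diff[OF linB])
lemma cls_0: "cls 0 = qclass v 0" by (simp add: cls_def linear_0[OF linB])

lemma cls_inj: "P \<bullet> y = 0 \<Longrightarrow> V \<bullet> y = 0 \<Longrightarrow> P \<bullet> y' = 0 \<Longrightarrow> V \<bullet> y' = 0 \<Longrightarrow> cls y = cls y' \<Longrightarrow> y = y'"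
  using V by (auto simp: cls_eq_iff inner_add_right)

lemma represents_qendo: assumes "represents F M" shows "qendo g v F"
proof -
  have F: "F (cls y) = cls (M *v y)" if "P \<bullet> y = 0" for y using assms that by (simp add: represents_def)
  have PM: "P \<bullet> (M *v y) = 0" for y using assms compressedD(5) by (simp add: represents_def)
  show ?thesis unfolding qendo_def Qsp_eq
    by (auto simp: F PM cls_add cls_scale inner_add_right matrix_vector_right_distrib matrix_vector_mult_scaleR)
qed

text \<open>The classes of the projected axis vectors span the quotient but satisfy two relations,
  with the components of \<open>P\<close> and of \<open>V\<close> as coefficients. Linearity of
  \<open>F\<close> carries these relations over to the images \<open>z\<close>, so the matrix kills
  \<open>P\<close> and \<open>V\<close> and is compressed.\<close>

lemma represents_columns:
  assumes F: "qendo g v F" and z: "\<And>j. P \<bullet> z j = 0" "\<And>j. F (cls (proj P V *v axis j 1)) = cls (z j)"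
  shows "represents F (\<chi> i j. (proj P V *v z j) $ i)"
proof -
  let ?M = "\<chi> i j. (proj P V *v z j) $ i"
  have M: "?M *v y = (\<Sum>j\<in>UNIV. y $ j *\<^sub>R (proj P V *v z j))" for y
    by (simp add: vec_eq_iff matrix_vector_mult_def sum_component mult.commute)
  have F0: "F (cls 0) = cls 0"
  proof -
    have "cls 0 \<in> Qsp g v" by (auto simp: Qsp_eq)
    then have "F (qscale v 0 (cls 0)) = qscale v 0 (F (cls 0))" "F (cls 0) \<in> Qsp g v" using F by (auto simp: qendo_def)
    then show ?thesis by (auto simp: Qsp_eq cls_scale)
  qed
  have Fsum: "F (cls (\<Sum>j\<in>T. y $ j *\<^sub>R (proj P V *v axis j 1))) = cls (\<Sum>j\<in>T. y $ j *\<^sub>R z j)" if "finite T" for T y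
    using that
  proof (induction T)
    case empty then show ?case by (simp add: F0)
  next
    case (insert j T)
    let ?a = "proj P V *v axis j 1" and ?b = "\<Sum>j\<in>T. y $ j *\<^sub>R (proj P V *v axis j 1)"
    have in1: "cls ?a \<in> Qsp g v" using P_proj by (auto simp: Qsp_eq)
    have in2: "cls (y $ j *\<^sub>R ?a) \<in> Qsp g v" using P_proj by (auto simp: Qsp_eq)
    have in3: "cls ?b \<in> Qsp g v" using P_proj by (auto simp: Qsp_eq inner_sum_right intro!: imageI)
    have "F (cls (y $ j *\<^sub>R ?a + ?b)) = qadd (F (cls (y $ j *\<^sub>R ?a))) (F (cls ?b))"
      using F in2 in3 by (simp add: qendo_def cls_add[symmetric])
    also have "F (cls (y $ j *\<^sub>R ?a)) = qscale v (y $ j) (F (cls ?a))"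
      using F in1 by (simp add: qendo_def cls_scale[symmetric])
    finally show ?case using insert by (simp add: z cls_scale cls_add)
  qed
  have act: "F (cls y) = cls (?M *v y)" if y: "P \<bullet> y = 0" for y
  proof -
    have "proj P V *v y = (\<Sum>j\<in>UNIV. y $ j *\<^sub>R (proj P V *v axis j 1))"
      by (rule linear_axis_expand) (rule matrix_vector_mul_linear)
    then have "F (cls y) = cls (\<Sum>j\<in>UNIV. y $ j *\<^sub>R z j)"
      using Fsum[of UNIV y] cls_proj[OF y] by simp
    also have "\<dots> = cls (proj P V *v (\<Sum>j\<in>UNIV. y $ j *\<^sub>R z j))"
      by (rule cls_proj[symmetric]) (simp add: inner_sum_right z)
    also have "proj P V *v (\<Sum>j\<in>UNIV. y $ j *\<^sub>R z j) = ?M *v y"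
      unfolding M by (simp add: linear_sum[OF matrix_vector_mul_linear] matrix_vector_mult_scaleR)
    finally show ?thesis .
  qed
  have PM: "P \<bullet> (?M *v w) = 0" "V \<bullet> (?M *v w) = 0" for w
    by (simp_all add: M inner_sum_right P_proj V_proj)
  have kill: "?M *v P = 0" "?M *v V = 0"
  proof -
    have "cls (?M *v V) = cls 0" using act[OF PV] F0 cls_eq_iff[of V 0] by (metis add_0 scaleR_one)
    then show MV: "?M *v V = 0" by (intro cls_inj) (simp_all add: PM)
    have "?M *v P = (\<Sum>j\<in>UNIV. P $ j *\<^sub>R (proj P V *v z j))" by (rule M)
    also have "\<dots> = proj P V *v (\<Sum>j\<in>UNIV. P $ j *\<^sub>R z j)"
      by (simp add: linear_sum[OF matrix_vector_mul_linear] matrix_vector_mult_scaleR)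
    finally have e: "?M *v P = proj P V *v (\<Sum>j\<in>UNIV. P $ j *\<^sub>R z j)" .
    \<comment> \<open>\<open>P\<close> is not orthogonal to itself, so \<open>act\<close> does not
      apply to it; the expansion of \<open>proj P V *v P = 0\<close> in projected axis vectors is
      pushed through \<open>F\<close> instead.\<close>
    have "cls 0 = F (cls (proj P V *v P))" by (simp add: proj_P F0)
    also have "proj P V *v P = (\<Sum>j\<in>UNIV. P $ j *\<^sub>R (proj P V *v axis j 1))"
      by (rule linear_axis_expand) (rule matrix_vector_mul_linear)
    also have "F (cls \<dots>) = cls (\<Sum>j\<in>UNIV. P $ j *\<^sub>R z j)" by (rule Fsum) simp
    also have "\<dots> = cls (?M *v P)" unfolding e by (rule cls_proj[symmetric]) (simp add: inner_sum_right z)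
    finally show "?M *v P = 0" by (intro cls_inj) (simp_all add: PM)
  qed
  have "?M *v (proj P V *v w) = ?M *v w" for w
    by (simp only: proj_mult[of P V w] matrix_vector_mult_diff_distrib matrix_vector_mult_scaleR kill) simp
  moreover have "proj P V *v (?M *v w) = ?M *v w" for w by (rule proj_fix) (rule PM)+
  ultimately have "compressed ?M" by (simp add: compressed_def matrix_eq matrix_vector_mul_assoc[symmetric])
  then show ?thesis using act by (simp add: represents_def)
qed

text \<open>Basis independence of the trace. The projected representatives \<open>?\<beta>\<close>
  of the basis form a basis of the range of the projection; with the coordinate functionals
  \<open>x\<close> on it, the trace of \<open>M\<close> becomes the sum of the diagonal coordinates
  of the images of the \<open>?\<beta>\<close>.\<close>

lemma trace_via_basis:
  assumes rep: "represents F M" and qb: "qbasis g v Bs"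
    and m: "\<And>b. b \<in> Bs \<Longrightarrow> F (qclass v b) = qclass v (\<Sum>a\<in>Bs. m a b *\<^sub>R a)"
  shows "trace M = (\<Sum>b\<in>Bs. m b b)"
proof -
  let ?\<beta> = "\<lambda>b. proj P V *v A b"
  have fin: "finite Bs" and sub: "\<And>b. b \<in> Bs \<Longrightarrow> P \<bullet> A b = 0"
    and ex: "\<And>C. C \<in> Qsp g v \<Longrightarrow> \<exists>!x. x \<in> extensional Bs \<and> C = qclass v (\<Sum>b\<in>Bs. x b *\<^sub>R b)"
    using qb by (auto simp: qbasis_def nperp)
  have AS: "A (\<Sum>b\<in>Bs. x b *\<^sub>R b) = (\<Sum>b\<in>Bs. x b *\<^sub>R A b)" for x
    by (simp add: linear_sum[OF linA] linear_scale[OF linA])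
  have qS: "qclass v (\<Sum>b\<in>Bs. x b *\<^sub>R b) = cls (\<Sum>b\<in>Bs. x b *\<^sub>R ?\<beta> b)" for x
  proof -
    have "qclass v (\<Sum>b\<in>Bs. x b *\<^sub>R b) = cls (\<Sum>b\<in>Bs. x b *\<^sub>R A b)" by (simp add: cls_def BA flip: AS)
    also have "\<dots> = cls (proj P V *v (\<Sum>b\<in>Bs. x b *\<^sub>R A b))"
      by (rule cls_proj[symmetric]) (simp add: inner_sum_right sub)
    finally show ?thesis by (simp add: linear_sum[OF matrix_vector_mul_linear] matrix_vector_mult_scaleR)
  qed
  have \<beta>perp: "P \<bullet> (\<Sum>b\<in>Bs. x b *\<^sub>R ?\<beta> b) = 0" "V \<bullet> (\<Sum>b\<in>Bs. x b *\<^sub>R ?\<beta> b) = 0" for x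
    by (simp_all add: inner_sum_right P_proj V_proj)
  have indep: "x b = y b" if e: "(\<Sum>b\<in>Bs. x b *\<^sub>R ?\<beta> b) = (\<Sum>b\<in>Bs. y b *\<^sub>R ?\<beta> b)" and b: "b \<in> Bs" for x y b
  proof -
    \<comment> \<open>\<open>qbasis\<close> grants uniqueness among extensional coefficient
      functions, hence the restriction to \<open>Bs\<close>.\<close>
    have r: "(\<Sum>b\<in>Bs. restrict x Bs b *\<^sub>R b) = (\<Sum>b\<in>Bs. x b *\<^sub>R b)" for x by (rule sum.cong) auto
    have "cls (\<Sum>b\<in>Bs. x b *\<^sub>R ?\<beta> b) \<in> Qsp g v" using \<beta>perp by (auto simp: Qsp_eq)
    from ex[OF this] obtain u where u: "\<And>w. w \<in> extensional Bs \<and>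
        cls (\<Sum>b\<in>Bs. x b *\<^sub>R ?\<beta> b) = qclass v (\<Sum>b\<in>Bs. w b *\<^sub>R b) \<Longrightarrow> w = u"
      by (elim ex1E) blast
    have "restrict x Bs = u" by (rule u) (simp add: r qS)
    moreover have "restrict y Bs = u" by (rule u) (simp add: r qS e)
    ultimately have "restrict x Bs = restrict y Bs" by simp
    then show ?thesis using b by (metis restrict_apply')
  qed
  have "\<exists>x. proj P V *v w = (\<Sum>b\<in>Bs. x b *\<^sub>R ?\<beta> b)" for w
  proof -
    have "cls (proj P V *v w) \<in> Qsp g v" using P_proj by (auto simp: Qsp_eq)
    from ex[OF this] obtain u where "cls (proj P V *v w) = qclass v (\<Sum>b\<in>Bs. u b *\<^sub>R b)" by blast
    then have "proj P V *v w = (\<Sum>b\<in>Bs. u b *\<^sub>R ?\<beta> b)"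
      unfolding qS by (rule cls_inj[OF P_proj V_proj \<beta>perp])
    then show ?thesis by blast
  qed
  then have "\<exists>x. \<forall>w. proj P V *v w = (\<Sum>b\<in>Bs. x w b *\<^sub>R ?\<beta> b)" by (intro choice) blast
  then obtain x where x: "\<And>w. proj P V *v w = (\<Sum>b\<in>Bs. x w b *\<^sub>R ?\<beta> b)" by blast
  have xlin: "linear (\<lambda>w. x w b)" if b: "b \<in> Bs" for b
  proof (rule linearI)
    fix w w' :: "real ^ 'i" and r :: real
    show "x (w + w') b = x w b + x w' b"
      by (rule indep[OF _ b]) (simp add: x[symmetric] scaleR_add_left sum.distrib matrix_vector_right_distrib)
    show "x (r *\<^sub>R w) b = r *\<^sub>R x w b"
    proof (rule indep[OF _ b, of "x (r *\<^sub>R w)" "\<lambda>b. r *\<^sub>R x w b"])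
      have "(\<Sum>b\<in>Bs. x (r *\<^sub>R w) b *\<^sub>R ?\<beta> b) = r *\<^sub>R (proj P V *v w)"
        by (simp only: x[symmetric] matrix_vector_mult_scaleR)
      also have "\<dots> = r *\<^sub>R (\<Sum>b\<in>Bs. x w b *\<^sub>R ?\<beta> b)" by (subst x[of w]) (rule refl)
      finally show "(\<Sum>b\<in>Bs. x (r *\<^sub>R w) b *\<^sub>R ?\<beta> b) = (\<Sum>b\<in>Bs. (r *\<^sub>R x w b) *\<^sub>R ?\<beta> b)"
        by (simp add: scaleR_sum_right)
    qed
  qed
  have x\<beta>: "x (?\<beta> a) b = (if a = b then 1 else 0)" if "a \<in> Bs" "b \<in> Bs" for a b
  proof (rule indep[OF _ that(2), of "x (?\<beta> a)" "\<lambda>b. if a = b then 1 else 0"])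
    have "(\<Sum>b\<in>Bs. (if a = b then 1 else 0) *\<^sub>R ?\<beta> b) = (\<Sum>b\<in>Bs. if a = b then ?\<beta> b else 0)"
      by (rule sum.cong) auto
    also have "\<dots> = ?\<beta> a" using fin that by simp
    finally show "(\<Sum>b\<in>Bs. x (?\<beta> a) b *\<^sub>R ?\<beta> b) = (\<Sum>b\<in>Bs. (if a = b then 1 else 0) *\<^sub>R ?\<beta> b)"
      unfolding x[symmetric] by (simp add: matrix_vector_mul_assoc proj_idem)
  qed
  have M\<beta>: "M *v ?\<beta> b = (\<Sum>a\<in>Bs. m a b *\<^sub>R ?\<beta> a)" if b: "b \<in> Bs" for b
  proof -
    have "cls (M *v ?\<beta> b) = F (cls (?\<beta> b))" using rep P_proj by (simp add: represents_def)
    also have "cls (?\<beta> b) = qclass v b" using cls_proj[OF sub[OF b]] by (simp add: cls_def BA)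
    also have "F (qclass v b) = cls (\<Sum>a\<in>Bs. m a b *\<^sub>R ?\<beta> a)" by (simp add: m[OF b] qS)
    finally show ?thesis
      using rep compressedD(5,6) by (intro cls_inj \<beta>perp) (auto simp: represents_def)
  qed
  have "M *v axis i 1 = (\<Sum>b\<in>Bs. x (axis i 1) b *\<^sub>R (M *v ?\<beta> b))" for i
  proof -
    have "M *v axis i 1 = M *v (proj P V *v axis i 1)" using rep compressedD(1) by (simp add: represents_def)
    also have "\<dots> = M *v (\<Sum>b\<in>Bs. x (axis i 1) b *\<^sub>R ?\<beta> b)" by (subst x[of "axis i 1"]) (rule refl)
    finally show ?thesis by (simp only: linear_sum[OF matrix_vector_mul_linear] matrix_vector_mult_scaleR)
  qed
  moreover have "trace M = (\<Sum>i\<in>UNIV. (M *v axis i 1) $ i)"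
    by (simp add: trace_def matrix_vector_mult_def axis_def if_distrib cong: if_cong)
  ultimately have "trace M = (\<Sum>i\<in>UNIV. \<Sum>b\<in>Bs. x (axis i 1) b * (M *v ?\<beta> b) $ i)"
    by (simp add: sum_component)
  also have "\<dots> = (\<Sum>b\<in>Bs. \<Sum>i\<in>UNIV. (M *v ?\<beta> b) $ i *\<^sub>R x (axis i 1) b)"
    by (subst sum.swap) (simp add: mult.commute)
  also have "\<dots> = (\<Sum>b\<in>Bs. x (M *v ?\<beta> b) b)"
    by (rule sum.cong[OF refl], rule linear_axis_expand[OF xlin, symmetric])
  also have "\<dots> = (\<Sum>b\<in>Bs. \<Sum>a\<in>Bs. m a b * x (?\<beta> a) b)"
    by (rule sum.cong[OF refl]) (simp add: M\<beta> linear_sum[OF xlin] linear_scale[OF xlin])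
  also have "\<dots> = (\<Sum>b\<in>Bs. \<Sum>a\<in>Bs. if a = b then m a b else 0)"
    by (intro sum.cong refl) (simp add: x\<beta>)
  also have "\<dots> = (\<Sum>b\<in>Bs. m b b)" using fin by simp
  finally show ?thesis .
qed

text \<open>A basis of the range of the projection, carried over by \<open>B\<close>: that range
  contains exactly one representative of each class.\<close>

lemma qbasis_exists: "\<exists>Bs. qbasis g v Bs"
proof -
  have "subspace (range ((*v) (proj P V)))" by (intro linear_subspace_image matrix_vector_mul_linear subspace_UNIV)
  then obtain C where C: "C \<subseteq> range ((*v) (proj P V))" "independent C" "span C = range ((*v) (proj P V))"
    using basis_exists[of "range ((*v) (proj P V))"] span_subspace by metis
  have finC: "finite C" using C(2) by (rule independent_imp_finite)
  have injB: "inj_on B C" by (metis AB inj_onI)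
  have Cp: "P \<bullet> y = 0" "V \<bullet> y = 0" if "y \<in> C" for y using C(1) that P_proj V_proj by auto
  have S: "(\<Sum>b\<in>B ` C. x b *\<^sub>R b) = B (\<Sum>y\<in>C. x (B y) *\<^sub>R y)" for x
    by (simp add: sum.reindex[OF injB] linear_sum[OF linB] linear_scale[OF linB])
  have "\<exists>!x. x \<in> extensional (B ` C) \<and> Q = qclass v (\<Sum>b\<in>B ` C. x b *\<^sub>R b)" if Q: "Q \<in> Qsp g v" for Q
  proof (rule ex_ex1I)
    obtain y where y: "P \<bullet> y = 0" "Q = cls y" using Q by (auto simp: Qsp_eq)
    have "proj P V *v y \<in> span C" using C(3) by auto
    then obtain u where u: "proj P V *v y = (\<Sum>c\<in>C. u c *\<^sub>R c)" using span_finite[OF finC] by auto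
    let ?x = "restrict (\<lambda>b. u (A b)) (B ` C)"
    have "(\<Sum>c\<in>C. ?x (B c) *\<^sub>R c) = proj P V *v y" unfolding u by (rule sum.cong) (auto simp: AB)
    then have "Q = qclass v (\<Sum>b\<in>B ` C. ?x b *\<^sub>R b)" unfolding S using cls_proj[OF y(1)] y(2) by (simp add: cls_def)
    then show "\<exists>x. x \<in> extensional (B ` C) \<and> Q = qclass v (\<Sum>b\<in>B ` C. x b *\<^sub>R b)" by blast
  next
    fix x x' assume x: "x \<in> extensional (B ` C) \<and> Q = qclass v (\<Sum>b\<in>B ` C. x b *\<^sub>R b)"
      and x': "x' \<in> extensional (B ` C) \<and> Q = qclass v (\<Sum>b\<in>B ` C. x' b *\<^sub>R b)"
    have "cls (\<Sum>y\<in>C. x (B y) *\<^sub>R y) = cls (\<Sum>y\<in>C. x' (B y) *\<^sub>R y)" using x x' unfolding S by (simp add: cls_def)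
    then have "(\<Sum>y\<in>C. x (B y) *\<^sub>R y) = (\<Sum>y\<in>C. x' (B y) *\<^sub>R y)"
      by (rule cls_inj[rotated 4]) (simp_all add: inner_sum_right Cp)
    then have "(\<Sum>y\<in>C. (x (B y) - x' (B y)) *\<^sub>R y) = 0" by (simp add: scaleR_diff_left sum_subtractf)
    then have "x (B y) - x' (B y) = 0" if "y \<in> C" for y
      using independentD[OF C(2) finC subset_refl, of "\<lambda>y. x (B y) - x' (B y)"] that by simp
    then show "x = x'" using x x' by (intro extensionalityI[of x "B ` C" x']) auto
  qed
  moreover have "B ` C \<subseteq> nperp g v" by (auto simp: nperp AB Cp)
  ultimately show ?thesis using finC by (intro exI[of _ "B ` C"]) (simp add: qbasis_def)
qed

text \<open>The definite description in \<open>qtrace\<close> requires both that some basis exists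
  and that every basis yields the same value.\<close>

lemma qtrace_represents: assumes rep: "represents F M" shows "qtrace g v F = trace M"
proof -
  obtain Bs where Bs: "qbasis g v Bs" using qbasis_exists by blast
  have "\<exists>x. F (qclass v b) = qclass v (\<Sum>a\<in>Bs. x a *\<^sub>R a)" if "b \<in> Bs" for b
  proof -
    have "qclass v b \<in> Qsp g v" using Bs that by (auto simp: qbasis_def Qsp_def)
    then have "F (qclass v b) \<in> Qsp g v" using represents_qendo[OF rep] by (simp add: qendo_def)
    then show ?thesis using Bs unfolding qbasis_def by blast
  qed
  then obtain m where m: "\<And>b. b \<in> Bs \<Longrightarrow> F (qclass v b) = qclass v (\<Sum>a\<in>Bs. m b a *\<^sub>R a)" by metis
  show ?thesis unfolding qtrace_def
  proof (rule the_equality)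
    show "\<exists>B m. qbasis g v B \<and> (\<forall>b\<in>B. F (qclass v b) = qclass v (\<Sum>a\<in>B. m a b *\<^sub>R a)) \<and> trace M = (\<Sum>b\<in>B. m b b)"
      using Bs m trace_via_basis[OF rep Bs, of "\<lambda>a b. m b a"]
      by (intro exI[of _ Bs] exI[of _ "\<lambda>a b. m b a"]) auto
  next
    fix s assume "\<exists>B m. qbasis g v B \<and> (\<forall>b\<in>B. F (qclass v b) = qclass v (\<Sum>a\<in>B. m a b *\<^sub>R a)) \<and> s = (\<Sum>b\<in>B. m b b)"
    then obtain B m where "qbasis g v B" "\<forall>b\<in>B. F (qclass v b) = qclass v (\<Sum>a\<in>B. m a b *\<^sub>R a)" "s = (\<Sum>b\<in>B. m b b)"
      by (elim exE conjE)
    then show "s = trace M" using trace_via_basis[OF rep, of B m] by simp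
  qed
qed

end

section \<open>Algebra of representing matrices and their inverses\<close>

context quotient_model
begin

lemma cls_in_Qsp: "P \<bullet> y = 0 \<Longrightarrow> cls y \<in> Qsp g v" by (auto simp: Qsp_eq)

lemma represents_compressed: "represents F M \<Longrightarrow> compressed M" by (simp add: represents_def)

lemma represents_apply: "represents F M \<Longrightarrow> P \<bullet> y = 0 \<Longrightarrow> F (cls y) = cls (M *v y)" by (simp add: represents_def)

lemma represents_scale:
  assumes "represents F M" shows "represents (\<lambda>A. qscale v r (F A)) (r *\<^sub>R M)"
proof -
  have "compressed (r *\<^sub>R M)"
    using compressedD(1,2)[OF represents_compressed[OF assms]]
    by (simp add: compressed_def matrix_eq matrix_vector_mul_assoc[symmetric] scaleR_matrix_vector_assoc[symmetric] matrix_vector_mult_scaleR)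
  then show ?thesis using represents_apply[OF assms]
    by (simp add: represents_def cls_scale scaleR_matrix_vector_assoc[symmetric])
qed

lemma represents_comp:
  assumes "represents F M" "represents G M'" shows "represents (F \<circ> G) (M ** M')"
proof -
  have "compressed (M ** M')"
    using compressedD(1,2)[OF represents_compressed[OF assms(1)]] compressedD(1,2)[OF represents_compressed[OF assms(2)]]
    by (simp add: compressed_def matrix_eq matrix_vector_mul_assoc[symmetric])
  then show ?thesis
    using represents_apply[OF assms(1)] represents_apply[OF assms(2)] compressedD(5)[OF represents_compressed[OF assms(2)]]
    by (simp add: represents_def matrix_vector_mul_assoc[symmetric])
qed

lemma represents_diff:
  assumes "represents F M" "represents G M'" shows "represents (\<lambda>A. qdiff v (F A) (G A)) (M - M')"
proof -
  have "compressed (M - M')"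
    using compressedD(1,2)[OF represents_compressed[OF assms(1)]] compressedD(1,2)[OF represents_compressed[OF assms(2)]]
    by (simp add: compressed_def matrix_eq matrix_vector_mul_assoc[symmetric] matrix_vector_mult_diff_rdistrib matrix_vector_mult_diff_distrib)
  then show ?thesis
    using represents_apply[OF assms(1)] represents_apply[OF assms(2)]
    by (simp add: represents_def cls_diff matrix_vector_mult_diff_rdistrib)
qed

lemma compressed_proj_self: "compressed (proj P V)" by (simp add: compressed_def proj_idem)

lemma represents_ident: "represents (\<lambda>A. A) (proj P V)"
  by (simp add: represents_def compressed_proj_self cls_proj)

text \<open>A compressed matrix is singular. Adding \<open>mat 1 - proj P V\<close>, the identity on
  the span of \<open>P\<close> and \<open>V\<close>, completes it to an invertible one when
  \<open>F\<close> is bijective, so that ordinary matrix inversion, a smooth operation, becomes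
  available.\<close>

lemma completion_invertible:
  assumes "represents F M" "bij_betw F (Qsp g v) (Qsp g v)"
  shows "invertible (M + mat 1 - proj P V)"
proof -
  have M: "compressed M" using represents_compressed[OF assms(1)] .
  have "w = 0" if w: "(M + mat 1 - proj P V) *v w = 0" for w
  proof -
    have e: "M *v w + w - proj P V *v w = 0"
      using w by (simp add: matrix_vector_mult_diff_rdistrib matrix_vector_mult_add_rdistrib)
    have "proj P V *v (M *v w + w - proj P V *v w) = M *v w"
      by (simp add: matrix_vector_right_distrib matrix_vector_mult_diff_distrib compressedD[OF M])
        (simp add: matrix_vector_mul_assoc proj_idem)
    then have Mw: "M *v w = 0" unfolding e by simp
    then have ww: "w = proj P V *v w" using e by simp
    then have pw: "P \<bullet> w = 0" "V \<bullet> w = 0" using P_proj V_proj by metis+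
    have "F (cls w) = F (cls 0)" using represents_apply[OF assms(1)] pw Mw by simp
    then have "cls w = cls 0"
      using assms(2) cls_in_Qsp[OF pw(1)] cls_in_Qsp[of 0] by (auto simp: bij_betw_def inj_on_def)
    then show "w = 0" by (intro cls_inj) (simp_all add: pw)
  qed
  then have "\<exists>B. B ** (M + mat 1 - proj P V) = mat 1"
    unfolding matrix_left_invertible_ker by blast
  then show ?thesis by (simp add: invertible_left_inverse)
qed

text \<open>The completion is block diagonal for the splitting given by the projection, hence so is
  its inverse; the block \<open>K ** proj P V\<close> inverts \<open>M\<close> on the
  complement.\<close>

lemma completion_inverse:
  assumes M: "compressed M" and inv: "invertible (M + mat 1 - proj P V)"
  defines "K \<equiv> matrix_inv (M + mat 1 - proj P V)"
  shows "K ** proj P V = proj P V ** K" "M ** K = proj P V" "compressed (K ** proj P V)"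
    "K ** proj P V ** M = proj P V" "M ** (K ** proj P V) = proj P V"
proof -
  let ?T = "M + mat 1 - proj P V"
  have TK: "?T ** K = mat 1" "K ** ?T = mat 1" using matrix_inv_mult[OF inv] by (simp_all add: K_def)
  have TK': "?T *v (K *v w) = w" "K *v (?T *v w) = w" for w by (simp_all add: matrix_vector_mul_assoc TK)
  have PT: "proj P V *v (?T *v w) = M *v w" "?T *v (proj P V *v w) = M *v w" for w
    by (simp_all add: matrix_vector_mult_diff_rdistrib matrix_vector_mult_add_rdistrib matrix_vector_right_distrib
        matrix_vector_mult_diff_distrib compressedD[OF M]) (simp_all add: matrix_vector_mul_assoc proj_idem)
  have MK: "M *v (K *v w) = proj P V *v w" for w using PT(1)[of "K *v w"] TK' by simp
  have KM: "K *v (M *v w) = proj P V *v w" for w using PT(2)[of w] TK'(2)[of "proj P V *v w"] by simp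
  have KP: "K *v (proj P V *v w) = proj P V *v (K *v w)" for w
    using KM[of "K *v w"] MK[of w] by simp
  show c: "K ** proj P V = proj P V ** K" by (simp add: matrix_eq matrix_vector_mul_assoc[symmetric] KP)
  show "M ** K = proj P V" by (simp add: matrix_eq matrix_vector_mul_assoc[symmetric] MK)
  show "K ** proj P V ** M = proj P V"
    by (simp add: matrix_eq matrix_vector_mul_assoc[symmetric] compressedD[OF M] KM)
  show "M ** (K ** proj P V) = proj P V"
    by (simp add: matrix_eq matrix_vector_mul_assoc[symmetric] MK) (simp add: matrix_vector_mul_assoc proj_idem)
  show "compressed (K ** proj P V)" unfolding compressed_def
    by (simp add: matrix_eq matrix_vector_mul_assoc[symmetric] KP) (simp add: matrix_vector_mul_assoc proj_idem matrix_mul_assoc)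
qed

lemma represents_inverse:
  assumes "represents F M" "bij_betw F (Qsp g v) (Qsp g v)"
  shows "represents (inv_into (Qsp g v) F) (matrix_inv (M + mat 1 - proj P V) ** proj P V)"
proof -
  let ?R = "matrix_inv (M + mat 1 - proj P V) ** proj P V"
  note K = completion_inverse[OF represents_compressed[OF assms(1)] completion_invertible[OF assms]]
  have "inv_into (Qsp g v) F (cls y) = cls (?R *v y)" if y: "P \<bullet> y = 0" for y
  proof (rule inv_into_f_eq)
    show "inj_on F (Qsp g v)" using assms(2) by (simp add: bij_betw_def)
    have p: "P \<bullet> (?R *v y) = 0" by (rule compressedD(5)[OF K(3)])
    then show "cls (?R *v y) \<in> Qsp g v" by (rule cls_in_Qsp)
    show "F (cls (?R *v y)) = cls y"
      using represents_apply[OF assms(1) p] cls_proj[OF y] K(5) by (simp add: matrix_vector_mul_assoc)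
  qed
  then show ?thesis using K(3) by (simp add: represents_def)
qed

end

section \<open>Sections and endomorphism fields along a lightlike geodesic\<close>

locale null_geodesic = geodesic S I \<eta>
  for S :: "('m::{t2_space, second_countable_topology}, 'i::finite) finsler_data" and I \<eta> +
  assumes null: "\<And>t. t \<in> I \<Longrightarrow> Lag S (\<eta> t) (velocity S I \<eta> t) = 0"
begin

abbreviation v where "v t \<equiv> vel S I \<eta> t"
abbreviation Pj where "Pj c t \<equiv> proj (Pc c t) (Vc c t)"
abbreviation cl where "cl c t \<equiv> quotient_model.cls (v t) (of_chart S c (\<eta> t))"
abbreviation repr where "repr c t \<equiv> quotient_model.represents (Pc c t) (Vc c t) (v t) (of_chart S c (\<eta> t))"
abbreviation Nz where "Nz c t \<equiv> Nc c (zc c t)"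

lemma Neta_chart:
  assumes c: "c \<in> atlas S" and t: "t \<in> Kc c"
  shows "Neta S I \<eta> t = {w. Pc c t \<bullet> to_chart S c (\<eta> t) w = 0}"
proof -
  have tI: "t \<in> I" using t by (simp add: Kc_def)
  interpret C: finsler_chart "snd (c0 t) ` fst (c0 t)" "lc (c0 t)" by (rule finsler_chart[OF chart_in(1)])
  have z: "zc (c0 t) t \<in> C.W" by (rule zc_W[OF chart_in(1) Kc_self[OF tI]])
  have co: "coords S (\<eta> t) (velocity S I \<eta> t) = zc (c0 t) t"
    by (simp add: coords_def zc_def velocity_eq Xc_def)
  have "form (gvel S I \<eta> t) (v t) w = Pc c t \<bullet> to_chart S c (\<eta> t) w" for w
  proof -
    have "form (gvel S I \<eta> t) (v t) w = C.gg (Vc (c0 t) t) w (zc (c0 t) t)"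
      using C.form_gmat[OF z] by (simp add: gvel_def metric_def vel_def co[unfolded velocity_eq] velocity_eq)
    also have "\<dots> = C.p w (zc (c0 t) t)"
      using C.gg_radial[of "Xc (c0 t) t" "Vc (c0 t) t"] z by (simp add: zc_def)
    also have "\<dots> = Pc (c0 t) t \<bullet> w" by (rule Pc_inner[OF chart_in(1) Kc_self[OF tI]])
    also have "\<dots> = Pc c t \<bullet> to_chart S c (\<eta> t) w"
      using Pc_change[OF chart_in(1) c Kc_self[OF tI] t] by (simp add: to_chart_def)
    finally show ?thesis .
  qed
  then show ?thesis by (simp add: Neta_def nperp_def)
qed

lemma model:
  assumes c: "c \<in> atlas S" and t: "t \<in> Kc c"
  shows "quotient_model (Pc c t) (Vc c t) (gvel S I \<eta> t) (v t) (to_chart S c (\<eta> t)) (of_chart S c (\<eta> t))"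
proof (intro quotient_model.intro orthogonal_pair.intro quotient_model_axioms.intro)
  have q: "\<eta> t \<in> fst c" and tI: "t \<in> I" using t by (auto simp: Kc_def)
  show "Pc c t \<noteq> 0" by (rule Pc_nonzero[OF c t])
  show "Vc c t \<noteq> 0" by (rule Vc_nonzero[OF c t])
  show "Pc c t \<bullet> Vc c t = 0" using Pc_Vc[OF c t] null[OF tI] by simp
  show "linear (to_chart S c (\<eta> t))" "linear (of_chart S c (\<eta> t))"
    using to_chart_linear[OF c q] of_chart_linear[OF c q] .
  show "to_chart S c (\<eta> t) (of_chart S c (\<eta> t) w) = w" "of_chart S c (\<eta> t) (to_chart S c (\<eta> t) w) = w" for w
    using to_of_chart[OF c q] of_to_chart[OF c q] by auto
  show "nperp (gvel S I \<eta> t) (v t) = {w. Pc c t \<bullet> to_chart S c (\<eta> t) w = 0}"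
    using Neta_chart[OF c t] by (simp add: Neta_def)
  show "to_chart S c (\<eta> t) (v t) = Vc c t" using Vc_velocity[OF c t] by (simp add: vel_def)
qed

lemma smooth_proj: "c \<in> atlas S \<Longrightarrow> smooth_on (Kc c) (\<lambda>t. Pj c t)"
proof -
  assume c: "c \<in> atlas S"
  have bo: "bounded_bilinear (outer :: real ^ 'i \<Rightarrow> real ^ 'i \<Rightarrow> _)"
    unfolding bilinear_conv_bounded_bilinear[symmetric] bilinear_def
    by (auto intro!: linearI simp: vec_eq_iff outer_def algebra_simps)
  show ?thesis unfolding proj_def
    by (intro smooth_on_diff smooth_on_scaleR smooth_on_inverse smooth_on_inner smooth_on_bilinear[OF bo]
        smooth_on_const smooth_Pc smooth_Vc c) (use Pc_nonzero[OF c] Vc_nonzero[OF c] in auto)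
qed

lemma to_chart_of_chart: "c \<in> atlas S \<Longrightarrow> d \<in> atlas S \<Longrightarrow> q \<in> fst c \<Longrightarrow> q \<in> fst d \<Longrightarrow>
    to_chart S d q (of_chart S c q u) = tchange c d q u"
  unfolding to_chart_def of_chart_def by (simp add: tchange_chain chart_in)

lemma smooth_field_of_chart:
  assumes c: "c \<in> atlas S" and J: "J \<subseteq> Kc c" and y: "smooth_on J y"
  shows "smooth_field S \<eta> J (\<lambda>t. of_chart S c (\<eta> t) (y t))"
proof (rule smooth_fieldI)
  show "J \<subseteq> I" using J by (auto simp: Kc_def)
  fix d assume d: "d \<in> atlas S"
  let ?Z = "snd c ` (fst c \<inter> fst d)" and ?f = "snd d \<circ> chart_inv c"
  have op: "open (?Z \<times> (UNIV :: (real ^ 'i) set))"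
    by (intro open_Times Cinf_open[OF Cinf_transition[OF c d]]) simp
  have 1: "Cinf (?Z \<times> UNIV) (\<lambda>z. fd ?f (fst z) (snd z))"
    by (rule Cinf_fd_joint[OF Cinf_fst[OF op] Cinf_snd[OF op] Cinf_transition[OF c d]]) auto
  have 2: "smooth_on (J \<inter> Kc d) (\<lambda>t. (Xc c t, y t))"
    by (intro smooth_on_Pair smooth_on_subset[OF smooth_Xc[OF c]] smooth_on_subset[OF y]) (use J in auto)
  have "smooth_on (J \<inter> Kc d) (\<lambda>t. fd ?f (fst (Xc c t, y t)) (snd (Xc c t, y t)))"
    by (rule smooth_on_Cinf_compose[OF 2 1]) (use J in \<open>auto simp: Xc_def Kc_def\<close>)
  then show "smooth_on (J \<inter> Kc d) (\<lambda>t. to_chart S d (\<eta> t) (of_chart S c (\<eta> t) (y t)))"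
  proof (rule smooth_on_cong)
    fix t assume "t \<in> J \<inter> Kc d"
    then have q: "\<eta> t \<in> fst c" "\<eta> t \<in> fst d" using J by (auto simp: Kc_def)
    show "fd ?f (fst (Xc c t, y t)) (snd (Xc c t, y t)) = to_chart S d (\<eta> t) (of_chart S c (\<eta> t) (y t))"
      using to_chart_of_chart[OF c d q] by (simp add: tchange_def Xc_def)
  qed
qed

lemma smooth_field_diff:
  assumes "smooth_field S \<eta> J Y" "smooth_field S \<eta> J Z" "J \<subseteq> I" shows "smooth_field S \<eta> J (\<lambda>t. Y t - Z t)"
proof (rule smooth_fieldI[OF _ assms(3)])
  fix c assume c: "c \<in> atlas S"
  show "smooth_on (J \<inter> Kc c) (\<lambda>t. to_chart S c (\<eta> t) (Y t - Z t))"
    by (rule smooth_on_cong[OF smooth_on_diff[OF smooth_fieldD[OF assms(1) c assms(3)] smooth_fieldD[OF assms(2) c assms(3)]]])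
      (auto simp: Kc_def linear_diff[OF to_chart_linear[OF c]])
qed

lemma smooth_field_scale:
  fixes f :: "real \<Rightarrow> real"
  assumes "smooth_field S \<eta> J Y" "smooth_on I f" "J \<subseteq> I" shows "smooth_field S \<eta> J (\<lambda>t. f t *\<^sub>R Y t)"
proof (rule smooth_fieldI[OF _ assms(3)])
  fix c assume c: "c \<in> atlas S"
  have "smooth_on (J \<inter> Kc c) f" by (rule smooth_on_subset[OF assms(2)]) (auto simp: Kc_def)
  from smooth_on_scaleR[OF this smooth_fieldD[OF assms(1) c assms(3)]]
  show "smooth_on (J \<inter> Kc c) (\<lambda>t. to_chart S c (\<eta> t) (f t *\<^sub>R Y t))"
    by (rule smooth_on_cong) (auto simp: Kc_def linear_scale[OF to_chart_linear[OF c]])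
qed

lemma liftsD:
  assumes "lifts S I \<eta> J Q Y" "c \<in> atlas S" "t \<in> J" "t \<in> Kc c"
  shows "Pc c t \<bullet> tc c Y t = 0" "Q t = cl c t (tc c Y t)"
proof -
  interpret Q: quotient_model "Pc c t" "Vc c t" "gvel S I \<eta> t" "v t" "to_chart S c (\<eta> t)" "of_chart S c (\<eta> t)"
    by (rule model[OF assms(2,4)])
  show "Pc c t \<bullet> tc c Y t = 0" proof -
    have "Y t \<in> Neta S I \<eta> t" using assms(1,3) by (simp add: lifts_def)
    then show ?thesis using Neta_chart[OF assms(2,4)] by simp
  qed
  show "Q t = cl c t (tc c Y t)" using assms by (simp add: lifts_def Q.cls_def Q.BA)
qed

text \<open>The covariant derivatives of vector and of endomorphism fields, in the chart \<open>c\<close>.\<close>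

definition Dc where "Dc c y t = cderiv I y t + Nz c t *v y t"
definition Dm where "Dm c M t = cderiv I M t + Nz c t ** M t - M t ** Nz c t"

context
  fixes c K
  assumes c: "c \<in> atlas S" and K: "openin (top_of_set I) K" and KK: "K \<subseteq> Kc c"
begin

text \<open>Lifts of the same section differ by a multiple \<open>?f\<close> of the velocity, smooth
  since it is read off by an inner product with \<open>Vc\<close>. As the velocity is parallel, the
  derivatives differ by a multiple of it as well.\<close>

lemma Dc_cong:
  assumes a: "smooth_on K a" and b: "smooth_on K b" and ab: "\<And>s. s \<in> K \<Longrightarrow> cl c s (a s) = cl c s (b s)" and t: "t \<in> K"
  shows "cl c t (Dc c a t) = cl c t (Dc c b t)"
proof -
  let ?d = "\<lambda>s. a s - b s" and ?f = "\<lambda>s. (Vc c s \<bullet> (a s - b s)) / (Vc c s \<bullet> Vc c s)"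
  have tK: "t \<in> Kc c" using t KK by auto
  have V: "smooth_on K (Vc c)" by (rule smooth_on_subset[OF smooth_Vc[OF c] KK])
  have f: "smooth_on K ?f"
    by (intro smooth_on_divide smooth_on_inner V smooth_on_diff a b) (use Vc_nonzero[OF c] KK in auto)
  have d: "smooth_on K ?d" by (rule smooth_on_diff[OF a b])
  have eq: "a s - b s = ?f s *\<^sub>R Vc c s" if "s \<in> K" for s
  proof -
    interpret Q: quotient_model "Pc c s" "Vc c s" "gvel S I \<eta> s" "v s" "to_chart S c (\<eta> s)" "of_chart S c (\<eta> s)"
      using model[OF c] that KK by blast
    obtain r where "a s = b s + r *\<^sub>R Vc c s" using ab[OF \<open>s \<in> K\<close>] Q.cls_eq_iff by blast
    then show ?thesis using Q.V by simp
  qed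
  have d1: "(?d has_vector_derivative cderiv I a t - cderiv I b t) (at t within I)"
    by (intro has_vector_derivative_diff smooth_on_has_cderiv[OF K a t] smooth_on_has_cderiv[OF K b t])
  have "((\<lambda>s. ?f s *\<^sub>R Vc c s) has_vector_derivative ?f t *\<^sub>R - (Nz c t *v Vc c t) + cderiv I ?f t *\<^sub>R Vc c t) (at t within I)"
    by (rule bounded_bilinear.has_vector_derivative[OF bounded_bilinear_scaleR smooth_on_has_cderiv[OF K f t] Vc_derivative_N[OF c tK]])
  then have d2: "(?d has_vector_derivative ?f t *\<^sub>R - (Nz c t *v Vc c t) + cderiv I ?f t *\<^sub>R Vc c t) (at t within I)"
    by (rule has_vector_derivative_local[OF _ K t]) (rule eq[symmetric])
  have "t \<in> I" using tK by (simp add: Kc_def)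
  then have "cderiv I a t - cderiv I b t = ?f t *\<^sub>R - (Nz c t *v Vc c t) + cderiv I ?f t *\<^sub>R Vc c t"
    using cderiv_eqI[OF _ d1] cderiv_eqI[OF _ d2] by (simp only:)
  moreover have "Nz c t *v a t - Nz c t *v b t = ?f t *\<^sub>R (Nz c t *v Vc c t)"
    using arg_cong[OF eq[OF t], of "(*v) (Nz c t)"]
    unfolding matrix_vector_mult_diff_distrib matrix_vector_mult_scaleR .
  ultimately have "Dc c a t - Dc c b t = cderiv I ?f t *\<^sub>R Vc c t"
    by (simp add: Dc_def algebra_simps)
  then have "Dc c a t = Dc c b t + cderiv I ?f t *\<^sub>R Vc c t" by (simp add: algebra_simps)
  then show ?thesis
    using quotient_model.cls_eq_iff[OF model[OF c tK]] by blast
qed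

text \<open>Differentiate \<open>Pc c s \<bullet> a s = 0\<close> and use that the covector is
  parallel; thus covariant differentiation preserves the orthogonal space of the velocity.\<close>

lemma Dc_perp:
  assumes a: "smooth_on K a" and P: "\<And>s. s \<in> K \<Longrightarrow> Pc c s \<bullet> a s = 0" and t: "t \<in> K"
  shows "Pc c t \<bullet> Dc c a t = 0"
proof -
  have tK: "t \<in> Kc c" using t KK by auto
  then have tI: "t \<in> I" by (simp add: Kc_def)
  have P': "(Pc c has_vector_derivative cderiv I (Pc c) t) (at t within I)"
    by (rule smooth_on_has_cderiv[OF Kc_openin[OF c] smooth_Pc[OF c] tK])
  have eq: "cderiv I (Pc c) t \<bullet> w = Pc c t \<bullet> (Nz c t *v w)" for w
  proof -
    have "((\<lambda>s. Pc c s \<bullet> w) has_vector_derivative cderiv I (Pc c) t \<bullet> w) (at t within I)"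
      by (rule bounded_linear.has_vector_derivative[OF bounded_linear_inner_left P'])
    from cderiv_eqI[OF tI this] cderiv_eqI[OF tI Pc_derivative[OF c tK, of w]] show ?thesis by (simp only:)
  qed
  have d1: "((\<lambda>s. Pc c s \<bullet> a s) has_vector_derivative Pc c t \<bullet> cderiv I a t + cderiv I (Pc c) t \<bullet> a t) (at t within I)"
    by (rule bounded_bilinear.has_vector_derivative[OF bounded_bilinear_inner P' smooth_on_has_cderiv[OF K a t]])
  have d2: "((\<lambda>s. Pc c s \<bullet> a s) has_vector_derivative 0) (at t within I)"
    by (rule has_vector_derivative_local[OF has_vector_derivative_const K t]) (simp add: P)
  have "Pc c t \<bullet> cderiv I a t + cderiv I (Pc c) t \<bullet> a t = 0"
    using cderiv_eqI[OF tI d1] cderiv_eqI[OF tI d2] by (simp only:)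
  then show ?thesis by (simp add: Dc_def inner_add_right eq)
qed

lemma Dc_mult:
  assumes M: "smooth_on K M" and a: "smooth_on K a" and t: "t \<in> K"
  shows "Dc c (\<lambda>s. M s *v a s) t = Dm c M t *v a t + M t *v Dc c a t"
proof -
  have tI: "t \<in> I" using t KK by (auto simp: Kc_def)
  have "((\<lambda>s. M s *v a s) has_vector_derivative M t *v cderiv I a t + cderiv I M t *v a t) (at t within I)"
    by (rule bounded_bilinear.has_vector_derivative[OF bounded_bilinear_matrix_vector_mult
        smooth_on_has_cderiv[OF K M t] smooth_on_has_cderiv[OF K a t]])
  then have "cderiv I (\<lambda>s. M s *v a s) t = M t *v cderiv I a t + cderiv I M t *v a t" by (rule cderiv_eqI[OF tI])
  then show ?thesis
    by (simp add: Dc_def Dm_def matrix_vector_mult_diff_rdistrib matrix_vector_mult_add_rdistrib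
        matrix_vector_right_distrib matrix_vector_mul_assoc[symmetric])
qed

lemma Dc_V: assumes t: "t \<in> K" shows "Dc c (Vc c) t = 0"
proof -
  have tK: "t \<in> Kc c" and tI: "t \<in> I" using t KK by (auto simp: Kc_def)
  show ?thesis using cderiv_eqI[OF tI Vc_derivative_N[OF c tK]] by (simp add: Dc_def)
qed

text \<open>The velocity is parallel, so the Leibniz rule reduces the derivative of
  \<open>M V\<close> to \<open>Dm c M\<close> applied to \<open>V\<close>, and \<open>M V\<close>
  vanishes identically.\<close>

lemma Dm_V:
  assumes M: "smooth_on K M" and MV: "\<And>s. s \<in> K \<Longrightarrow> M s *v Vc c s = 0" and t: "t \<in> K"
  shows "Dm c M t *v Vc c t = 0"
proof -
  have tI: "t \<in> I" using t KK by (auto simp: Kc_def)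
  have "cderiv I (\<lambda>s. M s *v Vc c s) t = cderiv I (\<lambda>s. 0) t" by (rule cderiv_cong[OF K t]) (simp add: MV)
  also have "\<dots> = (0 :: real ^ 'i)" by (rule cderiv_eqI[OF tI has_vector_derivative_const])
  finally have "Dc c (\<lambda>s. M s *v Vc c s) t = 0" by (simp add: Dc_def MV[OF t])
  then show ?thesis
    using Dc_mult[OF M smooth_on_subset[OF smooth_Vc[OF c] KK] t] Dc_V[OF t] by simp
qed

lemma Dm_perp:
  assumes M: "smooth_on K M" and PM: "\<And>s w. s \<in> K \<Longrightarrow> Pc c s \<bullet> (M s *v w) = 0"
    and MV: "\<And>s. s \<in> K \<Longrightarrow> M s *v Vc c s = 0" and t: "t \<in> K" and y: "Pc c t \<bullet> y = 0"
  shows "Pc c t \<bullet> (Dm c M t *v y) = 0"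
proof -
  have tK: "t \<in> Kc c" using t KK by auto
  interpret Q: quotient_model "Pc c t" "Vc c t" "gvel S I \<eta> t" "v t" "to_chart S c (\<eta> t)" "of_chart S c (\<eta> t)"
    by (rule model[OF c tK])
  \<comment> \<open>Extends the single vector \<open>y\<close> to a smooth field; at
    \<open>t\<close> it differs from \<open>y\<close> by a multiple of the velocity, which
    \<open>Dm c M t\<close> annihilates.\<close>
  have a: "smooth_on K (\<lambda>s. Pj c s *v y)"
    by (intro smooth_on_bilinear[OF bounded_bilinear_matrix_vector_mult] smooth_on_const smooth_on_subset[OF smooth_proj[OF c] KK])
  have "Pc c t \<bullet> Dc c (\<lambda>s. M s *v (Pj c s *v y)) t = 0"
    by (rule Dc_perp[OF smooth_on_bilinear[OF bounded_bilinear_matrix_vector_mult M a] _ t]) (simp add: PM)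
  then have "Pc c t \<bullet> (Dm c M t *v (Pj c t *v y)) = 0"
    unfolding Dc_mult[OF M a t] by (simp add: inner_add_right PM[OF t])
  then show ?thesis
    unfolding Q.proj_perp[OF y] by (simp add: matrix_vector_mult_diff_distrib matrix_vector_mult_scaleR Dm_V[OF M MV t])
qed

end

text \<open>By \<open>Dc_cong\<close> the lift chosen in \<open>qcovd\<close> may be replaced by any
  other, so the derivative of a section can be computed with the lift at hand.\<close>

lemma qcovd_lift:
  assumes c: "c \<in> atlas S" and J: "openin (top_of_set I) J" and Y: "lifts S I \<eta> J Q Y" and t: "t \<in> J" "t \<in> Kc c"
  shows "qcovd S I \<eta> J Q t = cl c t (Dc c (tc c Y) t)" "Pc c t \<bullet> Dc c (tc c Y) t = 0"
    "qcovd S I \<eta> J Q t = qclass (v t) (covd S I \<eta> Y t)" "to_chart S c (\<eta> t) (covd S I \<eta> Y t) = Dc c (tc c Y) t"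
proof -
  let ?Y = "SOME Y. lifts S I \<eta> J Q Y"
  have JI: "J \<subseteq> I" using J openin_imp_subset by blast
  have Y': "lifts S I \<eta> J Q ?Y" by (rule someI[of "lifts S I \<eta> J Q", OF Y])
  interpret Q: quotient_model "Pc c t" "Vc c t" "gvel S I \<eta> t" "v t" "to_chart S c (\<eta> t)" "of_chart S c (\<eta> t)"
    by (rule model[OF c t(2)])
  note KJ = openin_Int_Kc[OF J c]
  have sm: "smooth_on (J \<inter> Kc c) (tc c Z)" if "lifts S I \<eta> J Q Z" for Z
    by (rule smooth_fieldD[OF _ c JI]) (use that in \<open>simp add: lifts_def\<close>)
  have cov: "to_chart S c (\<eta> t) (covd S I \<eta> Z t) = Dc c (tc c Z) t" if "lifts S I \<eta> J Q Z" for Z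
    unfolding Dc_def by (rule covd_chart[OF c J _ t]) (use that in \<open>simp add: lifts_def\<close>)
  have qc: "qclass (v t) (covd S I \<eta> Z t) = cl c t (Dc c (tc c Z) t)" if "lifts S I \<eta> J Q Z" for Z
    by (simp add: Q.cls_def cov[OF that, symmetric] Q.BA)
  have "cl c t (Dc c (tc c ?Y) t) = cl c t (Dc c (tc c Y) t)"
  proof (rule Dc_cong[OF c KJ Int_lower2 sm[OF Y'] sm[OF Y]])
    fix s assume "s \<in> J \<inter> Kc c"
    then have "s \<in> J" "s \<in> Kc c" by auto
    then show "cl c s (tc c ?Y s) = cl c s (tc c Y s)" using liftsD(2)[OF Y' c] liftsD(2)[OF Y c] by simp
  qed (use t in auto)
  then show "qcovd S I \<eta> J Q t = cl c t (Dc c (tc c Y) t)" using qc[OF Y'] by (simp add: qcovd_def)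
  then show "qcovd S I \<eta> J Q t = qclass (v t) (covd S I \<eta> Y t)" using qc[OF Y] by simp
  show "to_chart S c (\<eta> t) (covd S I \<eta> Y t) = Dc c (tc c Y) t" by (rule cov[OF Y])
  show "Pc c t \<bullet> Dc c (tc c Y) t = 0"
    by (rule Dc_perp[OF c KJ Int_lower2 sm[OF Y]]) (use t liftsD(1)[OF Y c] in auto)
qed

lemma lifts_of_chart:
  assumes c: "c \<in> atlas S" and y: "smooth_on (Kc c) y" and P: "\<And>s. s \<in> Kc c \<Longrightarrow> Pc c s \<bullet> y s = 0"
  shows "lifts S I \<eta> (Kc c) (\<lambda>s. cl c s (y s)) (\<lambda>s. of_chart S c (\<eta> s) (y s))"
  unfolding lifts_def
proof (intro conjI ballI)
  show "smooth_field S \<eta> (Kc c) (\<lambda>s. of_chart S c (\<eta> s) (y s))" by (rule smooth_field_of_chart[OF c subset_refl y])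
  fix s assume s: "s \<in> Kc c"
  interpret Q: quotient_model "Pc c s" "Vc c s" "gvel S I \<eta> s" "v s" "to_chart S c (\<eta> s)" "of_chart S c (\<eta> s)"
    by (rule model[OF c s])
  show "of_chart S c (\<eta> s) (y s) \<in> Neta S I \<eta> s" using Neta_chart[OF c s] P[OF s] Q.AB by simp
  show "cl c s (y s) = qclass (v s) (of_chart S c (\<eta> s) (y s))" by (simp add: Q.cls_def)
qed

text \<open>A smooth field maps smooth sections to smooth sections; applied to the projected axis
  vectors this supplies smooth lifts, whose projections are the columns of \<open>M\<close>.\<close>

lemma qfield_matrix_exists:
  assumes E: "smooth_qfield S I \<eta> E" and c: "c \<in> atlas S"
  obtains M where "smooth_on (Kc c) M" "\<And>t. t \<in> Kc c \<Longrightarrow> repr c t (E t) (M t)"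
proof -
  have "\<exists>Z. lifts S I \<eta> (Kc c) (\<lambda>s. E s (cl c s (Pj c s *v axis j 1))) Z" for j
  proof -
    have "smooth_on (Kc c) (\<lambda>s. Pj c s *v axis j 1)"
      by (intro smooth_on_bilinear[OF bounded_bilinear_matrix_vector_mult] smooth_on_const smooth_proj[OF c])
    from lifts_of_chart[OF c this]
    have "smooth_section S I \<eta> (Kc c) (\<lambda>s. cl c s (Pj c s *v axis j 1))"
      using orthogonal_pair.P_proj[OF quotient_model.axioms(1)[OF model[OF c]]] Kc_openin[OF c]
      unfolding smooth_section_def by blast
    then have "smooth_section S I \<eta> (Kc c) (\<lambda>s. E s (cl c s (Pj c s *v axis j 1)))"
      using E unfolding smooth_qfield_def by blast
    then show ?thesis by (simp add: smooth_section_def)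
  qed
  from choice[OF allI[OF this]] obtain Z
    where "\<forall>j. lifts S I \<eta> (Kc c) (\<lambda>s. E s (cl c s (Pj c s *v axis j 1))) (Z j)" by (rule exE)
  then have Z: "\<And>j. lifts S I \<eta> (Kc c) (\<lambda>s. E s (cl c s (Pj c s *v axis j 1))) (Z j)" by (rule spec)
  let ?M = "\<lambda>t. (\<chi> i j. (Pj c t *v tc c (Z j) t) $ i)"
  have KI: "Kc c \<subseteq> I" by (auto simp: Kc_def)
  have col: "smooth_on (Kc c) (\<lambda>t. Pj c t *v tc c (Z j) t)" for j
  proof -
    have "smooth_on (Kc c \<inter> Kc c) (tc c (Z j))"
      by (rule smooth_fieldD[OF _ c KI]) (use Z[of j] in \<open>simp add: lifts_def\<close>)
    then have "smooth_on (Kc c) (tc c (Z j))" by simp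
    then show ?thesis by (intro smooth_on_bilinear[OF bounded_bilinear_matrix_vector_mult] smooth_proj[OF c])
  qed
  \<comment> \<open>The matrix is assembled as a sum of columns times axis rows, so its smoothness
    follows from that of the columns.\<close>
  have sum_smooth: "smooth_on (Kc c) (\<lambda>t. \<Sum>j\<in>T. outer (Pj c t *v tc c (Z j) t) (axis j 1))" if "finite T" for T
    using that
  proof (induction T)
    case empty show ?case by (simp add: smooth_on_const)
  next
    case (insert j T)
    have "linear (\<lambda>a. outer a (axis j 1 :: real ^ 'i))" by (rule linearI) (auto simp: vec_eq_iff outer_def algebra_simps)
    then have "smooth_on (Kc c) (\<lambda>t. outer (Pj c t *v tc c (Z j) t) (axis j 1))"
      by (intro smooth_on_linear[OF col]) (simp add: linear_conv_bounded_linear)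
    from smooth_on_add[OF this insert.IH] show ?case using insert by simp
  qed
  have "?M t = (\<Sum>j\<in>UNIV. outer (Pj c t *v tc c (Z j) t) (axis j 1))" for t
    by (simp add: vec_eq_iff outer_def sum_component axis_def if_distrib cong: if_cong)
  then have smM: "smooth_on (Kc c) ?M" using sum_smooth[of UNIV] by simp
  have "repr c t (E t) (?M t)" if t: "t \<in> Kc c" for t
  proof -
    interpret Q: quotient_model "Pc c t" "Vc c t" "gvel S I \<eta> t" "v t" "to_chart S c (\<eta> t)" "of_chart S c (\<eta> t)"
      by (rule model[OF c t])
    show ?thesis
    proof (rule Q.represents_columns)
      show "qendo (gvel S I \<eta> t) (v t) (E t)" using E KI t by (auto simp: smooth_qfield_def)
      show "Pc c t \<bullet> tc c (Z j) t = 0" for j by (rule liftsD(1)[OF Z c t t])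
      show "E t (cl c t (Pj c t *v axis j 1)) = cl c t (tc c (Z j) t)" for j by (rule liftsD(2)[OF Z c t t])
    qed
  qed
  with smM show ?thesis by (rule that)
qed

text \<open>The covariant derivative of an endomorphism field in a chart is a commutator expression; since
  this depends on the value of the section at \<open>t\<close> only, the choices made in \<open>qfield_deriv\<close> are
  irrelevant.\<close>

context
  fixes E c M
  assumes E: "smooth_qfield S I \<eta> E" and c: "c \<in> atlas S"
    and M: "smooth_on (Kc c) M" and rep: "\<And>t. t \<in> Kc c \<Longrightarrow> repr c t (E t) (M t)"
begin

lemma rep_MV: "s \<in> Kc c \<Longrightarrow> M s *v Vc c s = 0" and rep_PM: "s \<in> Kc c \<Longrightarrow> Pc c s \<bullet> (M s *v w) = 0"
proof -
  assume s: "s \<in> Kc c"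
  interpret Q: quotient_model "Pc c s" "Vc c s" "gvel S I \<eta> s" "v s" "to_chart S c (\<eta> s)" "of_chart S c (\<eta> s)"
    by (rule model[OF c s])
  show "M s *v Vc c s = 0" "Pc c s \<bullet> (M s *v w) = 0"
    using Q.compressedD[OF Q.represents_compressed[OF rep[OF s]]] by auto
qed

lemma Dm_kernel: "t \<in> Kc c \<Longrightarrow> Dm c M t *v Vc c t = 0"
  by (rule Dm_V[OF c Kc_openin[OF c] subset_refl M rep_MV])

lemma Dm_range: "t \<in> Kc c \<Longrightarrow> Pc c t \<bullet> y = 0 \<Longrightarrow> Pc c t \<bullet> (Dm c M t *v y) = 0"
  by (rule Dm_perp[OF c Kc_openin[OF c] subset_refl M rep_PM rep_MV])

text \<open>Leibniz rule for the lift \<open>M Y\<close> of the section \<open>E Q\<close>: the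
  terms with the derivative of \<open>Y\<close> cancel in the difference.\<close>

lemma section_deriv:
  assumes J: "openin (top_of_set I) J" and Y: "lifts S I \<eta> J Q Y" and t: "t \<in> J" "t \<in> Kc c"
  shows "qdiff (v t) (qcovd S I \<eta> J (\<lambda>s. E s (Q s)) t) (E t (qcovd S I \<eta> J Q t)) = cl c t (Dm c M t *v tc c Y t)"
proof -
  have JI: "J \<subseteq> I" using J openin_imp_subset by blast
  interpret Q: quotient_model "Pc c t" "Vc c t" "gvel S I \<eta> t" "v t" "to_chart S c (\<eta> t)" "of_chart S c (\<eta> t)"
    by (rule model[OF c t(2)])
  have "smooth_section S I \<eta> J (\<lambda>s. E s (Q s))"
    using E J Y unfolding smooth_qfield_def smooth_section_def by blast
  then obtain Z where Z: "lifts S I \<eta> J (\<lambda>s. E s (Q s)) Z" by (auto simp: smooth_section_def)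
  note KJ = openin_Int_Kc[OF J c]
  have smZ: "smooth_on (J \<inter> Kc c) (tc c Z)" and smY: "smooth_on (J \<inter> Kc c) (tc c Y)"
    using Z Y by (auto simp: lifts_def intro!: smooth_fieldD[OF _ c JI])
  have smM: "smooth_on (J \<inter> Kc c) M" by (rule smooth_on_subset[OF M]) auto
  have "qcovd S I \<eta> J (\<lambda>s. E s (Q s)) t = cl c t (Dc c (tc c Z) t)" by (rule qcovd_lift(1)[OF c J Z t])
  also have "\<dots> = cl c t (Dc c (\<lambda>s. M s *v tc c Y s) t)"
  proof (rule Dc_cong[OF c KJ Int_lower2 smZ])
    show "smooth_on (J \<inter> Kc c) (\<lambda>s. M s *v tc c Y s)"
      by (rule smooth_on_bilinear[OF bounded_bilinear_matrix_vector_mult smM smY])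
    fix s assume s: "s \<in> J \<inter> Kc c"
    then have "s \<in> J" "s \<in> Kc c" by auto
    note s = this
    interpret Qs: quotient_model "Pc c s" "Vc c s" "gvel S I \<eta> s" "v s" "to_chart S c (\<eta> s)" "of_chart S c (\<eta> s)"
      by (rule model[OF c s(2)])
    show "cl c s (tc c Z s) = cl c s (M s *v tc c Y s)"
      using liftsD[OF Y c s] liftsD(2)[OF Z c s] Qs.represents_apply[OF rep[OF s(2)]] by simp
  qed (use t in auto)
  also have "\<dots> = cl c t (Dm c M t *v tc c Y t + M t *v Dc c (tc c Y) t)"
    using Dc_mult[OF c KJ Int_lower2 smM smY] t by simp
  finally have 1: "qcovd S I \<eta> J (\<lambda>s. E s (Q s)) t = cl c t (Dm c M t *v tc c Y t + M t *v Dc c (tc c Y) t)" .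
  have 2: "E t (qcovd S I \<eta> J Q t) = cl c t (M t *v Dc c (tc c Y) t)"
    using qcovd_lift(1,2)[OF c J Y t] Q.represents_apply[OF rep[OF t(2)]] by simp
  show ?thesis unfolding 1 2 Q.cls_diff by simp
qed

lemma qfield_deriv_apply:
  assumes t: "t \<in> Kc c" and y: "Pc c t \<bullet> y = 0"
  shows "qfield_deriv S I \<eta> E t (cl c t y) = cl c t (Dm c M t *v y)"
proof -
  interpret Q: quotient_model "Pc c t" "Vc c t" "gvel S I \<eta> t" "v t" "to_chart S c (\<eta> t)" "of_chart S c (\<eta> t)"
    by (rule model[OF c t])
  let ?R = "\<lambda>(J, Q). smooth_section S I \<eta> J Q \<and> t \<in> J \<and> Q t = cl c t y"
  have sm: "smooth_on (Kc c) (\<lambda>s. Pj c s *v y)"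
    by (intro smooth_on_bilinear[OF bounded_bilinear_matrix_vector_mult] smooth_on_const smooth_proj[OF c])
  have "smooth_section S I \<eta> (Kc c) (\<lambda>s. cl c s (Pj c s *v y))"
    using lifts_of_chart[OF c sm] orthogonal_pair.P_proj[OF quotient_model.axioms(1)[OF model[OF c]]] Kc_openin[OF c]
    unfolding smooth_section_def by blast
  \<comment> \<open>The projected constant vector gives a section through the class, so the choice
    made in \<open>qfield_deriv\<close> is not vacuous.\<close>
  then have "?R (Kc c, \<lambda>s. cl c s (Pj c s *v y))" using t Q.cls_proj[OF y] by simp
  then have R: "?R (Eps ?R)" by (rule someI)
  obtain J Q where JQ: "Eps ?R = (J, Q)" by (cases "Eps ?R") auto
  with R have sec: "smooth_section S I \<eta> J Q" "t \<in> J" "Q t = cl c t y" by auto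
  then obtain Y where J: "openin (top_of_set I) J" and Y: "lifts S I \<eta> J Q Y" by (auto simp: smooth_section_def)
  have "qfield_deriv S I \<eta> E t (cl c t y) = cl c t (Dm c M t *v tc c Y t)"
    unfolding qfield_deriv_def JQ using section_deriv[OF J Y sec(2) t] by simp
  moreover have "cl c t (tc c Y t) = cl c t y" using liftsD(2)[OF Y c sec(2) t] sec(3) by simp
  then obtain r where "tc c Y t = y + r *\<^sub>R Vc c t" using Q.cls_eq_iff by blast
  then have "Dm c M t *v tc c Y t = Dm c M t *v y"
    by (simp add: matrix_vector_right_distrib matrix_vector_mult_scaleR Dm_kernel[OF t])
  ultimately show ?thesis by simp
qed

lemma qfield_deriv_represents:
  assumes t: "t \<in> Kc c" shows "repr c t (qfield_deriv S I \<eta> E t) (Pj c t ** Dm c M t ** Pj c t)"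
proof -
  interpret Q: quotient_model "Pc c t" "Vc c t" "gvel S I \<eta> t" "v t" "to_chart S c (\<eta> t)" "of_chart S c (\<eta> t)"
    by (rule model[OF c t])
  have "qfield_deriv S I \<eta> E t (cl c t y) = cl c t ((Pj c t ** Dm c M t ** Pj c t) *v y)" if y: "Pc c t \<bullet> y = 0" for y
  proof -
    have "Dm c M t *v (Pj c t *v y) = Dm c M t *v y"
      unfolding Q.proj_perp[OF y] by (simp add: matrix_vector_mult_diff_distrib matrix_vector_mult_scaleR Dm_kernel[OF t])
    then show ?thesis
      using qfield_deriv_apply[OF t y] Q.cls_proj[OF Dm_range[OF t y]] by (simp add: matrix_vector_mul_assoc[symmetric])
  qed
  then show ?thesis by (simp add: Q.represents_def Q.compressed_proj)
qed

end

lemma qfield_deriv_section: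
  assumes E: "smooth_qfield S I \<eta> E" and J: "openin (top_of_set I) J" and Y: "lifts S I \<eta> J Q Y" and s: "s \<in> J"
  shows "qfield_deriv S I \<eta> E s (Q s) = qdiff (v s) (qcovd S I \<eta> J (\<lambda>r. E r (Q r)) s) (E s (qcovd S I \<eta> J Q s))"
proof -
  have c: "c0 s \<in> atlas S" and sK: "s \<in> Kc (c0 s)" using chart_in Kc_self s J openin_imp_subset by blast+
  obtain M where M: "smooth_on (Kc (c0 s)) M" "\<And>t. t \<in> Kc (c0 s) \<Longrightarrow> repr (c0 s) t (E t) (M t)"
    by (rule qfield_matrix_exists[OF E c]) blast
  show ?thesis
    using section_deriv[OF E c M J Y s sK] qfield_deriv_apply[OF E c M sK] liftsD[OF Y c s sK] by simp
qed

text \<open>The Jacobi equation differentiates twice, so the derivative must itself be a smooth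
  field. A lift of its value on \<open>Q\<close> is a lift of the derivative of \<open>E Q\<close>
  minus a lift of \<open>E\<close> applied to the derivative of \<open>Q\<close>.\<close>

lemma smooth_qfield_deriv:
  assumes E: "smooth_qfield S I \<eta> E" shows "smooth_qfield S I \<eta> (qfield_deriv S I \<eta> E)"
  unfolding smooth_qfield_def
proof (intro conjI ballI allI impI)
  fix t assume t: "t \<in> I"
  obtain M where M: "smooth_on (Kc (c0 t)) M" "\<And>s. s \<in> Kc (c0 t) \<Longrightarrow> repr (c0 t) s (E s) (M s)"
    by (rule qfield_matrix_exists[OF E chart_in(1)]) blast
  show "qendo (gvel S I \<eta> t) (v t) (qfield_deriv S I \<eta> E t)"
    by (rule quotient_model.represents_qendo[OF model[OF chart_in(1) Kc_self[OF t]]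
          qfield_deriv_represents[OF E chart_in(1) M Kc_self[OF t]]])
next
  fix J Q assume "smooth_section S I \<eta> J Q"
  then obtain Y where J: "openin (top_of_set I) J" and Y: "lifts S I \<eta> J Q Y" by (auto simp: smooth_section_def)
  have JI: "J \<subseteq> I" using J openin_imp_subset by blast
  have sec: "\<exists>Z. lifts S I \<eta> J (\<lambda>s. E s (R s)) Z" if "lifts S I \<eta> J R W" for R W
    using E that J unfolding smooth_qfield_def smooth_section_def by blast
  have covN: "covd S I \<eta> Z s \<in> Neta S I \<eta> s" if "lifts S I \<eta> J R Z" "s \<in> J" for R Z s
  proof -
    have sK: "s \<in> Kc (c0 s)" using Kc_self JI that by blast
    show ?thesis using qcovd_lift(2,4)[OF chart_in(1) J that sK] Neta_chart[OF chart_in(1) sK] by simp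
  qed
  have qcov: "qcovd S I \<eta> J R s = qclass (v s) (covd S I \<eta> Z s)" if "lifts S I \<eta> J R Z" "s \<in> J" for R Z s
    using qcovd_lift(3)[OF chart_in(1) J that] Kc_self JI that by blast
  have covsm: "smooth_field S \<eta> J (covd S I \<eta> Z)" if "lifts S I \<eta> J R Z" for R Z
    by (rule smooth_field_covd[OF J]) (use that in \<open>simp add: lifts_def\<close>)
  obtain Z where Z: "lifts S I \<eta> J (\<lambda>s. E s (Q s)) Z" using sec[OF Y] by blast
  have "lifts S I \<eta> J (\<lambda>s. qclass (v s) (covd S I \<eta> Y s)) (covd S I \<eta> Y)"
    unfolding lifts_def using covsm[OF Y] covN[OF Y] by blast
  then obtain W where W: "lifts S I \<eta> J (\<lambda>s. E s (qclass (v s) (covd S I \<eta> Y s))) W" using sec by blast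
  have "lifts S I \<eta> J (\<lambda>s. qfield_deriv S I \<eta> E s (Q s)) (\<lambda>s. covd S I \<eta> Z s - W s)"
    unfolding lifts_def
  proof (intro conjI ballI)
    show "smooth_field S \<eta> J (\<lambda>s. covd S I \<eta> Z s - W s)"
      by (rule smooth_field_diff[OF covsm[OF Z] _ JI]) (use W in \<open>simp add: lifts_def\<close>)
    fix s assume s: "s \<in> J"
    have "W s \<in> Neta S I \<eta> s" using W s by (simp add: lifts_def)
    with covN[OF Z s] show "covd S I \<eta> Z s - W s \<in> Neta S I \<eta> s"
      by (simp add: Neta_def nperp_def form_def matrix_vector_mult_diff_distrib inner_diff_right)
    have "E s (qclass (v s) (covd S I \<eta> Y s)) = qclass (v s) (W s)" using W s by (simp add: lifts_def)
    then show "qfield_deriv S I \<eta> E s (Q s) = qclass (v s) (covd S I \<eta> Z s - W s)"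
      using qfield_deriv_section[OF E J Y s] qcov[OF Z s] qcov[OF Y s] by (simp add: qdiff_qclass)
  qed
  then show "smooth_section S I \<eta> J (\<lambda>s. qfield_deriv S I \<eta> E s (Q s))"
    using J by (auto simp: smooth_section_def)
qed

lemma smooth_qfield_scale:
  fixes f :: "real \<Rightarrow> real"
  assumes E: "smooth_qfield S I \<eta> E" and f: "smooth_on I f"
  shows "smooth_qfield S I \<eta> (\<lambda>t A. qscale (v t) (f t) (E t A))"
  unfolding smooth_qfield_def
proof (intro conjI ballI allI impI)
  fix t assume t: "t \<in> I"
  obtain M where M: "smooth_on (Kc (c0 t)) M" "\<And>s. s \<in> Kc (c0 t) \<Longrightarrow> repr (c0 t) s (E s) (M s)"
    by (rule qfield_matrix_exists[OF E chart_in(1)]) blast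
  interpret Q: quotient_model "Pc (c0 t) t" "Vc (c0 t) t" "gvel S I \<eta> t" "v t" "to_chart S (c0 t) (\<eta> t)" "of_chart S (c0 t) (\<eta> t)"
    by (rule model[OF chart_in(1) Kc_self[OF t]])
  show "qendo (gvel S I \<eta> t) (v t) (\<lambda>A. qscale (v t) (f t) (E t A))"
    by (rule Q.represents_qendo[OF Q.represents_scale[OF M(2)[OF Kc_self[OF t]]]])
next
  fix J Q assume "smooth_section S I \<eta> J Q"
  then have "smooth_section S I \<eta> J (\<lambda>s. E s (Q s))" using E unfolding smooth_qfield_def by blast
  then obtain Z where J: "openin (top_of_set I) J" and Z: "lifts S I \<eta> J (\<lambda>s. E s (Q s)) Z"
    by (auto simp: smooth_section_def)
  have JI: "J \<subseteq> I" using J openin_imp_subset by blast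
  have "lifts S I \<eta> J (\<lambda>s. qscale (v s) (f s) (E s (Q s))) (\<lambda>s. f s *\<^sub>R Z s)"
    using Z smooth_field_scale[OF _ f JI, of Z]
    by (auto simp: lifts_def Neta_def nperp_def form_def matrix_vector_mult_scaleR qscale_qclass)
  then show "smooth_section S I \<eta> J (\<lambda>t. qscale (v t) (f t) (E t (Q t)))"
    using J by (auto simp: smooth_section_def)
qed

end

section \<open>The weight along geodesics\<close>

context spacetime
begin

lemma Lag_chart: "lc (chart_at S q) (snd (chart_at S q) q, u) = Lag S q u"
  using chart_inv_left[OF chart_in] tchange_id[OF chart_in] by (simp add: chart_rep_def of_chart_def)

text \<open>A lightlike future-directed vector is a limit of future-directed timelike vectors: since
  \<open>dL \<noteq> 0\<close> there, \<open>{L \<le> 0}\<close> is locally connected at it.\<close>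

lemma future_directed_closure:
  assumes "future_directed S q w0" shows "w0 \<in> closure (Omega S q) - {0}"
proof -
  define f where "f = Lag S q"
  let ?C = "closure {w. f w < 0} - {0}"
  have ca: "f w0 < 0 \<or> (f w0 = 0 \<and> w0 \<noteq> 0)" and co: "connected_component ?C (time_or S q) w0"
    using assms by (auto simp: future_directed_def causal_vec_def f_def)
  have f0: "f 0 = 0" by (simp add: f_def Lag_0)
  have w0: "w0 \<noteq> 0" using ca f0 by auto
  have neg_C: "w \<in> ?C" if "f w < 0" for w using that f0 closure_subset[of "{w. f w < 0}"] by auto
  have fut: "w \<in> Omega S q" if "f w < 0" "connected_component ?C w w0" for w
    using that co connected_component_trans[OF co connected_component_sym]
    by (auto simp: Omega_def future_directed_def causal_vec_def f_def)
  show ?thesis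
  proof (cases "f w0 < 0")
    case True
    then show ?thesis using fut[OF True] neg_C[OF True] w0 closure_subset[of "Omega S q"] by auto
  next
    case False
    then have fw0: "f w0 = 0" using ca by simp
    define c where "c = chart_at S q"
    define x where "x = snd c q"
    have c: "c \<in> atlas S" and xX: "x \<in> snd c ` fst c" using chart_in by (auto simp: c_def x_def)
    interpret C: finsler_chart "snd c ` fst c" "lc c" by (rule finsler_chart[OF c])
    have lf: "lc c (x, w) = f w" for w using Lag_chart by (simp add: c_def x_def f_def)
    have zw: "(x, w0) \<in> C.W" using xX w0 by simp
    \<comment> \<open>A direction in which \<open>L\<close> strictly decreases at \<open>w0\<close>;
      if all fibre derivatives vanished there, the metric would be degenerate.\<close>
    obtain u where u: "C.p u (x, w0) < 0"
    proof -
      have "\<exists>a. C.p a (x, w0) \<noteq> 0"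
      proof (rule ccontr)
        assume "\<not> ?thesis"
        then have z: "C.gg w0 a (x, w0) = 0" for a using C.gg_radial[OF xX w0] by simp
        have "C.gg a w0 (x, w0) = C.gg a 0 (x, w0)" for a
          by (simp only: C.gg_commute[OF zw, of a w0] z linear_0[OF C.gg_linear2[OF zw]])
        then have "w0 = 0" by (rule C.gg_nondegenerate[OF zw])
        then show False using w0 by simp
      qed
      then obtain a where a: "C.p a (x, w0) \<noteq> 0" by blast
      have n: "C.p (- a) (x, w0) = - C.p a (x, w0)" by (rule linear_neg[OF C.p_linear[OF zw]])
      show ?thesis
      proof (cases "C.p a (x, w0) < 0")
        case True then show ?thesis by (rule that)
      next
        case False
        then have "C.p (- a) (x, w0) < 0" using a n by simp
        then show ?thesis by (rule that)
      qed
    qed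
    have cont: "continuous_on (- {0}) (\<lambda>w. C.p u (x, w))"
      by (rule continuous_on_compose2[OF Cinf_continuous_on[OF C.Cinf_p]]) (use xX in \<open>auto intro!: continuous_intros\<close>)
    obtain r where r: "r > 0" "\<forall>w. dist w w0 < r \<longrightarrow> w \<in> - {0} \<and> \<bar>C.p u (x, w) - C.p u (x, w0)\<bar> < - C.p u (x, w0)"
      by (rule continuous_on_two_point[OF cont, of w0 "- C.p u (x, w0)"]) (use u w0 in auto)
    have neg: "w \<noteq> 0 \<and> C.p u (x, w) < 0" if "dist w w0 < r" for w using r(2) that by force
    \<comment> \<open>So small that moving by \<open>\<delta> u\<close> from a point at distance
      less than \<open>r / 2\<close> stays inside the ball of radius \<open>r\<close> on which
      \<open>L\<close> decreases along \<open>u\<close>.\<close>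
    define \<delta> where "\<delta> = r / (2 * (norm u + 1))"
    have \<delta>: "\<delta> > 0" "\<delta> * norm u < r / 2"
    proof -
      have n: "norm u + 1 > 0" by (simp add: add_nonneg_pos)
      show "\<delta> > 0" using r(1) n by (simp add: \<delta>_def)
      have "\<delta> * norm u < \<delta> * (norm u + 1)" using \<open>\<delta> > 0\<close> by simp
      also have "\<dots> = r / 2"
      proof -
        have "r / (2 * k) * k = r / 2" if "k > 0" for k using that by simp
        from this[OF n] show ?thesis unfolding \<delta>_def .
      qed
      finally show "\<delta> * norm u < r / 2" .
    qed
    have near: "dist (w + s *\<^sub>R u) w0 < r" if "dist w w0 < r / 2" "0 \<le> s" "s \<le> \<delta>" for w s
    proof -
      have "dist (w + s *\<^sub>R u) w0 \<le> dist (w + s *\<^sub>R u) w + dist w w0" by (rule dist_triangle)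
      also have "dist (w + s *\<^sub>R u) w = s * norm u" using that by (simp add: dist_norm)
      also have "s * norm u \<le> \<delta> * norm u" using that by (simp add: mult_right_mono)
      finally show ?thesis using \<delta>(2) that by linarith
    qed
    have dec: "f (w + s *\<^sub>R u) < 0" if w: "dist w w0 < r / 2" "f w \<le> 0" and s: "0 < s" "s \<le> \<delta>" for w s
    proof -
      have der: "((\<lambda>s. f (w + s *\<^sub>R u)) has_real_derivative C.p u (x, w + k *\<^sub>R u)) (at k)" if "0 \<le> k" "k \<le> s" for k
      proof -
        have z: "(x, w + k *\<^sub>R u) \<in> C.W" using neg[OF near[OF w(1)]] that s xX by auto
        have "((\<lambda>k. (x, w + k *\<^sub>R u)) has_derivative (\<lambda>h. (0, h *\<^sub>R u))) (at k)"
          by (auto intro!: derivative_eq_intros)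
        from diff_chain_at[OF this Cinf_has_derivative[OF C.smooth z]]
        have "((\<lambda>k. f (w + k *\<^sub>R u)) has_derivative (\<lambda>h. fd (lc c) (x, w + k *\<^sub>R u) (0, h *\<^sub>R u))) (at k)"
          by (simp add: o_def lf)
        moreover have "fd (lc c) (x, w + k *\<^sub>R u) (0, h *\<^sub>R u) = C.p u (x, w + k *\<^sub>R u) * h" for h
          using linear_scale[OF Cinf_linear[OF C.smooth z], of h "(0, u)"] by (simp add: C.p_def mult.commute)
        ultimately show ?thesis by (simp add: has_field_derivative_def)
      qed
      obtain k where k: "0 < k" "k < s" "f (w + s *\<^sub>R u) - f (w + 0 *\<^sub>R u) = (s - 0) * C.p u (x, w + k *\<^sub>R u)"
        using MVT2[OF s(1) der] by blast
      have "C.p u (x, w + k *\<^sub>R u) < 0" using neg[OF near[OF w(1)]] k s by auto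
      then have "s * C.p u (x, w + k *\<^sub>R u) < 0" using s(1) by (simp add: mult_pos_neg)
      then show ?thesis using k(3) w(2) by simp
    qed
    let ?v1 = "w0 + \<delta> *\<^sub>R u"
    have fv1: "f ?v1 < 0" using dec[of w0 \<delta>] r(1) \<delta>(1) fw0 by simp
    have contf: "continuous_on (- {0}) f"
    proof -
      have "continuous_on (- {0}) (\<lambda>w. lc c (x, w))"
        by (rule continuous_on_compose2[OF Cinf_continuous_on[OF C.smooth]]) (use xX in \<open>auto intro!: continuous_intros\<close>)
      then show ?thesis by (simp add: lf)
    qed
    have v1n: "?v1 \<noteq> 0" using fv1 f0 by auto
    obtain r1 where r1: "r1 > 0" "\<forall>y. dist y ?v1 < r1 \<longrightarrow> y \<in> - {0} \<and> \<bar>f y - f ?v1\<bar> < - f ?v1"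
      by (rule continuous_on_two_point[OF contf, of ?v1 "- f ?v1"]) (use fv1 v1n in auto)
    have neg1: "f y < 0" if "dist y ?v1 < r1" for y using r1(2) that by force
    \<comment> \<open>A timelike \<open>w\<close> near \<open>w0\<close> exists because
      \<open>w0\<close> lies in the closure. It is joined to \<open>w0\<close> by three segments
      inside \<open>?C\<close>: along \<open>u\<close>, across to \<open>?v1\<close>, and back along
      \<open>u\<close>. Hence \<open>w\<close> lies in the future component.\<close>
    have "\<exists>w\<in>Omega S q. dist w w0 < e" if e: "e > 0" for e
    proof -
      have "w0 \<in> ?C" using connected_component_in[OF co] by simp
      then have "\<forall>e>0. \<exists>w\<in>{w. f w < 0}. dist w w0 < e" by (simp add: closure_approachable)
      moreover have "min e (min (r / 2) r1) > 0" using e r(1) r1(1) by simp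
      ultimately obtain w where w: "f w < 0" "dist w w0 < min e (min (r / 2) r1)" by blast
      have 1: "connected_component ?C w (w + \<delta> *\<^sub>R u)"
      proof (rule connected_componentI[of "closed_segment w (w + \<delta> *\<^sub>R u)"])
        show "closed_segment w (w + \<delta> *\<^sub>R u) \<subseteq> ?C"
        proof
          fix y assume "y \<in> closed_segment w (w + \<delta> *\<^sub>R u)"
          then obtain k where k: "0 \<le> k" "k \<le> 1" "y = w + (k * \<delta>) *\<^sub>R u"
            by (auto simp: in_segment algebra_simps)
          have "f y < 0"
          proof (cases "k = 0")
            case False
            then show ?thesis unfolding k(3) using k w \<delta>(1) by (intro dec) (auto simp: mult_left_le_one_le)
          qed (use w k in simp)
          then show "y \<in> ?C" by (rule neg_C)
        qed
      qed auto
      have 2: "connected_component ?C (w + \<delta> *\<^sub>R u) ?v1"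
      proof (rule connected_componentI[of "closed_segment (w + \<delta> *\<^sub>R u) ?v1"])
        show "closed_segment (w + \<delta> *\<^sub>R u) ?v1 \<subseteq> ?C"
        proof
          fix y assume y: "y \<in> closed_segment (w + \<delta> *\<^sub>R u) ?v1"
          have "dist y ?v1 \<le> dist (w + \<delta> *\<^sub>R u) ?v1"
            using segment_bound(2)[OF y] by (simp add: dist_norm norm_minus_commute)
          also have "\<dots> = dist w w0" by (simp add: dist_norm)
          finally show "y \<in> ?C" using neg1 w by (intro neg_C) auto
        qed
      qed auto
      have 3: "connected_component ?C ?v1 w0"
      proof (rule connected_componentI[of "closed_segment w0 ?v1"])
        show "closed_segment w0 ?v1 \<subseteq> ?C"
        proof
          fix y assume "y \<in> closed_segment w0 ?v1"
          then obtain k where k: "0 \<le> k" "k \<le> 1" "y = w0 + (k * \<delta>) *\<^sub>R u"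
            by (auto simp: in_segment algebra_simps)
          show "y \<in> ?C"
          proof (cases "k = 0")
            case True then show ?thesis using \<open>w0 \<in> ?C\<close> k by simp
          next
            case False
            then have "f y < 0" unfolding k(3) using k r(1) fw0 \<delta>(1) by (intro dec) (auto simp: mult_left_le_one_le)
            then show ?thesis by (rule neg_C)
          qed
        qed
      qed auto
      have "connected_component ?C w w0"
        by (rule connected_component_trans[OF connected_component_trans[OF 1 2] 3])
      then have "w \<in> Omega S q" using fut w(1) by blast
      then show ?thesis using w(2) by auto
    qed
    then show ?thesis using w0 by (auto simp: closure_approachable)
  qed
qed

text \<open>The segment from \<open>w\<close> to its multiple consists of positive multiples of
  \<open>w\<close>, and these remain in the closed cone without 0.\<close>

lemma future_directed_scale:
  assumes "future_directed S q w" "r > 0" shows "future_directed S q (r *\<^sub>R w)"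
proof -
  let ?A = "{w. Lag S q w < 0}" and ?C = "closure {w. Lag S q w < 0} - {0}"
  have co: "connected_component ?C (time_or S q) w" and ca: "causal_vec S q w"
    using assms by (auto simp: future_directed_def)
  have wC: "w \<in> ?C" using connected_component_in[OF co] by simp
  have sc: "k *\<^sub>R w \<in> ?C" if k: "k > 0" for k
  proof -
    have "(*\<^sub>R) k ` ?A \<subseteq> ?A" using k by (auto simp: Lag_scale mult_pos_neg)
    then have "(*\<^sub>R) k ` closure ?A \<subseteq> closure ?A" unfolding closure_scaleR by (rule closure_mono)
    then show ?thesis using wC k by auto
  qed
  have "connected_component ?C w (r *\<^sub>R w)"
  proof (rule connected_componentI[of "closed_segment w (r *\<^sub>R w)"])
    show "closed_segment w (r *\<^sub>R w) \<subseteq> ?C"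
    proof
      fix y assume "y \<in> closed_segment w (r *\<^sub>R w)"
      then obtain k where k: "0 \<le> k" "k \<le> 1" "y = ((1 - k) + k * r) *\<^sub>R w"
        by (auto simp: in_segment scaleR_add_left)
      have "(1 - k) + k * r > 0"
      proof (cases "k = 0")
        case False
        then have "k * r > 0" using k assms(2) by simp
        then show ?thesis using k by simp
      qed simp
      then show "y \<in> ?C" unfolding k(3) by (rule sc)
    qed
  qed auto
  then have "connected_component ?C (time_or S q) (r *\<^sub>R w)" using co connected_component_trans by blast
  moreover have "causal_vec S q (r *\<^sub>R w)"
    using ca assms(2) by (auto simp: causal_vec_def Lag_scale mult_pos_neg)
  ultimately show ?thesis by (simp add: future_directed_def)
qed

lemma weight_scale: "future_directed S q w \<Longrightarrow> r > 0 \<Longrightarrow> weight S q (r *\<^sub>R w) = weight S q w"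
  using wfs future_directed_closure[of q w] by (auto simp: weighted_finsler_spacetime_def weight_function_def)

text \<open>The weight is smooth only in the sense of local extensions from the closed cone. The
  neighbourhood is cut down to nonzero vectors, where the spray is smooth and can be used to
  differentiate \<open>F\<close> twice.\<close>

lemma weight_extension:
  assumes c: "c \<in> atlas S" and q: "q \<in> fst c" and w: "future_directed S q w"
  obtains U F where "Cinf U F" "(snd c q, to_chart S c q w) \<in> U" "U \<subseteq> (snd c ` fst c) \<times> - {0}"
    "\<And>q' w'. q' \<in> fst c \<Longrightarrow> future_directed S q' w' \<Longrightarrow> (snd c q', to_chart S c q' w') \<in> U \<Longrightarrow>
      F (snd c q', to_chart S c q' w') = weight S q' w'"
proof -
  let ?A = "{(snd c p, to_chart S c p v) | p v. p \<in> fst c \<and> v \<in> closure (Omega S p) - {0}}"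
  have sm: "smooth_on ?A (chart_rep S c (weight S))"
    using wfs c by (auto simp: weighted_finsler_spacetime_def weight_function_def)
  have "(snd c q, to_chart S c q w) \<in> ?A" using q future_directed_closure[OF w] by blast
  then obtain U F where U: "(snd c q, to_chart S c q w) \<in> U" "Cinf U F" "\<And>x. x \<in> ?A \<Longrightarrow> x \<in> U \<Longrightarrow> F x = chart_rep S c (weight S) x"
    by (rule smooth_on_Cinf[OF sm]) blast
  let ?W = "(snd c ` fst c) \<times> - {0 :: real ^ 'i}"
  interpret C: finsler_chart "snd c ` fst c" "lc c" by (rule finsler_chart[OF c])
  have rep: "chart_rep S c (weight S) (snd c q', to_chart S c q' w') = weight S q' w'" if "q' \<in> fst c" for q' w'
    using chart_inv_left[OF c that] of_to_chart[OF c that] by (simp add: chart_rep_def)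
  show ?thesis
  proof (rule that[of "U \<inter> ?W" F])
    show "Cinf (U \<inter> ?W) F"
      by (rule Cinf_subset[OF U(2) open_Int[OF Cinf_open[OF U(2)] C.open_W]]) auto
    have "to_chart S c q w \<noteq> 0"
      using of_to_chart[OF c q, of w] linear_0[OF of_chart_linear[OF c q]] future_directed_closure[OF w] by auto
    then show "(snd c q, to_chart S c q w) \<in> U \<inter> ?W" using U(1) q by auto
    fix q' w' assume "q' \<in> fst c" "future_directed S q' w'" "(snd c q', to_chart S c q' w') \<in> U \<inter> ?W"
    then have "(snd c q', to_chart S c q' w') \<in> ?A" "(snd c q', to_chart S c q' w') \<in> U"
      using future_directed_closure by blast+
    then show "F (snd c q', to_chart S c q' w') = weight S q' w'" using U(3) rep \<open>q' \<in> fst c\<close> by simp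
  qed auto
qed

end

context geodesic
begin

lemma future_velocity: "t \<in> I \<Longrightarrow> future_directed S (\<eta> t) (velocity S I \<eta> t)"
  using geo by (simp add: causal_geodesic_def)

lemma openin_zc:
  assumes c: "c \<in> atlas S" and U: "open U"
  shows "openin (top_of_set I) {s \<in> Kc c. zc c s \<in> U}"
proof -
  have "continuous_on (Kc c) (zc c)"
  proof (rule continuous_on_eq_continuous_within[THEN iffD2], rule ballI)
    fix s assume s: "s \<in> Kc c"
    have "continuous (at s within I) (zc c)"
      using zc_derivative[OF c s] has_vector_derivative_continuous by blast
    then show "continuous (at s within Kc c) (zc c)" by (rule continuous_within_subset) (auto simp: Kc_def)
  qed
  then have "openin (top_of_set (Kc c)) (Kc c \<inter> zc c -` U)" using U by (rule continuous_openin_preimage_gen)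
  moreover have "Kc c \<inter> zc c -` U = {s \<in> Kc c. zc c s \<in> U}" by auto
  ultimately show ?thesis using openin_trans Kc_openin[OF c] by metis
qed

context
  fixes c U F
  assumes c: "c \<in> atlas S" and F: "Cinf U F" and UW: "U \<subseteq> (snd c ` fst c) \<times> - {0}"
    and w: "\<And>q' w'. q' \<in> fst c \<Longrightarrow> future_directed S q' w' \<Longrightarrow> (snd c q', to_chart S c q' w') \<in> U \<Longrightarrow>
      F (snd c q', to_chart S c q' w') = weight S q' w'"
begin

abbreviation KU where "KU \<equiv> {s \<in> Kc c. zc c s \<in> U}"
text \<open>This is \<psi>' as a function on the tangent bundle, which shows that it depends on the
  velocity alone.\<close>

abbreviation H where "H \<equiv> \<lambda>z. fd F z (finsler_chart.spray (lc c) z)"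

lemma psi_F: "s \<in> KU \<Longrightarrow> psi_along S I \<eta> s = F (zc c s)"
proof -
  assume s: "s \<in> KU"
  then have "zc c s = (snd c (\<eta> s), to_chart S c (\<eta> s) (velocity S I \<eta> s))"
    using Vc_velocity[OF c] by (simp add: zc_def Xc_def)
  then show ?thesis using w[of "\<eta> s" "velocity S I \<eta> s"] future_velocity s by (auto simp: psi_along_def Kc_def)
qed

lemma psi_derivative:
  assumes s: "s \<in> KU" shows "(psi_along S I \<eta> has_vector_derivative H (zc c s)) (at s within I)"
proof -
  have "((\<lambda>s. F (zc c s)) has_vector_derivative H (zc c s)) (at s within I)"
    by (rule has_vector_derivative_compose_fd[OF zc_derivative[OF c] Cinf_differentiable[OF F]]) (use s in auto)
  then show ?thesis
    by (rule has_vector_derivative_local[OF _ openin_zc[OF c Cinf_open[OF F]] s]) (simp add: psi_F)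
qed

lemma psi_cderiv: "s \<in> KU \<Longrightarrow> cderiv I (psi_along S I \<eta>) s = H (zc c s)"
  by (rule cderiv_eqI[OF _ psi_derivative]) (auto simp: Kc_def)

lemma psi_cderiv2:
  assumes s: "s \<in> KU"
  shows "(cderiv I (psi_along S I \<eta>) has_vector_derivative fd H (zc c s) (finsler_chart.spray (lc c) (zc c s))) (at s within I)"
proof -
  interpret C: finsler_chart "snd c ` fst c" "lc c" by (rule finsler_chart[OF c])
  have z: "zc c s \<in> U" "zc c s \<in> C.W" using s UW by auto
  have "H differentiable (at (zc c s))"
    unfolding differentiable_def using fd_fd_variable[OF F z(1) C.spray_has_derivative[OF z(2)]] by blast
  then have "((\<lambda>s. H (zc c s)) has_vector_derivative fd H (zc c s) (finsler_chart.spray (lc c) (zc c s))) (at s within I)"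
    by (rule has_vector_derivative_compose_fd[OF zc_derivative[OF c], rotated]) (use s in auto)
  then show ?thesis
    by (rule has_vector_derivative_local[OF _ openin_zc[OF c Cinf_open[OF F]] s]) (simp add: psi_cderiv)
qed

lemma psi_smooth_local: "smooth_on KU (psi_along S I \<eta>)"
proof (rule smooth_on_cong)
  show "smooth_on KU (\<lambda>s. F (zc c s))"
    by (rule smooth_on_Cinf_compose[OF smooth_on_subset[OF smooth_zc[OF c]] F]) auto
qed (simp add: psi_F)

end

lemma psi_extension:
  assumes t: "t \<in> I"
  obtains U F where "Cinf U F" "zc (c0 t) t \<in> U" "U \<subseteq> (snd (c0 t) ` fst (c0 t)) \<times> - {0}"
    "\<And>q' w'. q' \<in> fst (c0 t) \<Longrightarrow> future_directed S q' w' \<Longrightarrow> (snd (c0 t) q', to_chart S (c0 t) q' w') \<in> U \<Longrightarrow>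
      F (snd (c0 t) q', to_chart S (c0 t) q' w') = weight S q' w'"
proof -
  have "zc (c0 t) t = (snd (c0 t) (\<eta> t), to_chart S (c0 t) (\<eta> t) (velocity S I \<eta> t))"
    using Vc_velocity[OF chart_in(1) Kc_self[OF t]] by (simp add: zc_def Xc_def)
  then show ?thesis using weight_extension[OF chart_in future_velocity[OF t]] that by metis
qed

lemma smooth_psi: "smooth_on I (psi_along S I \<eta>)"
proof (rule smooth_on_local)
  fix t assume t: "t \<in> I"
  obtain U F where U: "Cinf U F" "zc (c0 t) t \<in> U" "U \<subseteq> (snd (c0 t) ` fst (c0 t)) \<times> - {0}"
    "\<And>q' w'. q' \<in> fst (c0 t) \<Longrightarrow> future_directed S q' w' \<Longrightarrow> (snd (c0 t) q', to_chart S (c0 t) q' w') \<in> U \<Longrightarrow>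
      F (snd (c0 t) q', to_chart S (c0 t) q' w') = weight S q' w'"
    by (rule psi_extension[OF t]) blast
  obtain O' where "open O'" "{s \<in> Kc (c0 t). zc (c0 t) s \<in> U} = I \<inter> O'"
    using openin_zc[OF chart_in(1) Cinf_open[OF U(1)], of "\<eta> t"] by (auto simp: openin_open)
  then show "\<exists>U. open U \<and> t \<in> U \<and> smooth_on (I \<inter> U) (psi_along S I \<eta>)"
    using psi_smooth_local[OF chart_in(1) U(1,3,4)] t U(2) Kc_self[OF t] by (intro exI[of _ O']) auto
qed

end

text \<open>Along any two geodesics with a common velocity the first two derivatives of the weight agree,
  since the spray and a local extension of \<open>\<psi>\<close> determine them.\<close>

lemma psi_derivatives_agree:
  fixes S :: "('m::{t2_space, second_countable_topology}, 'i::finite) finsler_data"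
  assumes "geodesic S I \<eta>" "geodesic S I' \<xi>" and t: "t \<in> I" "t' \<in> I'" and "\<eta> t = \<xi> t'"
    and "velocity S I \<eta> t = velocity S I' \<xi> t'"
  shows "cderiv I (psi_along S I \<eta>) t = cderiv I' (psi_along S I' \<xi>) t'"
    and "cderiv I (cderiv I (psi_along S I \<eta>)) t = cderiv I' (cderiv I' (psi_along S I' \<xi>)) t'"
proof -
  interpret A: geodesic S I \<eta> by fact
  interpret B: geodesic S I' \<xi> by fact
  define c where "c = chart_at S (\<eta> t)"
  have c: "c \<in> atlas S" "t \<in> A.Kc c" "t' \<in> B.Kc c"
    using A.chart_in A.Kc_self[OF t(1)] B.Kc_self[OF t(2)] assms(5) by (auto simp: c_def)
  have z: "A.zc c t = B.zc c t'"
    using assms(5,6) A.Vc_velocity[OF c(1,2)] B.Vc_velocity[OF c(1,3)]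
    by (simp add: A.zc_def B.zc_def A.Xc_def B.Xc_def)
  obtain U F where U: "Cinf U F" "A.zc c t \<in> U" "U \<subseteq> (snd c ` fst c) \<times> - {0}"
    "\<And>q' w'. q' \<in> fst c \<Longrightarrow> future_directed S q' w' \<Longrightarrow> (snd c q', to_chart S c q' w') \<in> U \<Longrightarrow>
      F (snd c q', to_chart S c q' w') = weight S q' w'"
    unfolding c_def by (rule A.psi_extension[OF t(1)]) blast
  show "cderiv I (psi_along S I \<eta>) t = cderiv I' (psi_along S I' \<xi>) t'"
    using A.psi_cderiv[OF c(1) U(1,3,4), of t] B.psi_cderiv[OF c(1) U(1,3,4), of t'] c U(2) z by simp
  have "cderiv I (cderiv I (psi_along S I \<eta>)) t = fd (A.H c F) (A.zc c t) (finsler_chart.spray (A.lc c) (A.zc c t))"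
    by (rule A.cderiv_eqI[OF t(1) A.psi_cderiv2[OF c(1) U(1,3,4)]]) (use c U(2) in auto)
  moreover have "cderiv I' (cderiv I' (psi_along S I' \<xi>)) t' = fd (A.H c F) (B.zc c t') (finsler_chart.spray (A.lc c) (B.zc c t'))"
    by (rule B.cderiv_eqI[OF t(2) B.psi_cderiv2[OF c(1) U(1,3,4)]]) (use c U(2) z in auto)
  ultimately show "cderiv I (cderiv I (psi_along S I \<eta>)) t = cderiv I' (cderiv I' (psi_along S I' \<xi>)) t'"
    by (simp add: z)
qed

subsection \<open>Affine reparametrisation\<close>

text \<open>\<open>eta_star\<close> at \<open>t0\<close> is \<open>r\<close> times the velocity,
  with \<open>r\<close> the value of \<open>star_factor\<close>. A geodesic with this initial
  velocity is \<open>\<eta>\<close> run at speed \<open>r\<close> and shifted so that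
  \<open>t0\<close> sits at parameter 0.\<close>

locale reparametrised = geodesic S I \<eta>
  for S :: "('m::{t2_space, second_countable_topology}, 'i::finite) finsler_data" and I \<eta> +
  fixes t0 r :: real
  assumes t0: "t0 \<in> I" and r: "r > 0"
begin

definition I' where "I' = {\<tau>. t0 + r * \<tau> \<in> I}"
definition \<xi> where "\<xi> \<tau> = \<eta> (t0 + r * \<tau>)"

lemma interval_I': "nondegenerate_interval I'"
  unfolding nondegenerate_interval_def
proof
  have I: "is_interval I" "interior I \<noteq> {}" using geo by (auto simp: causal_geodesic_def nondegenerate_interval_def)
  show "is_interval I'" unfolding is_interval_1
  proof (intro ballI allI impI)
    fix a b x assume ab: "a \<in> I'" "b \<in> I'" "a \<le> x \<and> x \<le> b"
    have "t0 + r * a \<le> t0 + r * x" "t0 + r * x \<le> t0 + r * b" using ab(3) r by auto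
    then show "x \<in> I'" using I(1) ab unfolding is_interval_1 I'_def by blast
  qed
  obtain a e where ae: "e > 0" "ball a e \<subseteq> I" using I(2) by (auto simp: mem_interior)
  have "ball ((a - t0) / r) (e / r) \<subseteq> I'"
  proof
    fix \<tau> assume "\<tau> \<in> ball ((a - t0) / r) (e / r)"
    then have "\<bar>(a - t0) / r - \<tau>\<bar> * r < e" using r by (simp add: dist_real_def pos_less_divide_eq)
    then have "\<bar>((a - t0) / r - \<tau>) * r\<bar> < e" using r by (simp add: abs_mult)
    moreover have "((a - t0) / r - \<tau>) * r = a - (t0 + r * \<tau>)" using r by (simp add: field_simps)
    ultimately have "\<bar>a - (t0 + r * \<tau>)\<bar> < e" by simp
    then show "\<tau> \<in> I'" using ae(2) by (auto simp: I'_def dist_real_def)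
  qed
  then have "(a - t0) / r \<in> interior I'" using ae r by (auto simp: mem_interior intro!: exI[of _ "e / r"])
  then show "interior I' \<noteq> {}" by blast
qed

lemma reparam_derivative:
  assumes "(f has_vector_derivative d) (at (t0 + r * \<tau>) within I)"
  shows "((\<lambda>\<tau>. f (t0 + r * \<tau>)) has_vector_derivative r *\<^sub>R d) (at \<tau> within I')"
proof -
  have 1: "((\<lambda>\<tau>. t0 + r * \<tau>) has_vector_derivative r) (at \<tau> within I')"
    by (auto intro!: derivative_eq_intros simp: has_vector_derivative_def)
  have 2: "(f has_vector_derivative d) (at (t0 + r * \<tau>) within (\<lambda>\<tau>. t0 + r * \<tau>) ` I')"
    by (rule has_vector_derivative_within_subset[OF assms]) (auto simp: I'_def)
  from vector_diff_chain_within[OF 1 2] show ?thesis by (simp add: o_def)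
qed

sublocale J: interval_domain I' by unfold_locales (rule interval_I')

lemma I'D: "\<tau> \<in> I' \<Longrightarrow> t0 + r * \<tau> \<in> I" by (simp add: I'_def)

lemma reparam_cderiv_X:
  assumes c: "c \<in> atlas S" and \<tau>: "\<tau> \<in> I'" "t0 + r * \<tau> \<in> Kc c"
  shows "cderiv I' (snd c \<circ> \<xi>) \<tau> = r *\<^sub>R Vc c (t0 + r * \<tau>)"
  by (rule J.cderiv_eqI[OF \<tau>(1)])
    (use reparam_derivative[OF Xc_derivative[OF c \<tau>(2)]] in \<open>simp add: o_def \<xi>_def Xc_def[abs_def]\<close>)

lemma reparam_velocity: "\<tau> \<in> I' \<Longrightarrow> velocity S I' \<xi> \<tau> = r *\<^sub>R velocity S I \<eta> (t0 + r * \<tau>)"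
  using reparam_cderiv_X[OF chart_in(1) _ Kc_self[OF I'D]] by (simp add: velocity_def[of S I'] \<xi>_def[symmetric] velocity_eq)

lemma reparam_geodesic: "causal_geodesic S I' \<xi>"
  unfolding causal_geodesic_def
proof (intro conjI ballI)
  show "nondegenerate_interval I'" by (rule interval_I')
  show "smooth_curve S I' \<xi>" unfolding smooth_curve_def
  proof (intro conjI ballI)
    have "continuous_on I \<eta>" using geo by (simp add: causal_geodesic_def smooth_curve_def)
    then show "continuous_on I' \<xi>" unfolding \<xi>_def[abs_def]
      by (rule continuous_on_compose2) (auto simp: I'_def intro!: continuous_intros)
    fix c assume c: "c \<in> atlas S"
    have "Cinf UNIV (\<lambda>\<tau>. t0 + r * \<tau>)" by (intro Cinf_add Cinf_mult Cinf_const Cinf_ident open_UNIV)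
    then have "smooth_on {\<tau> \<in> I'. \<xi> \<tau> \<in> fst c} (\<lambda>\<tau>. t0 + r * \<tau>)" by (rule Cinf_smooth_on) simp
    then have "smooth_on {\<tau> \<in> I'. \<xi> \<tau> \<in> fst c} (\<lambda>\<tau>. Xc c (t0 + r * \<tau>))"
      by (rule smooth_on_compose[OF _ smooth_Xc[OF c]]) (auto simp: Kc_def I'_def \<xi>_def)
    then show "smooth_on {\<tau> \<in> I'. \<xi> \<tau> \<in> fst c} (snd c \<circ> \<xi>)" by (simp add: o_def Xc_def \<xi>_def)
  qed
  show "future_directed S (\<xi> \<tau>) (velocity S I' \<xi> \<tau>)" if "\<tau> \<in> I'" for \<tau>
    using future_directed_scale[OF future_velocity[OF I'D[OF that]] r] reparam_velocity[OF that] by (simp add: \<xi>_def)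
  show "geodesic_eq S I' \<xi>" unfolding geodesic_eq_def
  proof (intro ballI impI allI)
    fix c \<tau> \<alpha> assume c: "c \<in> atlas S" and \<tau>: "\<tau> \<in> I'" "\<xi> \<tau> \<in> fst c"
    interpret C: finsler_chart "snd c ` fst c" "lc c" by (rule finsler_chart[OF c])
    have tK: "t0 + r * \<tau> \<in> Kc c" using \<tau> by (simp add: Kc_def I'_def \<xi>_def)
    let ?K = "{\<tau> \<in> I'. t0 + r * \<tau> \<in> Kc c}"
    have "openin (top_of_set I') ?K"
    proof -
      obtain O' where O': "open O'" "Kc c = I \<inter> O'" using Kc_openin[OF c] by (auto simp: openin_open)
      have "?K = I' \<inter> (\<lambda>\<tau>. t0 + r * \<tau>) -` O'" using O'(2) by (auto simp: I'_def)
      moreover have "open ((\<lambda>\<tau>. t0 + r * \<tau>) -` O')"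
        by (rule open_vimage[OF O'(1)]) (auto intro!: continuous_intros)
      ultimately show ?thesis by (auto simp: openin_open)
    qed
    then have "cderiv I' (cderiv I' (snd c \<circ> \<xi>)) \<tau> = cderiv I' (\<lambda>\<tau>. r *\<^sub>R Vc c (t0 + r * \<tau>)) \<tau>"
      by (rule J.cderiv_cong) (use \<tau> tK reparam_cderiv_X[OF c] in auto)
    also have "\<dots> = r *\<^sub>R (r *\<^sub>R (- 2 *\<^sub>R Gc c (zc c (t0 + r * \<tau>))))"
      by (rule J.cderiv_eqI[OF \<tau>(1)])
        (rule bounded_linear.has_vector_derivative[OF bounded_linear_scaleR_right reparam_derivative[OF Vc_derivative[OF c tK]]])
    finally have "cderiv I' (cderiv I' (snd c \<circ> \<xi>)) \<tau> = - 2 *\<^sub>R (r\<^sup>2 *\<^sub>R C.G (zc c (t0 + r * \<tau>)))"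
      by (simp add: power2_eq_square mult_ac)
    \<comment> \<open>Rescaling the parameter multiplies the acceleration by the square of
      \<open>r\<close>, which the degree 2 of the spray absorbs.\<close>
    also have "r\<^sup>2 *\<^sub>R C.G (zc c (t0 + r * \<tau>)) = C.G (snd c (\<xi> \<tau>), r *\<^sub>R Vc c (t0 + r * \<tau>))"
      using pos_homogeneousD[OF C.hom_G _ _ r, of "Xc c (t0 + r * \<tau>)" "Vc c (t0 + r * \<tau>)"] zc_W[OF c tK]
      by (simp add: zc_def Xc_def \<xi>_def)
    finally have e: "cderiv I' (cderiv I' (snd c \<circ> \<xi>)) \<tau> = - 2 *\<^sub>R C.G (snd c (\<xi> \<tau>), r *\<^sub>R Vc c (t0 + r * \<tau>))" .
    show "cderiv I' (cderiv I' (snd c \<circ> \<xi>)) \<tau> $ \<alpha>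
        + 2 * Gspray (lc c) \<alpha> (snd c (\<xi> \<tau>), cderiv I' (snd c \<circ> \<xi>) \<tau>) = 0"
      unfolding e reparam_cderiv_X[OF c \<tau>(1) tK] by (simp add: C.G_def)
  qed
qed

lemma reparam_psi: "\<tau> \<in> I' \<Longrightarrow> psi_along S I' \<xi> \<tau> = psi_along S I \<eta> (t0 + r * \<tau>)"
  using weight_scale[OF future_velocity[OF I'D] r] reparam_velocity by (simp add: psi_along_def \<xi>_def)

lemma reparam_psi_cderiv:
  assumes "\<tau> \<in> I'" shows "cderiv I' (psi_along S I' \<xi>) \<tau> = r * cderiv I (psi_along S I \<eta>) (t0 + r * \<tau>)"
proof -
  have op: "openin (top_of_set I') I'" by simp
  have "cderiv I' (psi_along S I' \<xi>) \<tau> = cderiv I' (\<lambda>\<tau>. psi_along S I \<eta> (t0 + r * \<tau>)) \<tau>"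
    by (rule J.cderiv_cong[OF op assms]) (rule reparam_psi)
  also have "\<dots> = r *\<^sub>R cderiv I (psi_along S I \<eta>) (t0 + r * \<tau>)"
    by (intro J.cderiv_eqI[OF assms] reparam_derivative smooth_on_has_cderiv[OF _ smooth_psi] I'D[OF assms]) simp
  finally show ?thesis by simp
qed

lemma reparam_psi_cderiv2: "cderiv I' (cderiv I' (psi_along S I' \<xi>)) 0 = r\<^sup>2 * cderiv I (cderiv I (psi_along S I \<eta>)) t0"
proof -
  have op: "openin (top_of_set I') I'" "openin (top_of_set I) I" by simp_all
  have 0: "0 \<in> I'" using t0 by (simp add: I'_def)
  have "cderiv I' (cderiv I' (psi_along S I' \<xi>)) 0 = cderiv I' (\<lambda>\<tau>. r *\<^sub>R cderiv I (psi_along S I \<eta>) (t0 + r * \<tau>)) 0"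
    by (rule J.cderiv_cong[OF op(1) 0]) (simp add: reparam_psi_cderiv)
  also have "\<dots> = r *\<^sub>R (r *\<^sub>R cderiv I (cderiv I (psi_along S I \<eta>)) (t0 + r * 0))"
    by (intro J.cderiv_eqI[OF 0] bounded_linear.has_vector_derivative[OF bounded_linear_scaleR_right] reparam_derivative
        smooth_on_has_cderiv[OF op(2) smooth_on_cderiv[OF op(2) smooth_psi]]) (simp add: t0)
  finally show ?thesis by (simp add: power2_eq_square)
qed

text \<open>\<open>geodesic_from\<close> picks an unspecified geodesic. The reparametrised one shows
  that a choice is possible, and \<open>psi_derivatives_agree\<close> identifies the derivatives
  along both.\<close>

lemma psi_d_scaled:
  "psi_d1 S (\<eta> t0) (r *\<^sub>R velocity S I \<eta> t0) = r * cderiv I (psi_along S I \<eta>) t0"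
  "psi_d2 S (\<eta> t0) (r *\<^sub>R velocity S I \<eta> t0) = r\<^sup>2 * cderiv I (cderiv I (psi_along S I \<eta>)) t0"
proof -
  let ?w = "r *\<^sub>R velocity S I \<eta> t0"
  let ?Q = "\<lambda>(I, \<xi>). causal_geodesic S I \<xi> \<and> 0 \<in> I \<and> \<xi> 0 = \<eta> t0 \<and> velocity S I \<xi> 0 = ?w"
  have 0: "0 \<in> I'" using t0 by (simp add: I'_def)
  have own: "\<xi> 0 = \<eta> t0" "velocity S I' \<xi> 0 = ?w" using reparam_velocity[OF 0] by (simp_all add: \<xi>_def)
  then have "?Q (I', \<xi>)" using reparam_geodesic 0 by simp
  then have Q: "?Q (Eps ?Q)" by (rule someI)
  obtain I2 \<zeta> where e: "Eps ?Q = (I2, \<zeta>)" by (cases "Eps ?Q") auto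
  have ge: "geodesic_from S (\<eta> t0) ?w = (I2, \<zeta>)" unfolding geodesic_from_def by (rule e)
  have z: "causal_geodesic S I2 \<zeta>" "0 \<in> I2" "\<zeta> 0 = \<eta> t0" "velocity S I2 \<zeta> 0 = ?w" using Q e by auto
  have g1: "geodesic S I2 \<zeta>" by unfold_locales (rule z(1))
  have g2: "geodesic S I' \<xi>" by unfold_locales (rule reparam_geodesic)
  note a = psi_derivatives_agree[OF g1 g2 z(2) 0]
  show "psi_d1 S (\<eta> t0) ?w = r * cderiv I (psi_along S I \<eta>) t0"
    using a(1) z own reparam_psi_cderiv[OF 0] by (simp add: psi_d1_def ge)
  show "psi_d2 S (\<eta> t0) ?w = r\<^sup>2 * cderiv I (cderiv I (psi_along S I \<eta>)) t0"
    using a(2) z own reparam_psi_cderiv2 by (simp add: psi_d2_def ge)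
qed

lemma Ric_scaled: "Ric S (\<eta> t0) (r *\<^sub>R velocity S I \<eta> t0) = r\<^sup>2 * Ric S (\<eta> t0) (velocity S I \<eta> t0)"
proof -
  interpret C: finsler_chart "snd (c0 t0) ` fst (c0 t0)" "lc (c0 t0)" by (rule finsler_chart[OF chart_in(1)])
  have "snd (c0 t0) (\<eta> t0) \<in> snd (c0 t0) ` fst (c0 t0)" using chart_in by auto
  from C.Rmat_scale[OF this velocity_nonzero[OF t0] r]
  show ?thesis by (simp add: Ric_def curvature_def coords_def trace_def sum_distrib_left)
qed

end

section \<open>The Riccati equation and its trace\<close>

lemma Cinf_matrix_inv_self: "Cinf {A :: real ^ 'i ^ 'i::finite. invertible A} matrix_inv"
proof -
  let ?U = "{A :: real ^ 'i ^ 'i. invertible A}"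
  have nth: "bounded_linear (\<lambda>A :: real ^ 'i ^ 'i. A $ i $ j)" for i j
    by (rule bounded_linear_compose[OF bounded_linear_vec_nth bounded_linear_vec_nth])
  have det: "Cinf (UNIV :: (real ^ 'i ^ 'i) set) det"
    unfolding det_def[abs_def] by (intro Cinf_sum Cinf_mult Cinf_prod Cinf_const Cinf_bounded_linear nth open_UNIV)
  have "open (det -` (- {0 :: real}) :: (real ^ 'i ^ 'i) set)"
    using continuous_open_preimage[OF Cinf_continuous_on[OF det] open_UNIV, of "- {0}"] by auto
  moreover have "?U = det -` (- {0})" by (auto simp: invertible_det_nz)
  ultimately have op: "open ?U" by simp
  have "Cinf ?U (\<lambda>A. matrix_inv A $ k $ j)" for k j
    by (rule Cinf_matrix_inv[of ?U "\<lambda>A. A"]) (auto intro: Cinf_bounded_linear nth op)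
  then have "Cinf ?U (\<lambda>A. \<chi> k j. matrix_inv A $ k $ j)" by (intro Cinf_vec op)
  then show ?thesis by simp
qed

lemma bounded_linear_trace: "bounded_linear (trace :: real ^ 'i ^ 'i::finite \<Rightarrow> real)"
  unfolding linear_conv_bounded_linear[symmetric]
  by (rule linearI) (simp_all add: trace_def sum.distrib sum_distrib_left)

lemma trace_scale: "trace (r *\<^sub>R A) = r * trace (A :: real ^ 'i ^ 'i::finite)"
  by (simp add: trace_def sum_distrib_left)

lemma trace_minus: "trace (- A) = - trace (A :: real ^ 'i ^ 'i::finite)"
  by (simp add: trace_def sum_negf)

lemma matrix_mul_scaleR:
  fixes A B :: "real ^ 'i ^ 'i::finite"
  shows "(r *\<^sub>R A) ** B = r *\<^sub>R (A ** B)" "A ** (r *\<^sub>R B) = r *\<^sub>R (A ** B)"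
  by (simp_all add: vec_eq_iff matrix_matrix_mult_def sum_distrib_left mult_ac)

lemma matrix_mul_diff:
  fixes A B :: "real ^ 'i ^ 'i::finite"
  shows "(A - B) ** C = A ** C - B ** C" "C ** (A - B) = C ** A - C ** B"
  by (simp_all add: vec_eq_iff matrix_matrix_mult_def sum_subtractf left_diff_distrib right_diff_distrib)

lemma matrix_mul_add:
  fixes A B :: "real ^ 'i ^ 'i::finite"
  shows "(A + B) ** C = A ** C + B ** C" "C ** (A + B) = C ** A + C ** B"
  by (simp_all add: vec_eq_iff matrix_matrix_mult_def sum.distrib distrib_left distrib_right)

lemma matrix_mul_minus:
  fixes A B :: "real ^ 'i ^ 'i::finite"
  shows "(- A) ** C = - (A ** C)" "C ** (- A) = - (C ** A)"
  by (simp_all add: vec_eq_iff matrix_matrix_mult_def sum_negf)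

lemma matrix_vector_mult_minus:
  fixes A :: "real ^ 'i ^ 'j::finite" shows "(- A) *v w = - (A *v w)"
  by (simp add: vec_eq_iff matrix_vector_mult_def sum_negf)

context null_geodesic
begin

lemma Dm_product:
  assumes c: "c \<in> atlas S" and A: "smooth_on (Kc c) A" and B: "smooth_on (Kc c) B" and t: "t \<in> Kc c"
  shows "Dm c (\<lambda>s. A s ** B s) t = Dm c A t ** B t + A t ** Dm c B t"
proof -
  note K = Kc_openin[OF c]
  have "((\<lambda>s. A s ** B s) has_vector_derivative A t ** cderiv I B t + cderiv I A t ** B t) (at t within I)"
    by (rule bounded_bilinear.has_vector_derivative[OF bounded_bilinear_matrix_mult smooth_on_has_cderiv[OF K A t] smooth_on_has_cderiv[OF K B t]])
  then have "cderiv I (\<lambda>s. A s ** B s) t = A t ** cderiv I B t + cderiv I A t ** B t"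
    using t by (intro cderiv_eqI) (auto simp: Kc_def)
  then show ?thesis by (simp add: Dm_def matrix_mul_add matrix_mul_diff matrix_mul_assoc)
qed

lemma Dm_cong:
  assumes c: "c \<in> atlas S" and t: "t \<in> Kc c" and "\<And>s. s \<in> Kc c \<Longrightarrow> A s = B s"
  shows "Dm c A t = Dm c B t"
  using cderiv_cong[OF Kc_openin[OF c] t, of A B] assms by (simp add: Dm_def)

lemma Dm_diff:
  assumes c: "c \<in> atlas S" and A: "smooth_on (Kc c) A" and B: "smooth_on (Kc c) B" and t: "t \<in> Kc c"
  shows "Dm c (\<lambda>s. A s - B s) t = Dm c A t - Dm c B t"
proof -
  note K = Kc_openin[OF c]
  have "cderiv I (\<lambda>s. A s - B s) t = cderiv I A t - cderiv I B t"
    using t by (intro cderiv_eqI has_vector_derivative_diff smooth_on_has_cderiv[OF K A t] smooth_on_has_cderiv[OF K B t]) (auto simp: Kc_def)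
  then show ?thesis by (simp add: Dm_def matrix_mul_diff)
qed

lemma Dm_one: "t \<in> Kc c \<Longrightarrow> Dm c (\<lambda>s. mat 1) t = 0"
  using cderiv_eqI[OF _ has_vector_derivative_const, of t "mat 1 :: real ^ 'i ^ 'i"] by (simp add: Dm_def Kc_def)

lemma Dm_scale:
  fixes f :: "real \<Rightarrow> real"
  assumes c: "c \<in> atlas S" and A: "smooth_on (Kc c) A" and f: "(f has_vector_derivative f') (at t within I)" and t: "t \<in> Kc c"
  shows "Dm c (\<lambda>s. f s *\<^sub>R A s) t = f t *\<^sub>R Dm c A t + f' *\<^sub>R A t"
proof -
  have "cderiv I (\<lambda>s. f s *\<^sub>R A s) t = f t *\<^sub>R cderiv I A t + f' *\<^sub>R A t"
    using t by (intro cderiv_eqI bounded_bilinear.has_vector_derivative[OF bounded_bilinear_scaleR f]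
        smooth_on_has_cderiv[OF Kc_openin[OF c] A t]) (auto simp: Kc_def)
  then show ?thesis by (simp add: Dm_def matrix_mul_scaleR algebra_simps)
qed

lemma smooth_Dm:
  assumes c: "c \<in> atlas S" and A: "smooth_on (Kc c) A" shows "smooth_on (Kc c) (Dm c A)"
  unfolding Dm_def[abs_def]
  by (intro smooth_on_diff smooth_on_add smooth_on_bilinear[OF bounded_bilinear_matrix_mult] smooth_Nc c A
      smooth_on_cderiv[OF Kc_openin[OF c] A])

text \<open>\<open>Dm\<close> differs from the entrywise derivative by a commutator, which has trace
  0.\<close>

lemma trace_derivative:
  assumes c: "c \<in> atlas S" and A: "smooth_on (Kc c) A" and t: "t \<in> Kc c"
  shows "((\<lambda>s. trace (A s)) has_vector_derivative trace (Dm c A t)) (at t within I)"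
proof -
  have "trace (Dm c A t) = trace (cderiv I A t)"
    using trace_mul_sym[of "Nz c t" "A t"] by (simp add: Dm_def trace_add trace_sub)
  then show ?thesis
    using bounded_linear.has_vector_derivative[OF bounded_linear_trace smooth_on_has_cderiv[OF Kc_openin[OF c] A t]] by simp
qed

end

section \<open>Jacobi tensors in a chart\<close>

locale jacobi_geodesic = null_geodesic S I \<eta>
  for S :: "('m::{t2_space, second_countable_topology}, 'i::finite) finsler_data" and I \<eta> +
  fixes J :: "'i qfield"
  assumes jac: "jacobi_tensor S I \<eta> J" and nons: "nonsingular S I \<eta> J"
begin

lemma smooth_J: "smooth_qfield S I \<eta> J" using jac by (simp add: jacobi_tensor_def)

context
  fixes c M
  assumes c: "c \<in> atlas S" and M: "smooth_on (Kc c) M" and rep: "\<And>t. t \<in> Kc c \<Longrightarrow> repr c t (J t) (M t)"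
begin

text \<open>\<open>Tm\<close> extends the matrix of \<open>J\<close>, which is singular off the range of the projection, to an
  invertible matrix; \<open>Xm\<close> is the matrix of \<open>J'\<close>, so \<open>Xm t ** Km t\<close> is that of \<open>J' J\<^sup>-\<^sup>1\<close>.\<close>

definition Tm where "Tm t = M t + mat 1 - Pj c t"
definition Km where "Km t = matrix_inv (Tm t)"
definition Xm where "Xm t = Pj c t ** Dm c M t ** Pj c t"

lemma smooth_Tm: "smooth_on (Kc c) Tm"
  unfolding Tm_def by (intro smooth_on_diff smooth_on_add smooth_on_const M smooth_proj c)

lemma smooth_Xm: "smooth_on (Kc c) Xm"
  unfolding Xm_def by (intro smooth_on_bilinear[OF bounded_bilinear_matrix_mult] smooth_proj smooth_Dm c M)

context
  fixes t assumes t: "t \<in> Kc c"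
begin

interpretation Q: quotient_model "Pc c t" "Vc c t" "gvel S I \<eta> t" "v t" "to_chart S c (\<eta> t)" "of_chart S c (\<eta> t)"
  by (rule model[OF c t])

lemma bij_J: "bij_betw (J t) (Qsp (gvel S I \<eta> t) (v t)) (Qsp (gvel S I \<eta> t) (v t))"
  using nons t by (simp add: nonsingular_def Qeta_def Kc_def)

lemma Tm_invertible: "invertible (Tm t)"
  unfolding Tm_def by (rule Q.completion_invertible[OF rep[OF t] bij_J])

lemmas Km_facts = Q.completion_inverse[OF Q.represents_compressed[OF rep[OF t]]
    Q.completion_invertible[OF rep[OF t] bij_J], folded Tm_def Km_def]

lemma Tm_Km: "Tm t ** Km t = mat 1" "Km t ** Tm t = mat 1"
  unfolding Km_def using matrix_inv_mult[OF Tm_invertible] .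

lemma Xm_represents: "repr c t (qfield_deriv S I \<eta> J t) (Xm t)"
  unfolding Xm_def by (rule qfield_deriv_represents[OF smooth_J c M rep t])

lemma Xm_proj: "Pj c t ** Xm t = Xm t" "Xm t ** Pj c t = Xm t"
  using Q.represents_compressed[OF Xm_represents] by (auto simp: Q.compressed_def)

lemma M_proj: "Pj c t ** M t = M t" "M t ** Pj c t = M t"
  using Q.represents_compressed[OF rep[OF t]] by (auto simp: Q.compressed_def)

lemma proj_Km: "Km t ** Pj c t = Pj c t ** Km t" by (rule Km_facts(1))

text \<open>Differentiate \<open>Pj ** Pj = Pj\<close> by the Leibniz rule and compress on both
  sides: the result equals twice itself.\<close>

lemma Dm_proj: "Pj c t ** Dm c (Pj c) t ** Pj c t = 0"
proof -
  let ?P = "Pj c t" and ?D = "Dm c (Pj c) t"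
  have "Dm c (\<lambda>s. Pj c s ** Pj c s) t = ?D"
    by (rule Dm_cong[OF c t]) (use quotient_model.axioms(1)[OF model[OF c]] orthogonal_pair.proj_idem in blast)
  then have "?D = ?D ** ?P + ?P ** ?D" using Dm_product[OF c smooth_proj[OF c] smooth_proj[OF c] t] by simp
  then have "?P ** ?D ** ?P = ?P ** (?D ** ?P + ?P ** ?D) ** ?P" by simp
  also have "\<dots> = ?P ** ?D ** (?P ** ?P) + (?P ** ?P) ** ?D ** ?P"
    by (simp add: matrix_mul_add matrix_mul_assoc)
  also have "\<dots> = ?P ** ?D ** ?P + ?P ** ?D ** ?P" by (simp add: Q.proj_idem)
  finally show ?thesis by simp
qed

text \<open>Cyclicity of the trace places a projection on each side of the derivative, so that
  \<open>Dm_proj\<close> applies.\<close>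

lemma trace_compressed_Dm_proj:
  assumes "Pj c t ** Y = Y" "Y ** Pj c t = Y" shows "trace (Y ** Dm c (Pj c) t) = 0"
proof -
  have "trace (Y ** Dm c (Pj c) t) = trace ((Pj c t ** Y ** Pj c t) ** Dm c (Pj c) t)" using assms by simp
  also have "\<dots> = trace (Pj c t ** (Y ** Pj c t ** Dm c (Pj c) t))" by (simp add: matrix_mul_assoc)
  also have "\<dots> = trace (Y ** Pj c t ** Dm c (Pj c) t ** Pj c t)" by (rule trace_mul_sym)
  also have "\<dots> = trace (Y ** (Pj c t ** Dm c (Pj c) t ** Pj c t))" by (simp add: matrix_mul_assoc)
  finally show ?thesis unfolding Dm_proj by (simp add: trace_def matrix_matrix_mult_def)
qed

end

lemma smooth_Km: "smooth_on (Kc c) Km"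
  unfolding Km_def[abs_def] by (rule smooth_on_Cinf_compose[OF smooth_Tm Cinf_matrix_inv_self]) (simp add: Tm_invertible)

lemma Dm_Tm: "t \<in> Kc c \<Longrightarrow> Dm c Tm t = Dm c M t - Dm c (Pj c) t"
proof -
  assume t: "t \<in> Kc c"
  have 1: "smooth_on (Kc c) (\<lambda>s. Pj c s - mat 1)" by (intro smooth_on_diff smooth_proj c smooth_on_const)
  have "Dm c Tm t = Dm c (\<lambda>s. M s - (Pj c s - mat 1)) t"
    by (rule Dm_cong[OF c t]) (simp add: Tm_def)
  also have "\<dots> = Dm c M t - (Dm c (Pj c) t - Dm c (\<lambda>s. mat 1) t)"
    using Dm_diff[OF c M 1 t] Dm_diff[OF c smooth_proj[OF c] smooth_on_const t] by simp
  finally show ?thesis by (simp add: Dm_one[OF t])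
qed

lemma Dm_Km: "t \<in> Kc c \<Longrightarrow> Dm c Km t = - (Km t ** Dm c Tm t ** Km t)"
proof -
  assume t: "t \<in> Kc c"
  have "Dm c (\<lambda>s. Tm s ** Km s) t = Dm c (\<lambda>s. mat 1) t" by (rule Dm_cong[OF c t]) (simp add: Tm_Km)
  then have "Tm t ** Dm c Km t = - (Dm c Tm t ** Km t)"
    using Dm_product[OF c smooth_Tm smooth_Km t] Dm_one[OF t] by (simp add: eq_neg_iff_add_eq_0 add.commute)
  then have "Km t ** (Tm t ** Dm c Km t) = - (Km t ** (Dm c Tm t ** Km t))" by (simp add: matrix_mul_minus)
  then show ?thesis by (simp add: matrix_mul_assoc Tm_Km[OF t])
qed

text \<open>Trace of the Riccati equation \<open>B' + B\<^sup>2 = J'' J\<^sup>-\<^sup>1\<close> for \<open>B = J' J\<^sup>-\<^sup>1\<close>.\<close>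

lemma trace_riccati:
  assumes t: "t \<in> Kc c"
  shows "((\<lambda>s. trace (Xm s ** Km s)) has_vector_derivative
    trace (Pj c t ** Dm c Xm t ** Pj c t ** Km t) - trace (Xm t ** Km t ** (Xm t ** Km t))) (at t within I)"
proof -
  let ?P = "Pj c t" and ?X = "Xm t" and ?K = "Km t"
  note XP = Xm_proj[OF t] and PK = proj_Km[OF t]
  have KXP: "?P ** (?K ** ?X) = ?K ** ?X" "(?K ** ?X) ** ?P = ?K ** ?X"
    using XP PK by (metis matrix_mul_assoc)+
  have KXKP: "?P ** (?K ** ?X ** ?K) = ?K ** ?X ** ?K" "(?K ** ?X ** ?K) ** ?P = ?K ** ?X ** ?K"
    using KXP XP PK by (metis matrix_mul_assoc)+
  have "Dm c (\<lambda>s. Xm s ** Km s) t = Dm c Xm t ** ?K + ?X ** Dm c Km t" by (rule Dm_product[OF c smooth_Xm smooth_Km t])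
  then have D: "trace (Dm c (\<lambda>s. Xm s ** Km s) t) = trace (Dm c Xm t ** ?K) - trace (?X ** ?K ** Dm c Tm t ** ?K)"
    by (simp add: Dm_Km[OF t] matrix_mul_minus trace_sub matrix_mul_assoc)
  \<comment> \<open>Differentiating \<open>Xm = Xm ** Pj\<close> yields the right-hand projection
    and an error term that has trace 0 against the compressed \<open>?K ** ?X\<close>. The left-hand
    projection comes from cyclicity.\<close>
  have 1: "trace (Dm c Xm t ** ?K) = trace (?P ** Dm c Xm t ** ?P ** ?K)"
  proof -
    have "Dm c Xm t = Dm c (\<lambda>s. Xm s ** Pj c s) t" by (rule Dm_cong[OF c t]) (simp add: Xm_proj)
    also have "\<dots> = Dm c Xm t ** ?P + ?X ** Dm c (Pj c) t" by (rule Dm_product[OF c smooth_Xm smooth_proj[OF c] t])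
    finally have "trace (Dm c Xm t ** ?K) = trace ((Dm c Xm t ** ?P + ?X ** Dm c (Pj c) t) ** ?K)" by simp
    also have "\<dots> = trace (Dm c Xm t ** ?P ** ?K) + trace (?X ** Dm c (Pj c) t ** ?K)"
      by (simp add: matrix_mul_add trace_add)
    also have "trace (?X ** Dm c (Pj c) t ** ?K) = trace (?K ** (?X ** Dm c (Pj c) t))" by (rule trace_mul_sym)
    also have "\<dots> = trace ((?K ** ?X) ** Dm c (Pj c) t)" by (simp add: matrix_mul_assoc)
    also have "\<dots> = 0" by (rule trace_compressed_Dm_proj[OF t KXP])
    also have "trace (Dm c Xm t ** ?P ** ?K) = trace (Dm c Xm t ** ?P ** ?K ** ?P)"
    proof -
      have "?P ** ?K = ?P ** ?K ** ?P"
        using orthogonal_pair.proj_idem[OF quotient_model.axioms(1)[OF model[OF c t]]] PK by (metis matrix_mul_assoc)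
      then show ?thesis by (metis matrix_mul_assoc)
    qed
    also have "\<dots> = trace (?P ** (Dm c Xm t ** ?P ** ?K))" by (rule trace_mul_sym)
    finally show ?thesis by (simp add: matrix_mul_assoc)
  qed
  \<comment> \<open>The derivatives of \<open>Tm\<close> and \<open>M\<close> differ by that of
    \<open>Pj\<close>, which has trace 0 against the compressed \<open>?Y\<close>; cyclicity then
    compresses \<open>Dm c M t\<close> to \<open>Xm t\<close>.\<close>
  have 2: "trace (?X ** ?K ** Dm c Tm t ** ?K) = trace (?X ** ?K ** (?X ** ?K))"
  proof -
    let ?Y = "?K ** ?X ** ?K"
    have "trace (?X ** ?K ** Dm c Tm t ** ?K) = trace (?K ** (?X ** ?K ** Dm c Tm t))" by (rule trace_mul_sym)
    also have "\<dots> = trace (?Y ** Dm c M t) - trace (?Y ** Dm c (Pj c) t)"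
      by (simp add: Dm_Tm[OF t] matrix_mul_assoc matrix_mul_diff trace_sub)
    also have "trace (?Y ** Dm c (Pj c) t) = 0" by (rule trace_compressed_Dm_proj[OF t KXKP])
    also have "trace (?Y ** Dm c M t) = trace (?P ** (?Y ** ?P ** Dm c M t))" using KXKP by (simp add: matrix_mul_assoc)
    also have "\<dots> = trace (?Y ** ?P ** Dm c M t ** ?P)" by (rule trace_mul_sym)
    also have "\<dots> = trace (?Y ** ?X)" by (simp add: Xm_def matrix_mul_assoc)
    also have "\<dots> = trace (?K ** (?X ** ?K ** ?X))" by (simp add: matrix_mul_assoc)
    also have "\<dots> = trace (?X ** ?K ** ?X ** ?K)" by (rule trace_mul_sym)
    finally show ?thesis by (simp add: matrix_mul_assoc)
  qed
  show ?thesis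
    using trace_derivative[OF c smooth_on_bilinear[OF bounded_bilinear_matrix_mult smooth_Xm smooth_Km] t] D 1 2 by simp
qed

lemma Xm2_represents: "t \<in> Kc c \<Longrightarrow> repr c t (qfield_deriv S I \<eta> (qfield_deriv S I \<eta> J) t) (Pj c t ** Dm c Xm t ** Pj c t)"
  by (rule qfield_deriv_represents[OF smooth_qfield_deriv[OF smooth_J] c smooth_Xm Xm_represents])

text \<open>The chart is the preferred one at \<open>\<eta> t\<close>, where
  \<open>curvature\<close> is defined and vectors are their own components. The Jacobi equation
  makes the matrix of the second derivative \<open>- Pj R M\<close>, and multiplying by
  \<open>Km\<close> leaves \<open>- Pj R Pj\<close>.\<close>

lemma jacobi_trace:
  assumes t: "t \<in> I" and c0: "c = c0 t"
  shows "trace (Pj c t ** Dm c Xm t ** Pj c t ** Km t) = - Ric S (\<eta> t) (v t)"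
proof -
  have tK: "t \<in> Kc c" using Kc_self[OF t] c0 by simp
  interpret Q: quotient_model "Pc c t" "Vc c t" "gvel S I \<eta> t" "v t" "to_chart S c (\<eta> t)" "of_chart S c (\<eta> t)"
    by (rule model[OF c tK])
  interpret C: finsler_chart "snd c ` fst c" "lc c" by (rule finsler_chart[OF c])
  let ?R = "curvature S (\<eta> t) (v t)" and ?X2 = "Pj c t ** Dm c Xm t ** Pj c t" and ?P = "Pj c t"
  have B: "of_chart S c (\<eta> t) u = u" for u
    unfolding of_chart_def c0 by (rule tchange_id[OF chart_in])
  have cls: "Q.cls y = qclass (v t) y" for y by (simp add: Q.cls_def B)
  have vV: "v t = Vc c t" using velocity_eq by (simp add: vel_def c0)
  have R: "?R = Rmat (lc c) (zc c t)" by (simp add: curvature_def coords_def zc_def Xc_def vV c0)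
  have z: "zc c t \<in> C.W" by (rule zc_W[OF c tK])
  have RV: "?R *v Vc c t = 0" using C.Rmat_radial[of "Xc c t" "Vc c t"] z R by (simp add: zc_def)
  have PR: "Pc c t \<bullet> (?R *v w) = 0" for w using C.p_Rmat[OF z, of w] Pc_inner[OF c tK] R by simp
  note X2 = Xm2_represents[OF tK]
  have X2D: "?X2 *v (?P *v w) = ?X2 *v w" "?P *v (?X2 *v w) = ?X2 *v w" for w
    using Q.compressedD(1,2)[OF Q.represents_compressed[OF X2]] by auto
  have "?X2 *v w = (- (?P ** ?R ** M t)) *v w" for w
  proof -
    let ?y = "?P *v w"
    have y: "Pc c t \<bullet> ?y = 0" by (rule Q.P_proj)
    have "Q.cls ?y \<in> Qeta S I \<eta> t" unfolding Qeta_def by (rule Q.cls_in_Qsp[OF y])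
    then have "qadd (qfield_deriv S I \<eta> (qfield_deriv S I \<eta> J) t (Q.cls ?y)) (Rq S I \<eta> t (J t (Q.cls ?y))) = qclass (v t) 0"
      using jac t by (simp add: jacobi_tensor_def)
    moreover have "Rq S I \<eta> t (J t (Q.cls ?y)) = Q.cls (?R *v (M t *v ?y))"
      using Q.represents_apply[OF rep[OF tK] y] by (simp add: Rq_def cls qinduced_qclass[OF RV[folded vV]])
    ultimately have "Q.cls (?X2 *v ?y + ?R *v (M t *v ?y)) = Q.cls 0"
      using Q.represents_apply[OF X2 y] by (simp add: Q.cls_add Q.cls_0)
    then obtain r where "?X2 *v ?y + ?R *v (M t *v ?y) = 0 + r *\<^sub>R Vc c t" using Q.cls_eq_iff by blast
    \<comment> \<open>An equation between classes holds up to a multiple of the velocity; the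
      projection removes that multiple.\<close>
    then have "?P *v (?X2 *v ?y + ?R *v (M t *v ?y)) = ?P *v (r *\<^sub>R Vc c t)" by simp
    then have "?X2 *v w + ?P *v (?R *v (M t *v w)) = 0"
      using Q.compressedD(1)[OF Q.represents_compressed[OF rep[OF tK]]]
      by (simp only: matrix_vector_right_distrib matrix_vector_mult_scaleR Q.proj_V X2D scaleR_zero_right)
    then show ?thesis
      by (simp add: matrix_vector_mult_minus matrix_vector_mul_assoc eq_neg_iff_add_eq_0 matrix_mul_assoc)
  qed
  then have "?X2 = - (?P ** ?R ** M t)" by (simp add: matrix_eq)
  then have "trace (?X2 ** Km t) = - trace (?P ** ?R ** (M t ** Km t))"
    by (simp add: matrix_mul_minus trace_minus matrix_mul_assoc)
  also have "M t ** Km t = ?P" by (rule Km_facts(2)[OF tK])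
  also have "trace (?P ** ?R ** ?P) = trace (?P ** (?P ** ?R))" by (rule trace_mul_sym)
  also have "\<dots> = trace (?P ** ?R)" by (simp add: matrix_mul_assoc Q.proj_idem)
  also have "\<dots> = trace (?R ** ?P)" by (rule trace_mul_sym)
  \<comment> \<open>Both corrections in the trace vanish: \<open>PR\<close> annuls the one in
    direction \<open>Pc\<close>, \<open>RV\<close> the one in direction \<open>Vc\<close>.\<close>
  also have "\<dots> = trace ?R" unfolding Q.trace_mult_proj by (simp add: PR RV)
  finally show ?thesis by (simp add: Ric_def)
qed

section \<open>Expansion and shear in a chart\<close>

abbreviation \<psi> where "\<psi> \<equiv> psi_along S I \<eta>"

lemma psi_eta_eq: "psi_eta S I \<eta> = \<psi>" by (simp add: fun_eq_iff psi_eta_def)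

lemma psi_has_derivative: "t \<in> I \<Longrightarrow> (\<psi> has_vector_derivative cderiv I \<psi> t) (at t within I)"
  by (rule smooth_on_has_cderiv[OF _ smooth_psi]) simp_all

definition fac where "fac t = exp (- \<psi> t / (real CARD('i) - 2))"

lemma smooth_fac: "smooth_on I fac"
proof -
  have "smooth_on I (\<lambda>t. exp (\<psi> t * (- 1 / (real CARD('i) - 2))))" by (intro smooth_on_exp smooth_on_mult smooth_psi smooth_on_const)
  then show ?thesis by (simp add: fac_def[abs_def])
qed

lemma exp_psi_derivative:
  assumes "t \<in> I"
  shows "((\<lambda>t. exp (k * \<psi> t)) has_vector_derivative k * cderiv I \<psi> t * exp (k * \<psi> t)) (at t within I)"
proof -
  have "(\<psi> has_real_derivative cderiv I \<psi> t) (at t within I)"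
    using psi_has_derivative[OF assms] by (simp add: has_real_derivative_iff_has_vector_derivative)
  then have "((\<lambda>t. exp (k * \<psi> t)) has_real_derivative k * cderiv I \<psi> t * exp (k * \<psi> t)) (at t within I)"
    by (auto intro!: derivative_eq_intros)
  then show ?thesis by (simp add: has_real_derivative_iff_has_vector_derivative)
qed

lemma fac_derivative:
  assumes "t \<in> I" shows "(fac has_vector_derivative - (cderiv I \<psi> t / (real CARD('i) - 2)) * fac t) (at t within I)"
  using exp_psi_derivative[OF assms, of "- 1 / (real CARD('i) - 2)"] by (simp add: fac_def[abs_def])

lemma J_psi_eq: "J_psi S I \<eta> J = (\<lambda>t A. qscale (v t) (fac t) (J t A))"
  by (simp add: fun_eq_iff J_psi_def fac_def psi_eta_eq)

lemma smooth_J_psi: "smooth_qfield S I \<eta> (J_psi S I \<eta> J)"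
  unfolding J_psi_eq by (rule smooth_qfield_scale[OF smooth_J smooth_fac])

text \<open>The factor \<open>fac\<close> contributes \<open>- \<psi>' / (n - 1)\<close> through its
  logarithmic derivative and otherwise cancels against the inverse of \<open>J_psi\<close>.\<close>

lemma B_eps_represents:
  assumes t: "t \<in> Kc c"
  shows "repr c t (B_eps S I \<eta> \<epsilon> J t) (star_factor S I \<eta> \<epsilon> t *\<^sub>R (Xm t ** Km t - (cderiv I \<psi> t / (real CARD('i) - 2)) *\<^sub>R Pj c t))"
proof -
  have tI: "t \<in> I" using t by (simp add: Kc_def)
  interpret Q: quotient_model "Pc c t" "Vc c t" "gvel S I \<eta> t" "v t" "to_chart S c (\<eta> t)" "of_chart S c (\<eta> t)"
    by (rule model[OF c t])
  let ?F = "\<lambda>t. fac t *\<^sub>R M t" and ?J = "J_psi S I \<eta> J" and ?P = "Pj c t" and ?s = "star_factor S I \<eta> \<epsilon> t"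
  let ?f = "fac t" and ?f' = "- (cderiv I \<psi> t / (real CARD('i) - 2)) * fac t"
  have f: "?f > 0" by (simp add: fac_def)
  have smF: "smooth_on (Kc c) ?F"
    by (intro smooth_on_scaleR M smooth_on_subset[OF smooth_fac]) (auto simp: Kc_def)
  have repF: "repr c s (?J s) (?F s)" if "s \<in> Kc c" for s
    unfolding J_psi_eq by (rule quotient_model.represents_scale[OF model[OF c that] rep[OF that]])
  have d: "repr c t (qfield_deriv S I \<eta> ?J t) (?f *\<^sub>R Xm t + ?f' *\<^sub>R M t)"
  proof -
    have "?P ** Dm c ?F t ** ?P = ?f *\<^sub>R Xm t + ?f' *\<^sub>R M t"
      unfolding Dm_scale[OF c M fac_derivative[OF tI] t]
      by (simp add: matrix_mul_add matrix_mul_diff matrix_mul_scaleR Xm_def M_proj[OF t])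
    then show ?thesis using qfield_deriv_represents[OF smooth_J_psi c smF repF t] by simp
  qed
  have scale_bij: "bij_betw (qscale (v t) ?f) (Qsp (gvel S I \<eta> t) (v t)) (Qsp (gvel S I \<eta> t) (v t))"
    by (rule bij_betw_byWitness[of _ "qscale (v t) (1 / ?f)"]) (use f in \<open>auto simp: Q.Qsp_eq Q.cls_scale\<close>)
  have bij: "bij_betw (?J t) (Qsp (gvel S I \<eta> t) (v t)) (Qsp (gvel S I \<eta> t) (v t))"
    using bij_betw_trans[OF bij_J[OF t] scale_bij] by (simp add: J_psi_eq o_def)
  let ?R = "matrix_inv (?F t + mat 1 - ?P) ** ?P"
  note KF = Q.completion_inverse[OF Q.represents_compressed[OF repF[OF t]] Q.completion_invertible[OF repF[OF t] bij]]
  \<comment> \<open>The completion of \<open>fac t *\<^sub>R M t\<close> is in general no multiple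
    of that of \<open>M t\<close>, but the compressed inverses are proportional, by uniqueness of
    inverses on the complement.\<close>
  have R: "?R = (1 / ?f) *\<^sub>R (Km t ** ?P)"
  proof -
    have "?R = ?R ** ?P" using KF(3) by (simp add: Q.compressed_def)
    also have "\<dots> = ?R ** (M t ** (Km t ** ?P))" by (simp only: Km_facts(5)[OF t])
    also have "\<dots> = (1 / ?f) *\<^sub>R ((?R ** ?F t) ** (Km t ** ?P))"
      using f by (simp add: matrix_mul_scaleR matrix_mul_assoc)
    also have "?R ** ?F t = ?P" by (rule KF(4))
    also have "?P ** (Km t ** ?P) = Km t ** ?P" using Km_facts(3)[OF t] by (simp add: Q.compressed_def)
    finally show ?thesis .
  qed
  have inv: "repr c t (inv_into (Qeta S I \<eta> t) (?J t)) ((1 / ?f) *\<^sub>R (Km t ** ?P))"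
    using Q.represents_inverse[OF repF[OF t] bij] unfolding R Qeta_def .
  have "repr c t (B_eps S I \<eta> \<epsilon> J t) ((?s *\<^sub>R (?f *\<^sub>R Xm t + ?f' *\<^sub>R M t)) ** ((1 / ?f) *\<^sub>R (Km t ** ?P)))"
    using Q.represents_comp[OF Q.represents_scale[OF d] inv]
    unfolding B_eps_def qfield_star_def[abs_def] .
  moreover have "(?s *\<^sub>R (?f *\<^sub>R Xm t + ?f' *\<^sub>R M t)) ** ((1 / ?f) *\<^sub>R (Km t ** ?P))
      = ?s *\<^sub>R (Xm t ** Km t - (cderiv I \<psi> t / (real CARD('i) - 2)) *\<^sub>R ?P)"
  proof -
    have 1: "Xm t ** (Km t ** ?P) = Xm t ** Km t"
      using Xm_proj(2)[OF t] proj_Km[OF t] by (metis matrix_mul_assoc)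
    have "(?f *\<^sub>R Xm t + ?f' *\<^sub>R M t) ** (Km t ** ?P) = ?f *\<^sub>R (Xm t ** Km t) + ?f' *\<^sub>R ?P"
      by (simp only: matrix_mul_add matrix_mul_scaleR 1 Km_facts(5)[OF t])
    then have "(?s *\<^sub>R (?f *\<^sub>R Xm t + ?f' *\<^sub>R M t)) ** ((1 / ?f) *\<^sub>R (Km t ** ?P))
      = ?s *\<^sub>R ((1 / ?f) *\<^sub>R (?f *\<^sub>R (Xm t ** Km t) + ?f' *\<^sub>R ?P))"
      by (simp add: matrix_mul_scaleR)
    also have "(1 / ?f) *\<^sub>R (?f *\<^sub>R (Xm t ** Km t) + ?f' *\<^sub>R ?P) = Xm t ** Km t - (cderiv I \<psi> t / (real CARD('i) - 2)) *\<^sub>R ?P"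
      using f by (simp add: scaleR_diff_right)
    finally show ?thesis .
  qed
  ultimately show ?thesis by simp
qed

lemma proj_trace: "t \<in> Kc c \<Longrightarrow> trace (Pj c t) = real CARD('i) - 2"
  by (rule orthogonal_pair.trace_proj[OF quotient_model.axioms(1)[OF model[OF c]]])

text \<open>The projection has trace \<open>n - 1\<close>, which cancels the denominator of the
  \<psi>' term.\<close>

lemma theta_eps_eq:
  assumes t: "t \<in> Kc c" and dim: "real CARD('i) - 2 \<noteq> 0"
  shows "theta_eps S I \<eta> \<epsilon> J t = star_factor S I \<eta> \<epsilon> t * (trace (Xm t ** Km t) - cderiv I \<psi> t)"
  using quotient_model.qtrace_represents[OF model[OF c t] B_eps_represents[OF t]] dim
  by (simp add: theta_eps_def trace_scale trace_sub proj_trace[OF t])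

lemma tr_sigma_sq_eq:
  assumes t: "t \<in> Kc c" and dim: "real CARD('i) - 2 \<noteq> 0"
  shows "tr_sigma_sq S I \<eta> \<epsilon> J t = (star_factor S I \<eta> \<epsilon> t)\<^sup>2 * (trace (Xm t ** Km t ** (Xm t ** Km t))
    - 2 * (cderiv I \<psi> t / (real CARD('i) - 2)) * trace (Xm t ** Km t) + (cderiv I \<psi> t)\<^sup>2 / (real CARD('i) - 2)) - (theta_eps S I \<eta> \<epsilon> J t)\<^sup>2 / (real CARD('i) - 2)"
proof -
  interpret Q: quotient_model "Pc c t" "Vc c t" "gvel S I \<eta> t" "v t" "to_chart S c (\<eta> t)" "of_chart S c (\<eta> t)"
    by (rule model[OF c t])
  let ?B = "Xm t ** Km t" and ?P = "Pj c t" and ?s = "star_factor S I \<eta> \<epsilon> t" and ?th = "theta_eps S I \<eta> \<epsilon> J t"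
  let ?a = "cderiv I \<psi> t / (real CARD('i) - 2)"
  \<comment> \<open>The total coefficient in \<open>sigma_eps\<close> of the projection, which
    represents the identity of the quotient.\<close>
  define q where "q = ?s * ?a + ?th / (real CARD('i) - 2)"
  have BP: "?B ** ?P = ?B" "?P ** ?B = ?B"
    using Xm_proj[OF t] proj_Km[OF t] by (metis matrix_mul_assoc)+
  have "repr c t (sigma_eps S I \<eta> \<epsilon> J t) (?s *\<^sub>R (?B - ?a *\<^sub>R ?P) - (?th / (real CARD('i) - 2)) *\<^sub>R ?P)"
    using Q.represents_diff[OF B_eps_represents[OF t] Q.represents_scale[OF Q.represents_ident]]
    unfolding sigma_eps_def[abs_def] .
  moreover have "?s *\<^sub>R (?B - ?a *\<^sub>R ?P) - (?th / (real CARD('i) - 2)) *\<^sub>R ?P = ?s *\<^sub>R ?B - q *\<^sub>R ?P"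
    by (simp add: q_def scaleR_diff_right scaleR_add_left)
  ultimately have sig: "repr c t (sigma_eps S I \<eta> \<epsilon> J t) (?s *\<^sub>R ?B - q *\<^sub>R ?P)" by simp
  have "(?s *\<^sub>R ?B - q *\<^sub>R ?P) ** (?s *\<^sub>R ?B - q *\<^sub>R ?P)
      = (?s * ?s) *\<^sub>R (?B ** ?B) - (2 * ?s * q) *\<^sub>R ?B + (q * q) *\<^sub>R ?P"
    by (simp add: matrix_mul_diff matrix_mul_scaleR BP Q.proj_idem algebra_simps flip: scaleR_2)
  then have "tr_sigma_sq S I \<eta> \<epsilon> J t = ?s * ?s * trace (?B ** ?B) - 2 * ?s * q * trace ?B + q * q * (real CARD('i) - 2)"
    unfolding tr_sigma_sq_def Q.qtrace_represents[OF Q.represents_comp[OF sig sig]]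
    by (simp add: trace_add trace_sub trace_scale proj_trace[OF t])
  moreover have "k * k * b2 - 2 * k * x * b + x * x * m = k\<^sup>2 * (b2 - 2 * (p / m) * b + p\<^sup>2 / m) - th\<^sup>2 / m"
    if "m \<noteq> 0" "th = k * (b - p)" "x = k * (p / m) + th / m" for k b b2 x m p th :: real
  proof -
    have x: "x = k * b / m" using that by (simp add: field_simps)
    show ?thesis unfolding x that(2) using that(1) by (simp add: field_simps power2_eq_square)
  qed
  note this[OF dim theta_eps_eq[OF t dim] q_def]
  ultimately show ?thesis by simp
qed

lemma theta_eps_derivative:
  assumes t: "t \<in> Kc c" and dim: "real CARD('i) - 2 \<noteq> 0"
  shows "(theta_eps S I \<eta> \<epsilon> J has_vector_derivative
    star_factor S I \<eta> \<epsilon> t * ((trace (Pj c t ** Dm c Xm t ** Pj c t ** Km t) - trace (Xm t ** Km t ** (Xm t ** Km t))) - cderiv I (cderiv I \<psi>) t)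
    + (2 * (1 - \<epsilon>) / (real CARD('i) - 2) * cderiv I \<psi> t * star_factor S I \<eta> \<epsilon> t) * (trace (Xm t ** Km t) - cderiv I \<psi> t)) (at t within I)"
proof -
  have tI: "t \<in> I" using t by (simp add: Kc_def)
  have s: "(star_factor S I \<eta> \<epsilon> has_vector_derivative 2 * (1 - \<epsilon>) / (real CARD('i) - 2) * cderiv I \<psi> t * star_factor S I \<eta> \<epsilon> t) (at t within I)"
    using exp_psi_derivative[OF tI, of "2 * (1 - \<epsilon>) / (real CARD('i) - 2)"] by (simp add: star_factor_def[abs_def] psi_eta_eq)
  have op: "openin (top_of_set I) I" by simp
  have "((\<lambda>s. trace (Xm s ** Km s) - cderiv I \<psi> s) has_vector_derivative
      (trace (Pj c t ** Dm c Xm t ** Pj c t ** Km t) - trace (Xm t ** Km t ** (Xm t ** Km t))) - cderiv I (cderiv I \<psi>) t) (at t within I)"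
    by (rule has_vector_derivative_diff[OF trace_riccati[OF t] smooth_on_has_cderiv[OF op smooth_on_cderiv[OF op smooth_psi] tI]])
  from bounded_bilinear.has_vector_derivative[OF bounded_bilinear_mult s this]
  show ?thesis by (rule has_vector_derivative_local[OF _ Kc_openin[OF c] t]) (simp add: theta_eps_eq[OF _ dim])
qed

end

text \<open>This is the equation for infinite N with its square expanded, and the other cases are
  read off from it. To the mixed term of \<psi>' and the expansion, differentiating
  \<open>star_factor\<close> contributes 2 (1 - \<epsilon>) and the trace of the square of
  \<open>B_eps\<close> contributes - 2, whence the compensating 2 \<epsilon>.\<close>

lemma raychaudhuri_base:
  assumes dim: "real CARD('i) - 2 > 0" and t: "t \<in> I"
  shows "theta_eps S I \<eta> \<epsilon> J differentiable (at t within I)"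
    and "star S I \<eta> \<epsilon> (theta_eps S I \<eta> \<epsilon> J) t
      + 2 * \<epsilon> / (real CARD('i) - 2) * star S I \<eta> \<epsilon> (psi_eta S I \<eta>) t * theta_eps S I \<eta> \<epsilon> J t
      + (theta_eps S I \<eta> \<epsilon> J t)\<^sup>2 / (real CARD('i) - 2) + tr_sigma_sq S I \<eta> \<epsilon> J t
      + Ric_inf S (\<eta> t) (eta_star S I \<eta> \<epsilon> t)
      + (star S I \<eta> \<epsilon> (psi_eta S I \<eta>) t)\<^sup>2 / (real CARD('i) - 2) = 0"
    and "psi_d1 S (\<eta> t) (eta_star S I \<eta> \<epsilon> t) = star S I \<eta> \<epsilon> (psi_eta S I \<eta>) t"
proof -
  let ?c = "c0 t" and ?\<psi> = "psi_along S I \<eta>" and ?m = "real CARD('i) - 2" and ?s = "star_factor S I \<eta> \<epsilon> t"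
  have c: "?c \<in> atlas S" and tK: "t \<in> Kc ?c" using chart_in Kc_self[OF t] by auto
  obtain M where M: "smooth_on (Kc ?c) M" "\<And>s. s \<in> Kc ?c \<Longrightarrow> repr ?c s (J s) (M s)"
    by (rule qfield_matrix_exists[OF smooth_J c]) blast
  have spos: "?s > 0" by (simp add: star_factor_def)
  interpret R: reparametrised S I \<eta> t ?s by unfold_locales (rule t, rule spos)
  have m0: "?m \<noteq> 0" using dim by simp
  have pe: "psi_eta S I \<eta> = ?\<psi>" by (simp add: fun_eq_iff psi_eta_def)
  have vel: "eta_star S I \<eta> \<epsilon> t = ?s *\<^sub>R velocity S I \<eta> t" by (simp add: eta_star_def vel_def)
  note th' = theta_eps_derivative[OF c M tK m0, of \<epsilon>]
  show "theta_eps S I \<eta> \<epsilon> J differentiable (at t within I)"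
    using th' by (auto simp: has_vector_derivative_def differentiable_def)
  show "psi_d1 S (\<eta> t) (eta_star S I \<eta> \<epsilon> t) = star S I \<eta> \<epsilon> (psi_eta S I \<eta>) t"
    unfolding vel R.psi_d_scaled(1) by (simp add: star_def pe)
  define b where "b = trace (Xm ?c M t ** Km ?c M t)"
  define b2 where "b2 = trace (Xm ?c M t ** Km ?c M t ** (Xm ?c M t ** Km ?c M t))"
  define p1 where "p1 = cderiv I ?\<psi> t"
  define p2 where "p2 = cderiv I (cderiv I ?\<psi>) t"
  define R where "R = Ric S (\<eta> t) (velocity S I \<eta> t)"
  have th: "theta_eps S I \<eta> \<epsilon> J t = ?s * (b - p1)"
    using theta_eps_eq[OF c M tK m0] by (simp add: b_def p1_def)
  have sg: "tr_sigma_sq S I \<eta> \<epsilon> J t = ?s\<^sup>2 * (b2 - 2 * (p1 / ?m) * b + p1\<^sup>2 / ?m) - (?s * (b - p1))\<^sup>2 / ?m"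
    using tr_sigma_sq_eq[OF c M tK m0, of \<epsilon>] by (simp add: b_def b2_def p1_def th)
  have "cderiv I (theta_eps S I \<eta> \<epsilon> J) t = ?s * ((- R - b2) - p2) + (2 * (1 - \<epsilon>) / ?m * p1 * ?s) * (b - p1)"
    using cderiv_eqI[OF t th'] jacobi_trace[OF c M t refl] by (simp add: b_def b2_def p1_def p2_def R_def vel_def)
  then have st: "star S I \<eta> \<epsilon> (theta_eps S I \<eta> \<epsilon> J) t = ?s * (?s * ((- R - b2) - p2) + (2 * (1 - \<epsilon>) / ?m * p1 * ?s) * (b - p1))"
    by (simp add: star_def)
  have sp: "star S I \<eta> \<epsilon> (psi_eta S I \<eta>) t = ?s * p1" by (simp add: star_def pe p1_def)
  have ri: "Ric_inf S (\<eta> t) (eta_star S I \<eta> \<epsilon> t) = ?s\<^sup>2 * R + ?s\<^sup>2 * p2"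
    unfolding Ric_inf_def vel R.psi_d_scaled(2) R.Ric_scaled by (simp add: R_def p2_def)
  show "star S I \<eta> \<epsilon> (theta_eps S I \<eta> \<epsilon> J) t
      + 2 * \<epsilon> / ?m * star S I \<eta> \<epsilon> (psi_eta S I \<eta>) t * theta_eps S I \<eta> \<epsilon> J t
      + (theta_eps S I \<eta> \<epsilon> J t)\<^sup>2 / ?m + tr_sigma_sq S I \<eta> \<epsilon> J t
      + Ric_inf S (\<eta> t) (eta_star S I \<eta> \<epsilon> t)
      + (star S I \<eta> \<epsilon> (psi_eta S I \<eta>) t)\<^sup>2 / ?m = 0"
  proof -
    have "k * (k * ((- R - b2) - p2) + (2 * (1 - \<epsilon>) / m * p1 * k) * (b - p1)) + 2 * \<epsilon> / m * (k * p1) * (k * (b - p1))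
      + (k * (b - p1))\<^sup>2 / m + (k\<^sup>2 * (b2 - 2 * (p1 / m) * b + p1\<^sup>2 / m) - (k * (b - p1))\<^sup>2 / m)
      + (k\<^sup>2 * R + k\<^sup>2 * p2) + (k * p1)\<^sup>2 / m = 0" if "m \<noteq> 0" for k m :: real
      using that by (simp add: field_simps power2_eq_square)
    from this[OF m0, of ?s] show ?thesis unfolding st sp th sg ri .
  qed
qed

end

theorem theorem6p1:
  fixes S :: "('m::{t2_space, second_countable_topology}, 'i::finite) finsler_data"
    and n :: nat and I :: "real set" and \<eta> :: "real \<Rightarrow> 'm"
    and J :: "'i qfield" and \<epsilon> :: real
  assumes "weighted_finsler_spacetime S"
    and "CARD('i) = n + 1" and "n + 1 \<ge> 3"
    and "lightlike_geodesic S I \<eta>"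
    and "lagrange_tensor S I \<eta> J" and "nonsingular S I \<eta> J"
  shows "let \<theta> = theta_eps S I \<eta> \<epsilon> J;
             \<theta>star = star S I \<eta> \<epsilon> \<theta>;
             \<psi>star = star S I \<eta> \<epsilon> (psi_eta S I \<eta>);
             \<eta>star = eta_star S I \<eta> \<epsilon>;
             tr\<sigma>2 = tr_sigma_sq S I \<eta> \<epsilon> J
    in \<theta> differentiable_on I \<and>
      (\<forall>t\<in>I. \<theta>star t + 2 * \<epsilon> / (real n - 1) * \<psi>star t * \<theta> t + (\<theta> t)\<^sup>2 / (real n - 1)
        + tr\<sigma>2 t + Ric_N S 1 (\<eta> t) (\<eta>star t) = 0) \<and>
      (\<forall>N::real. N \<noteq> 1 \<and> N \<noteq> real n \<longrightarrow>
        (\<forall>t\<in>I. \<theta>star t + (1 - \<epsilon>\<^sup>2 * ((N - real n) / (N - 1))) * ((\<theta> t)\<^sup>2 / (real n - 1))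
          + (N - 1) * (N - real n) / (real n - 1)
              * (\<epsilon> * \<theta> t / (N - 1) + \<psi>star t / (N - real n))\<^sup>2
          + tr\<sigma>2 t + Ric_N S N (\<eta> t) (\<eta>star t) = 0)) \<and>
      (\<forall>t\<in>I. \<theta>star t + (1 - \<epsilon>\<^sup>2) * ((\<theta> t)\<^sup>2 / (real n - 1))
        + 1 / (real n - 1) * (\<epsilon> * \<theta> t + \<psi>star t)\<^sup>2
        + tr\<sigma>2 t + Ric_inf S (\<eta> t) (\<eta>star t) = 0)"
proof -
  interpret jacobi_geodesic S I \<eta> J
    using assms by unfold_locales (auto simp: lightlike_geodesic_def lagrange_tensor_def)
  let ?\<theta> = "theta_eps S I \<eta> \<epsilon> J" and ?p = "star S I \<eta> \<epsilon> (psi_eta S I \<eta>)"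
  let ?ric = "\<lambda>t. Ric_inf S (\<eta> t) (eta_star S I \<eta> \<epsilon> t)"
  have card: "real CARD('i) - 2 = real n - 1" "real CARD('i) - 1 = real n" using assms(2) by auto
  have n: "real n - 1 > 0" using assms(3) by auto
  note base = raychaudhuri_base[unfolded card, OF n, of _ \<epsilon>]
  have RN: "Ric_N S N (\<eta> t) (eta_star S I \<eta> \<epsilon> t) = ?ric t - (?p t)\<^sup>2 / (N - real n)" if "t \<in> I" for N t
    using base(3)[OF that] by (simp add: Ric_N_def Ric_inf_def card)
  have core: "star S I \<eta> \<epsilon> ?\<theta> t = - 2 * \<epsilon> / (real n - 1) * ?p t * ?\<theta> t - (?\<theta> t)\<^sup>2 / (real n - 1)
      - tr_sigma_sq S I \<eta> \<epsilon> J t - ?ric t - (?p t)\<^sup>2 / (real n - 1)" if "t \<in> I" for t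
    using base(2)[OF that] by simp
  \<comment> \<open>For N = 1 the subtracted square in \<open>Ric_N\<close> has denominator 1 - n,
    the negative of n - 1, and so supplies the last term of the base identity.\<close>
  have one: "- (p\<^sup>2 / m) - p\<^sup>2 / (1 - k) = 0" if "m = k - 1" "m > 0" for p m k :: real
  proof -
    have "1 - k = - m" using that by simp
    then show ?thesis by simp
  qed
  have gen: "- 2 * \<epsilon> / m * p * th - th\<^sup>2 / m - p\<^sup>2 / m + (1 - \<epsilon>\<^sup>2 * ((N - k) / (N - 1))) * (th\<^sup>2 / m)
      + (N - 1) * (N - k) / m * (\<epsilon> * th / (N - 1) + p / (N - k))\<^sup>2 - p\<^sup>2 / (N - k) = 0"
    if "m = k - 1" "m > 0" "N \<noteq> 1" "N \<noteq> k" for p m k th N :: real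
  proof -
    \<comment> \<open>In terms of \<open>u\<close> and \<open>w\<close> the mixed term of the square
      is free of \<open>N\<close>, its first square cancels the \<epsilon> correction of the
      \<open>th\<close> term, and \<open>m = u - w\<close> makes the remaining multiples of the
      square of \<open>p\<close> add up to \<open>1 / m\<close>.\<close>
    define u where "u = N - 1"
    define w where "w = N - k"
    have uw: "u \<noteq> 0" "w \<noteq> 0" "m \<noteq> 0" "m = u - w" using that by (auto simp: u_def w_def)
    have "u * w / m * (\<epsilon> * th / u + p / w)\<^sup>2 = \<epsilon>\<^sup>2 * th\<^sup>2 * w / u / m + 2 * (\<epsilon> * th * p / m) + p\<^sup>2 * u / w / m"
      using uw(1-3) by (simp add: field_simps power2_eq_square)
    moreover have "p\<^sup>2 * u / w / m - p\<^sup>2 / w = p\<^sup>2 / m"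
    proof -
      have "u = m + w" using uw(4) by simp
      then show ?thesis using uw(2,3) by (simp add: field_simps)
    qed
    moreover have "(1 - \<epsilon>\<^sup>2 * (w / u)) * (th\<^sup>2 / m) = th\<^sup>2 / m - \<epsilon>\<^sup>2 * th\<^sup>2 * w / u / m"
      using uw(1-3) by (simp add: field_simps)
    moreover have "- 2 * \<epsilon> / m * p * th = - 2 * (\<epsilon> * th * p / m)" by simp
    ultimately show ?thesis unfolding u_def[symmetric] w_def[symmetric] by linarith
  qed
  have inf: "- 2 * \<epsilon> / m * p * th - th\<^sup>2 / m - p\<^sup>2 / m + (1 - \<epsilon>\<^sup>2) * (th\<^sup>2 / m) + 1 / m * (\<epsilon> * th + p)\<^sup>2 = 0"
    if "m > 0" for p m th :: real
    using that by (simp add: field_simps power2_eq_square)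
  show ?thesis unfolding Let_def
  proof (intro conjI allI impI ballI)
    show "?\<theta> differentiable_on I" using base(1) by (simp add: differentiable_on_def)
    fix t assume t: "t \<in> I"
    show "star S I \<eta> \<epsilon> ?\<theta> t + 2 * \<epsilon> / (real n - 1) * ?p t * ?\<theta> t + (?\<theta> t)\<^sup>2 / (real n - 1)
        + tr_sigma_sq S I \<eta> \<epsilon> J t + Ric_N S 1 (\<eta> t) (eta_star S I \<eta> \<epsilon> t) = 0"
      unfolding core[OF t] RN[OF t] using one[OF refl n, of "?p t"] by simp
    show "star S I \<eta> \<epsilon> ?\<theta> t + (1 - \<epsilon>\<^sup>2) * ((?\<theta> t)\<^sup>2 / (real n - 1))
        + 1 / (real n - 1) * (\<epsilon> * ?\<theta> t + ?p t)\<^sup>2 + tr_sigma_sq S I \<eta> \<epsilon> J t + ?ric t = 0"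
      unfolding core[OF t] using inf[OF n, of "?p t" "?\<theta> t"] by linarith
  next
    fix N t assume N: "N \<noteq> 1 \<and> N \<noteq> real n" and t: "t \<in> I"
    show "star S I \<eta> \<epsilon> ?\<theta> t + (1 - \<epsilon>\<^sup>2 * ((N - real n) / (N - 1))) * ((?\<theta> t)\<^sup>2 / (real n - 1))
          + (N - 1) * (N - real n) / (real n - 1) * (\<epsilon> * ?\<theta> t / (N - 1) + ?p t / (N - real n))\<^sup>2
          + tr_sigma_sq S I \<eta> \<epsilon> J t + Ric_N S N (\<eta> t) (eta_star S I \<eta> \<epsilon> t) = 0"
      unfolding core[OF t] RN[OF t] using gen[OF refl n, of N "?p t" "?\<theta> t"] N by linarith
  qed
qed

end
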